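(* Let $m\ge 1$ be an integer, let $0=x_0<x_1<\cdots<x_m<x_{m+1}=1$, let $f:(0,1)\times\mathbb{R}\to\mathbb{R}$ be a Carathéodory function, and let $\imath_1,\dots,\imath_m:\mathbb{R}\to\mathbb{R}$ be continuous. Assume: (i) there are $a_1,\dots,a_{m+1}\in\mathbb{R}$ such that $f(x,t)=\sum_{j=1}^{m+1}a_j\,\chi_j(x)\,t+g(x,t)$, where $\chi_j$ is the characteristic function of $(x_{j-1},x_j)$ and $|g(x,t)|\le C(|t|^{r-1}+1)$ for a.e. $x\in(0,1)$ and all $t\in\mathbb{R}$, for some $r\in(1,2)$ and some constant $C>0$; (ii) there are constants $\mu>2$, $c>0$ and $C'>0$ such that $t\,\imath_j(t)\ge c|t|^\mu-C'$ for all $t\in\mathbb{R}$ and $j=1,\dots,m$; (iii) $f(x,t)=o(t)$ as $t\to0$, uniformly for a.e. $x\in(0,1)$; (iv) $\imath_j(t)=b_j\,t+h_j(t)$ for $j=1,\dots,m$, where $b=(b_1,\dots,b_m)\in\mathbb{R}^m$ and $h_j(t)=o(t)$ as $t\to0$ for each $j$; (v) $a_j\notin\sigma_j:=\{\lambda^j_k: k=1,2,\dots\}$ for $j=1,\dots,m+1$, where $\lambda^j_k=\frac{k^2\pi^2}{(x_j-x_{j-1})^2}$, and $b\notin B$, where $B$ is the resonance set defined in the context. If $a_{j_0}>\lambda^{j_0}_1$ for some $j_0\in\{1,\dots,m+1\}$, or $$\int_0^1(w_0')^2\ge\sum_{j=1}^mb_j\,w_0(x_j)^2\quad\text{for some }w_0\in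 M\setminus\{0\},$$ then the impulsive problem $$-u''=f(x,u)\ \text{ for } x\in(0,1)\setminus\{x_1,\dots,x_m\},\quad u(0)=u(1)=0,\quad u(x_j^+)=u(x_j^-),\quad u'(x_j^+)=u'(x_j^-)-\imath_j(u(x_j)),\quad j=1,\dots,m,$$ has a nontrivial (weak) solution, i.e. one with $u\ne0$.
   Context: $u(x_j^\pm)$ and $u'(x_j^\pm)$ denote one-sided limits at $x_j$ from the right ($+$) and left ($-$). A weak solution of the impulsive problem is a function $u\in H^1_0(0,1)$ such that $$\int_0^1u'v'=\int_0^1f(x,u)\,v+\sum_{j=1}^m\imath_j(u(x_j))\,v(x_j)\quad\text{for all }v\in H^1_0(0,1),$$ and solutions are understood in this sense. "$f(x,t)=o(t)$ as $t\to0$ uniformly a.e." means: for every $\varepsilon>0$ there is $\delta>0$ such that $|f(x,t)|\le\varepsilon|t|$ for a.e. $x$ and all $|t|\le\delta$ (so $f(\cdot,0)=0$ a.e.); similarly for $h_j$ (so $\imath_j(0)=0$). Hence $u=0$ is a solution. Resonance set: $B$ is the set of $b=(b_1,\dots,b_m)\in\mathbb{R}^m$ for which the problem $$-u''=0\text{ on }(0,1)\setminus\{x_1,\dots,x_m\},\quad u(0)=u(1)=0,\quad u(x_j^+)=u(x_j^-),\quad u'(x_j^+)=u'(x_j^-)-b_j\,u(x_j),\ j=1,\dots,m,$$ has a nontrivial solution. $M\subset H^1_0(0,1)$ is the $m$-dimensional subspace of continuous functions on $[0,1]$ that vanish at $0$ and $1$ and are affine on each $[x_{j-1},x_j]$,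 $j=1,\dots,m+1$. *)

theory Defs
  imports "HOL-Analysis.Analysis"
begin

abbreviation unit_ivl :: "real measure"
  where "unit_ivl \<equiv> lebesgue_on {0<..<1}"

definition L2 :: "(real \<Rightarrow> real) set"
  where "L2 = {u. u \<in> borel_measurable unit_ivl \<and> integrable unit_ivl (\<lambda>y. (u y)\<^sup>2)}"

text \<open>Test functions: continuously differentiable with compact support in (0,1). As in Brezis'
  book, weak derivatives and the space \<open>H10\<close> are defined from these; using infinitely
  differentiable test functions instead gives the same notions.\<close>

definition C1c :: "(real \<Rightarrow> real) set"
  where "C1c = {\<phi>. \<phi> C1_differentiable_on UNIV \<and>
    compact (closure {y. \<phi> y \<noteq> 0}) \<and> closure {y. \<phi> y \<noteq> 0} \<subseteq> {0<..<1}}"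

text \<open>\<open>u\<close> is in \<open>H\<^sup>1(0,1)\<close> with weak derivative \<open>du\<close>.\<close>

definition has_weak_deriv :: "(real \<Rightarrow> real) \<Rightarrow> (real \<Rightarrow> real) \<Rightarrow> bool"
  where "has_weak_deriv u du \<longleftrightarrow> u \<in> L2 \<and> du \<in> L2 \<and>
    (\<forall>\<phi>\<in>C1c. (\<integral>y. u y * deriv \<phi> y \<partial>unit_ivl) = - (\<integral>y. du y * \<phi> y \<partial>unit_ivl))"

text \<open>The closure of the test functions in \<open>H\<^sup>1(0,1)\<close>. Each class is represented by its
  continuous representative on [0,1], so that the point values \<open>u (x j)\<close> make sense; values
  outside [0,1] are irrelevant.\<close>

definition H10 :: "(real \<Rightarrow> real) set"
  where "H10 = {u. continuous_on {0..1} u \<and>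
    (\<exists>du. has_weak_deriv u du \<and>
      (\<exists>\<phi> :: nat \<Rightarrow> real \<Rightarrow> real. (\<forall>n. \<phi> n \<in> C1c) \<and>
        (\<lambda>n. \<integral>y. (\<phi> n y - u y)\<^sup>2 \<partial>unit_ivl) \<longlonglongrightarrow> 0 \<and>
        (\<lambda>n. \<integral>y. (deriv (\<phi> n) y - du y)\<^sup>2 \<partial>unit_ivl) \<longlonglongrightarrow> 0))}"

text \<open>For functions continuous on [0,1], in particular for elements of \<open>H10\<close>, this is
  the same as not vanishing almost everywhere.\<close>

definition nontrivial :: "(real \<Rightarrow> real) \<Rightarrow> bool"
  where "nontrivial u \<longleftrightarrow> (\<exists>y\<in>{0..1}. u y \<noteq> 0)"

definition is_partition :: "nat \<Rightarrow> (nat \<Rightarrow> real) \<Rightarrow> bool"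
  where "is_partition m x \<longleftrightarrow> x 0 = 0 \<and> x (m + 1) = 1 \<and> (\<forall>j\<le>m. x j < x (j + 1))"

definition caratheodory :: "(real \<Rightarrow> real \<Rightarrow> real) \<Rightarrow> bool"
  where "caratheodory f \<longleftrightarrow> (\<forall>t. (\<lambda>y. f y t) \<in> borel_measurable unit_ivl) \<and>
    (AE y in unit_ivl. continuous_on UNIV (f y))"

text \<open>The integrability clause excludes the library's default value 0 for the integral of a
  non-integrable function.\<close>

definition weak_solution ::
    "nat \<Rightarrow> (nat \<Rightarrow> real) \<Rightarrow> (real \<Rightarrow> real \<Rightarrow> real) \<Rightarrow> (nat \<Rightarrow> real \<Rightarrow> real) \<Rightarrow> (real \<Rightarrow> real) \<Rightarrow> bool"
  where "weak_solution m x f \<iota> u \<longleftrightarrow> u \<in> H10 \<and>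
    (\<exists>du. has_weak_deriv u du \<and>
      (\<forall>v\<in>H10. \<forall>dv. has_weak_deriv v dv \<longrightarrow>
        integrable unit_ivl (\<lambda>y. f y (u y) * v y) \<and>
        (\<integral>y. du y * dv y \<partial>unit_ivl) =
          (\<integral>y. f y (u y) * v y \<partial>unit_ivl) + (\<Sum>j=1..m. \<iota> j (u (x j)) * v (x j))))"

text \<open>Only the entries \<open>b 1, \<dots>, b m\<close> matter. Here \<open>du\<close> is the classical derivative off the
  points \<open>x j\<close>; the matching \<open>u(x\<^sub>j\<^sup>+) = u(x\<^sub>j\<^sup>-)\<close> and the attainment of the
  boundary values are expressed by continuity of \<open>u\<close> on [0,1].\<close>

definition resonance_set :: "nat \<Rightarrow> (nat \<Rightarrow> real) \<Rightarrow> (nat \<Rightarrow> real) set"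
  where "resonance_set m x = {b. \<exists>u du.
    nontrivial u \<and> continuous_on {0..1} u \<and> u 0 = 0 \<and> u 1 = 0 \<and>
    (\<forall>y\<in>{0<..<1} - x ` {1..m}.
      (u has_real_derivative du y) (at y) \<and> (du has_real_derivative 0) (at y)) \<and>
    (\<forall>j\<in>{1..m}. \<exists>l r. (du \<longlongrightarrow> l) (at_left (x j)) \<and> (du \<longlongrightarrow> r) (at_right (x j)) \<and>
      r = l - b j * u (x j))}"

definition piecewise_affine :: "nat \<Rightarrow> (nat \<Rightarrow> real) \<Rightarrow> (real \<Rightarrow> real) set"
  where "piecewise_affine m x = {w. continuous_on {0..1} w \<and> w 0 = 0 \<and> w 1 = 0 \<and>
    (\<forall>j\<in>{1..m+1}. \<exists>\<alpha> \<beta>. \<forall>y\<in>{x (j - 1)..x j}. w y = \<alpha> + \<beta> * y)}"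

definition eigenval :: "(nat \<Rightarrow> real) \<Rightarrow> nat \<Rightarrow> nat \<Rightarrow> real"
  where "eigenval x j k = (real k)\<^sup>2 * pi\<^sup>2 / (x j - x (j - 1))\<^sup>2"

end

(* Weak solutions are the critical points of the energy
   E u = |u|^2 / 2 - int F(y, u) - sum_j I_j (u (x j)), where |u|^2 = int u'^2 and F, I_j are
   primitives of f and of the impulses. Near 0, E is close to half of the form
   |u|^2 - sum_j b_j u(x j)^2, which is nondegenerate because b is not in B and negative definite on
   a space of dimension n <= m. Near infinity, let N be the space of all u vanishing at the x j.
   On N the form |u|^2 - sum_j a_j int_j u^2 is nondegenerate because a_j is not an eigenvalue; let k
   be its negative dimension. In the m directions complementary to N the superlinear impulses make E
   decrease, so E behaves like a form of negative dimension d = m + k. The alternative in the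
   hypotheses gives n < d: either k >= 1, or the form at 0 is nonnegative somewhere on M \ {0}, which
   forces n < m.

   If 0 were the only critical point, then |E'| would be bounded below on annuli, and the gradient
   together with a linear flow near infinity would deform levels of E downwards. A small
   (n - 1)-sphere in the negative space at 0 could be moved to low levels, which are homotopy
   equivalent to a (d - 1)-sphere; it is null-homotopic there as n < d. This produces an n-sphere in
   {E <= 0} that links with the sphere of radius rho in the complement of the negative space at 0,
   and yet can be contracted away from it. *)

theory Submission
  imports Defs "HOL-Homology.Homology" "HOL-Complex_Analysis.Great_Picard"
begin

section \<open>Maps of spheres\<close>

text \<open>The nonlinearity is merely continuous in its second argument, so the gradient need not
  be locally Lipschitz and a gradient flow need not exist. Every deformation is therefore a finite
  composition of explicit maps: a gradient step with cut-off, so short that the gradient hardly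
  changes along it, followed far out by a linear flow. Far out there is no asymptotic quadratic form
  either, since the impulses grow faster than linearly; what takes its place is one inequality,
  \<open>out\<close>: reversing the sign of \<open>d\<close> directions in \<open>u\<close> gives a
  vector along which \<open>E\<close> increases at a definite rate. Topology enters through two
  facts only: spheres are not contractible, and a map of a sphere of dimension less than
  \<open>d - 1\<close> into d-space without 0 is null-homotopic. The gradient is the identity minus
  a map \<open>K\<close> that turns bounded pointwise convergence into convergence in norm and takes
  merely continuous arguments. This makes Lipschitz functions a sufficient energy space, in which
  every Riesz representative is given by a formula.\<close>

definition sph :: "nat \<Rightarrow> (nat \<Rightarrow> real) set"
  where "sph n = {x. (\<Sum>i<n. (x i)\<^sup>2) = 1 \<and> (\<forall>i\<ge>n. x i = 0)}"

definition punctured :: "nat \<Rightarrow> (nat \<Rightarrow> real) set"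
  where "punctured n = {x. \<exists>i<n. x i \<noteq> 0}"

text \<open>The index shifts by one: \<open>sph n\<close> has \<open>n\<close> coordinates and
  dimension n - 1. In particular \<open>sph 0\<close> is empty, so the case \<open>n = 0\<close> of
  the linking argument, in which 0 is a strict local minimum, needs no separate treatment.\<close>

lemma nsphere_eq_sph: "nsphere n = top_of_set (sph (Suc n))"
  by (simp add: nsphere sph_def euclidean_product_topology lessThan_Suc_atMost Suc_le_eq)

lemma sum_squares_pos_if_punctured: "x \<in> punctured n \<Longrightarrow> (\<Sum>i<n. (x i)\<^sup>2) > 0"
  unfolding punctured_def by (auto intro!: sum_pos2)

lemma sph_abs_le_1: assumes "x \<in> sph n" shows "\<bar>x i\<bar> \<le> 1"
proof (cases "i < n")
  case True
  then have "(x i)\<^sup>2 \<le> (\<Sum>i<n. (x i)\<^sup>2)" by (intro member_le_sum) auto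
  then show ?thesis using assms by (simp add: sph_def abs_square_le_1)
next
  case False then show ?thesis using assms by (simp add: sph_def)
qed

lemma continuous_on_coord [continuous_intros]: "continuous_on S (\<lambda>x::nat \<Rightarrow> real. x i)"
  by (rule continuous_on_subset[OF continuous_on_product_coordinates]) simp

lemma continuous_on_coord_comp:
  fixes f :: "'a::topological_space \<Rightarrow> nat \<Rightarrow> real"
  shows "continuous_on S f \<Longrightarrow> continuous_on S (\<lambda>x. f x i)"
  by (rule continuous_on_product_then_coordinatewise)

lemma homotopic_canonI:
  fixes h :: "real \<times> 'a::topological_space \<Rightarrow> 'b::topological_space"
  assumes "continuous_on ({0..1} \<times> S) h" "\<And>t x. 0 \<le> t \<Longrightarrow> t \<le> 1 \<Longrightarrow> x \<in> S \<Longrightarrow> h (t, x) \<in> T"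
    and "\<And>x. x \<in> S \<Longrightarrow> h (0, x) = f x" "\<And>x. x \<in> S \<Longrightarrow> h (1, x) = g x"
  shows "homotopic_with_canon (\<lambda>_. True) S T f g"
proof (subst homotopic_with, simp)
  show "\<exists>h. continuous_map (prod_topology (top_of_set {0..1::real}) (top_of_set S)) (top_of_set T) h \<and>
      (\<forall>x\<in>topspace (top_of_set S). h (0, x) = f x) \<and> (\<forall>x\<in>topspace (top_of_set S). h (1, x) = g x) \<and>
      (\<forall>t\<in>{0..1::real}. True)"
    using assms by (intro exI[of _ h]) (auto simp: image_subset_iff Pi_iff)
qed

lemma homotopic_canonE:
  assumes "homotopic_with_canon (\<lambda>_. True) S T f g"
  obtains h :: "real \<times> 'a::topological_space \<Rightarrow> 'b::topological_space" where "continuous_on ({0..1} \<times> S) h"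
    "\<And>t x. 0 \<le> t \<Longrightarrow> t \<le> 1 \<Longrightarrow> x \<in> S \<Longrightarrow> h (t, x) \<in> T"
    "\<And>x. h (0, x) = f x" "\<And>x. h (1, x) = g x"
proof -
  obtain h where h: "continuous_map (prod_topology (top_of_set {0..1::real}) (top_of_set S)) (top_of_set T) h"
      "\<forall>x. h (0, x) = f x" "\<forall>x. h (1, x) = g x"
    using assms unfolding homotopic_with_def by auto
  have "continuous_on ({0..1} \<times> S) h" "\<And>t x. 0 \<le> t \<Longrightarrow> t \<le> 1 \<Longrightarrow> x \<in> S \<Longrightarrow> h (t, x) \<in> T"
    using h(1) by (auto simp: image_subset_iff Pi_iff)
  then show ?thesis using h by (intro that[of h]) auto
qed

lemma homotopic_linear_coord:
  fixes f g :: "'a::topological_space \<Rightarrow> nat \<Rightarrow> real"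
  assumes "continuous_on S f" "continuous_on S g"
    and "\<And>x t. x \<in> S \<Longrightarrow> 0 \<le> t \<Longrightarrow> t \<le> 1 \<Longrightarrow> (\<lambda>i. (1 - t) * f x i + t * g x i) \<in> T"
  shows "homotopic_with_canon (\<lambda>_. True) S T f g"
proof -
  let ?h = "\<lambda>p::real \<times> 'a. \<lambda>i. (1 - fst p) * f (snd p) i + fst p * g (snd p) i"
  have c1: "continuous_on ({0..1} \<times> S) (\<lambda>p. f (snd p) i)" for i
    by (rule continuous_on_compose2[OF continuous_on_coord_comp[OF assms(1)]]) (auto intro!: continuous_intros)
  have c2: "continuous_on ({0..1} \<times> S) (\<lambda>p. g (snd p) i)" for i
    by (rule continuous_on_compose2[OF continuous_on_coord_comp[OF assms(2)]]) (auto intro!: continuous_intros)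
  have "continuous_on ({0..1} \<times> S) ?h"
    by (intro continuous_on_coordinatewise_then_product continuous_intros c1 c2)
  then show ?thesis
    by (rule homotopic_canonI) (auto simp: assms(3))
qed

text \<open>The sphere lives in an infinite product. The cube of intervals is compact by Tychonoff's
  theorem, and the defining equations are closed conditions.\<close>

lemma compact_sph: "compact (sph n)"
proof (cases n)
  case 0 then show ?thesis by (simp add: sph_def)
next
  case (Suc k)
  have K: "compact (Pi\<^sub>E UNIV (\<lambda>i::nat. {-1..1::real}))"
  proof -
    have "compactin (product_topology (\<lambda>_. euclideanreal) UNIV) (Pi\<^sub>E UNIV (\<lambda>i::nat. {-1..1::real}))"
      by (subst compactin_PiE) auto
    then show ?thesis by (simp add: euclidean_product_topology)
  qed
  have "closed (sph n)"
  proof -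
    have e: "sph n = {x. (\<Sum>i<n. (x i)\<^sup>2) = 1} \<inter> (\<Inter>i\<in>{n..}. {x. x i = 0})"
      by (auto simp: sph_def)
    show ?thesis unfolding e
      by (intro closed_Int closed_INT ballI closed_Collect_eq continuous_intros)
  qed
  moreover have "sph n \<subseteq> Pi\<^sub>E UNIV (\<lambda>i::nat. {-1..1::real})"
    using sph_abs_le_1[of _ n] by (auto simp: abs_le_iff minus_le_iff)
  ultimately show ?thesis using K by (metis compact_Int_closed inf.absorb_iff2)
qed

text \<open>Composed with the radial projection, such a homotopy would contract
  \<open>nsphere n\<close> in itself, which homology excludes.\<close>

theorem sph_not_null_homotopic:
  "\<not> homotopic_with_canon (\<lambda>_. True) (sph (Suc n)) (punctured (Suc n)) (\<lambda>z. z) (\<lambda>_. k)"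
proof
  assume h: "homotopic_with_canon (\<lambda>_. True) (sph (Suc n)) (punctured (Suc n)) (\<lambda>z. z) (\<lambda>_. k)"
  define \<nu> where "\<nu> x = (\<lambda>i. if i < Suc n then x i / sqrt (\<Sum>i<Suc n. (x i)\<^sup>2) else 0)" for x :: "nat \<Rightarrow> real"
  have cn: "continuous_on (punctured (Suc n)) \<nu>"
  proof (rule continuous_on_coordinatewise_then_product)
    fix i
    show "continuous_on (punctured (Suc n)) (\<lambda>x. \<nu> x i)"
      unfolding \<nu>_def
      by (cases "i < Suc n")
        (auto intro!: continuous_intros simp del: sum.lessThan_Suc dest!: sum_squares_pos_if_punctured)
  qed
  have rng: "\<nu> x \<in> sph (Suc n)" if "x \<in> punctured (Suc n)" for x
  proof -
    have p: "(\<Sum>i<Suc n. (x i)\<^sup>2) > 0" using sum_squares_pos_if_punctured[OF that] .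
    have "(\<Sum>i<Suc n. (\<nu> x i)\<^sup>2) = (\<Sum>i<Suc n. (x i)\<^sup>2 / (\<Sum>i<Suc n. (x i)\<^sup>2))"
      using p by (intro sum.cong) (auto simp: \<nu>_def power_divide simp del: sum.lessThan_Suc)
    also have "\<dots> = 1" using p by (simp add: sum_divide_distrib[symmetric] del: sum.lessThan_Suc)
    finally show ?thesis by (simp add: sph_def \<nu>_def)
  qed
  have "homotopic_with_canon (\<lambda>_. True) (sph (Suc n)) (sph (Suc n)) (\<nu> \<circ> (\<lambda>z. z)) (\<nu> \<circ> (\<lambda>_. k))"
    by (rule homotopic_with_compose_continuous_map_left[OF h])
      (use cn rng in \<open>auto simp: continuous_map_in_subtopology image_subset_iff\<close>)
  moreover have "homotopic_with_canon (\<lambda>_. True) (sph (Suc n)) (sph (Suc n)) id (\<nu> \<circ> (\<lambda>z. z))"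
  proof (rule homotopic_with_equal)
    fix x assume "x \<in> topspace (top_of_set (sph (Suc n)))"
    then have x: "x \<in> sph (Suc n)" by simp
    then show "id x = (\<nu> \<circ> (\<lambda>z. z)) x"
      by (intro ext) (auto simp: \<nu>_def sph_def simp del: sum.lessThan_Suc)
  qed auto
  ultimately have "homotopic_with_canon (\<lambda>_. True) (sph (Suc n)) (sph (Suc n)) id (\<nu> \<circ> (\<lambda>_. k))"
    using homotopic_with_trans by blast
  then have "contractible_space (nsphere n)"
    unfolding contractible_space_def nsphere_eq_sph by (auto simp: o_def)
  then show False using non_contractible_space_nsphere by blast
qed

text \<open>Counting grid cells against lattice points: the image of an \<open>n\<close>-cube under a Lipschitz map
  meets at most \<open>O(K ^ n)\<close> of the \<open>K ^ d\<close> points of a lattice of mesh \<open>\<eta> / K\<close>.\<close>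

lemma lipschitz_misses_point:
  fixes Q :: "(nat \<Rightarrow> real) \<Rightarrow> nat \<Rightarrow> real"
  assumes nd: "n < d" and \<eta>: "\<eta> > 0" and L: "L \<ge> 0"
    and lip: "\<And>i x z. i < d \<Longrightarrow> \<bar>Q x i - Q z i\<bar> \<le> L * (\<Sum>j<n. \<bar>x j - z j\<bar>)"
  obtains v where "\<And>i. 0 \<le> v i \<and> v i \<le> \<eta>"
    "\<And>x. \<forall>i. \<bar>x i\<bar> \<le> 1 \<Longrightarrow> \<exists>i<d. Q x i \<noteq> v i"
proof -
  obtain J :: nat where J: "2 * real n * L / \<eta> < real J" using reals_Archimedean2 by blast
  \<comment> \<open>At most \<open>(P + 1) ^ n \<le> ((J + 2) * K) ^ n\<close> cells face
    \<open>K ^ d \<ge> K ^ (n + 1)\<close> lattice points, so \<open>K > (J + 2) ^ n\<close> decides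
    the count. With \<open>P\<close> subdivisions per axis, two points of one cell have images
    closer than the lattice mesh \<open>\<eta> / K\<close>, by the choice of
    \<open>J\<close>.\<close>
  define K where "K = (J + 2) ^ n + 1"
  define P where "P = (J + 1) * K"
  have K0: "K > 0" by (simp add: K_def)
  have P0: "P > 0" using K0 by (simp add: P_def)
  define lat where "lat a = (\<lambda>i. \<eta> * real (a i) / real K)" for a :: "nat \<Rightarrow> nat"
  define A where "A = PiE {..<d} (\<lambda>_. {..<K})"
  have "\<exists>a\<in>A. \<forall>x. (\<forall>i. \<bar>x i\<bar> \<le> 1) \<longrightarrow> (\<exists>i<d. Q x i \<noteq> lat a i)"
  proof (rule ccontr)
    assume "\<not> ?thesis"
    then have "\<forall>a\<in>A. \<exists>x. (\<forall>i. \<bar>x i\<bar> \<le> 1) \<and> (\<forall>i<d. Q x i = lat a i)" by auto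
    then obtain X where X: "\<And>a i. a \<in> A \<Longrightarrow> \<bar>X a i\<bar> \<le> 1" "\<And>a i. a \<in> A \<Longrightarrow> i < d \<Longrightarrow> Q (X a) i = lat a i"
      by metis
    define cell where "cell x = restrict (\<lambda>i. nat \<lfloor>(x i + 1) * real P / 2\<rfloor>) {..<n}" for x :: "nat \<Rightarrow> real"
    have inj: "inj_on (cell \<circ> X) A"
    proof (rule inj_onI)
      fix a b assume a: "a \<in> A" and b: "b \<in> A" and e: "(cell \<circ> X) a = (cell \<circ> X) b"
      have close: "\<bar>X a j - X b j\<bar> \<le> 2 / real P" if "j < n" for j
      proof -
        have "nat \<lfloor>(X a j + 1) * real P / 2\<rfloor> = nat \<lfloor>(X b j + 1) * real P / 2\<rfloor>"
          using fun_cong[OF e, of j] that by (simp add: cell_def)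
        moreover have "(X a j + 1) * real P / 2 \<ge> 0" "(X b j + 1) * real P / 2 \<ge> 0"
          using X(1)[OF a, of j] X(1)[OF b, of j] by (auto simp: abs_le_iff)
        ultimately have "\<lfloor>(X a j + 1) * real P / 2\<rfloor> = \<lfloor>(X b j + 1) * real P / 2\<rfloor>"
          by (metis eq_nat_nat_iff zero_le_floor)
        then have "\<bar>(X a j + 1) * real P / 2 - (X b j + 1) * real P / 2\<bar> < 1" by linarith
        also have "(X a j + 1) * real P / 2 - (X b j + 1) * real P / 2 = (X a j - X b j) * (real P / 2)"
          by (simp add: field_simps)
        finally have "\<bar>X a j - X b j\<bar> * (real P / 2) < 1" by (simp add: abs_mult)
        then show ?thesis using P0 by (simp add: field_simps)
      qed
      have "a i = b i" if i: "i < d" for i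
      proof -
        have "\<bar>lat a i - lat b i\<bar> \<le> L * (\<Sum>j<n. \<bar>X a j - X b j\<bar>)"
          using lip[OF i, of "X a" "X b"] X(2)[OF a i] X(2)[OF b i] by simp
        also have "\<dots> \<le> L * (\<Sum>j<n. 2 / real P)"
          by (intro mult_left_mono sum_mono close L) auto
        also have "\<dots> = (2 * real n * L / \<eta>) * (\<eta> / real P)" using \<eta> by simp
        also have "\<dots> < (real J + 1) * (\<eta> / real P)"
          by (intro mult_strict_right_mono) (use J \<eta> P0 in auto)
        also have "\<dots> = \<eta> / real K" 
        proof -
          have "real P = (real J + 1) * real K" by (simp add: P_def algebra_simps)
          then show ?thesis using K0 by simp
        qed
        finally have "\<bar>lat a i - lat b i\<bar> < \<eta> / real K" .
        moreover have "lat a i - lat b i = (\<eta> / real K) * (real (a i) - real (b i))"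
          by (simp add: lat_def right_diff_distrib)
        ultimately have "(\<eta> / real K) * \<bar>real (a i) - real (b i)\<bar> < (\<eta> / real K) * 1"
          using \<eta> K0 by (simp add: abs_mult)
        then have "\<bar>real (a i) - real (b i)\<bar> < 1" using \<eta> K0
          by (metis mult_less_cancel_left_pos divide_pos_pos of_nat_0_less_iff)
        then show "a i = b i" by linarith
      qed
      then show "a = b" using a b unfolding A_def by (auto intro: PiE_ext)
    qed
    have rng: "(cell \<circ> X) ` A \<subseteq> PiE {..<n} (\<lambda>_. {..P})"
    proof
      fix c assume "c \<in> (cell \<circ> X) ` A"
      then obtain a where a: "a \<in> A" "c = cell (X a)" by auto
      have "nat \<lfloor>(X a i + 1) * real P / 2\<rfloor> \<le> P" for i
      proof -
        have "(X a i + 1) * real P \<le> 2 * real P"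
          by (intro mult_right_mono) (use X(1)[OF a(1), of i] in auto)
        then have "\<lfloor>(X a i + 1) * real P / 2\<rfloor> \<le> int P" by linarith
        then show ?thesis by linarith
      qed
      then show "c \<in> PiE {..<n} (\<lambda>_. {..P})" using a by (auto simp: cell_def)
    qed
    have "card A \<le> card (PiE {..<n} (\<lambda>_. {..P}))"
      by (rule card_inj_on_le[OF inj rng]) (auto intro: finite_PiE)
    then have 1: "K ^ d \<le> (P + 1) ^ n" by (simp add: A_def card_PiE)
    have "(P + 1) ^ n \<le> ((J + 2) * K) ^ n"
      by (intro power_mono) (use K0 in \<open>auto simp: P_def algebra_simps\<close>)
    also have "\<dots> = (J + 2) ^ n * K ^ n" by (rule power_mult_distrib)
    also have "\<dots> < K * K ^ n" using K0 by (intro mult_strict_right_mono) (auto simp: K_def)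
    also have "\<dots> \<le> K ^ d" using nd K0 by (simp flip: power_Suc add: power_increasing)
    finally show False using 1 by simp
  qed
  then obtain a where a: "a \<in> A" "\<And>x. \<forall>i. \<bar>x i\<bar> \<le> 1 \<Longrightarrow> (\<exists>i<d. Q x i \<noteq> lat a i)" by auto
  define v where "v i = (if i < d then lat a i else 0)" for i
  have "0 \<le> v i \<and> v i \<le> \<eta>" for i
  proof (cases "i < d")
    case True
    then have "a i < K" using a(1) by (auto simp: A_def PiE_iff)
    then show ?thesis using True \<eta> K0 by (simp add: v_def lat_def field_simps)
  qed (use \<eta> in \<open>simp add: v_def\<close>)
  moreover have "\<exists>i<d. Q x i \<noteq> v i" if "\<forall>i. \<bar>x i\<bar> \<le> 1" for x
    using a(2)[OF that] by (auto simp: v_def)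
  ultimately show ?thesis using that by blast
qed

text \<open>Only the first \<open>n\<close> coordinates enter. On \<open>sph n\<close>, where the
  others vanish, this separates points; elsewhere it is a pseudometric.\<close>

definition dist1 :: "nat \<Rightarrow> (nat \<Rightarrow> real) \<Rightarrow> (nat \<Rightarrow> real) \<Rightarrow> real"
  where "dist1 n x z = (\<Sum>j<n. \<bar>x j - z j\<bar>)"

lemma dist1_triangle: "dist1 n x z \<le> dist1 n x y + dist1 n y z"
  unfolding dist1_def sum.distrib[symmetric] by (intro sum_mono) auto

lemma dist1_nonneg: "0 \<le> dist1 n x z"
  unfolding dist1_def by (intro sum_nonneg) auto

text \<open>Lipschitz approximation on the compact sphere by the infimal convolution
  \<open>x \<mapsto> inf (q z + L * dist1 n x z)\<close>, which is defined and Lipschitz on the whole space.\<close>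

lemma lipschitz_approx_sph:
  assumes q: "continuous_on (sph n) q" and e: "(e::real) > 0" and ne: "sph n \<noteq> {}"
  obtains Q L where "L \<ge> 0" "\<And>x z. \<bar>Q x - Q z\<bar> \<le> L * dist1 n x z"
    "\<And>x. x \<in> sph n \<Longrightarrow> \<bar>Q x - q x\<bar> \<le> e"
proof -
  have "bounded (q ` sph n)" using compact_continuous_image[OF q compact_sph] compact_imp_bounded by blast
  then obtain B where B: "\<And>x. x \<in> sph n \<Longrightarrow> \<bar>q x\<bar> \<le> B" by (auto simp: bounded_iff)
  obtain x0 where x0: "x0 \<in> sph n" using ne by auto
  have B0: "B \<ge> 0" using B[OF x0] by linarith
  \<comment> \<open>The pairs on which \<open>q\<close> varies by at least \<open>e\<close>. They
    form a compact set off the diagonal, so \<open>dist1\<close> is at least some \<mu> > 0 there,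
    and the slope \<open>2 * B / \<mu>\<close> outweighs any variation of \<open>q\<close>.\<close>
  define T where "T = {p \<in> sph n \<times> sph n. e \<le> \<bar>q (fst p) - q (snd p)\<bar>}"
  have cq1: "continuous_on (sph n \<times> sph n) (\<lambda>p. q (fst p))"
    by (rule continuous_on_compose2[OF q]) (auto intro: continuous_on_fst continuous_on_id)
  have cq2: "continuous_on (sph n \<times> sph n) (\<lambda>p. q (snd p))"
    by (rule continuous_on_compose2[OF q]) (auto intro: continuous_on_snd continuous_on_id)
  have cT: "compact T"
  proof -
    have c: "continuous_on (sph n \<times> sph n) (\<lambda>p. \<bar>q (fst p) - q (snd p)\<bar>)"
      by (intro continuous_intros cq1 cq2)
    have cc: "compact (sph n \<times> sph n)" by (intro compact_Times compact_sph)
    have "closedin (top_of_set (sph n \<times> sph n)) ((sph n \<times> sph n) \<inter> (\<lambda>p. \<bar>q (fst p) - q (snd p)\<bar>) -` {e..})"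
      by (rule continuous_closedin_preimage[OF c]) simp
    moreover have "(sph n \<times> sph n) \<inter> (\<lambda>p. \<bar>q (fst p) - q (snd p)\<bar>) -` {e..} = T" by (auto simp: T_def)
    ultimately show ?thesis using closedin_compact[OF cc] by simp
  qed
  have cd: "continuous_on T (\<lambda>p. dist1 n (fst p) (snd p))"
    unfolding dist1_def
    by (intro continuous_on_sum continuous_on_rabs continuous_on_diff
        continuous_on_coord_comp[OF continuous_on_fst[OF continuous_on_id]] continuous_on_coord_comp[OF continuous_on_snd[OF continuous_on_id]])
  have dpos: "dist1 n (fst p) (snd p) > 0" if "p \<in> T" for p
  proof (rule ccontr)
    assume "\<not> ?thesis"
    then have "dist1 n (fst p) (snd p) = 0" using dist1_nonneg[of n "fst p" "snd p"] by linarith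
    then have "\<forall>j<n. fst p j = snd p j" by (auto simp: dist1_def sum_nonneg_eq_0_iff)
    then have "fst p = snd p" using that by (intro ext) (auto simp: T_def sph_def, metis linorder_not_less)
    then show False using that e by (simp add: T_def)
  qed
  obtain \<mu> where \<mu>: "\<mu> > 0" "\<And>p. p \<in> T \<Longrightarrow> \<mu> \<le> dist1 n (fst p) (snd p)"
  proof (cases "T = {}")
    case False
    obtain p where "p \<in> T" "\<forall>y\<in>T. dist1 n (fst p) (snd p) \<le> dist1 n (fst y) (snd y)"
      using continuous_attains_inf[OF cT False cd] by blast
    then show ?thesis using that dpos by blast
  qed (use that[of 1] in auto)
  define L where "L = 2 * B / \<mu>"
  have L0: "L \<ge> 0" using B0 \<mu> by (simp add: L_def)
  have ap: "q x \<le> q z + L * dist1 n x z + e" if "x \<in> sph n" "z \<in> sph n" for x z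
  proof (cases "(x, z) \<in> T")
    case True
    have "2 * B = L * \<mu>" using \<mu> by (simp add: L_def)
    also have "\<dots> \<le> L * dist1 n x z" using \<mu>(2)[OF True] L0 by (intro mult_left_mono) auto
    finally show ?thesis using B[OF that(1)] B[OF that(2)] e by linarith
  next
    case False
    then have "\<bar>q x - q z\<bar> < e" using that by (auto simp: T_def)
    moreover have "0 \<le> L * dist1 n x z" using L0 dist1_nonneg by simp
    ultimately show ?thesis by linarith
  qed
  define Q where "Q x = (INF z\<in>sph n. q z + L * dist1 n x z)" for x
  have bb: "bdd_below ((\<lambda>z. q z + L * dist1 n x z) ` sph n)" for x
  proof (rule bdd_belowI2)
    fix z assume "z \<in> sph n"
    then show "- B \<le> q z + L * dist1 n x z" using B[of z] L0 dist1_nonneg[of n x z]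
      by (smt (verit) mult_nonneg_nonneg)
  qed
  have half: "Q x - Q y \<le> L * dist1 n x y" for x y
  proof -
    have "Q x - L * dist1 n x y \<le> Q y"
      unfolding Q_def[of y]
    proof (rule cINF_greatest[OF ne])
      fix z assume z: "z \<in> sph n"
      have "Q x \<le> q z + L * dist1 n x z" unfolding Q_def by (rule cINF_lower[OF bb z])
      also have "L * dist1 n x z \<le> L * (dist1 n x y + dist1 n y z)"
        by (intro mult_left_mono dist1_triangle L0)
      finally show "Q x - L * dist1 n x y \<le> q z + L * dist1 n y z" by (simp add: algebra_simps)
    qed
    then show ?thesis by linarith
  qed
  have sym: "dist1 n x y = dist1 n y x" for x y by (simp add: dist1_def abs_minus_commute)
  show ?thesis
  proof (rule that[OF L0])
    show "\<bar>Q x - Q z\<bar> \<le> L * dist1 n x z" for x z using half[of x z] half[of z x] sym[of x z] by auto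
    fix x assume x: "x \<in> sph n"
    have "Q x \<le> q x + L * dist1 n x x" unfolding Q_def by (rule cINF_lower[OF bb x])
    then have "Q x \<le> q x" by (simp add: dist1_def)
    moreover have "q x - e \<le> Q x" unfolding Q_def
      by (rule cINF_greatest[OF ne]) (use ap[OF x] in \<open>force simp: algebra_simps\<close>)
    ultimately show "\<bar>Q x - q x\<bar> \<le> e" by linarith
  qed
qed

text \<open>A Lipschitz approximation \<open>Q\<close> of \<open>q\<close>, defined on the whole
  cube, misses some small vector \<open>v\<close>. So \<open>q\<close> can be moved to
  \<open>Q - v\<close> without meeting 0, and \<open>Q - v\<close> is contracted by shrinking its
  argument to the origin: the shrunk points stay in the cube, where \<open>Q\<close> misses
  \<open>v\<close>.\<close>

theorem low_dim_sph_null_homotopic: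
  assumes nd: "n < d" and q: "continuous_on (sph n) q" and qd: "\<And>x. x \<in> sph n \<Longrightarrow> q x \<in> punctured d"
  obtains k where "homotopic_with_canon (\<lambda>_. True) (sph n) (punctured d) q (\<lambda>_. k)" "k \<in> punctured d"
proof (cases "sph n = {}")
  case True
  have "(\<lambda>_. 1) \<in> punctured d" using nd by (auto simp: punctured_def)
  then show ?thesis using that True by (metis homotopic_with_canon_on_empty)
next
  case ne: False
  define N where "N x = (\<Sum>i<d. \<bar>x i\<bar>)" for x :: "nat \<Rightarrow> real"
  have Npos: "N x > 0 \<longleftrightarrow> x \<in> punctured d" for x
  proof
    show "x \<in> punctured d" if "N x > 0"
    proof (rule ccontr)
      assume "x \<notin> punctured d"
      then have "N x = 0" by (auto simp: punctured_def N_def)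
      then show False using that by simp
    qed
    show "N x > 0" if "x \<in> punctured d" using that unfolding N_def punctured_def by (auto intro!: sum_pos2)
  qed
  have Ntri: "N x \<le> N y + N (\<lambda>i. x i - y i)" for x y
    unfolding N_def sum.distrib[symmetric] by (intro sum_mono) auto
  have cN: "continuous_on (sph n) (\<lambda>x. N (q x))"
    unfolding N_def by (intro continuous_on_sum continuous_on_rabs continuous_on_coord_comp[OF q])
  obtain x1 where x1: "x1 \<in> sph n" "\<And>x. x \<in> sph n \<Longrightarrow> N (q x1) \<le> N (q x)"
    using continuous_attains_inf[OF compact_sph ne cN] by blast
  define \<mu> where "\<mu> = N (q x1)"
  have \<mu>0: "\<mu> > 0" using qd[OF x1(1)] Npos by (simp add: \<mu>_def)
  \<comment> \<open>Approximation and shift cost at most \<open>e\<close> each in every coordinate,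
    together at most two thirds of \<mu> in the norm \<open>N\<close>, while \<open>N\<close> is at
    least \<mu> along \<open>q\<close>.\<close>
  define e where "e = \<mu> / (3 * real d)"
  have e0: "e > 0" using \<mu>0 nd by (simp add: e_def)
  have de: "real d * e = \<mu> / 3" using nd by (simp add: e_def)
  have "\<exists>Q L. L \<ge> 0 \<and> (\<forall>x z. \<bar>Q x - Q z\<bar> \<le> L * dist1 n x z) \<and> (\<forall>x\<in>sph n. \<bar>Q x - q x i\<bar> \<le> e)" for i
  proof -
    obtain Q L where "L \<ge> 0" "\<And>x z. \<bar>Q x - Q z\<bar> \<le> L * dist1 n x z" "\<And>x. x \<in> sph n \<Longrightarrow> \<bar>Q x - q x i\<bar> \<le> e"
      using lipschitz_approx_sph[OF continuous_on_coord_comp[OF q, of i] e0 ne] by metis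
    then show ?thesis by (intro exI[of _ Q] exI[of _ L]) simp
  qed
  then obtain Q' L' where Q': "\<And>i. L' i \<ge> 0" "\<And>i x z. \<bar>Q' i x - Q' i z\<bar> \<le> L' i * dist1 n x z"
    "\<And>i x. x \<in> sph n \<Longrightarrow> \<bar>Q' i x - q x i\<bar> \<le> e" by metis
  define Q where "Q x = (\<lambda>i. Q' i x)" for x
  define L where "L = (\<Sum>i<d. L' i)"
  have L0: "L \<ge> 0" unfolding L_def by (intro sum_nonneg Q')
  have lip: "\<bar>Q x i - Q z i\<bar> \<le> L * (\<Sum>j<n. \<bar>x j - z j\<bar>)" if "i < d" for i x z
  proof -
    have "L' i \<le> L" unfolding L_def by (intro member_le_sum) (use that Q' in auto)
    then have "L' i * dist1 n x z \<le> L * dist1 n x z" by (intro mult_right_mono dist1_nonneg)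
    then show ?thesis using Q'(2)[of i x z] by (simp add: Q_def dist1_def)
  qed
  obtain v where v: "\<And>i. 0 \<le> v i \<and> v i \<le> e" "\<And>x. \<forall>i. \<bar>x i\<bar> \<le> 1 \<Longrightarrow> \<exists>i<d. Q x i \<noteq> v i"
    by (rule lipschitz_misses_point[OF nd e0 L0, of Q]) (use lip in auto)
  have cQ: "continuous_on S (\<lambda>y. Q (f y) i)" if f: "continuous_on S f" for f :: "'b::topological_space \<Rightarrow> nat \<Rightarrow> real" and S i
  proof -
    have "continuous_on S (\<lambda>y. Q (f y) i)"
      unfolding continuous_on_def
    proof
      fix y assume y: "y \<in> S"
      have fj: "((\<lambda>y. f y j) \<longlongrightarrow> f y j) (at y within S)" for j
        using continuous_on_coord_comp[OF f, of j] y by (simp add: continuous_on_def)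
      have t: "((\<lambda>w. L' i * dist1 n (f w) (f y)) \<longlongrightarrow> L' i * (\<Sum>j<n. \<bar>f y j - f y j\<bar>)) (at y within S)"
        unfolding dist1_def by (intro tendsto_intros fj)
      have "((\<lambda>w. Q (f w) i - Q (f y) i) \<longlongrightarrow> 0) (at y within S)"
      proof (rule Lim_null_comparison)
        show "\<forall>\<^sub>F w in at y within S. norm (Q (f w) i - Q (f y) i) \<le> L' i * dist1 n (f w) (f y)"
          using Q'(2) by (simp add: Q_def)
      qed (use t in simp)
      then show "((\<lambda>w. Q (f w) i) \<longlongrightarrow> Q (f y) i) (at y within S)"
        using LIM_zero_iff by blast
    qed
    then show ?thesis .
  qed
  have near: "z \<in> punctured d" if "x \<in> sph n" "\<And>i. \<bar>z i - q x i\<bar> \<le> 2 * e" for x z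
  proof -
    have "N (\<lambda>i. q x i - z i) \<le> (\<Sum>i<d. 2 * e)"
      unfolding N_def by (intro sum_mono) (use that(2) in \<open>simp add: abs_minus_commute\<close>)
    also have "\<dots> = 2 * (real d * e)" by simp
    also have "\<dots> = 2 * (\<mu> / 3)" by (simp only: de)
    finally have "N z > 0" using Ntri[of "q x" z] x1(2)[OF that(1)] \<mu>0 unfolding \<mu>_def by linarith
    then show ?thesis using Npos by blast
  qed
  define q2 where "q2 x = (\<lambda>i. Q x i - v i)" for x
  have cid: "continuous_on S (\<lambda>x::nat \<Rightarrow> real. x)" for S by simp
  have cq2: "continuous_on (sph n) q2"
    unfolding q2_def by (intro continuous_on_coordinatewise_then_product continuous_intros cQ cid)
  have h1: "homotopic_with_canon (\<lambda>_. True) (sph n) (punctured d) q q2"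
  proof (rule homotopic_linear_coord[OF q cq2])
    fix x and t :: real assume x: "x \<in> sph n" and t: "0 \<le> t" "t \<le> 1"
    have "\<bar>(1 - t) * q x i + t * q2 x i - q x i\<bar> \<le> 2 * e" for i
    proof -
      have "(1 - t) * q x i + t * q2 x i - q x i = t * ((Q' i x - q x i) - v i)"
        by (simp add: q2_def Q_def algebra_simps)
      moreover have "\<bar>(Q' i x - q x i) - v i\<bar> \<le> 2 * e" using Q'(3)[OF x, of i] v(1)[of i] by auto
      then have "t * \<bar>(Q' i x - q x i) - v i\<bar> \<le> 1 * (2 * e)" using t by (intro mult_mono) auto
      ultimately show ?thesis using t by (simp add: abs_mult)
    qed
    then show "(\<lambda>i. (1 - t) * q x i + t * q2 x i) \<in> punctured d" using near[OF x] by simp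
  qed
  define h where "h p = (\<lambda>i. Q (\<lambda>j. (1 - fst p) * snd p j) i - v i)" for p :: "real \<times> (nat \<Rightarrow> real)"
  have h2: "homotopic_with_canon (\<lambda>_. True) (sph n) (punctured d) q2 (\<lambda>_. q2 (\<lambda>_. 0))"
  proof (rule homotopic_canonI[of _ h])
    show "continuous_on ({0..1} \<times> sph n) h"
      unfolding h_def
      by (intro continuous_on_coordinatewise_then_product continuous_intros cQ)
        (rule continuous_on_coord_comp, intro continuous_intros)
    fix t :: real and x assume p: "0 \<le> t" "t \<le> 1" "x \<in> sph n"
    have "\<forall>i. \<bar>(1 - t) * x i\<bar> \<le> 1"
      using p sph_abs_le_1[of x n] by (auto simp: abs_mult intro!: mult_le_one)
    from v(2)[OF this] show "h (t, x) \<in> punctured d" by (auto simp: h_def punctured_def)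
  qed (auto simp: h_def q2_def)
  have "q2 (\<lambda>_. 0) \<in> punctured d" using v(2)[of "\<lambda>_. 0"] by (auto simp: q2_def punctured_def)
  then show ?thesis using that[OF homotopic_with_trans[OF h1 h2]] by simp
qed

section \<open>A linking principle\<close>

text \<open>A situation to be refuted. \<open>y\<close> and \<open>l\<close> are biorthogonal
  systems for the \<open>d\<close> directions that descend at infinity, \<open>c\<close> and
  \<open>p\<close> for the \<open>n\<close> negative directions at 0. \<open>out\<close> makes the
  linear field that expands the span of \<open>y\<close> and contracts its complement a descent
  direction beyond radius \<open>R\<close>; \<open>ann\<close> is the quantitative absence of
  critical points other than 0.\<close>

locale linking_geometry =
  fixes E :: "'h::real_inner \<Rightarrow> real" and G :: "'h \<Rightarrow> 'h"
    and d :: nat and y :: "nat \<Rightarrow> 'h" and l :: "nat \<Rightarrow> 'h \<Rightarrow> real" and R :: real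
    and n :: nat and c :: "nat \<Rightarrow> 'h" and p :: "nat \<Rightarrow> 'h \<Rightarrow> real" and \<kappa> \<rho> :: real
  assumes deriv: "\<And>u. (E has_derivative (\<lambda>v. G u \<bullet> v)) (at u)"
    and unif: "\<And>B \<epsilon>. \<epsilon> > 0 \<Longrightarrow>
      \<exists>\<delta>>0. \<forall>u v. norm u \<le> B \<longrightarrow> norm v \<le> B \<longrightarrow> norm (u - v) \<le> \<delta> \<longrightarrow> norm (G u - G v) \<le> \<epsilon>"
    and bdd: "\<And>B. \<exists>C. \<forall>u. norm u \<le> B \<longrightarrow> norm (G u) \<le> C"
    and lin_l: "\<And>i. i < d \<Longrightarrow> bounded_linear (l i)"
    and l_y: "\<And>i j. i < d \<Longrightarrow> j < d \<Longrightarrow> l i (y j) = (if i = j then 1 else 0)"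
    and R: "R > 0"
    and out: "\<And>u. R \<le> norm u \<Longrightarrow> 1 \<le> G u \<bullet> (u - 2 *\<^sub>R (\<Sum>i<d. l i u *\<^sub>R y i))"
    and ann: "\<And>r B. r > 0 \<Longrightarrow> \<exists>\<gamma>>0. \<forall>u. r \<le> norm u \<longrightarrow> norm u \<le> B \<longrightarrow> \<gamma> \<le> norm (G u)"
    and nd: "n < d"
    and lin_p: "\<And>i. i < n \<Longrightarrow> bounded_linear (p i)"
    and p_c: "\<And>i j. i < n \<Longrightarrow> j < n \<Longrightarrow> p i (c j) = (if i = j then 1 else 0)"
    and \<kappa>: "\<kappa> > 0" and \<rho>: "\<rho> > 0"
    and Epos: "\<And>u. \<forall>i<n. p i u = 0 \<Longrightarrow> norm u \<le> \<rho> \<Longrightarrow> \<kappa> * (norm u)\<^sup>2 \<le> E u"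
    and Eneg: "\<And>x. (\<Sum>i<n. (x i)\<^sup>2) \<le> \<rho>\<^sup>2 \<Longrightarrow> E (\<Sum>i<n. x i *\<^sub>R c i) \<le> - \<kappa> * (\<Sum>i<n. (x i)\<^sup>2)"
begin

text \<open>\<open>Epos\<close> and \<open>Eneg\<close> both apply at the origin and bound
  \<open>E\<close> from either side.\<close>

lemma E_zero: "E 0 = 0"
  using Epos[of 0] Eneg[of "\<lambda>_. 0"] \<rho> lin_p by (simp add: linear_simps)

lemma E_cont: "continuous_on S E"
  using has_derivative_continuous[OF deriv] continuous_at_imp_continuous_on by blast

lemma E_cont_comp [continuous_intros]: "continuous_on S f \<Longrightarrow> continuous_on S (\<lambda>x. E (f x))"
  by (rule continuous_on_compose2[OF E_cont[of UNIV]]) auto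

lemma G_cont: "continuous_on S G"
proof (rule continuous_at_imp_continuous_on, rule ballI)
  fix u
  show "isCont G u"
    unfolding continuous_at_eps_delta
  proof (intro allI impI)
    fix e :: real assume "e > 0"
    then obtain \<delta> where \<delta>: "\<delta> > 0"
      "\<And>v w. norm v \<le> norm u + 1 \<Longrightarrow> norm w \<le> norm u + 1 \<Longrightarrow> norm (v - w) \<le> \<delta> \<Longrightarrow> norm (G v - G w) \<le> e / 2"
      using unif[of "e / 2" "norm u + 1"] by auto
    show "\<exists>\<delta>>0. \<forall>x'. dist x' u < \<delta> \<longrightarrow> dist (G x') (G u) < e"
    proof (intro exI[of _ "min \<delta> 1"] conjI allI impI)
      fix x' assume x': "dist x' u < min \<delta> 1"
      have "norm x' \<le> norm u + 1" using x' norm_triangle_sub[of x' u] by (simp add: dist_norm)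
      then have "norm (G x' - G u) \<le> e / 2" using x' \<delta>(2)[of x' u] by (simp add: dist_norm)
      then show "dist (G x') (G u) < e" using \<open>e > 0\<close> by (simp add: dist_norm)
    qed (use \<delta> in simp)
  qed
qed

lemma E_segment_deriv: "((\<lambda>t. E (u + t *\<^sub>R v)) has_real_derivative G (u + t *\<^sub>R v) \<bullet> v) (at t)"
proof -
  have "((\<lambda>t. u + t *\<^sub>R v) has_derivative (\<lambda>h. h *\<^sub>R v)) (at t)"
    by (auto intro!: derivative_eq_intros)
  from has_derivative_compose[OF this deriv] show ?thesis
    by (simp add: has_field_derivative_def mult_commute_abs)
qed

lemma E_mvt:
  obtains \<theta> where "0 < \<theta>" "\<theta> < 1" "E (u + v) - E u = G (u + \<theta> *\<^sub>R v) \<bullet> v"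
proof -
  have "\<exists>z>0. z < 1 \<and> E (u + 1 *\<^sub>R v) - E (u + 0 *\<^sub>R v) = (1 - 0) * (G (u + z *\<^sub>R v) \<bullet> v)"
    by (rule MVT2) (auto intro: E_segment_deriv)
  then show ?thesis using that by auto
qed

lemma E_bounded: obtains C where "C \<ge> 0" "\<And>u. norm u \<le> B \<Longrightarrow> \<bar>E u\<bar> \<le> C"
proof -
  obtain C where C: "\<And>u. norm u \<le> B \<Longrightarrow> norm (G u) \<le> C" using bdd by blast
  have "\<bar>E u\<bar> \<le> \<bar>C\<bar> * \<bar>B\<bar>" if u: "norm u \<le> B" for u
  proof -
    obtain \<theta> where t: "0 < \<theta>" "\<theta> < 1" "E (0 + u) - E 0 = G (0 + \<theta> *\<^sub>R u) \<bullet> u" using E_mvt by blast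
    have "norm (\<theta> *\<^sub>R u) \<le> B" using u t by (simp add: mult_left_le_one_le order_trans[OF _ u])
    from C[OF this] have "norm (G (\<theta> *\<^sub>R u)) * norm u \<le> \<bar>C\<bar> * \<bar>B\<bar>"
      using u by (intro mult_mono) auto
    then show ?thesis using t E_zero Cauchy_Schwarz_ineq2[of "G (\<theta> *\<^sub>R u)" u] by simp
  qed
  then show ?thesis using that[of "\<bar>C\<bar> * \<bar>B\<bar>"] by simp
qed

section \<open>The linear flow at infinity\<close>

definition Y :: "'h \<Rightarrow> 'h" where "Y u = (\<Sum>i<d. l i u *\<^sub>R y i)"
text \<open>The linear flow that expands the range of \<open>Y\<close> and contracts its complement; by \<open>out\<close> it
  decreases \<open>E\<close> outside the ball of radius \<open>R\<close>.\<close>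

definition S :: "real \<Rightarrow> 'h \<Rightarrow> 'h" where "S t u = exp (- t) *\<^sub>R (u - Y u) + exp t *\<^sub>R Y u"

lemma bl_Y: "bounded_linear Y"
  unfolding Y_def
  by (intro bounded_linear_sum bounded_linear_scaleR_const lin_l) auto

lemma l_Y: "i < d \<Longrightarrow> l i (Y u) = l i u"
proof -
  assume i: "i < d"
  interpret bounded_linear "l i" using lin_l[OF i] .
  have "l i (Y u) = (\<Sum>j<d. l j u * (if i = j then 1 else 0))"
    unfolding Y_def sum scale by (intro sum.cong) (auto simp: l_y[OF i])
  also have "\<dots> = l i u" using i by (simp add: if_distrib cong: if_cong)
  finally show ?thesis .
qed

lemma l_S: "i < d \<Longrightarrow> l i (S t u) = exp t * l i u"
  unfolding S_def using lin_l[of i] l_Y[of i u] by (simp add: linear_simps)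

lemma Y_S: "Y (S t u) = exp t *\<^sub>R Y u"
  unfolding Y_def[of "S t u"] Y_def[of u] scaleR_sum_right by (intro sum.cong) (simp_all add: l_S)

lemma S_0 [simp]: "S 0 u = u" by (simp add: S_def)

lemma S_S: "S s (S t u) = S (s + t) u"
proof -
  have "S t u - Y (S t u) = exp (- t) *\<^sub>R (u - Y u)" unfolding Y_S by (simp add: S_def)
  then show ?thesis unfolding S_def[of s "S t u"] Y_S by (simp add: S_def flip: exp_add)
qed

lemma S_cont [continuous_intros]:
  "continuous_on T f \<Longrightarrow> continuous_on T g \<Longrightarrow> continuous_on T (\<lambda>x. S (f x) (g x))"
  unfolding S_def by (intro continuous_intros bounded_linear.continuous_on[OF bl_Y])

text \<open>The velocity of the flow at a point is minus the vector that is paired with the gradient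
  in \<open>out\<close>, so \<open>E\<close> falls at least at unit rate as long as the trajectory
  stays beyond radius \<open>R\<close>.\<close>

lemma flow_descent:
  assumes t: "0 \<le> t" and far: "\<And>s. 0 \<le> s \<Longrightarrow> s \<le> t \<Longrightarrow> R \<le> norm (S s u)"
  shows "E (S t u) \<le> E u - t"
proof -
  have "E (S t u) + t \<le> E (S 0 u) + 0"
  proof (rule DERIV_nonpos_imp_nonincreasing[OF t, of "\<lambda>s. E (S s u) + s"])
    fix s assume s: "0 \<le> s" "s \<le> t"
    define w where "w = S s u - 2 *\<^sub>R Y (S s u)"
    have "((\<lambda>s. S s u) has_derivative (\<lambda>h. h *\<^sub>R (- w))) (at s)"
      unfolding S_def w_def Y_S[unfolded S_def]
      by (auto intro!: derivative_eq_intros ext simp: algebra_simps simp flip: scaleR_2)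
    from has_derivative_compose[OF this deriv]
    have "((\<lambda>s. E (S s u)) has_real_derivative - (G (S s u) \<bullet> w)) (at s)"
      by (simp add: has_field_derivative_def mult_commute_abs[of "- (G (S s u) \<bullet> w)", symmetric])
    then have "((\<lambda>s. E (S s u) + s) has_real_derivative - (G (S s u) \<bullet> w) + 1) (at s)"
      by (auto intro!: derivative_eq_intros)
    moreover have "1 \<le> G (S s u) \<bullet> w" using out[OF far[OF s]] by (simp add: w_def Y_def)
    ultimately show "\<exists>z. ((\<lambda>s. E (S s u) + s) has_real_derivative z) (at s) \<and> z \<le> 0"
      by (intro exI[of _ "- (G (S s u) \<bullet> w) + 1"]) auto
  qed
  then show ?thesis by simp
qed

text \<open>One gradient step with cut-off in place of a gradient flow. The step is so short that
  the gradient along it differs from \<open>G u\<close> by at most half of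
  \<open>norm (G u)\<close>, hence the energy drops by at least
  \<open>\<sigma> * \<gamma>\<^sup>2 / 2\<close> for step size \<sigma>. The bound 1/4 on the
  displacement is there for the outer step that follows.\<close>

lemma inner_step:
  assumes r: "r > 0"
  obtains s \<eta> c0 where "c0 > 0" "continuous_on UNIV \<eta>"
    "\<And>t u. 0 \<le> t \<Longrightarrow> t \<le> 1 \<Longrightarrow> E (u - (t * s * \<eta> (norm u)) *\<^sub>R G u) \<le> E u"
    "\<And>u. r \<le> norm u \<Longrightarrow> norm u \<le> B \<Longrightarrow> E (u - (s * \<eta> (norm u)) *\<^sub>R G u) \<le> E u - c0"
    "\<And>t u. 0 \<le> t \<Longrightarrow> t \<le> 1 \<Longrightarrow> norm ((t * s * \<eta> (norm u)) *\<^sub>R G u) \<le> 1 / 4"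
proof -
  \<comment> \<open>Equal to 0 for arguments up to \<open>r / 2\<close> and from
    \<open>B + 1\<close> on, and to 1 on \<open>{r..B}\<close>. The step is thereby continuous
    everywhere, although the gradient is bounded below on an annulus only.\<close>
  define \<eta> where "\<eta> v = max 0 (min 1 (min ((2 * v - r) / r) (B + 1 - v)))" for v :: real
  have \<eta>01: "0 \<le> \<eta> v" "\<eta> v \<le> 1" for v by (auto simp: \<eta>_def)
  have \<eta>0: "\<eta> v = 0" if "v \<le> r / 2 \<or> v \<ge> B + 1" for v
  proof -
    have "(2 * v - r) / r \<le> 0 \<or> B + 1 - v \<le> 0" using that r by (auto simp: field_simps)
    then show ?thesis by (auto simp: \<eta>_def)
  qed
  have \<eta>1: "\<eta> v = 1" if "r \<le> v" "v \<le> B" for v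
  proof -
    have "(2 * v - r) / r \<ge> 1" "B + 1 - v \<ge> 1" using that r by (auto simp: field_simps)
    then show ?thesis by (auto simp: \<eta>_def)
  qed
  obtain \<gamma> where \<gamma>: "\<gamma> > 0" "\<And>u. r / 2 \<le> norm u \<Longrightarrow> norm u \<le> B + 1 \<Longrightarrow> \<gamma> \<le> norm (G u)"
    using ann[of "r / 2" "B + 1"] r by auto
  obtain C' where C': "\<And>u. norm u \<le> B + 1 \<Longrightarrow> norm (G u) \<le> C'" using bdd by blast
  define C where "C = max 1 C'"
  have C: "C > 0" "\<And>u. norm u \<le> B + 1 \<Longrightarrow> norm (G u) \<le> C" using C' by (auto simp: C_def intro: max.coboundedI2)
  obtain \<delta> where \<delta>: "\<delta> > 0"
    "\<And>v w. norm v \<le> B + 2 \<Longrightarrow> norm w \<le> B + 2 \<Longrightarrow> norm (v - w) \<le> \<delta> \<Longrightarrow> norm (G v - G w) \<le> \<gamma> / 2"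
    using unif[of "\<gamma> / 2" "B + 2"] \<gamma> by auto
  define s where "s = min \<delta> (1 / 4) / C"
  have s: "s > 0" "s * C \<le> \<delta>" "s * C \<le> 1 / 4" using \<delta> C by (auto simp: s_def)
  have key: "E (u - \<sigma> *\<^sub>R G u) \<le> E u - \<sigma> * \<gamma>\<^sup>2 / 2"
    if u: "r / 2 \<le> norm u" "norm u \<le> B + 1" and \<sigma>: "0 \<le> \<sigma>" "\<sigma> \<le> s" for u \<sigma>
  proof -
    obtain \<theta> where \<theta>: "0 < \<theta>" "\<theta> < 1"
      "E (u + (- (\<sigma> *\<^sub>R G u))) - E u = G (u + \<theta> *\<^sub>R (- (\<sigma> *\<^sub>R G u))) \<bullet> (- (\<sigma> *\<^sub>R G u))"
      using E_mvt by blast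
    define u' where "u' = u + \<theta> *\<^sub>R (- (\<sigma> *\<^sub>R G u))"
    have "norm (u' - u) = (\<theta> * \<sigma>) * norm (G u)" using \<theta> \<sigma> by (simp add: u'_def)
    also have "\<dots> \<le> s * C"
    proof (rule mult_mono)
      show "\<theta> * \<sigma> \<le> s" using \<theta> \<sigma> s by (smt (verit) mult_left_le_one_le)
    qed (use C(2)[OF u(2)] s in auto)
    finally have nu: "norm (u' - u) \<le> s * C" .
    then have "norm u' \<le> B + 2" using s u norm_triangle_sub[of u' u] by linarith
    then have "norm (G u' - G u) \<le> \<gamma> / 2" using \<delta>(2)[of u' u] nu s u by linarith
    then have "norm (G u' - G u) \<le> norm (G u) / 2" using \<gamma>(2)[OF u] by linarith
    then have "\<bar>(G u' - G u) \<bullet> G u\<bar> \<le> norm (G u) / 2 * norm (G u)"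
      using Cauchy_Schwarz_ineq2[of "G u' - G u" "G u"]
      by (meson mult_right_mono norm_ge_zero order_trans)
    then have "\<bar>G u' \<bullet> G u - (norm (G u))\<^sup>2\<bar> \<le> (norm (G u))\<^sup>2 / 2"
      by (simp add: inner_diff_left power2_eq_square power2_norm_eq_inner[symmetric])
    then have "(norm (G u))\<^sup>2 / 2 \<le> G u' \<bullet> G u" by linarith
    moreover have "\<gamma>\<^sup>2 \<le> (norm (G u))\<^sup>2" using \<gamma>(2)[OF u] \<gamma>(1) by (intro power_mono) auto
    ultimately have "\<gamma>\<^sup>2 / 2 \<le> G u' \<bullet> G u" by linarith
    then have "\<sigma> * (\<gamma>\<^sup>2 / 2) \<le> \<sigma> * (G u' \<bullet> G u)" using \<sigma> by (intro mult_left_mono)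
    then show ?thesis using \<theta>(3) by (simp add: u'_def)
  qed
  show ?thesis
  proof (rule that[of "s * \<gamma>\<^sup>2 / 2" \<eta> s])
    show "s * \<gamma>\<^sup>2 / 2 > 0" using s \<gamma> by simp
    show "continuous_on UNIV \<eta>" unfolding \<eta>_def by (intro continuous_intros) (use r in auto)
    fix t :: real and u :: 'h assume t: "0 \<le> t" "t \<le> 1"
    have ts: "0 \<le> t * s * \<eta> (norm u)" "t * s * \<eta> (norm u) \<le> s"
    proof -
      show "0 \<le> t * s * \<eta> (norm u)" using t s \<eta>01 by simp
      have "t * \<eta> (norm u) \<le> 1" using t \<eta>01 by (simp add: mult_le_one)
      then have "s * (t * \<eta> (norm u)) \<le> s * 1" using s by (intro mult_left_mono) auto
      then show "t * s * \<eta> (norm u) \<le> s" by (simp add: mult_ac)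
    qed
    show "E (u - (t * s * \<eta> (norm u)) *\<^sub>R G u) \<le> E u"
    proof (cases "r / 2 \<le> norm u \<and> norm u \<le> B + 1")
      case True
      have "0 \<le> (t * s * \<eta> (norm u)) * \<gamma>\<^sup>2 / 2" using ts by simp
      then show ?thesis using key[of u "t * s * \<eta> (norm u)"] True ts by linarith
    next
      case False then show ?thesis using \<eta>0[of "norm u"] by auto
    qed
    show "norm ((t * s * \<eta> (norm u)) *\<^sub>R G u) \<le> 1 / 4"
    proof (cases "norm u \<le> B + 1")
      case True
      have "(t * s * \<eta> (norm u)) * norm (G u) \<le> s * C"
        using ts C(2)[OF True] s by (intro mult_mono) auto
      moreover have "norm ((t * s * \<eta> (norm u)) *\<^sub>R G u) = (t * s * \<eta> (norm u)) * norm (G u)"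
        using ts(1) by (simp only: norm_scaleR abs_of_nonneg)
      ultimately show ?thesis using s by linarith
    next
      case False then show ?thesis using \<eta>0[of "norm u"] by auto
    qed
  next
    fix u :: 'h assume u: "r \<le> norm u" "norm u \<le> B"
    show "E (u - (s * \<eta> (norm u)) *\<^sub>R G u) \<le> E u - s * \<gamma>\<^sup>2 / 2"
      using key[of u s] u r s \<eta>1[OF u] by simp
  qed
qed

text \<open>The flow time is cut off to 0 below radius \<open>R + 1 / 2\<close> and equals \<tau>
  from \<open>R + 1\<close> on. Within time \<tau> no trajectory gets from radius
  \<open>R + 1 / 2\<close> down below \<open>R\<close>, so \<open>flow_descent\<close> applies all
  along it.\<close>

lemma outer_step:
  obtains \<tau> \<eta> where "\<tau> > 0" "continuous_on UNIV \<eta>" "\<And>v. 0 \<le> \<eta> v"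
    "\<And>t u. 0 \<le> t \<Longrightarrow> t \<le> 1 \<Longrightarrow> E (S (t * \<tau> * \<eta> (norm u)) u) \<le> E u - t * \<tau> * \<eta> (norm u)"
    "\<And>v. R + 1 \<le> v \<Longrightarrow> \<eta> v = 1"
proof -
  define \<eta> where "\<eta> v = max 0 (min 1 (2 * (v - R) - 1))" for v :: real
  obtain \<Lambda> where \<Lambda>: "\<And>u. norm (Y u) \<le> norm u * \<Lambda>" "\<Lambda> > 0"
    using bounded_linear.pos_bounded[OF bl_Y] by blast
  \<comment> \<open>While \<open>exp s \<le> 1 + q\<close>, the flow displaces \<open>u\<close> by
    at most \<open>q * (1 + 2 * \<Lambda>) * norm u\<close>. This \<open>q\<close> makes the factor
    \<open>(1 / 2) / (R + 1 / 2)\<close>, which is the relative loss from radius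
    \<open>R + 1 / 2\<close> to \<open>R\<close>.\<close>
  define q where "q = (1 / 2) / ((R + 1 / 2) * (1 + 2 * \<Lambda>))"
  have q: "q > 0" using R \<Lambda> by (simp add: q_def)
  define \<tau> where "\<tau> = ln (1 + q)"
  have \<tau>: "\<tau> > 0" "exp \<tau> = 1 + q" using q by (auto simp: \<tau>_def)
  have far: "R \<le> norm (S s u)" if u: "R + 1 / 2 \<le> norm u" and s: "0 \<le> s" "s \<le> \<tau>" for s u
  proof -
    have es: "1 \<le> exp s" "exp s \<le> 1 + q" using s \<tau> by (auto simp flip: \<tau>(2))
    have "1 - exp (- s) \<le> exp s - 1"
    proof -
      have "exp s + exp (- s) \<ge> 2" using exp_ge_add_one_self[of s] exp_ge_add_one_self[of "-s"] by linarith
      then show ?thesis by linarith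
    qed
    then have b: "1 - exp (- s) \<le> q" "0 \<le> 1 - exp (-s)" "exp s - exp (- s) \<le> 2 * q" "0 \<le> exp s - exp (- s)"
      using es s by auto
    have "u - S s u = (1 - exp (- s)) *\<^sub>R u - (exp s - exp (- s)) *\<^sub>R Y u"
      by (simp add: S_def algebra_simps)
    also have "norm \<dots> \<le> (1 - exp (- s)) * norm u + (exp s - exp (- s)) * norm (Y u)"
      using b by (intro order_trans[OF norm_triangle_ineq4]) auto
    also have "\<dots> \<le> q * norm u + (2 * q) * (norm u * \<Lambda>)"
      using b \<Lambda>(1)[of u] q by (intro add_mono mult_mono) auto
    also have "\<dots> = q * (1 + 2 * \<Lambda>) * norm u" by (simp add: algebra_simps)
    finally have "norm (u - S s u) \<le> q * (1 + 2 * \<Lambda>) * norm u" .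
    moreover have q2: "q * (1 + 2 * \<Lambda>) = (1 / 2) / (R + 1 / 2)"
      using \<Lambda> R by (simp add: q_def divide_simps)
    ultimately have "norm u - norm (S s u) \<le> (1 / 2) / (R + 1 / 2) * norm u"
      using norm_triangle_ineq2[of u "S s u"] by simp
    then have "norm u * (1 - (1 / 2) / (R + 1 / 2)) \<le> norm (S s u)" by (simp add: algebra_simps)
    moreover have "1 - (1 / 2) / (R + 1 / 2) = R / (R + 1 / 2)" using R by (simp add: field_simps)
    moreover have "(R + 1 / 2) * (R / (R + 1 / 2)) \<le> norm u * (R / (R + 1 / 2))"
      using u R by (intro mult_right_mono) auto
    ultimately show ?thesis using R by simp
  qed
  show ?thesis
  proof (rule that[OF \<tau>(1), of \<eta>])
    show "continuous_on UNIV \<eta>" unfolding \<eta>_def by (intro continuous_intros)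
    show "0 \<le> \<eta> v" for v by (simp add: \<eta>_def)
    show "\<eta> v = 1" if "R + 1 \<le> v" for v using that by (simp add: \<eta>_def)
    fix t :: real and u :: 'h assume t: "0 \<le> t" "t \<le> 1"
    show "E (S (t * \<tau> * \<eta> (norm u)) u) \<le> E u - t * \<tau> * \<eta> (norm u)"
    proof (cases "R + 1 / 2 \<le> norm u")
      case True
      have "t * \<eta> (norm u) \<le> 1" using t by (intro mult_le_one) (auto simp: \<eta>_def)
      then have "\<tau> * (t * \<eta> (norm u)) \<le> \<tau> * 1" using \<tau> by (intro mult_left_mono) auto
      then have le: "t * \<tau> * \<eta> (norm u) \<le> \<tau>" by (simp add: mult_ac)
      show ?thesis
      proof (rule flow_descent)
        show "0 \<le> t * \<tau> * \<eta> (norm u)" using t \<tau> by (simp add: \<eta>_def)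
        show "R \<le> norm (S s u)" if "0 \<le> s" "s \<le> t * \<tau> * \<eta> (norm u)" for s
          using far[OF True that(1)] that(2) le by linarith
      qed
    next
      case False
      then have "\<eta> (norm u) = 0" by (simp add: \<eta>_def)
      then show ?thesis by simp
    qed
  qed
qed

text \<open>An inner step is followed by an outer one. Between radius \<open>r\<close> and
  \<open>R + 2\<close> the inner step gains \<open>c1\<close>. Beyond \<open>R + 2\<close> it moves
  the point by at most 1/4, hence not below \<open>R + 1\<close>, and the outer step gains the full
  \<tau>.\<close>

lemma descent_step:
  assumes r: "r > 0"
  obtains \<Phi> :: "real \<Rightarrow> 'h \<Rightarrow> 'h" and c0 where "c0 > 0" "continuous_on UNIV (\<lambda>q. \<Phi> (fst q) (snd q))"
    "\<And>u. \<Phi> 0 u = u" "\<And>t u. 0 \<le> t \<Longrightarrow> t \<le> 1 \<Longrightarrow> E (\<Phi> t u) \<le> E u"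
    "\<And>u. r \<le> norm u \<Longrightarrow> E (\<Phi> 1 u) \<le> E u - c0"
proof -
  obtain s \<eta> c1 where I: "c1 > 0" "continuous_on UNIV \<eta>"
    "\<And>t u. 0 \<le> t \<Longrightarrow> t \<le> 1 \<Longrightarrow> E (u - (t * s * \<eta> (norm u)) *\<^sub>R G u) \<le> E u"
    "\<And>u. r \<le> norm u \<Longrightarrow> norm u \<le> R + 2 \<Longrightarrow> E (u - (s * \<eta> (norm u)) *\<^sub>R G u) \<le> E u - c1"
    "\<And>t u. 0 \<le> t \<Longrightarrow> t \<le> 1 \<Longrightarrow> norm ((t * s * \<eta> (norm u)) *\<^sub>R G u) \<le> 1 / 4"
    by (rule inner_step[OF r, of "R + 2"]) (rule that, assumption+)
  obtain \<tau> \<eta>' where O: "\<tau> > 0" "continuous_on UNIV \<eta>'" "\<And>v. 0 \<le> \<eta>' v"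
    "\<And>t u. 0 \<le> t \<Longrightarrow> t \<le> 1 \<Longrightarrow> E (S (t * \<tau> * \<eta>' (norm u)) u) \<le> E u - t * \<tau> * \<eta>' (norm u)"
    "\<And>v. R + 1 \<le> v \<Longrightarrow> \<eta>' v = 1"
    by (rule outer_step) (rule that, assumption+)
  define w where "w t u = u - (t * s * \<eta> (norm u)) *\<^sub>R G u" for t u
  define \<Phi> where "\<Phi> t u = S (t * \<tau> * \<eta>' (norm (w t u))) (w t u)" for t u
  have O': "E (S (t * \<tau> * \<eta>' (norm u)) u) \<le> E u" if "0 \<le> t" "t \<le> 1" for t u
    using O(4)[OF that, of u] O(1,3) that by (smt (verit) mult_nonneg_nonneg)
  show ?thesis
  proof (rule that[of "min c1 \<tau>" \<Phi>])
    show "min c1 \<tau> > 0" using I O by simp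
    have cw: "continuous_on UNIV (\<lambda>q. w (fst q) (snd q))"
      unfolding w_def
      by (intro continuous_intros continuous_on_compose2[OF I(2)] continuous_on_compose2[OF G_cont[of UNIV]]) auto
    show "continuous_on UNIV (\<lambda>q. \<Phi> (fst q) (snd q))"
      unfolding \<Phi>_def by (intro continuous_intros continuous_on_compose2[OF O(2)] cw) auto
    show "\<Phi> 0 u = u" for u by (simp add: \<Phi>_def w_def)
    show "E (\<Phi> t u) \<le> E u" if "0 \<le> t" "t \<le> 1" for t u
      using O'[OF that, of "w t u"] I(3)[OF that, of u] by (simp add: \<Phi>_def w_def)
    fix u :: 'h assume u: "r \<le> norm u"
    show "E (\<Phi> 1 u) \<le> E u - min c1 \<tau>"
    proof (cases "norm u \<le> R + 2")
      case True
      show ?thesis using O'[of 1 "w 1 u"] I(4)[OF u True] by (simp add: \<Phi>_def w_def)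
    next
      case False
      have "norm (u - w 1 u) \<le> 1 / 4" using I(5)[of 1 u] by (simp add: w_def)
      then have "R + 1 \<le> norm (w 1 u)" using False norm_triangle_sub[of u "w 1 u"] by linarith
      then have "E (\<Phi> 1 u) \<le> E (w 1 u) - \<tau>" using O(4)[of 1 "w 1 u"] O(5) by (simp add: \<Phi>_def)
      then show ?thesis using I(3)[of 1 u] by (simp add: w_def)
    qed
  qed
qed

text \<open>Under iteration a point loses \<open>c0\<close> each time unless it is within
  \<open>r\<close> of the origin, where \<open>\<bar>E u\<bar> < e\<close>. A point that starts at
  or below \<open>- e\<close> never gets there. Any other point either ends at or below
  \<open>e\<close> or has lost \<open>k * c0\<close>; for both claims
  \<open>k * c0 > 2 * \<bar>b\<bar>\<close> is enough.\<close>

lemma deformation: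
  assumes e: "e > 0"
  obtains \<Psi> :: "real \<Rightarrow> 'h \<Rightarrow> 'h" where "continuous_on UNIV (\<lambda>q. \<Psi> (fst q) (snd q))"
    "\<And>u. \<Psi> 0 u = u" "\<And>t u. 0 \<le> t \<Longrightarrow> t \<le> 1 \<Longrightarrow> E (\<Psi> t u) \<le> E u"
    "\<And>u. E u \<le> b \<Longrightarrow> E (\<Psi> 1 u) \<le> e" "\<And>u. E u \<le> - e \<Longrightarrow> E (\<Psi> 1 u) \<le> - b"
proof -
  obtain r where r: "r > 0" "\<And>u. norm u < r \<Longrightarrow> \<bar>E u\<bar> < e"
  proof -
    have "isCont E 0" using has_derivative_continuous[OF deriv] .
    from this[unfolded continuous_at_eps_delta, rule_format, OF e]
    obtain r where "r > 0" "\<And>u. dist u 0 < r \<Longrightarrow> dist (E u) (E 0) < e" by blast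
    then show ?thesis using that[of r] E_zero by (simp add: dist_norm)
  qed
  obtain \<Phi> :: "real \<Rightarrow> 'h \<Rightarrow> 'h" and c0 where \<Phi>: "c0 > 0" "continuous_on UNIV (\<lambda>q. \<Phi> (fst q) (snd q))"
    "\<And>u. \<Phi> 0 u = u" "\<And>t u. 0 \<le> t \<Longrightarrow> t \<le> 1 \<Longrightarrow> E (\<Phi> t u) \<le> E u"
    "\<And>u. r \<le> norm u \<Longrightarrow> E (\<Phi> 1 u) \<le> E u - c0"
    by (rule descent_step[OF r(1)]) (rule that, assumption+)
  have it: "\<exists>\<Psi> :: real \<Rightarrow> 'h \<Rightarrow> 'h. continuous_on UNIV (\<lambda>q. \<Psi> (fst q) (snd q)) \<and>
    (\<forall>u. \<Psi> 0 u = u) \<and> (\<forall>t u. 0 \<le> t \<longrightarrow> t \<le> 1 \<longrightarrow> E (\<Psi> t u) \<le> E u) \<and>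
    (\<forall>u. E (\<Psi> 1 u) \<le> e \<or> E (\<Psi> 1 u) \<le> E u - real k * c0) \<and>
    (\<forall>u. E u \<le> - e \<longrightarrow> E (\<Psi> 1 u) \<le> E u - real k * c0)" for k
  proof (induction k)
    case 0
    show ?case by (intro exI[of _ "\<lambda>_ u. u"]) (auto intro!: continuous_intros)
  next
    case (Suc k)
    then obtain \<Psi> :: "real \<Rightarrow> 'h \<Rightarrow> 'h" where IH: "continuous_on UNIV (\<lambda>q. \<Psi> (fst q) (snd q))"
      "\<And>u. \<Psi> 0 u = u" "\<And>t u. 0 \<le> t \<Longrightarrow> t \<le> 1 \<Longrightarrow> E (\<Psi> t u) \<le> E u"
      "\<And>u. E (\<Psi> 1 u) \<le> e \<or> E (\<Psi> 1 u) \<le> E u - real k * c0"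
      "\<And>u. E u \<le> - e \<Longrightarrow> E (\<Psi> 1 u) \<le> E u - real k * c0" by blast
    show ?case
    proof (intro exI[of _ "\<lambda>t u. \<Phi> t (\<Psi> t u)"] conjI allI impI)
      have "continuous_on UNIV (\<lambda>q. (\<lambda>q. \<Phi> (fst q) (snd q)) (fst q, \<Psi> (fst q) (snd q)))"
        by (rule continuous_on_compose2[OF \<Phi>(2)]) (auto intro!: continuous_intros IH)
      then show "continuous_on UNIV (\<lambda>q. \<Phi> (fst q) (\<Psi> (fst q) (snd q)))" by simp
      show "\<Phi> 0 (\<Psi> 0 u) = u" for u using IH \<Phi> by simp
      show "E (\<Phi> t (\<Psi> t u)) \<le> E u" if "0 \<le> t" "t \<le> 1" for t u
        using IH(3)[OF that, of u] \<Phi>(4)[OF that, of "\<Psi> t u"] by linarith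
      have step: "E (\<Phi> 1 v) \<le> E v - c0" if "\<not> norm v < r" for v using \<Phi>(5)[of v] that by simp
      show "E (\<Phi> 1 (\<Psi> 1 u)) \<le> e \<or> E (\<Phi> 1 (\<Psi> 1 u)) \<le> E u - real (Suc k) * c0" for u
      proof (cases "norm (\<Psi> 1 u) < r")
        case True
        then show ?thesis using r(2)[OF True] \<Phi>(4)[of 1 "\<Psi> 1 u"] by auto
      next
        case False
        then show ?thesis using step[OF False] IH(4)[of u] \<Phi>(1) by (auto simp: algebra_simps)
      qed
      show "E (\<Phi> 1 (\<Psi> 1 u)) \<le> E u - real (Suc k) * c0" if "E u \<le> - e" for u
      proof -
        have le: "E (\<Psi> 1 u) \<le> E u - real k * c0" using IH(5)[OF that] .
        moreover have "0 \<le> real k * c0" using \<Phi>(1) by simp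
        ultimately have "E (\<Psi> 1 u) \<le> - e" using that by linarith
        then have "\<not> norm (\<Psi> 1 u) < r" using r(2)[of "\<Psi> 1 u"] by auto
        from step[OF this] le show ?thesis by (simp add: algebra_simps)
      qed
    qed
  qed
  obtain k :: nat where "(\<bar>b\<bar> + b) / c0 < real k" using reals_Archimedean2 by blast
  then obtain k :: nat where "2 * \<bar>b\<bar> / c0 < real k" using reals_Archimedean2 by blast
  then have k: "2 * \<bar>b\<bar> < real k * c0" using \<Phi>(1) by (simp add: field_simps)
  from it[of k] obtain \<Psi> :: "real \<Rightarrow> 'h \<Rightarrow> 'h" where W: "continuous_on UNIV (\<lambda>q. \<Psi> (fst q) (snd q))"
      "\<And>u. \<Psi> 0 u = u" "\<And>t u. 0 \<le> t \<Longrightarrow> t \<le> 1 \<Longrightarrow> E (\<Psi> t u) \<le> E u"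
      "\<And>u. E (\<Psi> 1 u) \<le> e \<or> E (\<Psi> 1 u) \<le> E u - real k * c0"
      "\<And>u. E u \<le> - e \<Longrightarrow> E (\<Psi> 1 u) \<le> E u - real k * c0" by blast
  show ?thesis
  proof (rule that[OF W(1-3)])
    show "E (\<Psi> 1 u) \<le> e" if "E u \<le> b" for u
      using W(4)[of u] that k e by linarith
    show "E (\<Psi> 1 u) \<le> - b" if "E u \<le> - e" for u
      using W(5)[OF that] that k e by linarith
  qed
qed

text \<open>A trajectory starting below \<open>- \<beta>\<close> cannot enter the ball of radius
  \<open>R\<close>: up to the first entry time \<open>E\<close> decreases, but in the ball it is at
  least \<open>- \<beta>\<close>. If all coordinates \<open>l i u\<close> vanished, the flow would
  merely shrink \<open>u\<close> and so reach radius \<open>R\<close>.\<close>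

lemma low_levels:
  assumes \<beta>: "\<And>u. norm u \<le> R \<Longrightarrow> \<bar>E u\<bar> \<le> \<beta>" and u: "E u < - \<beta>"
  shows "0 \<le> t \<Longrightarrow> E (S t u) < - \<beta>" "0 \<le> t \<Longrightarrow> R < norm (S t u)" "\<exists>i<d. l i u \<noteq> 0"
proof -
  have far: "R < norm (S t u)" if t: "0 \<le> t" for t
  proof (rule ccontr)
    assume n: "\<not> ?thesis"
    define A where "A = {0..t} \<inter> (\<lambda>s. norm (S s u)) -` {..R}"
    have c: "continuous_on {0..t} (\<lambda>s. norm (S s u))" by (intro continuous_intros)
    have "closed A" unfolding A_def by (rule continuous_closed_preimage[OF c]) auto
    then have "compact ({0..t} \<inter> A)" by (intro compact_Int_closed) auto
    then have "compact A" by (simp add: A_def)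
    moreover have "A \<noteq> {}" using n t by (auto simp: A_def)
    ultimately have "\<exists>s\<in>A. \<forall>t\<in>A. s \<le> t" by (rule compact_attains_inf)
    then obtain s0 where s0: "s0 \<in> A" "\<And>s. s \<in> A \<Longrightarrow> s0 \<le> s" by blast
    have le: "R \<le> norm (S s u)" if "0 \<le> s" "s < s0" for s
    proof -
      have "s \<notin> A" using s0(2)[of s] that by auto
      then show ?thesis using s0(1) that by (auto simp: A_def)
    qed
    have s0R: "R \<le> norm (S s0 u)"
    proof (cases "s0 = 0")
      case True
      then show ?thesis using s0(1) \<beta>[of u] u by (auto simp: A_def)
    next
      case False
      then have pos: "0 < s0" using s0(1) by (auto simp: A_def)
      have "((\<lambda>s. norm (S s u)) \<longlongrightarrow> norm (S s0 u)) (at_left s0)"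
      proof -
        have "continuous_on UNIV (\<lambda>s. norm (S s u))" by (intro continuous_intros)
        then have "isCont (\<lambda>s. norm (S s u)) s0" by (simp add: continuous_on_eq_continuous_at)
        then show ?thesis by (simp add: isCont_def filterlim_at_split)
      qed
      moreover have "\<forall>\<^sub>F s in at_left s0. R \<le> norm (S s u)"
        unfolding eventually_at_left_field using le pos by (metis less_imp_le)
      ultimately show ?thesis by (rule tendsto_lowerbound) simp
    qed
    have "E (S s0 u) \<le> E u - s0"
    proof (rule flow_descent)
      show "0 \<le> s0" using s0(1) by (auto simp: A_def)
      show "R \<le> norm (S s u)" if "0 \<le> s" "s \<le> s0" for s
        using le[OF that(1)] s0R that by (cases "s = s0") auto
    qed
    moreover have "\<bar>E (S s0 u)\<bar> \<le> \<beta>" "0 \<le> s0" using s0(1) by (auto simp: A_def intro!: \<beta>)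
    ultimately show False using u by linarith
  qed
  show "0 \<le> t \<Longrightarrow> R < norm (S t u)" using far .
  show "E (S t u) < - \<beta>" if "0 \<le> t"
    using flow_descent[OF that, of u] far u that by (smt (verit))
  show "\<exists>i<d. l i u \<noteq> 0"
  proof (rule ccontr)
    assume "\<not> ?thesis"
    then have Y0: "Y u = 0" by (simp add: Y_def)
    have uR: "R < norm u" using far[of 0] by simp
    have "exp (ln (norm u / R)) = norm u / R" using uR R by (intro exp_ln divide_pos_pos) auto
    then have "norm (S (ln (norm u / R)) u) = R"
      using uR R by (auto simp: S_def Y0 exp_minus)
    moreover have "0 \<le> ln (norm u / R)" using uR R by simp
    ultimately show False using far by fastforce
  qed
qed

text \<open>The coordinates \<open>l i\<close> grow like \<open>exp s\<close>, uniformly on a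
  compact set on which they have no common zero. This carries the set beyond radius \<open>R\<close>
  for good, and from then on \<open>E\<close> falls at unit rate.\<close>

lemma flow_negative:
  assumes C: "compact C" and ne: "C \<noteq> {}" and l: "\<And>u. u \<in> C \<Longrightarrow> \<exists>i<d. l i u \<noteq> 0"
  obtains T where "T \<ge> 0" "\<And>u. u \<in> C \<Longrightarrow> E (S T u) < 0"
proof -
  define N where "N u = (\<Sum>i<d. \<bar>l i u\<bar>)" for u
  have cN: "continuous_on C N" unfolding N_def
    by (intro continuous_intros bounded_linear.continuous_on[OF lin_l]) auto
  obtain u1 where u1: "u1 \<in> C" "\<And>u. u \<in> C \<Longrightarrow> N u1 \<le> N u" using continuous_attains_inf[OF C ne cN] by blast
  have N1: "N u1 > 0" unfolding N_def using l[OF u1(1)] by (auto intro!: sum_pos2)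
  have "\<exists>K. \<forall>u. \<bar>l i u\<bar> \<le> norm u * K" if "i < d" for i
    using bounded_linear.bounded[OF lin_l[OF that]] by auto
  then obtain K where K: "\<And>i u. i < d \<Longrightarrow> \<bar>l i u\<bar> \<le> norm u * K i" by metis
  define \<Lambda> where "\<Lambda> = \<bar>\<Sum>i<d. K i\<bar> + 1"
  have \<Lambda>: "\<Lambda> > 0" "N u \<le> norm u * \<Lambda>" for u
  proof -
    show "\<Lambda> > 0" by (simp add: \<Lambda>_def add.commute add_pos_nonneg)
    have "N u \<le> norm u * (\<Sum>i<d. K i)" unfolding N_def sum_distrib_left by (intro sum_mono K) auto
    also have "\<dots> \<le> norm u * \<Lambda>" by (intro mult_left_mono) (auto simp: \<Lambda>_def)
    finally show "N u \<le> norm u * \<Lambda>" .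
  qed
  define s0 where "s0 = max 0 (ln (R * \<Lambda> / N u1))"
  have far: "R \<le> norm (S s u)" if "u \<in> C" "s0 \<le> s" for u s
  proof -
    have "N (S s u) = exp s * N u"
      unfolding N_def sum_distrib_left by (intro sum.cong) (auto simp: l_S abs_mult)
    then have "exp s * N u \<le> norm (S s u) * \<Lambda>" using \<Lambda>(2)[of "S s u"] by simp
    moreover have "R * \<Lambda> / N u1 \<le> exp s"
    proof -
      have "R * \<Lambda> / N u1 = exp (ln (R * \<Lambda> / N u1))" using R \<Lambda> N1 by simp
      also have "\<dots> \<le> exp s" using that by (simp add: s0_def)
      finally show ?thesis .
    qed
    then have "(R * \<Lambda> / N u1) * N u1 \<le> exp s * N u" using u1(2)[OF that(1)] N1 by (intro mult_mono) auto
    ultimately have "R * \<Lambda> \<le> norm (S s u) * \<Lambda>" using N1 by simp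
    then show ?thesis using \<Lambda>(1) by simp
  qed
  have "continuous_on C (\<lambda>u. E (S s0 u))" by (intro continuous_intros)
  from continuous_attains_sup[OF C ne this]
  obtain M where M: "\<And>u. u \<in> C \<Longrightarrow> E (S s0 u) \<le> M" by blast
  define T where "T = s0 + (\<bar>M\<bar> + 1)"
  have "E (S T u) < 0" if u: "u \<in> C" for u
  proof -
    have "E (S (\<bar>M\<bar> + 1) (S s0 u)) \<le> E (S s0 u) - (\<bar>M\<bar> + 1)"
      by (rule flow_descent) (auto simp: S_S intro!: far[OF u])
    then show ?thesis using M[OF u] by (simp add: S_S T_def add.commute)
  qed
  moreover have "T \<ge> 0" by (simp add: T_def s0_def)
  ultimately show ?thesis using that by blast
qed

text \<open>The disc of radius \<open>\<rho>\<close> in the span of the \<open>c i\<close>, the deformation of its boundary to low levels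
  and a null-homotopy of the deformed sphere there are glued to a map \<open>Sg\<close> of the \<open>n\<close>-sphere into
  \<open>{E \<le> 0}\<close>. The map \<open>P u = (p u, norm u - \<rho>)\<close> has no zero where \<open>E u < \<kappa> * \<rho>\<^sup>2\<close>, and
  \<open>P \<circ> Sg\<close> is homotopic to the identity of the sphere through \<open>Q\<close>. But pushing the cone over \<open>Sg\<close> down
  along the deformation makes \<open>P \<circ> Sg\<close> null-homotopic.\<close>

theorem inconsistent: False
proof -
  \<comment> \<open>\<open>E \<le> - \<delta>\<close> on the sphere of radius \<rho> in the span of
    \<open>c\<close>, and \<open>E \<ge> \<delta>\<close> on the one in the common kernel of the
    \<open>p i\<close>. Both deformations below use the intermediate level
    \<open>\<delta> / 2\<close>.\<close>
  define \<delta> where "\<delta> = \<kappa> * \<rho>\<^sup>2"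
  have \<delta>: "\<delta> > 0" using \<kappa> \<rho> by (simp add: \<delta>_def)
  define lin where "lin z = (\<Sum>i<n. z i *\<^sub>R c i)" for z :: "nat \<Rightarrow> real"
  have p_lin: "p i (lin z) = z i" if "i < n" for i z
  proof -
    interpret bounded_linear "p i" using lin_p[OF that] .
    have "p i (lin z) = (\<Sum>j<n. z j * (if i = j then 1 else 0))"
      unfolding lin_def sum scale by (intro sum.cong) (auto simp: p_c[OF that])
    also have "\<dots> = z i" using that by (simp add: if_distrib cong: if_cong)
    finally show ?thesis .
  qed
  have c_lin: "continuous_on T (\<lambda>x. lin (f x))" if "\<And>i. i < n \<Longrightarrow> continuous_on T (\<lambda>x. f x i)" for T :: "'x::topological_space set" and f
    unfolding lin_def by (intro continuous_intros that) auto
  define s where "s x = lin (\<lambda>i. \<rho> * x i)" for x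
  have Es: "E (s x) \<le> - \<delta>" if "x \<in> sph n" for x
  proof -
    have "(\<Sum>i<n. (\<rho> * x i)\<^sup>2) = \<rho>\<^sup>2"
      using that by (simp add: power_mult_distrib sum_distrib_left[symmetric] sph_def)
    then show ?thesis using Eneg[of "\<lambda>i. \<rho> * x i"] by (simp add: s_def lin_def \<delta>_def)
  qed
  obtain \<beta> where \<beta>: "\<beta> \<ge> 0" "\<And>u. norm u \<le> R \<Longrightarrow> \<bar>E u\<bar> \<le> \<beta>"
    by (rule E_bounded[of R]) (rule that, assumption+)
  have e: "\<delta> / 2 > 0" using \<delta> by simp
  obtain \<Psi> :: "real \<Rightarrow> 'h \<Rightarrow> 'h" where \<Psi>: "continuous_on UNIV (\<lambda>q. \<Psi> (fst q) (snd q))"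
    "\<And>u. \<Psi> 0 u = u" "\<And>t u. 0 \<le> t \<Longrightarrow> t \<le> 1 \<Longrightarrow> E (\<Psi> t u) \<le> E u"
    "\<And>u. E u \<le> - (\<delta> / 2) \<Longrightarrow> E (\<Psi> 1 u) \<le> - (\<beta> + 1)"
    by (rule deformation[OF e, of "\<beta> + 1"]) (rule that, assumption+)
  have c_\<Psi>: "continuous_on T (\<lambda>x. \<Psi> (f x) (g x))" if "continuous_on T f" "continuous_on T g"
    for T :: "'x::topological_space set" and f g
    using continuous_on_compose2[OF \<Psi>(1), of T "\<lambda>x. (f x, g x)"] that by (auto intro: continuous_intros)
  have c_s: "continuous_on T (\<lambda>x. s (f x))" if "continuous_on T f" for T :: "'x::topological_space set" and f
    unfolding s_def by (intro c_lin continuous_intros continuous_on_coord_comp[OF that])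
  define p1 where "p1 x = \<Psi> 1 (s x)" for x
  have Ep1: "E (p1 x) < - \<beta>" if "x \<in> sph n" for x
    using \<Psi>(4)[of "s x"] Es[OF that] \<delta> by (simp add: p1_def)
  have c_p1: "continuous_on T (\<lambda>x. p1 (f x))" if "continuous_on T f" for T :: "'x::topological_space set" and f
    unfolding p1_def by (intro c_\<Psi> c_s that continuous_intros)
  \<comment> \<open>The deformed sphere lies below \<open>- \<beta>\<close>, so the coordinates
    \<open>l i\<close> of its points are not all 0. They define a map of an (n - 1)-sphere into
    punctured d-space, which is null-homotopic as \<open>n < d\<close>.\<close>
  define q where "q x = (\<lambda>i. if i < d then l i (p1 x) else 0)" for x
  have cid: "continuous_on T (\<lambda>x. x)" for T :: "'x::topological_space set" by (rule continuous_on_id)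
  have c_q: "continuous_on (sph n) q"
  proof (rule continuous_on_coordinatewise_then_product)
    show "continuous_on (sph n) (\<lambda>x. q x i)" for i
      unfolding q_def
      by (cases "i < d") (auto intro!: bounded_linear.continuous_on[OF lin_l] c_p1[OF cid])
  qed
  have q_d: "q x \<in> punctured d" if x: "x \<in> sph n" for x
  proof -
    have "\<exists>i<d. l i (p1 x) \<noteq> 0" by (rule low_levels(3)[OF \<beta>(2) Ep1[OF x]])
    then show ?thesis by (auto simp: q_def punctured_def)
  qed
  obtain k where k: "homotopic_with_canon (\<lambda>_. True) (sph n) (punctured d) q (\<lambda>_. k)" "k \<in> punctured d"
    by (rule low_dim_sph_null_homotopic[OF nd c_q q_d], assumption) (rule that, assumption+)
  obtain K where K: "continuous_on ({0..1} \<times> sph n) K"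
    "\<And>t x. 0 \<le> t \<Longrightarrow> t \<le> 1 \<Longrightarrow> x \<in> sph n \<Longrightarrow> K (t, x) \<in> punctured d"
    "\<And>x. K (0::real, x) = q x" "\<And>x. K (1, x) = k"
    by (rule homotopic_canonE[OF k(1)]) (rule that, assumption+)
  define ylin where "ylin z = (\<Sum>i<d. z i *\<^sub>R y i)" for z :: "nat \<Rightarrow> real"
  have l_ylin: "l i (ylin z) = z i" if "i < d" for i z
  proof -
    interpret bounded_linear "l i" using lin_l[OF that] .
    have "l i (ylin z) = (\<Sum>j<d. z j * (if i = j then 1 else 0))"
      unfolding ylin_def sum scale by (intro sum.cong) (auto simp: l_y[OF that])
    also have "\<dots> = z i" using that by (simp add: if_distrib cong: if_cong)
    finally show ?thesis .
  qed
  \<comment> \<open>Lifts the null-homotopy \<open>K\<close> from coordinates to the space: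
    \<open>w a\<close> has coordinates \<open>K a\<close>, and its other component is scaled down to
    0. At time 0 it is the deformed sphere.\<close>
  define w where "w a = (1 - fst a) *\<^sub>R (p1 (snd a) - Y (p1 (snd a))) + ylin (K a)" for a
  have l_w: "l i (w a) = K a i" if "i < d" for i a
    using l_Y[OF that] l_ylin[OF that] lin_l[OF that] by (simp add: w_def linear_simps)
  have c_w: "continuous_on ({0..1} \<times> sph n) w"
    unfolding w_def ylin_def
    by (intro continuous_intros c_p1 bounded_linear.continuous_on[OF bl_Y] continuous_on_coord_comp[OF K(1)])
  \<comment> \<open>The end point is inserted because \<open>sph n\<close> is empty for
    \<open>n = 0\<close>; it makes \<open>C\<close> nonempty and \<open>u0\<close> negative in that
    case too.\<close>
  define C where "C = insert (ylin k) (w ` ({0..1} \<times> sph n))"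
  have "compact C" unfolding C_def
    by (intro compact_insert compact_continuous_image[OF c_w] compact_Times compact_sph compact_Icc)
  moreover have "\<exists>i<d. l i u \<noteq> 0" if u: "u \<in> C" for u
  proof -
    consider "u = ylin k" | t x where "0 \<le> t" "t \<le> 1" "x \<in> sph n" "u = w (t, x)"
      using u by (auto simp: C_def)
    then show ?thesis
    proof cases
      case 1 then show ?thesis using k(2) by (auto simp: punctured_def l_ylin)
    next
      case 2
      then show ?thesis using K(2)[of t x] by (auto simp: punctured_def l_w)
    qed
  qed
  moreover have "C \<noteq> {}" by (simp add: C_def)
  ultimately have "\<exists>T\<ge>0. \<forall>u\<in>C. E (S T u) < 0" by (metis flow_negative)
  then obtain T where T: "T \<ge> 0" "\<And>u. u \<in> C \<Longrightarrow> E (S T u) < 0" by blast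
  define u0 where "u0 = S T (ylin k)"
  have u0: "E u0 < 0" using T(2) by (simp add: u0_def C_def)
  define NEG where "NEG = {u. E u < 0}"
  \<comment> \<open>Three homotopies within negative energy: the deformation to low levels, the
    linear flow up to time \<open>T\<close>, and the lifted null-homotopy transported by
    \<open>S T\<close>.\<close>
  have h1: "homotopic_with_canon (\<lambda>_. True) (sph n) NEG s p1"
  proof (rule homotopic_canonI[of _ "\<lambda>a. \<Psi> (fst a) (s (snd a))"])
    show "continuous_on ({0..1} \<times> sph n) (\<lambda>a. \<Psi> (fst a) (s (snd a)))"
      by (intro c_\<Psi> c_s continuous_intros)
    show "\<Psi> (fst (t, x)) (s (snd (t, x))) \<in> NEG" if "0 \<le> t" "t \<le> 1" "x \<in> sph n" for t x
      using \<Psi>(3)[OF that(1,2), of "s x"] Es[OF that(3)] \<delta> by (simp add: NEG_def)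
  qed (auto simp: p1_def \<Psi>(2))
  have h2: "homotopic_with_canon (\<lambda>_. True) (sph n) NEG p1 (\<lambda>x. S T (p1 x))"
  proof (rule homotopic_canonI[of _ "\<lambda>a. S (fst a * T) (p1 (snd a))"])
    show "continuous_on ({0..1} \<times> sph n) (\<lambda>a. S (fst a * T) (p1 (snd a)))"
      by (intro continuous_intros c_p1)
    fix t :: real and x assume t: "0 \<le> t" "t \<le> 1" "x \<in> sph n"
    have "E (S (t * T) (p1 x)) < - \<beta>" by (rule low_levels(1)[OF \<beta>(2) Ep1]) (use t T in auto)
    then show "S (fst (t, x) * T) (p1 (snd (t, x))) \<in> NEG" using \<beta> by (simp add: NEG_def)
  qed auto
  have h3: "homotopic_with_canon (\<lambda>_. True) (sph n) NEG (\<lambda>x. S T (p1 x)) (\<lambda>_. u0)"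
  proof (rule homotopic_canonI[of _ "\<lambda>a. S T (w a)"])
    show "continuous_on ({0..1} \<times> sph n) (\<lambda>a. S T (w a))" by (intro continuous_intros c_w)
    show "S T (w (t, x)) \<in> NEG" if "0 \<le> t" "t \<le> 1" "x \<in> sph n" for t x
      using T(2)[of "w (t, x)"] that by (auto simp: NEG_def C_def)
    show "S T (w (0, x)) = S T (p1 x)" for x
    proof -
      have "ylin (q x) = Y (p1 x)" by (simp add: ylin_def Y_def q_def)
      then show ?thesis by (simp add: w_def K)
    qed
    show "S T (w (1, x)) = u0" for x by (simp add: w_def K u0_def)
  qed
  obtain H where H: "continuous_on ({0..1} \<times> sph n) H"
    "\<And>t x. 0 \<le> t \<Longrightarrow> t \<le> 1 \<Longrightarrow> x \<in> sph n \<Longrightarrow> H (t, x) \<in> NEG"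
    "\<And>x. H (0::real, x) = s x" "\<And>x. H (1, x) = u0"
    by (rule homotopic_canonE[OF homotopic_with_trans[OF homotopic_with_trans[OF h1 h2] h3]]) (rule that, assumption+)
  let ?S = "sph (Suc n)"
  have nsum: "(\<Sum>i<n. (z i)\<^sup>2) = 1 - (z n)\<^sup>2" if "z \<in> ?S" for z
    using that by (simp add: sph_def)
  define \<nu> where "\<nu> z = (\<lambda>i. if i < n then z i / sqrt (1 - (z n)\<^sup>2) else 0)" for z :: "nat \<Rightarrow> real"
  have sq: "1 - v\<^sup>2 \<ge> 16 / 25" if "-(3/5) \<le> v" "v \<le> 3/5" for v :: real
  proof -
    have "v\<^sup>2 \<le> (3/5)\<^sup>2" using that by (intro abs_le_square_iff[THEN iffD1]) auto
    then show ?thesis by (simp add: power2_eq_square)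
  qed
  have \<nu>: "\<nu> z \<in> sph n" if z: "z \<in> ?S" and r: "-(3/5) \<le> z n" "z n \<le> 3/5" for z
  proof -
    have "(\<Sum>i<n. (\<nu> z i)\<^sup>2) = (\<Sum>i<n. (z i)\<^sup>2 / (1 - (z n)\<^sup>2))"
      using sq[OF r] by (intro sum.cong) (auto simp: \<nu>_def power_divide)
    also have "\<dots> = 1" using sq[OF r] nsum[OF z] by (simp add: sum_divide_distrib[symmetric])
    finally show ?thesis by (simp add: sph_def \<nu>_def)
  qed
  \<comment> \<open>At height -3/5 the sphere has radius 4/5, so the factor 5/4 spreads the lower
    cap over the disc of radius \<rho>. The band up to height 3/5 carries the homotopy
    \<open>H\<close>, the factor 5/6 turning height into time, and the upper cap goes to
    \<open>u0\<close>.\<close>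
  define mid where "mid z = H ((z n + 3/5) * (5/6), \<nu> z)" for z
  define cap where "cap z = lin (\<lambda>i. \<rho> * (5/4) * z i)" for z
  define Sg where "Sg z = (if z n \<le> -(3/5) then cap z else if z n \<le> 3/5 then mid z else u0)" for z
  have c_mid: "continuous_on {z \<in> {z \<in> ?S. -(3/5) \<le> z n}. z n \<le> 3/5} mid"
    unfolding mid_def
  proof (rule continuous_on_compose2[OF H(1)])
    have "continuous_on {z \<in> {z \<in> ?S. -(3/5) \<le> z n}. z n \<le> 3/5} \<nu>"
    proof (rule continuous_on_coordinatewise_then_product)
      show "continuous_on {z \<in> {z \<in> ?S. -(3/5) \<le> z n}. z n \<le> 3/5} (\<lambda>z. \<nu> z i)" for i
        unfolding \<nu>_def using sq by (cases "i < n") (force intro!: continuous_intros)+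
    qed
    then show "continuous_on {z \<in> {z \<in> ?S. -(3/5) \<le> z n}. z n \<le> 3/5} (\<lambda>z. ((z n + 3/5) * (5/6), \<nu> z))"
      by (rule continuous_on_Pair[rotated]) (intro continuous_intros)
    show "(\<lambda>z. ((z n + 3/5) * (5/6), \<nu> z)) ` {z \<in> {z \<in> ?S. -(3/5) \<le> z n}. z n \<le> 3/5} \<subseteq> {0..1} \<times> sph n"
      using \<nu> by auto
  qed
  have c_cap: "continuous_on T' cap" for T'
    unfolding cap_def by (intro c_lin continuous_intros)
  have c_Sg: "continuous_on ?S Sg"
    unfolding Sg_def
  proof (rule continuous_on_cases_le)
    show "continuous_on {t \<in> ?S. t n \<le> -(3/5)} cap" by (rule c_cap)
    show "continuous_on {t \<in> ?S. -(3/5) \<le> t n} (\<lambda>x. if x n \<le> 3/5 then mid x else u0)"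
    proof (rule continuous_on_cases_le[OF c_mid])
      fix z assume "z \<in> {t \<in> ?S. -(3/5) \<le> t n}" "z n = 3/5"
      then show "mid z = u0" by (simp add: mid_def H)
    qed (intro continuous_intros)+
    fix z assume z: "z \<in> ?S" "z n = -(3/5)"
    have sqe: "sqrt (1 - (z n)\<^sup>2) = 4/5" unfolding z by (rule real_sqrt_unique) (auto simp: power2_eq_square)
    have "\<rho> * (5/4) * z i = \<rho> * \<nu> z i" if "i < n" for i
    proof -
      have "\<nu> z i = z i / (4/5)" by (simp only: \<nu>_def that if_True sqe)
      then show ?thesis by simp
    qed
    then have "cap z = s (\<nu> z)" unfolding cap_def s_def lin_def by (intro sum.cong) auto
    then show "cap z = (if z n \<le> 3/5 then mid z else u0)" using z by (simp add: mid_def H)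
  qed (intro continuous_intros)
  have E_cap: "E (cap z) \<le> 0" if z: "z \<in> ?S" "z n \<le> -(3/5)" for z
  proof -
    have "(3/5)\<^sup>2 \<le> (z n)\<^sup>2" using z by (intro abs_le_square_iff[THEN iffD1]) auto
    then have le: "(\<Sum>i<n. (z i)\<^sup>2) \<le> 16/25" using nsum[OF z(1)] by (simp add: power2_eq_square)
    have "(\<Sum>i<n. (\<rho> * (5/4) * z i)\<^sup>2) = (\<rho>\<^sup>2 * (25/16)) * (\<Sum>i<n. (z i)\<^sup>2)"
      by (simp add: power_mult_distrib sum_distrib_left power_divide)
    also have "\<dots> \<le> (\<rho>\<^sup>2 * (25/16)) * (16/25)" using le by (intro mult_left_mono) auto
    finally have "(\<Sum>i<n. (\<rho> * (5/4) * z i)\<^sup>2) \<le> \<rho>\<^sup>2" by simp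
    from Eneg[OF this] have "E (cap z) \<le> - \<kappa> * (\<Sum>i<n. (\<rho> * (5/4) * z i)\<^sup>2)" by (simp add: cap_def lin_def)
    also have "\<dots> \<le> 0" using \<kappa> by (simp add: sum_nonneg)
    finally show ?thesis .
  qed
  have E_off: "E (Sg z) < 0" if z: "z \<in> ?S" "\<not> z n \<le> -(3/5)" for z
  proof (cases "z n \<le> 3/5")
    case True
    have "mid z \<in> NEG" unfolding mid_def by (rule H(2)[OF _ _ \<nu>]) (use z True in auto)
    then show ?thesis using z True by (simp add: Sg_def NEG_def)
  next
    case False then show ?thesis using z u0 by (simp add: Sg_def)
  qed
  have E_Sg: "E (Sg z) \<le> 0" if z: "z \<in> ?S" for z
    using E_off[OF z] E_cap[OF z] by (cases "z n \<le> -(3/5)") (auto simp: Sg_def)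
  define P where "P u = (\<lambda>i. if i < n then p i u else if i = n then norm u - \<rho> else 0)" for u
  have c_P: "continuous_on T' (\<lambda>x. P (f x))" if "continuous_on T' f" for T' :: "'x::topological_space set" and f
  proof (rule continuous_on_coordinatewise_then_product)
    show "continuous_on T' (\<lambda>x. P (f x) i)" for i
      unfolding P_def
      by (cases "i < n"; cases "i = n") (auto intro!: bounded_linear.continuous_on[OF lin_p] continuous_intros that)
  qed
  have P_d: "P u \<in> punctured (Suc n)" if u: "E u < \<delta>" for u
  proof (rule ccontr)
    assume "P u \<notin> punctured (Suc n)"
    then have z: "P u i = 0" if "i < Suc n" for i using that by (auto simp: punctured_def)
    have "p i u = 0" if "i < n" for i using z[of i] that by (simp add: P_def)
    moreover have "norm u = \<rho>" using z[of n] by (simp add: P_def)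
    ultimately have "\<kappa> * \<rho>\<^sup>2 \<le> E u" using Epos[of u] by auto
    then show False using u by (simp add: \<delta>_def)
  qed
  \<comment> \<open>On the lower cap the first \<open>n\<close> coordinates of \<open>Q z\<close>
    and of \<open>P (Sg z)\<close> are nonnegative multiples of \<open>z i\<close>; above it those
    of \<open>Q z\<close> vanish and its last coordinate is positive. Straight lines from the
    identity to \<open>Q\<close> and from \<open>Q\<close> to \<open>P (Sg z)\<close> therefore
    avoid 0.\<close>
  define Q where "Q z = (\<lambda>i. if i < n then max 0 (-(3/5) - z n) * z i else if i = n then z n + 4/5 else 0)" for z :: "nat \<Rightarrow> real"
  have c_Q: "continuous_on ?S Q"
  proof (rule continuous_on_coordinatewise_then_product)
    show "continuous_on ?S (\<lambda>z. Q z i)" for i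
      unfolding Q_def by (cases "i < n"; cases "i = n") (auto intro!: continuous_intros)
  qed
  have pole: "z n = -1" if z: "z \<in> ?S" "z n \<le> -(3/5)" and 0: "\<forall>i<n. z i = 0" for z
  proof -
    have "(z n)\<^sup>2 = 1" using nsum[OF z(1)] 0 by simp
    then have "z n = 1 \<or> z n = -1" by (simp add: power2_eq_1_iff)
    then show ?thesis using z by auto
  qed
  have H1: "homotopic_with_canon (\<lambda>_. True) ?S (punctured (Suc n)) (\<lambda>z. z) Q"
  proof (rule homotopic_linear_coord[OF continuous_on_id c_Q])
    fix z and t :: real assume z: "z \<in> ?S" and t: "0 \<le> t" "t \<le> 1"
    show "(\<lambda>i. (1 - t) * z i + t * Q z i) \<in> punctured (Suc n)" (is "?v \<in> _")
    proof (rule ccontr)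
      assume "?v \<notin> punctured (Suc n)"
      then have 0: "?v i = 0" if "i < Suc n" for i using that by (auto simp: punctured_def)
      have zi: "((1 - t) + t * max 0 (-(3/5) - z n)) * z i = 0" if "i < n" for i
        using 0[of i] that by (simp add: Q_def algebra_simps)
      have vert: "z n + t * (4/5) = 0" using 0[of n] by (simp add: Q_def algebra_simps)
      have t1: "z n \<le> -(3/5) \<or> t < 1" using vert by linarith
      show False
      proof (cases "(1 - t) + t * max 0 (-(3/5) - z n) = 0")
        case True
        then have "1 - t = 0" using t by (smt (verit) mult_nonneg_nonneg)
        then show False using True vert by auto
      next
        case False
        then have zi0: "\<forall>i<n. z i = 0" using zi by auto
        then have "(z n)\<^sup>2 = 1" using nsum[OF z] by simp
        then have "z n = 1 \<or> z n = -1" by (simp add: power2_eq_1_iff)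
        then show False using vert t by auto
      qed
    qed
  qed
  have H2: "homotopic_with_canon (\<lambda>_. True) ?S (punctured (Suc n)) Q (\<lambda>z. P (Sg z))"
  proof (rule homotopic_linear_coord[OF c_Q c_P[OF c_Sg]])
    fix z and t :: real assume z: "z \<in> ?S" and t: "0 \<le> t" "t \<le> 1"
    show "(\<lambda>i. (1 - t) * Q z i + t * P (Sg z) i) \<in> punctured (Suc n)" (is "?v \<in> _")
    proof (rule ccontr)
      assume "?v \<notin> punctured (Suc n)"
      then have 0: "?v i = 0" if "i < Suc n" for i using that by (auto simp: punctured_def)
      have vert: "(1 - t) * (z n + 4/5) + t * (norm (Sg z) - \<rho>) = 0" using 0[of n] by (simp add: Q_def P_def)
      show False
      proof (cases "z n \<le> -(3/5)")
        case True
        have coef: "((1 - t) * (-(3/5) - z n) + t * (\<rho> * (5/4))) * z i = 0" if "i < n" for i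
          using 0[of i] that True by (simp add: Q_def P_def Sg_def cap_def p_lin algebra_simps)
        show False
        proof (cases "(1 - t) * (-(3/5) - z n) + t * (\<rho> * (5/4)) = 0")
          case c0: True
          have "0 \<le> (1 - t) * (-(3/5) - z n)" using True t by simp
          moreover have "0 \<le> t * (\<rho> * (5/4))" using t \<rho> by simp
          ultimately have "t * (\<rho> * (5/4)) = 0" "(1 - t) * (-(3/5) - z n) = 0" using c0 by linarith+
          then have "t = 0" "z n = -(3/5)" using \<rho> by auto
          then show False using vert by simp
        next
          case False
          then have zi: "\<forall>i<n. z i = 0" using coef by auto
          then have "Sg z = 0" using True by (simp add: Sg_def cap_def lin_def)
          then have "(1 - t) * (-1 + 4/5) + t * (- \<rho>) = 0" using vert pole[OF z True zi] by simp
          then have "(1 - t) * (1/5) + t * \<rho> = 0" by (simp add: field_simps)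
          moreover have nn: "0 \<le> t * \<rho>" "0 \<le> (1 - t) * (1/5)" using t \<rho> by auto
          ultimately have "(1 - t) * (1/5) = 0" "t * \<rho> = 0" using nn by linarith+
          then show False using \<rho> by simp
        qed
      next
        \<comment> \<open>Above the cap a zero would put \<open>Sg z\<close> into the common kernel
          of the \<open>p i\<close> within radius \<rho>, where \<open>E\<close> is nonnegative; but
          \<open>E (Sg z) < 0\<close>.\<close>
        case False
        have "t \<noteq> 0" using vert False by auto
        then have tp: "t > 0" using t by simp
        have "t * p i (Sg z) = 0" if "i < n" for i using 0[of i] that False by (simp add: Q_def P_def)
        then have "\<forall>i<n. p i (Sg z) = 0" using tp by simp
        moreover have "norm (Sg z) \<le> \<rho>"
        proof -
          have "0 \<le> (1 - t) * (z n + 4/5)" using t False by (intro mult_nonneg_nonneg) auto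
          then have "t * (norm (Sg z) - \<rho>) \<le> 0" using vert by linarith
          then show ?thesis using tp by (simp add: mult_le_0_iff)
        qed
        ultimately have "\<kappa> * (norm (Sg z))\<^sup>2 \<le> E (Sg z)" using Epos by blast
        moreover have "0 \<le> \<kappa> * (norm (Sg z))\<^sup>2" using \<kappa> by simp
        ultimately show False using E_off[OF z False] by linarith
      qed
    qed
  qed
  \<comment> \<open>The cone may rise far above \<delta>, but by compactness its energy is bounded,
    so a single deformation brings all of it to level \<open>\<delta> / 2\<close>.\<close>
  define cone where "cone a = (1 - fst a) *\<^sub>R Sg (snd a) + fst a *\<^sub>R u0" for a :: "real \<times> (nat \<Rightarrow> real)"
  have c_cone: "continuous_on ({0..1} \<times> ?S) cone"
    unfolding cone_def by (intro continuous_intros continuous_on_compose2[OF c_Sg]) auto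
  have "compact (cone ` ({0..1} \<times> ?S))"
    by (intro compact_continuous_image[OF c_cone] compact_Times compact_sph compact_Icc)
  then have "compact (E ` cone ` ({0..1} \<times> ?S))" by (rule compact_continuous_image[OF E_cont])
  then have "bounded (E ` cone ` ({0..1} \<times> ?S))" by (rule compact_imp_bounded)
  then obtain b where b: "\<And>a. a \<in> {0..1} \<times> ?S \<Longrightarrow> \<bar>E (cone a)\<bar> \<le> b"
    unfolding bounded_iff by auto
  obtain \<Theta> :: "real \<Rightarrow> 'h \<Rightarrow> 'h" where \<Theta>: "continuous_on UNIV (\<lambda>q. \<Theta> (fst q) (snd q))"
    "\<And>u. \<Theta> 0 u = u" "\<And>t u. 0 \<le> t \<Longrightarrow> t \<le> 1 \<Longrightarrow> E (\<Theta> t u) \<le> E u"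
    "\<And>u. E u \<le> b \<Longrightarrow> E (\<Theta> 1 u) \<le> \<delta> / 2"
    by (rule deformation[OF e, of b]) (rule that, assumption+)
  have c_\<Theta>: "continuous_on T (\<lambda>x. \<Theta> (f x) (g x))" if "continuous_on T f" "continuous_on T g"
    for T :: "'x::topological_space set" and f g
    using continuous_on_compose2[OF \<Theta>(1), of T "\<lambda>x. (f x, g x)"] that by (auto intro: continuous_intros)
  have H3: "homotopic_with_canon (\<lambda>_. True) ?S (punctured (Suc n)) (\<lambda>z. P (Sg z)) (\<lambda>z. P (\<Theta> 1 (Sg z)))"
  proof (rule homotopic_canonI[of _ "\<lambda>a. P (\<Theta> (fst a) (Sg (snd a)))"])
    show "continuous_on ({0..1} \<times> ?S) (\<lambda>a. P (\<Theta> (fst a) (Sg (snd a))))"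
      by (intro c_P c_\<Theta> continuous_intros continuous_on_compose2[OF c_Sg]) auto
    show "P (\<Theta> (fst (t, z)) (Sg (snd (t, z)))) \<in> punctured (Suc n)" if "0 \<le> t" "t \<le> 1" "z \<in> ?S" for t z
      using \<Theta>(3)[OF that(1,2), of "Sg z"] E_Sg[OF that(3)] \<delta> by (intro P_d) simp
  qed (auto simp: \<Theta>(2))
  have H4: "homotopic_with_canon (\<lambda>_. True) ?S (punctured (Suc n)) (\<lambda>z. P (\<Theta> 1 (Sg z))) (\<lambda>z. P (\<Theta> 1 u0))"
  proof (rule homotopic_canonI[of _ "\<lambda>a. P (\<Theta> 1 (cone a))"])
    show "continuous_on ({0..1} \<times> ?S) (\<lambda>a. P (\<Theta> 1 (cone a)))"
      by (intro c_P c_\<Theta> continuous_intros c_cone)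
    show "P (\<Theta> 1 (cone (t, z))) \<in> punctured (Suc n)" if "0 \<le> t" "t \<le> 1" "z \<in> ?S" for t z
      using \<Theta>(4)[of "cone (t, z)"] b[of "(t, z)"] that \<delta> by (intro P_d) (auto simp: abs_le_iff)
  qed (auto simp: cone_def)
  show False
    using homotopic_with_trans[OF homotopic_with_trans[OF homotopic_with_trans[OF H1 H2] H3] H4]
      sph_not_null_homotopic by blast
qed

end

section \<open>Primitives of bounded functions\<close>

lemma finite_measure_unit_ivl: "finite_measure unit_ivl"
  by (rule finite_measure_lebesgue_on) auto

text \<open>The bound holds at every point of the open interval rather than almost everywhere, which
  keeps null sets out of sums, products and comparisons.\<close>

definition bdd_meas :: "(real \<Rightarrow> real) \<Rightarrow> bool"
  where "bdd_meas p \<longleftrightarrow> p \<in> borel_measurable unit_ivl \<and> (\<exists>B. \<forall>y\<in>{0<..<1}. \<bar>p y\<bar> \<le> B)"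

lemma bdd_measI: "p \<in> borel_measurable unit_ivl \<Longrightarrow> (\<And>y. 0 < y \<Longrightarrow> y < 1 \<Longrightarrow> \<bar>p y\<bar> \<le> B) \<Longrightarrow> bdd_meas p"
  unfolding bdd_meas_def by (auto intro!: exI[of _ B])

lemma bdd_measE:
  assumes "bdd_meas p"
  obtains B where "B > 0" "\<And>y. 0 < y \<Longrightarrow> y < 1 \<Longrightarrow> \<bar>p y\<bar> \<le> B"
proof -
  obtain B where "\<forall>y\<in>{0<..<1}. \<bar>p y\<bar> \<le> B" using assms by (auto simp: bdd_meas_def)
  then show ?thesis using that[of "max B 1"] by (force simp: le_max_iff_disj)
qed

lemma bdd_meas_measurable [measurable_dest]: "bdd_meas p \<Longrightarrow> p \<in> borel_measurable unit_ivl"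
  by (simp add: bdd_meas_def)

lemma bounded_integrable:
  fixes p :: "real \<Rightarrow> real"
  assumes "p \<in> borel_measurable unit_ivl" "AE y in unit_ivl. \<bar>p y\<bar> \<le> B"
  shows "integrable unit_ivl p"
  using finite_measure.integrable_const_bound[OF finite_measure_unit_ivl, of p B] assms by auto

lemma bdd_meas_integrable: "bdd_meas p \<Longrightarrow> integrable unit_ivl p"
proof -
  assume p: "bdd_meas p"
  obtain B where "\<And>y. 0 < y \<Longrightarrow> y < 1 \<Longrightarrow> \<bar>p y\<bar> \<le> B" by (rule bdd_measE[OF p]) (rule that, assumption)
  then show "integrable unit_ivl p" by (intro bounded_integrable[of p B] bdd_meas_measurable[OF p] AE_I2) auto
qed

lemma bdd_meas_add: assumes "bdd_meas p" "bdd_meas q" shows "bdd_meas (\<lambda>y. p y + q y)"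
proof -
  obtain A where A: "\<And>y. 0 < y \<Longrightarrow> y < 1 \<Longrightarrow> \<bar>p y\<bar> \<le> A" by (rule bdd_measE[OF assms(1)]) (rule that, assumption)
  obtain B where B: "\<And>y. 0 < y \<Longrightarrow> y < 1 \<Longrightarrow> \<bar>q y\<bar> \<le> B" by (rule bdd_measE[OF assms(2)]) (rule that, assumption)
  show ?thesis
  proof (rule bdd_measI[of _ "A + B"])
    show "\<bar>p y + q y\<bar> \<le> A + B" if "0 < y" "y < 1" for y
      using A[OF that] B[OF that] by linarith
  qed (intro borel_measurable_add bdd_meas_measurable assms)
qed

lemma bdd_meas_mult: assumes "bdd_meas p" "bdd_meas q" shows "bdd_meas (\<lambda>y. p y * q y)"
proof -
  obtain A where A: "A > 0" "\<And>y. 0 < y \<Longrightarrow> y < 1 \<Longrightarrow> \<bar>p y\<bar> \<le> A" using assms by (meson bdd_measE)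
  obtain B where B: "B > 0" "\<And>y. 0 < y \<Longrightarrow> y < 1 \<Longrightarrow> \<bar>q y\<bar> \<le> B" using assms by (meson bdd_measE)
  show ?thesis
  proof (rule bdd_measI[of _ "A * B"])
    show "(\<lambda>y. p y * q y) \<in> borel_measurable unit_ivl"
      by (intro borel_measurable_times bdd_meas_measurable assms)
    show "\<bar>p y * q y\<bar> \<le> A * B" if "0 < y" "y < 1" for y
      unfolding abs_mult using A B that by (intro mult_mono) auto
  qed
qed

lemma bdd_meas_const: "bdd_meas (\<lambda>_. c)"
  by (rule bdd_measI[of _ "\<bar>c\<bar>"]) auto

lemma bdd_meas_cmult: "bdd_meas p \<Longrightarrow> bdd_meas (\<lambda>y. c * p y)"
  by (rule bdd_meas_mult[OF bdd_meas_const])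

lemma bdd_meas_minus: "bdd_meas p \<Longrightarrow> bdd_meas (\<lambda>y. - p y)"
  using bdd_meas_cmult[of p "-1"] by simp

lemma bdd_meas_diff: "bdd_meas p \<Longrightarrow> bdd_meas q \<Longrightarrow> bdd_meas (\<lambda>y. p y - q y)"
  using bdd_meas_add[of p "\<lambda>y. - q y"] bdd_meas_minus by simp

lemma bdd_meas_sum: "(\<And>i. i \<in> I \<Longrightarrow> bdd_meas (p i)) \<Longrightarrow> bdd_meas (\<lambda>y. \<Sum>i\<in>I. p i y)"
  by (induction I rule: infinite_finite_induct) (auto intro: bdd_meas_const bdd_meas_add)

lemma bdd_meas_indicator: "A \<in> sets borel \<Longrightarrow> bdd_meas (indicator A)"
proof (rule bdd_measI[of _ 1])
  assume "A \<in> sets borel"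
  then have "(indicator A :: real \<Rightarrow> real) \<in> borel_measurable lebesgue"
    by (intro borel_measurable_indicator) auto
  then show "(indicator A :: real \<Rightarrow> real) \<in> borel_measurable unit_ivl" by (rule measurable_restrict_space1)
qed (simp add: indicator_def)

lemma bdd_meas_continuous: assumes "continuous_on {0..1} p" shows "bdd_meas p"
proof -
  have "p \<in> borel_measurable (lebesgue_on {0<..<1})"
    by (rule continuous_imp_measurable_on_sets_lebesgue[OF continuous_on_subset[OF assms]]) auto
  moreover have "bounded (p ` {0..1})" by (intro compact_imp_bounded compact_continuous_image assms) simp
  ultimately show ?thesis unfolding bounded_iff by (auto intro!: bdd_measI)
qed

lemmas bdd_meas_intros = bdd_meas_add bdd_meas_mult bdd_meas_const bdd_meas_cmult bdd_meas_minus
  bdd_meas_diff bdd_meas_sum bdd_meas_indicator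

text \<open>All integrals thus refer to the one measure \<open>unit_ivl\<close>; the part of
  \<open>[a, b]\<close> outside (0, 1) does not contribute.\<close>

definition itv :: "(real \<Rightarrow> real) \<Rightarrow> real \<Rightarrow> real \<Rightarrow> real"
  where "itv p a b = (\<integral>y. indicator {a..b} y * p y \<partial>unit_ivl)"

lemma itv_integrable: "bdd_meas p \<Longrightarrow> integrable unit_ivl (\<lambda>y. indicator {a..b} y * p y)"
  by (intro bdd_meas_integrable bdd_meas_intros) auto

lemma itv_0_1: "itv p 0 1 = (\<integral>y. p y \<partial>unit_ivl)"
  unfolding itv_def by (intro Bochner_Integration.integral_cong) auto

lemma itv_eq_integral:
  assumes p: "bdd_meas p" and ab: "0 \<le> a" "b \<le> 1"
  shows "itv p a b = integral {a..b} p"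
proof -
  have "itv p a b = integral {0<..<1} (\<lambda>y. indicator {a..b} y * p y)"
    unfolding itv_def by (rule lebesgue_integral_eq_integral[OF itv_integrable[OF p]]) auto
  also have "\<dots> = integral {0..1} (\<lambda>y. indicator {a..b} y * p y)"
    by (rule integral_open_interval_real[symmetric])
  also have "\<dots> = integral {0..1} (\<lambda>y. if y \<in> {a..b} then p y else 0)"
    by (intro Henstock_Kurzweil_Integration.integral_cong) auto
  also have "\<dots> = integral ({a..b} \<inter> {0..1}) p" by (rule integral_restrict_Int)
  also have "{a..b} \<inter> {0..1} = {a..b}" using ab by auto
  finally show ?thesis .
qed

lemma itv_const: "0 \<le> a \<Longrightarrow> a \<le> b \<Longrightarrow> b \<le> 1 \<Longrightarrow> itv (\<lambda>_. c) a b = c * (b - a)"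
  by (subst itv_eq_integral) (auto intro: bdd_meas_const)

lemma itv_mono:
  assumes "bdd_meas p" "bdd_meas q" "\<And>y. 0 < y \<Longrightarrow> y < 1 \<Longrightarrow> p y \<le> q y"
  shows "itv p a b \<le> itv q a b"
  unfolding itv_def
  by (intro integral_mono_AE itv_integrable assms AE_I2) (auto intro!: mult_left_mono assms)

lemma itv_abs_le:
  assumes "bdd_meas p" "\<And>y. 0 < y \<Longrightarrow> y < 1 \<Longrightarrow> \<bar>p y\<bar> \<le> B" "0 \<le> a" "a \<le> b" "b \<le> 1"
  shows "\<bar>itv p a b\<bar> \<le> B * (b - a)"
proof -
  have "itv p a b \<le> itv (\<lambda>_. B) a b"
    by (intro itv_mono assms bdd_meas_const) (use assms(2) in \<open>force simp: abs_le_iff\<close>)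
  moreover have "itv (\<lambda>_. - B) a b \<le> itv p a b"
    by (intro itv_mono assms bdd_meas_const) (use assms(2) in \<open>force simp: abs_le_iff\<close>)
  ultimately show ?thesis using itv_const[OF assms(3-5)] by (simp add: abs_le_iff minus_mult_left[symmetric])
qed

lemma AE_unit_ivl_neq: "AE y in unit_ivl. y \<noteq> b"
proof -
  have "AE y in lebesgue. y \<noteq> b"
    by (rule AE_I'[of "{b}"]) (auto simp: negligible_iff_null_sets[symmetric])
  then show ?thesis by (subst AE_restrict_space_iff) auto
qed

lemma itv_add: "bdd_meas p \<Longrightarrow> bdd_meas q \<Longrightarrow> itv (\<lambda>y. p y + q y) a b = itv p a b + itv q a b"
  unfolding itv_def distrib_left by (intro Bochner_Integration.integral_add itv_integrable)

lemma itv_cmult: "itv (\<lambda>y. c * p y) a b = c * itv p a b"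
  unfolding itv_def by (simp add: mult.left_commute)

lemma itv_split:
  assumes "bdd_meas p" "a \<le> b" "b \<le> c"
  shows "itv p a c = itv p a b + itv p b c"
proof -
  have "itv p a c = (\<integral>y. indicator {a..b} y * p y + indicator {b..c} y * p y \<partial>unit_ivl)"
    unfolding itv_def
  proof (rule integral_cong_AE)
    show "AE y in unit_ivl. indicator {a..c} y * p y = indicator {a..b} y * p y + indicator {b..c} y * p y"
      using AE_unit_ivl_neq[of b] by eventually_elim (use assms in \<open>auto simp: indicator_def\<close>)
  qed (intro borel_measurable_integrable itv_integrable Bochner_Integration.integrable_add assms)+
  also have "\<dots> = itv p a b + itv p b c"
    unfolding itv_def by (intro Bochner_Integration.integral_add itv_integrable assms)
  finally show ?thesis .
qed

lemma itv_tendsto: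
  assumes p: "\<And>k. bdd_meas (p k)" "bdd_meas q" and B: "\<And>k y. 0 < y \<Longrightarrow> y < 1 \<Longrightarrow> \<bar>p k y\<bar> \<le> B"
    and lim: "AE y in unit_ivl. (\<lambda>k. p k y) \<longlonglongrightarrow> q y"
  shows "(\<lambda>k. itv (p k) a b) \<longlonglongrightarrow> itv q a b"
  unfolding itv_def
proof (rule integral_dominated_convergence[where w="\<lambda>_. \<bar>B\<bar>"])
  show "integrable unit_ivl (\<lambda>_. \<bar>B\<bar>)" by (intro bdd_meas_integrable bdd_meas_const)
  show "AE y in unit_ivl. (\<lambda>k. indicator {a..b} y * p k y) \<longlonglongrightarrow> indicator {a..b} y * q y"
    using lim by eventually_elim (intro tendsto_intros)
  show "AE y in unit_ivl. norm (indicator {a..b} y * p k y) \<le> \<bar>B\<bar>" for k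
    using B[of _ k] by (intro AE_I2) (force simp: indicator_def)
qed (auto intro!: borel_measurable_integrable itv_integrable p)

text \<open>A measurable function is an almost everywhere limit of continuous functions. Truncating
  them at the bound of \<open>p\<close> preserves the limit and makes dominated convergence
  applicable.\<close>

lemma bdd_meas_continuous_approx:
  assumes p: "bdd_meas p" and B: "\<And>y. 0 < y \<Longrightarrow> y < 1 \<Longrightarrow> \<bar>p y\<bar> \<le> B"
  obtains g :: "nat \<Rightarrow> real \<Rightarrow> real" where "\<And>k. continuous_on UNIV (g k)" "\<And>k y. \<bar>g k y\<bar> \<le> B"
    "AE y in unit_ivl. (\<lambda>k. g k y) \<longlonglongrightarrow> p y"
proof -
  have B0: "0 \<le> B" using B[of "1/2"] by auto
  have m: "(\<lambda>y. if y \<in> {0<..<1} then p y else 0) \<in> borel_measurable lebesgue"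
    using p borel_measurable_if[of "{0<..<1::real}" p] by (auto simp: bdd_meas_def)
  obtain N g where N: "negligible N" and g: "\<And>n. continuous_on UNIV (g n)"
    and lim: "\<And>x. x \<notin> N \<Longrightarrow> (\<lambda>n. g n x) \<longlonglongrightarrow> (if x \<in> UNIV then (if x \<in> {0<..<1} then p x else 0) else 0)"
    using lebesgue_measurable_imp_measurable_on_real[OF m, of UNIV] unfolding measurable_on_def by auto
  show ?thesis
  proof (rule that[of "\<lambda>k y. max (- B) (min B (g k y))"])
    show "continuous_on UNIV (\<lambda>y. max (- B) (min B (g k y)))" for k
      by (intro continuous_intros g)
    show "\<bar>max (- B) (min B (g k y))\<bar> \<le> B" for k y using B0 by auto
    have "AE y in lebesgue. y \<notin> N"
      by (rule AE_I'[of N]) (use N in \<open>auto simp: negligible_iff_null_sets\<close>)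
    then have "AE y in lebesgue. y \<in> {0<..<1} \<longrightarrow> (\<lambda>k. max (- B) (min B (g k y))) \<longlonglongrightarrow> p y"
    proof eventually_elim
      fix y assume y: "y \<notin> N"
      show "y \<in> {0<..<1} \<longrightarrow> (\<lambda>k. max (- B) (min B (g k y))) \<longlonglongrightarrow> p y"
      proof
        assume y01: "y \<in> {0<..<1}"
        then have "(\<lambda>n. g n y) \<longlonglongrightarrow> p y" using lim[OF y] by auto
        then have "(\<lambda>k. max (- B) (min B (g k y))) \<longlonglongrightarrow> max (- B) (min B (p y))" by (intro tendsto_intros)
        moreover have "max (- B) (min B (p y)) = p y" using B[of y] y01 by (auto simp: abs_le_iff)
        ultimately show "(\<lambda>k. max (- B) (min B (g k y))) \<longlonglongrightarrow> p y" by simp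
      qed
    qed
    then show "AE y in unit_ivl. (\<lambda>k. max (- B) (min B (g k y))) \<longlonglongrightarrow> p y"
      by (subst AE_restrict_space_iff) auto
  qed
qed

text \<open>The functions \<open>u\<close> for which such a \<open>p\<close> exists are those that
  are Lipschitz on [0, 1]. \<open>p\<close> is determined only almost everywhere, and
  \<open>u\<close> is unconstrained outside [0, 1].\<close>

definition ac :: "(real \<Rightarrow> real) \<Rightarrow> (real \<Rightarrow> real) \<Rightarrow> bool"
  where "ac u p \<longleftrightarrow> bdd_meas p \<and> (\<forall>a b. 0 \<le> a \<longrightarrow> a \<le> b \<longrightarrow> b \<le> 1 \<longrightarrow> u b - u a = itv p a b)"

lemma acD: "ac u p \<Longrightarrow> bdd_meas p" "ac u p \<Longrightarrow> 0 \<le> a \<Longrightarrow> a \<le> b \<Longrightarrow> b \<le> 1 \<Longrightarrow> u b - u a = itv p a b"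
  by (auto simp: ac_def)

lemma ac_cong: "ac u p \<Longrightarrow> (\<And>y. 0 \<le> y \<Longrightarrow> y \<le> 1 \<Longrightarrow> u y = v y) \<Longrightarrow> (\<And>y. 0 < y \<Longrightarrow> y < 1 \<Longrightarrow> p y = q y) \<Longrightarrow> ac v q"
proof -
  assume a: "ac u p" and uv: "\<And>y. 0 \<le> y \<Longrightarrow> y \<le> 1 \<Longrightarrow> u y = v y"
    and pq: "\<And>y. 0 < y \<Longrightarrow> y < 1 \<Longrightarrow> p y = q y"
  have "bdd_meas q"
    using acD(1)[OF a] pq measurable_cong[of unit_ivl p q borel] by (auto simp: bdd_meas_def)
  moreover have "itv p a b = itv q a b" for a b
    unfolding itv_def by (intro Bochner_Integration.integral_cong) (auto simp: pq)
  ultimately show "ac v q" using a uv by (auto simp: ac_def)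
qed

lemma ac_const: "ac (\<lambda>_. c) (\<lambda>_. 0)"
  by (simp add: ac_def itv_def bdd_meas_const)

lemma ac_add: "ac u p \<Longrightarrow> ac v q \<Longrightarrow> ac (\<lambda>y. u y + v y) (\<lambda>y. p y + q y)"
  by (simp add: ac_def bdd_meas_add itv_add add_diff_add)

lemma ac_cmult: "ac u p \<Longrightarrow> ac (\<lambda>y. c * u y) (\<lambda>y. c * p y)"
  by (simp add: ac_def bdd_meas_cmult itv_cmult right_diff_distrib[symmetric])

lemma ac_minus: "ac u p \<Longrightarrow> ac (\<lambda>y. - u y) (\<lambda>y. - p y)"
  using ac_cmult[of u p "-1"] by simp

lemma ac_diff: "ac u p \<Longrightarrow> ac v q \<Longrightarrow> ac (\<lambda>y. u y - v y) (\<lambda>y. p y - q y)"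
  using ac_add[of u p "\<lambda>y. - v y" "\<lambda>y. - q y"] ac_minus by simp

lemma ac_integral: "ac u p \<Longrightarrow> (\<integral>y. p y \<partial>unit_ivl) = u 1 - u 0"
  using acD(2)[of u p 0 1] by (simp add: itv_0_1)

lemma ac_prim: assumes "bdd_meas p" shows "ac (\<lambda>y. itv p 0 y) p"
  unfolding ac_def
proof (intro conjI allI impI assms)
  fix a b :: real assume "0 \<le> a" "a \<le> b" "b \<le> 1"
  then show "itv p 0 b - itv p 0 a = itv p a b" using itv_split[OF assms, of 0 a b] by simp
qed

lemma ac_C1:
  assumes d: "\<And>y. 0 \<le> y \<Longrightarrow> y \<le> 1 \<Longrightarrow> (u has_real_derivative p y) (at y within {0..1})"
    and c: "continuous_on {0..1} p"
  shows "ac u p"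
proof -
  have p: "bdd_meas p" by (rule bdd_meas_continuous[OF c])
  have "u b - u a = itv p a b" if ab: "0 \<le> a" "a \<le> b" "b \<le> 1" for a b
  proof -
    have "(p has_integral u b - u a) {a..b}"
    proof (rule fundamental_theorem_of_calculus[OF ab(2)])
      fix y assume y: "y \<in> {a..b}"
      then have "(u has_real_derivative p y) (at y within {0..1})" using ab by (intro d) auto
      then have "(u has_real_derivative p y) (at y within {a..b})"
        by (rule DERIV_subset) (use ab in auto)
      then show "(u has_vector_derivative p y) (at y within {a..b})"
        by (simp add: has_real_derivative_iff_has_vector_derivative)
    qed
    then show ?thesis using itv_eq_integral[OF p ab(1,3)] by (simp add: integral_unique)
  qed
  then show ?thesis using p by (simp add: ac_def)
qed

lemma ac_lipschitz:
  assumes "ac u p"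
  obtains B where "B > 0" "\<And>a b. 0 \<le> a \<Longrightarrow> a \<le> 1 \<Longrightarrow> 0 \<le> b \<Longrightarrow> b \<le> 1 \<Longrightarrow> \<bar>u b - u a\<bar> \<le> B * \<bar>b - a\<bar>"
proof -
  obtain B where B: "B > 0" "\<And>y. 0 < y \<Longrightarrow> y < 1 \<Longrightarrow> \<bar>p y\<bar> \<le> B" by (rule bdd_measE[OF acD(1)[OF assms]]) (rule that, assumption+)
  have *: "\<bar>u b - u a\<bar> \<le> B * \<bar>b - a\<bar>" if "0 \<le> a" "a \<le> b" "b \<le> 1" for a b
    using itv_abs_le[OF acD(1)[OF assms] B(2) that] acD(2)[OF assms that] that by simp
  show ?thesis
  proof (rule that[OF B(1)])
    show "\<bar>u b - u a\<bar> \<le> B * \<bar>b - a\<bar>" if "0 \<le> a" "a \<le> 1" "0 \<le> b" "b \<le> 1" for a b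
      using *[of a b] *[of b a] that by (cases "a \<le> b") (auto simp: abs_minus_commute)
  qed
qed

lemma ac_continuous: assumes "ac u p" shows "continuous_on {0..1} u"
proof -
  obtain B where B: "B > 0" "\<And>a b. 0 \<le> a \<Longrightarrow> a \<le> 1 \<Longrightarrow> 0 \<le> b \<Longrightarrow> b \<le> 1 \<Longrightarrow> \<bar>u b - u a\<bar> \<le> B * \<bar>b - a\<bar>"
    by (rule ac_lipschitz[OF assms]) (rule that, assumption+)
  show ?thesis unfolding continuous_on_iff
  proof (intro ballI allI impI)
    fix x e :: real assume x: "x \<in> {0..1}" and e: "e > 0"
    show "\<exists>d>0. \<forall>x'\<in>{0..1}. dist x' x < d \<longrightarrow> dist (u x') (u x) < e"
    proof (intro exI[of _ "e / B"] conjI ballI impI)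
      fix x' :: real assume x': "x' \<in> {0..1}" "dist x' x < e / B"
      have "\<bar>u x' - u x\<bar> \<le> B * \<bar>x' - x\<bar>" using B(2) x x' by auto
      also have "\<dots> < e" using x' B(1) by (simp add: dist_real_def field_simps)
      finally show "dist (u x') (u x) < e" by (simp add: dist_real_def)
    qed (use e B in simp)
  qed
qed

text \<open>For continuous \<open>p\<close> this is the classical chain rule. A general
  \<open>p\<close> is the almost everywhere limit of bounded continuous \<open>g k\<close> whose
  primitives \<open>U k\<close> converge uniformly to \<open>u\<close>, and both sides pass to the
  limit by dominated convergence.\<close>

lemma ac_comp:
  assumes u: "ac u p" and rng: "\<And>y. 0 \<le> y \<Longrightarrow> y \<le> 1 \<Longrightarrow> A < u y \<and> u y < B"
    and d: "\<And>t. A < t \<Longrightarrow> t < B \<Longrightarrow> (\<psi> has_real_derivative \<psi>' t) (at t)"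
    and c: "continuous_on {A<..<B} \<psi>'"
  shows "ac (\<lambda>y. \<psi> (u y)) (\<lambda>y. \<psi>' (u y) * p y)"
proof -
  have cu: "continuous_on {0..1} u" by (rule ac_continuous[OF u])
  have p: "bdd_meas p" using acD(1)[OF u] .
  obtain y1 where y1: "y1 \<in> {0..1}" "\<And>y. y \<in> {0..1} \<Longrightarrow> u y1 \<le> u y"
    using continuous_attains_inf[OF compact_Icc _ cu] by auto
  obtain y2 where y2: "y2 \<in> {0..1}" "\<And>y. y \<in> {0..1} \<Longrightarrow> u y \<le> u y2"
    using continuous_attains_sup[OF compact_Icc _ cu] by auto
  \<comment> \<open>Half the distance between the range of \<open>u\<close> and the ends of the open
    interval: a function within \<eta> of \<open>u\<close> has its values in the compact interval
    \<open>I\<close>, on which \<open>\<psi>'\<close> is bounded.\<close>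
  define \<eta> where "\<eta> = min (u y1 - A) (B - u y2) / 2"
  have \<eta>: "\<eta> > 0" using rng[of y1] rng[of y2] y1 y2 by (auto simp: \<eta>_def)
  define I where "I = {u y1 - \<eta>..u y2 + \<eta>}"
  have IAB: "A < t \<and> t < B" if "t \<in> I" for t
  proof -
    have "A < u y1" "u y2 < B" using rng[of y1] rng[of y2] y1(1) y2(1) by auto
    moreover have "2 * \<eta> \<le> u y1 - A" "2 * \<eta> \<le> B - u y2" by (auto simp: \<eta>_def)
    ultimately show ?thesis using that by (auto simp: I_def)
  qed
  have "bounded (\<psi>' ` I)"
    by (intro compact_imp_bounded compact_continuous_image continuous_on_subset[OF c]) (use IAB in \<open>auto simp: I_def\<close>)
  then obtain M where M: "\<And>t. t \<in> I \<Longrightarrow> \<bar>\<psi>' t\<bar> \<le> M" unfolding bounded_iff by auto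
  have M0: "0 \<le> M" using M[of "u y1"] \<eta> y2(2)[OF y1(1)] by (force simp: I_def)
  obtain P where P: "P > 0" "\<And>y. 0 < y \<Longrightarrow> y < 1 \<Longrightarrow> \<bar>p y\<bar> \<le> P" by (rule bdd_measE[OF p]) (rule that, assumption+)
  obtain g where g: "\<And>k. continuous_on UNIV (g k)" "\<And>k y. \<bar>g k y\<bar> \<le> P"
    "AE y in unit_ivl. (\<lambda>k. g k y) \<longlonglongrightarrow> p y"
    by (rule bdd_meas_continuous_approx[OF p P(2)], assumption, assumption) (rule that, assumption+)
  have bg: "bdd_meas (g k)" for k by (rule bdd_meas_continuous[OF continuous_on_subset[OF g(1)]]) simp
  define U where "U k y = u 0 + itv (g k) 0 y" for k y
  have acU: "ac (U k) (g k)" for k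
    unfolding U_def using ac_add[OF ac_const ac_prim[OF bg]] by (simp add: o_def)
  have dU: "(U k has_real_derivative g k y) (at y within {0..1})" if "0 \<le> y" "y \<le> 1" for k y
  proof -
    have "((\<lambda>y. u 0 + integral {0..y} (g k)) has_real_derivative 0 + g k y) (at y within {0..1})"
      by (intro DERIV_add DERIV_const integral_has_real_derivative continuous_on_subset[OF g(1)]) (use that in auto)
    then have "((\<lambda>y. u 0 + integral {0..y} (g k)) has_real_derivative g k y) (at y within {0..1})" by simp
    then show ?thesis
      by (rule has_field_derivative_transform_within[of _ _ _ _ 1]) (use that in \<open>auto simp: U_def itv_eq_integral[OF bg]\<close>)
  qed
  define e where "e k = itv (\<lambda>y. \<bar>g k y - p y\<bar>) 0 1" for k
  have babs: "bdd_meas (\<lambda>y. \<bar>g k y - p y\<bar>)" for k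
    using bdd_meas_diff[OF bg[of k] p] by (auto simp: bdd_meas_def)
  have e0: "e \<longlonglongrightarrow> 0"
  proof -
    have "e \<longlonglongrightarrow> itv (\<lambda>y. 0) 0 1" unfolding e_def
    proof (rule itv_tendsto[where B="2 * P"])
      show "AE y in unit_ivl. (\<lambda>k. \<bar>g k y - p y\<bar>) \<longlonglongrightarrow> 0"
        using g(3) by eventually_elim (metis LIM_zero tendsto_rabs_zero)
      show "\<bar>\<bar>g k y - p y\<bar>\<bar> \<le> 2 * P" if "0 < y" "y < 1" for k y
        using g(2)[of k y] P(2)[OF that] by auto
    qed (auto intro: babs bdd_meas_const)
    then show ?thesis by (simp add: itv_def)
  qed
  have near: "\<bar>U k y - u y\<bar> \<le> e k" if y: "0 \<le> y" "y \<le> 1" for k y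
  proof -
    have "U k y - u y = itv (g k) 0 y - itv p 0 y" using acD(2)[OF u, of 0 y] y by (simp add: U_def)
    also have "\<dots> = itv (\<lambda>z. g k z + (-1) * p z) 0 y" 
      using itv_add[OF bg[of k] bdd_meas_cmult[OF p, of "-1"], of 0 y] itv_cmult[of "-1" p 0 y] by simp
    finally have eq: "U k y - u y = itv (\<lambda>z. g k z - p z) 0 y" by simp
    have "itv (\<lambda>z. g k z - p z) 0 y \<le> itv (\<lambda>z. \<bar>g k z - p z\<bar>) 0 y"
      by (intro itv_mono babs bdd_meas_diff bg p) auto
    moreover have "- itv (\<lambda>z. g k z - p z) 0 y \<le> itv (\<lambda>z. \<bar>g k z - p z\<bar>) 0 y"
    proof -
      have "itv (\<lambda>z. (-1) * (g k z - p z)) 0 y \<le> itv (\<lambda>z. \<bar>g k z - p z\<bar>) 0 y"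
        by (intro itv_mono babs bdd_meas_cmult bdd_meas_diff bg p) auto
      then show ?thesis unfolding itv_cmult by simp
    qed
    moreover have "itv (\<lambda>z. \<bar>g k z - p z\<bar>) 0 y \<le> e k"
    proof -
      have "itv (\<lambda>_. 0) y 1 \<le> itv (\<lambda>z. \<bar>g k z - p z\<bar>) y 1"
        by (intro itv_mono babs bdd_meas_const) auto
      then show ?thesis unfolding e_def using itv_split[OF babs[of k] y] by (simp add: itv_def)
    qed
    ultimately show ?thesis unfolding eq by linarith
  qed
  obtain k0 where k0: "\<And>k. k \<ge> k0 \<Longrightarrow> e k < \<eta>"
    using order_tendstoD(2)[OF e0 \<eta>] by (auto simp: eventually_sequentially)
  have UI: "U (k + k0) y \<in> I" if y: "0 \<le> y" "y \<le> 1" for k y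
    using near[OF y, of "k + k0"] k0[of "k + k0"] y1(2)[of y] y2(2)[of y] y by (auto simp: I_def)
  have uI: "u y \<in> I" if y: "0 \<le> y" "y \<le> 1" for y
    using y1(2)[of y] y2(2)[of y] y \<eta> by (auto simp: I_def)
  have limU: "(\<lambda>k. U (k + k0) y) \<longlonglongrightarrow> u y" if y: "0 \<le> y" "y \<le> 1" for y
  proof -
    have "(\<lambda>k. e (k + k0)) \<longlonglongrightarrow> 0" using LIMSEQ_ignore_initial_segment[OF e0] .
    then have "(\<lambda>k. U (k + k0) y - u y) \<longlonglongrightarrow> 0"
      by (rule Lim_null_comparison[rotated]) (use near[OF y] in simp)
    then show ?thesis by (simp add: LIM_zero_iff)
  qed
  have cI': "continuous_on I \<psi>'" using c by (rule continuous_on_subset) (use IAB in auto)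
  have acU': "ac (\<lambda>y. \<psi> (U (k + k0) y)) (\<lambda>y. \<psi>' (U (k + k0) y) * g (k + k0) y)" for k
  proof (rule ac_C1)
    show "((\<lambda>y. \<psi> (U (k + k0) y)) has_real_derivative \<psi>' (U (k + k0) y) * g (k + k0) y) (at y within {0..1})"
      if "0 \<le> y" "y \<le> 1" for y
      by (rule DERIV_chain2[OF d dU]) (use IAB[OF UI[OF that]] that in auto)
    show "continuous_on {0..1} (\<lambda>y. \<psi>' (U (k + k0) y) * g (k + k0) y)"
      by (intro continuous_intros continuous_on_subset[OF g(1)] continuous_on_compose2[OF cI' ac_continuous[OF acU]])
        (use UI in auto)
  qed
  have cu': "continuous_on {0..1} (\<lambda>y. \<psi>' (u y))"
    by (rule continuous_on_compose2[OF cI' cu]) (use uI in auto)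
  have bm: "bdd_meas (\<lambda>y. \<psi>' (u y) * p y)" by (intro bdd_meas_mult bdd_meas_continuous[OF cu'] p)
  have "\<psi> (u b) - \<psi> (u a) = itv (\<lambda>y. \<psi>' (u y) * p y) a b" if ab: "0 \<le> a" "a \<le> b" "b \<le> 1" for a b
  proof -
    have "(\<lambda>k. itv (\<lambda>y. \<psi>' (U (k + k0) y) * g (k + k0) y) a b) \<longlonglongrightarrow> itv (\<lambda>y. \<psi>' (u y) * p y) a b"
    proof (rule itv_tendsto[where B="M * P"])
      show "bdd_meas (\<lambda>y. \<psi>' (U (k + k0) y) * g (k + k0) y)" for k using acD(1)[OF acU'] .
      show "\<bar>\<psi>' (U (k + k0) y) * g (k + k0) y\<bar> \<le> M * P" if "0 < y" "y < 1" for k y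
        unfolding abs_mult using that M0 by (intro mult_mono M UI g) auto
      have "AE y in unit_ivl. (\<lambda>k. g (k + k0) y) \<longlonglongrightarrow> p y"
        using g(3) by eventually_elim (rule LIMSEQ_ignore_initial_segment)
      then show "AE y in unit_ivl. (\<lambda>k. \<psi>' (U (k + k0) y) * g (k + k0) y) \<longlonglongrightarrow> \<psi>' (u y) * p y"
      proof (rule AE_mp, intro AE_I2 impI)
        fix y assume y: "y \<in> space unit_ivl" and l: "(\<lambda>k. g (k + k0) y) \<longlonglongrightarrow> p y"
        have "(\<lambda>k. \<psi>' (U (k + k0) y)) \<longlonglongrightarrow> \<psi>' (u y)"
          by (rule continuous_on_tendsto_compose[OF cI' limU]) (use y uI UI in auto)
        then show "(\<lambda>k. \<psi>' (U (k + k0) y) * g (k + k0) y) \<longlonglongrightarrow> \<psi>' (u y) * p y" using l by (rule tendsto_mult)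
      qed
    qed (rule bm)
    moreover have "itv (\<lambda>y. \<psi>' (U (k + k0) y) * g (k + k0) y) a b = \<psi> (U (k + k0) b) - \<psi> (U (k + k0) a)" for k
      using acD(2)[OF acU' ab] by simp
    moreover have "(\<lambda>k. \<psi> (U (k + k0) b) - \<psi> (U (k + k0) a)) \<longlonglongrightarrow> \<psi> (u b) - \<psi> (u a)"
    proof -
      have "isCont \<psi> (u y)" if "0 \<le> y" "y \<le> 1" for y
        using d rng[OF that] by (intro DERIV_isCont) auto
      then show ?thesis using ab by (intro tendsto_diff isCont_tendsto_compose[OF _ limU]) auto
    qed
    ultimately show ?thesis using LIMSEQ_unique by simp
  qed
  then show ?thesis using bm by (simp add: ac_def)
qed

lemma ac_compI:
  assumes u: "ac u p" and d: "\<And>t. (\<psi> has_real_derivative \<psi>' t) (at t)" and c: "continuous_on UNIV \<psi>'"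
  shows "ac (\<lambda>y. \<psi> (u y)) (\<lambda>y. \<psi>' (u y) * p y)"
proof -
  have "bounded (u ` {0..1})" by (intro compact_imp_bounded compact_continuous_image ac_continuous[OF u]) simp
  then obtain K where "\<forall>y\<in>{0..1}. \<bar>u y\<bar> \<le> K" unfolding bounded_iff by auto
  then have "- (K + 1) < u y \<and> u y < K + 1" if "0 \<le> y" "y \<le> 1" for y using that by force
  from ac_comp[OF u this d continuous_on_subset[OF c]] show ?thesis by simp
qed

text \<open>Polarization reduces the product rule to the chain rule for the square.\<close>

lemma ac_mult:
  assumes "ac u p" "ac v q"
  shows "ac (\<lambda>y. u y * v y) (\<lambda>y. p y * v y + u y * q y)"
proof -
  have sq: "ac (\<lambda>y. (u y)\<^sup>2) (\<lambda>y. 2 * u y * p y)" if "ac u p" for u p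
    by (rule ac_compI[OF that, of "\<lambda>t. t\<^sup>2" "\<lambda>t. 2 * t"]) (auto intro!: derivative_eq_intros continuous_intros)
  have "ac (\<lambda>y. (1/4) * ((u y + v y)\<^sup>2 - (u y - v y)\<^sup>2))
      (\<lambda>y. (1/4) * (2 * (u y + v y) * (p y + q y) - 2 * (u y - v y) * (p y - q y)))"
    by (intro ac_cmult ac_diff sq ac_add assms)
  then show ?thesis by (rule ac_cong) (auto simp: power2_eq_square algebra_simps)
qed

text \<open>The derivative of \<open>y \<mapsto> max a (min y b)\<close>; composing with it localizes a function to \<open>[a, b]\<close>.\<close>

lemma ac_clamp:
  assumes "0 \<le> a" "a \<le> b" "b \<le> 1"
  shows "ac (\<lambda>y. max a (min y b)) (indicator {a..b})"
proof -
  have "max a (min t b) - max a (min s b) = itv (indicator {a..b}) s t" if st: "0 \<le> s" "s \<le> t" "t \<le> 1" for s t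
  proof -
    have "itv (indicator {a..b}) s t = integral {s..t} (indicator {a..b})"
      by (rule itv_eq_integral) (use st in \<open>auto intro: bdd_meas_indicator\<close>)
    also have "\<dots> = integral {s..t} (\<lambda>y. if y \<in> {a..b} then 1 else 0)"
      by (intro Henstock_Kurzweil_Integration.integral_cong) auto
    also have "\<dots> = integral ({a..b} \<inter> {s..t}) (\<lambda>_. 1::real)" by (rule integral_restrict_Int)
    also have "{a..b} \<inter> {s..t} = {max a s..min b t}" by auto
    also have "integral {max a s..min b t} (\<lambda>_. 1::real) = max 0 (min b t - max a s)" by (auto simp: max_def)
    finally show ?thesis using assms st by (auto simp: max_def min_def)
  qed
  then show ?thesis by (auto simp: ac_def intro!: bdd_meas_indicator)
qed

section \<open>The energy space\<close>

text \<open>Squaring the positive part removes its corner; the test functions are built from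
  this.\<close>

lemma DERIV_max_0_square: "((\<lambda>t::real. (max 0 t)\<^sup>2) has_real_derivative 2 * max 0 t) (at t)"
proof -
  consider "t > 0" | "t < 0" | "t = 0" by linarith
  then show ?thesis
  proof cases
    case 1
    have "((\<lambda>t. t\<^sup>2) has_real_derivative 2 * t) (at t)" by (auto intro!: derivative_eq_intros)
    then have "((\<lambda>t. (max 0 t)\<^sup>2) has_real_derivative 2 * t) (at t)"
      by (rule has_field_derivative_transform_within_open[of _ _ _ "{0<..}"]) (use 1 in auto)
    then show ?thesis using 1 by simp
  next
    case 2
    have "((\<lambda>t. 0) has_real_derivative 0) (at t)" by simp
    then have "((\<lambda>t. (max 0 t)\<^sup>2) has_real_derivative 0) (at t)"
      by (rule has_field_derivative_transform_within_open[of _ _ _ "{..<0}"]) (use 2 in auto)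
    then show ?thesis using 2 by simp
  next
    case 3
    have "((\<lambda>h. ((max 0 (0 + h))\<^sup>2 - (max 0 0)\<^sup>2) / h) \<longlongrightarrow> 0) (at (0::real))"
    proof (rule Lim_null_comparison[where g="\<lambda>h. \<bar>h\<bar>"])
      show "\<forall>\<^sub>F h in at 0. norm (((max 0 (0 + h))\<^sup>2 - (max 0 0)\<^sup>2) / h) \<le> \<bar>h::real\<bar>"
        by (intro always_eventually allI) (auto simp: max_def power2_eq_square)
      show "((\<lambda>h. \<bar>h\<bar>) \<longlongrightarrow> 0) (at (0::real))" by (rule tendsto_rabs_zero) (rule tendsto_ident_at)
    qed
    then show ?thesis using 3 by (simp add: DERIV_def)
  qed
qed

section \<open>Test functions and the fundamental lemma of the calculus of variations\<close>

lemma C1cD: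
  assumes "\<phi> \<in> C1c"
  shows "(\<phi> has_real_derivative deriv \<phi> y) (at y)" "continuous_on UNIV (deriv \<phi>)" "y \<notin> {0<..<1} \<Longrightarrow> \<phi> y = 0"
proof -
  from assms obtain D where D: "\<And>x. (\<phi> has_vector_derivative D x) (at x)" "continuous_on UNIV D"
    unfolding C1c_def C1_differentiable_on_def by auto
  have d: "(\<phi> has_real_derivative D y) (at y)" for y
    using D(1) by (simp add: has_real_derivative_iff_has_vector_derivative)
  then have e: "deriv \<phi> = D" by (auto intro!: ext DERIV_imp_deriv)
  show "(\<phi> has_real_derivative deriv \<phi> y) (at y)" "continuous_on UNIV (deriv \<phi>)" using d D e by auto
  have "closure {y. \<phi> y \<noteq> 0} \<subseteq> {0<..<1}" using assms by (simp add: C1c_def)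
  then show "\<phi> y = 0" if "y \<notin> {0<..<1}" using that closure_subset[of "{y. \<phi> y \<noteq> 0}"] by auto
qed

lemma C1c_ac: "\<phi> \<in> C1c \<Longrightarrow> ac \<phi> (deriv \<phi>)"
  by (rule ac_C1) (auto intro: has_field_derivative_at_within C1cD continuous_on_subset[OF C1cD(2)])

lemma C1cI:
  assumes "\<And>y. (\<phi> has_real_derivative d y) (at y)" "continuous_on UNIV d"
    and "closed K" "K \<subseteq> {0<..<1}" "\<And>y. y \<notin> K \<Longrightarrow> \<phi> y = 0"
  shows "\<phi> \<in> C1c"
proof -
  have cl: "closure {y. \<phi> y \<noteq> 0} \<subseteq> K" by (rule closure_minimal) (use assms in auto)
  have "bounded (closure {y. \<phi> y \<noteq> 0})"
    by (rule bounded_subset[of "{0<..<1}"]) (use cl assms in auto)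
  moreover have "\<phi> C1_differentiable_on UNIV"
    unfolding C1_differentiable_on_def
    by (intro exI[of _ d]) (use assms in \<open>auto simp: has_real_derivative_iff_has_vector_derivative\<close>)
  ultimately show ?thesis using cl assms by (auto simp: C1c_def compact_eq_bounded_closed)
qed

lemma C1c_mult:
  assumes t: "\<theta> \<in> C1c" and d: "\<And>y. (\<phi> has_real_derivative d y) (at y)" "continuous_on UNIV d"
  shows "(\<lambda>y. \<theta> y * \<phi> y) \<in> C1c"
proof (rule C1cI)
  show "((\<lambda>y. \<theta> y * \<phi> y) has_real_derivative deriv \<theta> y * \<phi> y + d y * \<theta> y) (at y)" for y
    by (intro DERIV_mult C1cD t d)
  have "continuous_on UNIV \<phi>" using DERIV_isCont[OF d(1)] by (simp add: continuous_at_imp_continuous_on)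
  moreover have "continuous_on UNIV \<theta>" using DERIV_isCont[OF C1cD(1)[OF t]] by (simp add: continuous_at_imp_continuous_on)
  ultimately show "continuous_on UNIV (\<lambda>y. deriv \<theta> y * \<phi> y + d y * \<theta> y)"
    by (intro continuous_intros d C1cD t)
  show "closure {y. \<theta> y \<noteq> 0} \<subseteq> {0<..<1}" using t by (simp add: C1c_def)
  show "\<theta> y * \<phi> y = 0" if "y \<notin> closure {y. \<theta> y \<noteq> 0}" for y
    using that closure_subset[of "{y. \<theta> y \<noteq> 0}"] by auto
qed simp

text \<open>Continuously differentiable because the positive part is squared, supported where
  \<open>y * (1 - y) \<ge> \<epsilon>\<close>, and convergent to 1 on (0, 1) as \<epsilon> tends to
  0. The added \<epsilon> keeps the denominator positive.\<close>

definition bump :: "real \<Rightarrow> real \<Rightarrow> real"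
  where "bump \<epsilon> y = (max 0 (y * (1 - y) - \<epsilon>))\<^sup>2 / ((max 0 (y * (1 - y) - \<epsilon>))\<^sup>2 + \<epsilon>)"

lemma bump_bounds: "\<epsilon> > 0 \<Longrightarrow> 0 \<le> bump \<epsilon> y \<and> bump \<epsilon> y \<le> 1"
  by (auto simp: bump_def divide_simps add_nonneg_pos)

lemma bump_C1c: assumes e: "\<epsilon> > 0" shows "bump \<epsilon> \<in> C1c"
proof (rule C1cI)
  let ?s = "\<lambda>y. (max 0 (y * (1 - y) - \<epsilon>))\<^sup>2"
  let ?s' = "\<lambda>y. 2 * max 0 (y * (1 - y) - \<epsilon>) * (1 - 2 * y)"
  have pos: "?s y + \<epsilon> \<noteq> 0" for y using e by (smt (verit) zero_le_power2)
  have ds: "(?s has_real_derivative ?s' y) (at y)" for y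
    by (rule DERIV_chain2[OF DERIV_max_0_square]) (auto intro!: derivative_eq_intros)
  show "(bump \<epsilon> has_real_derivative (?s' y * (?s y + \<epsilon>) - ?s y * ?s' y) / ((?s y + \<epsilon>) * (?s y + \<epsilon>))) (at y)" for y
  proof -
    have "((\<lambda>y. ?s y + \<epsilon>) has_real_derivative ?s' y + 0) (at y)" by (intro DERIV_add ds DERIV_const)
    from DERIV_divide[OF ds[of y] this pos[of y]] show ?thesis unfolding bump_def[abs_def] by simp
  qed
  show "continuous_on UNIV (\<lambda>y. (?s' y * (?s y + \<epsilon>) - ?s y * ?s' y) / ((?s y + \<epsilon>) * (?s y + \<epsilon>)))"
    using pos by (intro continuous_intros) auto
  show "closed {y. \<epsilon> \<le> y * (1 - y)}" by (intro closed_Collect_le continuous_intros)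
  show "{y. \<epsilon> \<le> y * (1 - y)} \<subseteq> {0<..<1}"
  proof
    fix y assume "y \<in> {y. \<epsilon> \<le> y * (1 - y)}"
    then have "0 < y * (1 - y)" using e by simp
    then show "y \<in> {0<..<1}" by (auto simp: zero_less_mult_iff)
  qed
  show "bump \<epsilon> y = 0" if "y \<notin> {y. \<epsilon> \<le> y * (1 - y)}" for y using that by (simp add: bump_def)
qed

lemma bump_tendsto_1:
  assumes y: "0 < y" "y < 1"
  shows "(\<lambda>k. bump (inverse (real (Suc k))) y) \<longlonglongrightarrow> 1"
proof -
  have p: "y * (1 - y) > 0" using y by simp
  have "(\<lambda>k. bump (inverse (real (Suc k))) y) \<longlonglongrightarrow> (max 0 (y * (1 - y) - 0))\<^sup>2 / ((max 0 (y * (1 - y) - 0))\<^sup>2 + 0)"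
    unfolding bump_def by (intro tendsto_intros LIMSEQ_inverse_real_of_nat) (use p in auto)
  moreover have "(max 0 (y * (1 - y) - 0))\<^sup>2 / ((max 0 (y * (1 - y) - 0))\<^sup>2 + 0) = 1" using p y by (simp add: max_def)
  ultimately show ?thesis by simp
qed

text \<open>Continuous approximations are replaced by polynomials within \<open>1 / (k + 1)\<close>
  on [0, 1], and the factor \<open>bump\<close> gives these compact support without changing the
  pointwise limit.\<close>

lemma bdd_meas_C1c_approx:
  assumes p: "bdd_meas p" and B: "\<And>y. 0 < y \<Longrightarrow> y < 1 \<Longrightarrow> \<bar>p y\<bar> \<le> B"
  obtains g :: "nat \<Rightarrow> real \<Rightarrow> real" where "\<And>k. g k \<in> C1c" "\<And>k y. \<bar>g k y\<bar> \<le> B + 1"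
    "AE y in unit_ivl. (\<lambda>k. g k y) \<longlonglongrightarrow> p y"
proof -
  have B0: "0 \<le> B" using B[of "1/2"] by auto
  obtain g where g: "\<And>k. continuous_on UNIV (g k)" "\<And>k y. \<bar>g k y\<bar> \<le> B"
    "AE y in unit_ivl. (\<lambda>k. g k y) \<longlonglongrightarrow> p y"
    by (rule bdd_meas_continuous_approx[OF p B], assumption, assumption) (rule that, assumption+)
  have "\<exists>q. real_polynomial_function q \<and> (\<forall>x\<in>{0..1}. \<bar>g k x - q x\<bar> < inverse (real (Suc k)))" for k
  proof (rule Stone_Weierstrass_real_polynomial_function[of "{0..1}" "g k" "inverse (real (Suc k))"])
    show "continuous_on {0..1} (g k)" by (rule continuous_on_subset[OF g(1)]) simp
    fix q assume "real_polynomial_function q" "\<And>x. x \<in> {0..1} \<Longrightarrow> \<bar>g k x - q x\<bar> < inverse (real (Suc k))"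
    then show ?thesis by (intro exI[of _ q]) simp
  qed auto
  then have "\<forall>k. \<exists>q. real_polynomial_function q \<and> (\<forall>x\<in>{0..1}. \<bar>g k x - q x\<bar> < inverse (real (Suc k)))" ..
  from choice[OF this] obtain q where "\<forall>k. real_polynomial_function (q k) \<and> (\<forall>x\<in>{0..1}. \<bar>g k x - q k x\<bar> < inverse (real (Suc k)))" ..
  then have q: "\<And>k. real_polynomial_function (q k)"
    "\<And>k x. x \<in> {0..1} \<Longrightarrow> \<bar>g k x - q k x\<bar> < inverse (real (Suc k))" by simp_all
  show ?thesis
  proof (rule that[of "\<lambda>k y. bump (inverse (real (Suc k))) y * q k y"])
    fix k
    obtain q' where q': "real_polynomial_function q'" "\<And>x. (q k has_real_derivative q' x) (at x)"
      using has_real_derivative_polynomial_function[OF q(1)] by blast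
    have "continuous_on UNIV q'"
      using continuous_on_polymonial_function[of q'] q'(1) by (simp add: real_polynomial_function_eq)
    then show "(\<lambda>y. bump (inverse (real (Suc k))) y * q k y) \<in> C1c"
      by (intro C1c_mult[OF bump_C1c q'(2)]) simp_all
    fix y
    show "\<bar>bump (inverse (real (Suc k))) y * q k y\<bar> \<le> B + 1"
    proof (cases "y \<in> {0<..<1}")
      case True
      have "inverse (real (Suc k)) \<le> 1" by (simp add: field_simps)
      then have "\<bar>q k y\<bar> \<le> B + 1" using q(2)[of y k] g(2)[of k y] True by auto
      moreover have "\<bar>bump (inverse (real (Suc k))) y\<bar> \<le> 1" using bump_bounds[of "inverse (real (Suc k))" y] by simp
      ultimately have "\<bar>bump (inverse (real (Suc k))) y\<bar> * \<bar>q k y\<bar> \<le> 1 * (B + 1)" by (intro mult_mono) auto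
      then show ?thesis by (simp add: abs_mult)
    next
      case False
      then show ?thesis using C1cD(3)[OF bump_C1c] B0 by simp
    qed
  next
    show "AE y in unit_ivl. (\<lambda>k. bump (inverse (real (Suc k))) y * q k y) \<longlonglongrightarrow> p y"
      using g(3)
    proof (rule AE_mp, intro AE_I2 impI)
      fix y assume y: "y \<in> space unit_ivl" and l: "(\<lambda>k. g k y) \<longlonglongrightarrow> p y"
      have "(\<lambda>k. q k y - g k y) \<longlonglongrightarrow> 0"
      proof (rule Lim_null_comparison[OF _ LIMSEQ_inverse_real_of_nat])
        show "\<forall>\<^sub>F k in sequentially. norm (q k y - g k y) \<le> inverse (real (Suc k))"
          using q(2)[of y] y by (intro always_eventually allI) (auto simp: abs_minus_commute less_imp_le)
      qed
      from tendsto_add[OF this l] have "(\<lambda>k. q k y) \<longlonglongrightarrow> p y" by simp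
      from tendsto_mult[OF bump_tendsto_1 this]
      show "(\<lambda>k. bump (inverse (real (Suc k))) y * q k y) \<longlonglongrightarrow> p y" using y by simp
    qed
  qed
qed

text \<open>The truncation \<open>p\<close> of \<open>q\<close> to [-1, 1] is a bounded limit of
  test functions, so the integral of \<open>q * p\<close> is 0. This product is nonnegative and
  vanishes only where \<open>q\<close> does.\<close>

theorem AE_zero_if_test_integrals_zero:
  assumes q: "integrable unit_ivl q" and 0: "\<And>\<phi>. \<phi> \<in> C1c \<Longrightarrow> (\<integral>y. q y * \<phi> y \<partial>unit_ivl) = 0"
  shows "AE y in unit_ivl. q y = 0"
proof -
  define p where "p y = max (-1) (min 1 (q y))" for y
  have mq: "q \<in> borel_measurable unit_ivl" using q by simp
  have mp: "bdd_meas p" unfolding p_def by (rule bdd_measI[of _ 1]) (use mq in auto)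
  have B: "\<bar>p y\<bar> \<le> 1" for y by (auto simp: p_def)
  obtain \<psi> where \<psi>: "\<And>k. \<psi> k \<in> C1c" "\<And>k y. \<bar>\<psi> k y\<bar> \<le> 1 + 1" "AE y in unit_ivl. (\<lambda>k. \<psi> k y) \<longlonglongrightarrow> p y"
    by (rule bdd_meas_C1c_approx[OF mp B]) (rule that, assumption+)
  have m\<psi>: "\<psi> k \<in> borel_measurable unit_ivl" for k
    by (intro bdd_meas_measurable bdd_meas_continuous ac_continuous[OF C1c_ac] \<psi>)
  have "(\<lambda>k. \<integral>y. q y * \<psi> k y \<partial>unit_ivl) \<longlonglongrightarrow> (\<integral>y. q y * p y \<partial>unit_ivl)"
  proof (rule integral_dominated_convergence[where w="\<lambda>y. 2 * \<bar>q y\<bar>"])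
    show "AE y in unit_ivl. (\<lambda>k. q y * \<psi> k y) \<longlonglongrightarrow> q y * p y"
      using \<psi>(3) by eventually_elim (intro tendsto_intros)
    show "AE y in unit_ivl. norm (q y * \<psi> k y) \<le> 2 * \<bar>q y\<bar>" for k
      using \<psi>(2)[of k] by (intro AE_I2) (auto simp: abs_mult mult.commute[of 2] intro!: mult_left_mono)
  qed (use mq m\<psi> bdd_meas_measurable[OF mp] q in auto)
  then have z: "(\<integral>y. q y * p y \<partial>unit_ivl) = 0" using 0[OF \<psi>(1)] by (simp add: LIMSEQ_const_iff)
  have int: "integrable unit_ivl (\<lambda>y. q y * p y)"
    by (rule Bochner_Integration.integrable_bound[OF q])
      (use mq bdd_meas_measurable[OF mp] B in \<open>auto simp: abs_mult mult_left_le\<close>)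
  have nn: "0 \<le> q y * p y" for y
    by (auto simp: p_def max_def min_def mult_nonpos_nonpos)
  have "AE y in unit_ivl. q y * p y = 0"
    using integral_nonneg_eq_0_iff_AE[OF int] nn z by simp
  then show ?thesis by eventually_elim (auto simp: p_def max_def min_def split: if_splits)
qed

lemma ac_unique:
  assumes "ac u p" "ac u q"
  shows "AE y in unit_ivl. p y = q y"
proof -
  have 0: "ac (\<lambda>y. 0) (\<lambda>y. p y - q y)" using ac_diff[OF assms] by simp
  have "AE y in unit_ivl. p y - q y = 0"
  proof (rule AE_zero_if_test_integrals_zero)
    show "integrable unit_ivl (\<lambda>y. p y - q y)" by (rule bdd_meas_integrable[OF acD(1)[OF 0]])
    fix \<phi> assume "\<phi> \<in> C1c"
    from ac_integral[OF ac_mult[OF 0 C1c_ac[OF this]]]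
    show "(\<integral>y. (p y - q y) * \<phi> y \<partial>unit_ivl) = 0" by simp
  qed
  then show ?thesis by eventually_elim simp
qed

text \<open>The energy space: primitives of bounded functions, vanishing at 0 and 1. It is not complete, but
  it contains every critical point in \<open>H10\<close>, and the compactness of \<open>K\<close> replaces completeness.\<close>

typedef pcf = "{u::real \<Rightarrow> real. (\<exists>p. ac u p) \<and> u 0 = 0 \<and> u 1 = 0 \<and> (\<forall>y. y \<notin> {0..1} \<longrightarrow> u y = 0)}"
  morphisms ev Pcf
  by (rule exI[of _ "\<lambda>_. 0"]) (auto intro!: exI[of _ "\<lambda>_. 0"] ac_const)

setup_lifting type_definition_pcf

text \<open>An arbitrary choice among derivatives that agree almost everywhere. By
  \<open>ip_eq\<close> any other choice gives the same inner products.\<close>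

definition D :: "pcf \<Rightarrow> real \<Rightarrow> real" where "D u = (SOME p. ac (ev u) p)"

lemma ac_D: "ac (ev u) (D u)"
proof -
  have "\<exists>p. ac (ev u) p" using ev[of u] by auto
  then show ?thesis unfolding D_def by (rule someI_ex)
qed

lemma ev_0 [simp]: "ev u 0 = 0" and ev_1 [simp]: "ev u 1 = 0" and ev_out: "y \<notin> {0..1} \<Longrightarrow> ev u y = 0"
  using ev[of u] by auto

lemma pcf_eqI: "(\<And>y. 0 < y \<Longrightarrow> y < 1 \<Longrightarrow> ev u y = ev v y) \<Longrightarrow> u = v"
proof -
  assume a: "\<And>y. 0 < y \<Longrightarrow> y < 1 \<Longrightarrow> ev u y = ev v y"
  have "ev u y = ev v y" for y
  proof (cases "0 < y \<and> y < 1")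
    case False
    then have "y = 0 \<or> y = 1 \<or> y \<notin> {0..1}" by auto
    then show ?thesis using ev_out by auto
  qed (use a in auto)
  then show "u = v" by (simp add: ev_inject[symmetric] ext)
qed

instantiation pcf :: real_vector
begin

lift_definition zero_pcf :: pcf is "\<lambda>_. 0" by (auto intro: ac_const)
lift_definition plus_pcf :: "pcf \<Rightarrow> pcf \<Rightarrow> pcf" is "\<lambda>u v y. u y + v y" by (auto intro: ac_add)
lift_definition minus_pcf :: "pcf \<Rightarrow> pcf \<Rightarrow> pcf" is "\<lambda>u v y. u y - v y" by (auto intro: ac_diff)
lift_definition uminus_pcf :: "pcf \<Rightarrow> pcf" is "\<lambda>u y. - u y" by (auto intro: ac_minus)
lift_definition scaleR_pcf :: "real \<Rightarrow> pcf \<Rightarrow> pcf" is "\<lambda>c u y. c * u y" by (auto intro: ac_cmult)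

instance
  by standard (transfer, simp add: algebra_simps fun_eq_iff)+

end

lemma ev_add [simp]: "ev (u + v) y = ev u y + ev v y" by transfer simp
lemma ev_diff [simp]: "ev (u - v) y = ev u y - ev v y" by transfer simp
lemma ev_scaleR [simp]: "ev (c *\<^sub>R u) y = c * ev u y" by transfer simp
lemma ev_zero [simp]: "ev 0 y = 0" by transfer simp
lemma ev_sum [simp]: "ev (sum f I) y = (\<Sum>i\<in>I. ev (f i) y)"
  by (induction I rule: infinite_finite_induct) auto

definition ip :: "pcf \<Rightarrow> pcf \<Rightarrow> real" where "ip u v = (\<integral>y. D u y * D v y \<partial>unit_ivl)"

lemma ip_eq:
  assumes "ac (ev u) p" "ac (ev v) q"
  shows "ip u v = (\<integral>y. p y * q y \<partial>unit_ivl)"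
  unfolding ip_def
proof (rule integral_cong_AE)
  show "AE y in unit_ivl. D u y * D v y = p y * q y"
    using ac_unique[OF ac_D[of u] assms(1)] ac_unique[OF ac_D[of v] assms(2)] by eventually_elim simp
qed (intro borel_measurable_times bdd_meas_measurable acD(1)[OF ac_D] acD(1)[OF assms(1)] acD(1)[OF assms(2)])+

lemma ac_ev_add: "ac (ev (u + v)) (\<lambda>y. D u y + D v y)"
  using ac_add[OF ac_D[of u] ac_D[of v]] by (rule ac_cong) auto

lemma ac_ev_scaleR: "ac (ev (c *\<^sub>R u)) (\<lambda>y. c * D u y)"
  using ac_cmult[OF ac_D[of u]] by (rule ac_cong) auto

lemma bdd_meas_D: "bdd_meas (D u)" by (rule acD(1)[OF ac_D])

lemma integrable_DD: "integrable unit_ivl (\<lambda>y. D u y * D v y)"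
  by (intro bdd_meas_integrable bdd_meas_mult bdd_meas_D)

lemma ip_nonneg: "0 \<le> ip u u" unfolding ip_def by (intro integral_nonneg_AE) auto

text \<open>Cauchy-Schwarz for \<open>D u\<close> against the indicator of \<open>[a, b]\<close>,
  read off from the integral of the square of \<open>D u y - \<mu> * indicator {a..b} y\<close> with
  the mean slope \<mu>. It is proved by hand because definiteness of the inner product depends on
  it; the bound on values and Hoelder continuity follow as well.\<close>

lemma ev_diff_square_le:
  assumes "0 \<le> a" "a \<le> b" "b \<le> 1"
  shows "(ev u b - ev u a)\<^sup>2 \<le> ip u u * (b - a)"
proof (cases "a = b")
  case False
  then have ab: "b - a > 0" using assms by simp
  define \<mu> where "\<mu> = (ev u b - ev u a) / (b - a)"
  have i1: "integrable unit_ivl (\<lambda>y. indicator {a..b} y * D u y)" by (rule itv_integrable[OF bdd_meas_D])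
  have i2: "integrable unit_ivl (\<lambda>y. indicator {a..b} y * (1::real))" by (rule itv_integrable[OF bdd_meas_const])
  have "0 \<le> (\<integral>y. (D u y - \<mu> * indicator {a..b} y)\<^sup>2 \<partial>unit_ivl)" by (intro integral_nonneg_AE) auto
  also have "(\<integral>y. (D u y - \<mu> * indicator {a..b} y)\<^sup>2 \<partial>unit_ivl)
      = (\<integral>y. D u y * D u y - 2 * \<mu> * (indicator {a..b} y * D u y) + \<mu>\<^sup>2 * (indicator {a..b} y * 1) \<partial>unit_ivl)"
    by (intro Bochner_Integration.integral_cong) (auto simp: power2_eq_square indicator_def algebra_simps)
  also have "\<dots> = ip u u - 2 * \<mu> * itv (D u) a b + \<mu>\<^sup>2 * itv (\<lambda>_. 1) a b"
    unfolding ip_def itv_def using i1 i2 integrable_DD[of u u] by simp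
  also have "\<dots> = ip u u - 2 * \<mu> * (ev u b - ev u a) + \<mu>\<^sup>2 * (b - a)"
    using acD(2)[OF ac_D assms, of u] itv_const[OF assms, of 1] by simp
  also have "\<dots> = ip u u - (ev u b - ev u a)\<^sup>2 / (b - a)"
  proof -
    have "i - 2 * (x / L) * x + (x / L)\<^sup>2 * L = i - x\<^sup>2 / L" if "L > 0" for i x L :: real
      using that by (simp add: power2_eq_square field_simps)
    from this[OF ab] show ?thesis unfolding \<mu>_def .
  qed
  finally show ?thesis using ab by (simp add: field_simps)
qed simp

instantiation pcf :: real_inner
begin

definition inner_pcf :: "pcf \<Rightarrow> pcf \<Rightarrow> real" where "inner_pcf = ip"
definition norm_pcf :: "pcf \<Rightarrow> real" where "norm_pcf u = sqrt (ip u u)"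
definition dist_pcf :: "pcf \<Rightarrow> pcf \<Rightarrow> real" where "dist_pcf u v = norm (u - v)"
definition sgn_pcf :: "pcf \<Rightarrow> pcf" where "sgn_pcf u = inverse (norm u) *\<^sub>R u"
definition uniformity_pcf :: "(pcf \<times> pcf) filter"
  where "uniformity_pcf = (INF e\<in>{0<..}. principal {(u, v). dist u v < e})"
definition open_pcf :: "pcf set \<Rightarrow> bool"
  where "open_pcf S \<longleftrightarrow> (\<forall>u\<in>S. \<forall>\<^sub>F (u', v) in uniformity. u' = u \<longrightarrow> v \<in> S)"

instance
proof
  fix u v w :: pcf and r :: real
  show "dist u v = norm (u - v)" by (rule dist_pcf_def)
  show "sgn u = u /\<^sub>R norm u" by (rule sgn_pcf_def)
  show "(uniformity :: (pcf \<times> pcf) filter) = (INF e\<in>{0<..}. principal {(u, v). dist u v < e})"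
    by (rule uniformity_pcf_def)
  show "open S \<longleftrightarrow> (\<forall>u\<in>S. \<forall>\<^sub>F (u', v) in uniformity. u' = u \<longrightarrow> v \<in> S)" for S :: "pcf set"
    by (rule open_pcf_def)
  show "u \<bullet> v = v \<bullet> u" by (simp add: inner_pcf_def ip_def mult.commute)
  show "(u + v) \<bullet> w = u \<bullet> w + v \<bullet> w"
  proof -
    have "(u + v) \<bullet> w = (\<integral>y. D u y * D w y + D v y * D w y \<partial>unit_ivl)"
      unfolding inner_pcf_def by (subst ip_eq[OF ac_ev_add ac_D]) (simp add: distrib_right)
    also have "\<dots> = u \<bullet> w + v \<bullet> w"
      unfolding inner_pcf_def ip_def by (intro Bochner_Integration.integral_add integrable_DD)
    finally show ?thesis .
  qed
  show "(r *\<^sub>R u) \<bullet> v = r * (u \<bullet> v)"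
    unfolding inner_pcf_def by (subst ip_eq[OF ac_ev_scaleR ac_D]) (simp add: ip_def mult.assoc)
  show "0 \<le> u \<bullet> u" by (simp add: inner_pcf_def ip_nonneg)
  show "u \<bullet> u = 0 \<longleftrightarrow> u = 0"
  proof
    assume z: "u \<bullet> u = 0"
    show "u = 0"
    proof (rule pcf_eqI)
      fix y :: real assume "0 < y" "y < 1"
      then show "ev u y = ev 0 y" using ev_diff_square_le[of 0 y u] z by (simp add: inner_pcf_def)
    qed
  next
    assume "u = 0"
    moreover have "ip 0 0 = 0" using ip_eq[of 0 "\<lambda>_. 0" 0 "\<lambda>_. 0"] ac_const[of 0] ac_cong[OF ac_const[of 0], of "ev 0" "\<lambda>_. 0"] by simp
    ultimately show "u \<bullet> u = 0" by (simp add: inner_pcf_def)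
  qed
  show "norm u = sqrt (u \<bullet> u)" by (simp add: norm_pcf_def inner_pcf_def)
qed

end

section \<open>Point evaluations and Riesz representatives in the energy space\<close>

lemma inner_eq: "ac (ev u) p \<Longrightarrow> ac (ev v) q \<Longrightarrow> u \<bullet> v = (\<integral>y. p y * q y \<partial>unit_ivl)"
  unfolding inner_pcf_def by (rule ip_eq)

lemma ev_holder:
  assumes "0 \<le> y" "y \<le> 1" "0 \<le> z" "z \<le> 1"
  shows "\<bar>ev u y - ev u z\<bar> \<le> norm u * sqrt \<bar>y - z\<bar>"
proof -
  have *: "\<bar>ev u b - ev u a\<bar> \<le> norm u * sqrt \<bar>b - a\<bar>" if "0 \<le> a" "a \<le> b" "b \<le> 1" for a b
  proof (rule power2_le_imp_le)
    show "\<bar>ev u b - ev u a\<bar>\<^sup>2 \<le> (norm u * sqrt \<bar>b - a\<bar>)\<^sup>2"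
      using ev_diff_square_le[OF that, of u] that ip_nonneg[of u]
      by (simp add: power_mult_distrib norm_pcf_def)
  qed simp
  show ?thesis using *[of y z] *[of z y] assms by (cases "y \<le> z") (auto simp: abs_minus_commute)
qed

lemma ev_bound: "\<bar>ev u y\<bar> \<le> norm u"
proof (cases "y \<in> {0..1}")
  case True
  have "\<bar>ev u y - ev u 0\<bar> \<le> norm u * sqrt \<bar>y - 0\<bar>" by (rule ev_holder) (use True in auto)
  also have "\<dots> \<le> norm u * 1" using True by (intro mult_left_mono) auto
  finally show ?thesis by simp
qed (simp add: ev_out)

lemma ev_continuous: "continuous_on {0..1} (ev u)" by (rule ac_continuous[OF ac_D])

lemma bdd_meas_ev: "bdd_meas (ev u)" by (rule bdd_meas_continuous[OF ev_continuous])

lemma bounded_linear_ev: "bounded_linear (\<lambda>u. ev u y)"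
  by (rule bounded_linear_intro[of _ 1]) (auto simp: ev_bound)

definition mk :: "(real \<Rightarrow> real) \<Rightarrow> pcf" where "mk u = Pcf (\<lambda>y. if y \<in> {0..1} then u y else 0)"

lemma ev_mk: "ac u p \<Longrightarrow> u 0 = 0 \<Longrightarrow> u 1 = 0 \<Longrightarrow> ev (mk u) y = (if y \<in> {0..1} then u y else 0)"
  unfolding mk_def by (subst Pcf_inverse) (auto intro!: exI[of _ p] intro: ac_cong)

lemma ac_ev_mk: "ac u p \<Longrightarrow> u 0 = 0 \<Longrightarrow> u 1 = 0 \<Longrightarrow> ac (ev (mk u)) p"
  by (rule ac_cong[of u p]) (simp_all add: ev_mk)

text \<open>The Riesz representative of the evaluation at \<open>z\<close> is Green's function of \<open>- d\<^sup>2 / dy\<^sup>2\<close>.\<close>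

definition green :: "real \<Rightarrow> real \<Rightarrow> real" where "green z y = max 0 (min y z) - z * y"

lemma itv_same [simp]: "itv p a a = 0"
  unfolding itv_def
proof (rule integral_eq_zero_AE)
  show "AE y in unit_ivl. indicator {a..a} y * p y = 0"
    using AE_unit_ivl_neq[of a] by eventually_elim (simp add: indicator_def)
qed

lemma pcf_inner_eqI: "(\<And>v. u \<bullet> v = w \<bullet> v) \<Longrightarrow> u = (w::pcf)"
proof -
  assume "\<And>v. u \<bullet> v = w \<bullet> v"
  then have "(u - w) \<bullet> (u - w) = 0" by (simp add: inner_diff_left)
  then show ?thesis by simp
qed

lemma ac_green: assumes "0 \<le> z" "z \<le> 1" shows "ac (green z) (\<lambda>y. indicator {0..z} y - z)"
proof -
  have "ac (\<lambda>y. y) (\<lambda>_. 1)" by (rule ac_C1) auto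
  from ac_diff[OF ac_clamp[of 0 z] ac_cmult[OF this, of z]] show ?thesis
    using assms by (simp add: green_def[abs_def])
qed

lemma inner_green: assumes z: "0 \<le> z" "z \<le> 1" shows "mk (green z) \<bullet> u = ev u z"
proof -
  have a: "ac (ev (mk (green z))) (\<lambda>y. indicator {0..z} y - z)"
    by (rule ac_ev_mk[OF ac_green[OF z]]) (use z in \<open>auto simp: green_def\<close>)
  have "mk (green z) \<bullet> u = (\<integral>y. indicator {0..z} y * D u y - z * D u y \<partial>unit_ivl)"
    unfolding inner_eq[OF a ac_D] by (simp add: algebra_simps)
  also have "\<dots> = itv (D u) 0 z - z * (\<integral>y. D u y \<partial>unit_ivl)"
    unfolding itv_def using itv_integrable[OF bdd_meas_D] bdd_meas_integrable[OF bdd_meas_D] by simp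
  also have "\<dots> = ev u z" using acD(2)[OF ac_D, of 0 z u] ac_integral[OF ac_D, of u] z by simp
  finally show ?thesis .
qed

text \<open>The solution \<open>w\<close> of \<open>- w'' = p\<close> with \<open>w(0) = w(1) = 0\<close>.\<close>

definition solve :: "(real \<Rightarrow> real) \<Rightarrow> real \<Rightarrow> real"
  where "solve p y = itv (\<lambda>z. itv p 0 z) 0 1 * y - itv (\<lambda>z. itv p 0 z) 0 y"

lemma ac_solve: assumes p: "bdd_meas p"
  shows "ac (solve p) (\<lambda>y. itv (\<lambda>z. itv p 0 z) 0 1 - itv p 0 y)"
proof -
  have "bdd_meas (\<lambda>y. itv p 0 y)" by (intro bdd_meas_continuous ac_continuous[OF ac_prim[OF p]])
  note b = ac_prim[OF this]
  have "ac (\<lambda>y. y) (\<lambda>_. 1)" by (rule ac_C1) auto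
  from ac_diff[OF ac_cmult[OF this] b] show ?thesis by (simp add: solve_def[abs_def])
qed

text \<open>By \<open>inner_T\<close>, the Riesz representative of integration against
  \<open>p\<close>. The explicit formula shows that it lies in the energy space.\<close>

definition T :: "(real \<Rightarrow> real) \<Rightarrow> pcf" where "T p = mk (solve p)"

lemma ac_T: "bdd_meas p \<Longrightarrow> ac (ev (T p)) (\<lambda>y. itv (\<lambda>z. itv p 0 z) 0 1 - itv p 0 y)"
  unfolding T_def by (rule ac_ev_mk[OF ac_solve]) (auto simp: solve_def)

lemma inner_T:
  assumes p: "bdd_meas p"
  shows "T p \<bullet> v = (\<integral>y. p y * ev v y \<partial>unit_ivl)"
proof -
  let ?c = "itv (\<lambda>z. itv p 0 z) 0 1"
  have bP: "bdd_meas (\<lambda>y. itv p 0 y)" by (intro bdd_meas_continuous ac_continuous[OF ac_prim[OF p]])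
  have "T p \<bullet> v = (\<integral>y. ?c * D v y - itv p 0 y * D v y \<partial>unit_ivl)"
    unfolding inner_eq[OF ac_T[OF p] ac_D] by (simp add: left_diff_distrib)
  also have "\<dots> = ?c * (\<integral>y. D v y \<partial>unit_ivl) - (\<integral>y. itv p 0 y * D v y \<partial>unit_ivl)"
    using bdd_meas_integrable[OF bdd_meas_D[of v]] bdd_meas_integrable[OF bdd_meas_mult[OF bP bdd_meas_D[of v]]] by simp
  also have "(\<integral>y. D v y \<partial>unit_ivl) = 0" using ac_integral[OF ac_D, of v] by simp
  also have "(\<integral>y. itv p 0 y * D v y \<partial>unit_ivl) = - (\<integral>y. p y * ev v y \<partial>unit_ivl)"
  proof -
    have "(\<integral>y. p y * ev v y + itv p 0 y * D v y \<partial>unit_ivl) = 0"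
      using ac_integral[OF ac_mult[OF ac_prim[OF p] ac_D[of v]]] by (simp add: itv_def)
    moreover have "(\<integral>y. p y * ev v y + itv p 0 y * D v y \<partial>unit_ivl)
       = (\<integral>y. p y * ev v y \<partial>unit_ivl) + (\<integral>y. itv p 0 y * D v y \<partial>unit_ivl)"
      by (intro Bochner_Integration.integral_add bdd_meas_integrable bdd_meas_mult p bdd_meas_ev bP bdd_meas_D)
    ultimately show ?thesis by simp
  qed
  finally show ?thesis by simp
qed

text \<open>\<open>T p\<close> is paired with itself, and its values are bounded by its norm. The
  point is that an L1 bound on \<open>p\<close>, as supplied by dominated convergence, controls the
  energy norm.\<close>

lemma norm_T_le:
  assumes p: "bdd_meas p"
  shows "norm (T p) \<le> (\<integral>y. \<bar>p y\<bar> \<partial>unit_ivl)"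
proof (cases "T p = 0")
  case True then show ?thesis by (simp add: integral_nonneg_AE)
next
  case False
  have "norm (T p) * norm (T p) = (\<integral>y. p y * ev (T p) y \<partial>unit_ivl)"
    using inner_T[OF p, of "T p"] by (simp add: power2_norm_eq_inner[symmetric] power2_eq_square)
  also have "\<dots> \<le> (\<integral>y. \<bar>p y\<bar> * norm (T p) \<partial>unit_ivl)"
  proof (rule integral_mono)
    show "integrable unit_ivl (\<lambda>y. p y * ev (T p) y)" by (intro bdd_meas_integrable bdd_meas_mult p bdd_meas_ev)
    show "integrable unit_ivl (\<lambda>y. \<bar>p y\<bar> * norm (T p))" using bdd_meas_integrable[OF p] by simp
    show "p y * ev (T p) y \<le> \<bar>p y\<bar> * norm (T p)" for y
      using ev_bound[of "T p" y] by (metis abs_ge_self abs_mult abs_ge_zero mult_left_mono order_trans)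
  qed
  also have "\<dots> = (\<integral>y. \<bar>p y\<bar> \<partial>unit_ivl) * norm (T p)" by simp
  finally show ?thesis using False by simp
qed

lemma T_add: assumes "bdd_meas p" "bdd_meas q" shows "T (\<lambda>y. p y + q y) = T p + T q"
proof (rule pcf_inner_eqI)
  show "T (\<lambda>y. p y + q y) \<bullet> v = (T p + T q) \<bullet> v" for v
    using bdd_meas_integrable[OF bdd_meas_mult[OF assms(1) bdd_meas_ev]]
      bdd_meas_integrable[OF bdd_meas_mult[OF assms(2) bdd_meas_ev]]
    by (simp add: inner_add_left inner_T[OF bdd_meas_add[OF assms]] inner_T[OF assms(1)] inner_T[OF assms(2)] distrib_right)
qed

lemma T_cmult: assumes "bdd_meas p" shows "T (\<lambda>y. c * p y) = c *\<^sub>R T p"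
proof (rule pcf_inner_eqI)
  show "T (\<lambda>y. c * p y) \<bullet> v = (c *\<^sub>R T p) \<bullet> v" for v
    by (simp add: inner_T[OF bdd_meas_cmult[OF assms]] inner_T[OF assms] mult.assoc)
qed

lemma T_diff: assumes "bdd_meas p" "bdd_meas q" shows "T (\<lambda>y. p y - q y) = T p - T q"
  using T_add[OF assms(1) bdd_meas_cmult[OF assms(2), of "-1"]] T_cmult[OF assms(2), of "-1"] by simp

section \<open>Superposition operators\<close>

text \<open>Rounding \<open>v\<close> down to multiples of \<open>1 / (k + 1)\<close> leaves
  countably many values, for which measurability is clear; continuity in the second argument gives
  the limit.\<close>

lemma caratheodory_measurable:
  fixes \<phi> :: "'a \<Rightarrow> real \<Rightarrow> real"
  assumes m: "\<And>t. (\<lambda>\<omega>. \<phi> \<omega> t) \<in> borel_measurable M" and c: "\<And>\<omega>. continuous_on UNIV (\<phi> \<omega>)"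
    and v: "v \<in> borel_measurable M"
  shows "(\<lambda>\<omega>. \<phi> \<omega> (v \<omega>)) \<in> borel_measurable M"
proof (rule borel_measurable_LIMSEQ_real)
  let ?r = "\<lambda>k::nat. \<lambda>\<omega>. of_int \<lfloor>real (Suc k) * v \<omega>\<rfloor> / real (Suc k)"
  show "(\<lambda>\<omega>. \<phi> \<omega> (?r k \<omega>)) \<in> borel_measurable M" for k
  proof (rule measurable_compose_countable[where f="\<lambda>i \<omega>. \<phi> \<omega> (of_int i / real (Suc k))"])
    show "(\<lambda>\<omega>. \<lfloor>real (Suc k) * v \<omega>\<rfloor>) \<in> measurable M (count_space UNIV)"
      using v by measurable
  qed (rule m)
  show "(\<lambda>k. \<phi> \<omega> (?r k \<omega>)) \<longlonglongrightarrow> \<phi> \<omega> (v \<omega>)" for \<omega>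
  proof (rule continuous_on_tendsto_compose[OF c])
    have "(\<lambda>k. ?r k \<omega> - v \<omega>) \<longlonglongrightarrow> 0"
    proof (rule Lim_null_comparison[OF _ LIMSEQ_inverse_real_of_nat])
      have "\<bar>?r k \<omega> - v \<omega>\<bar> \<le> inverse (real (Suc k))" for k
      proof -
        have "?r k \<omega> - v \<omega> = (of_int \<lfloor>real (Suc k) * v \<omega>\<rfloor> - real (Suc k) * v \<omega>) / real (Suc k)"
          by (simp add: diff_divide_distrib del: of_nat_Suc)
        moreover have "\<bar>of_int \<lfloor>real (Suc k) * v \<omega>\<rfloor> - real (Suc k) * v \<omega>\<bar> \<le> 1" by linarith
        ultimately show ?thesis by (simp add: abs_divide divide_right_mono inverse_eq_divide del: of_nat_Suc)
      qed
      then show "\<forall>\<^sub>F k in sequentially. norm (?r k \<omega> - v \<omega>) \<le> inverse (real (Suc k))" by simp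
    qed
    then show "(\<lambda>k. ?r k \<omega>) \<longlonglongrightarrow> v \<omega>" by (simp only: LIM_zero_iff)
  qed auto
qed

text \<open>The integral of \<phi> from 0 to \<open>t\<close>, rescaled to the fixed interval (0,
  1). In this form the measurability of \<open>prim (f y) (w y)\<close> in \<open>y\<close> is an
  instance of Fubini's theorem.\<close>

definition prim :: "(real \<Rightarrow> real) \<Rightarrow> real \<Rightarrow> real"
  where "prim \<phi> t = (\<integral>s. \<phi> (s * t) * t \<partial>unit_ivl)"

lemma prim_deriv:
  assumes c: "continuous_on UNIV \<phi>"
  shows "(prim \<phi> has_real_derivative \<phi> t) (at t)"
proof -
  have "isCont \<phi> s" for s using c by (simp add: continuous_on_eq_continuous_at)
  then have "\<exists>F. \<forall>x::real. (-\<infinity>::ereal) < x \<longrightarrow> x < \<infinity> \<longrightarrow> (F has_vector_derivative \<phi> x) (at x)"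
    by (intro einterval_antiderivative) auto
  then obtain \<Phi> where \<Phi>: "\<And>s. (\<Phi> has_real_derivative \<phi> s) (at s)"
    by (auto simp: has_real_derivative_iff_has_vector_derivative)
  have "prim \<phi> t = \<Phi> t - \<Phi> 0" for t
  proof -
    have "ac (\<lambda>s. \<Phi> (s * t)) (\<lambda>s. \<phi> (s * t) * t)"
    proof (rule ac_C1)
      show "((\<lambda>s. \<Phi> (s * t)) has_real_derivative \<phi> (s * t) * t) (at s within {0..1})" for s
        by (rule DERIV_chain2[OF \<Phi>]) (auto intro!: derivative_eq_intros)
      show "continuous_on {0..1} (\<lambda>s. \<phi> (s * t) * t)"
        by (intro continuous_intros continuous_on_compose2[OF c]) auto
    qed
    from ac_integral[OF this] show ?thesis by (simp add: prim_def)
  qed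
  then have "prim \<phi> = (\<lambda>t. \<Phi> t - \<Phi> 0)" by auto
  then show ?thesis using \<Phi> by (auto intro!: derivative_eq_intros)
qed

lemma prim_0 [simp]: "prim \<phi> 0 = 0" by (simp add: prim_def)

lemma prim_bound:
  assumes c: "continuous_on UNIV \<phi>" and b: "\<And>s. \<bar>s\<bar> \<le> \<bar>t\<bar> \<Longrightarrow> \<bar>\<phi> s\<bar> \<le> C"
  shows "\<bar>prim \<phi> t\<bar> \<le> C * \<bar>t\<bar>"
proof (cases "t = 0")
  case False
  have "\<exists>z. \<bar>z\<bar> \<le> \<bar>t\<bar> \<and> prim \<phi> t = t * \<phi> z"
  proof (cases "t > 0")
    case True
    from MVT2[OF True, of "prim \<phi>" \<phi>] show ?thesis using prim_deriv[OF c] by force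
  next
    case f: False
    then have "t < 0" using False by simp
    from MVT2[OF this, of "prim \<phi>" \<phi>] show ?thesis using prim_deriv[OF c] by force
  qed
  then obtain z where "\<bar>z\<bar> \<le> \<bar>t\<bar>" "prim \<phi> t = t * \<phi> z" by blast
  then show ?thesis using mult_right_mono[OF b[of z], of "\<bar>t\<bar>"] by (simp add: abs_mult mult.commute)
qed simp

lemma prim_increment:
  assumes c: "continuous_on UNIV \<phi>"
  obtains \<xi> where "\<bar>\<xi> - a\<bar> \<le> \<bar>h\<bar>" "prim \<phi> (a + h) - prim \<phi> a = h * \<phi> \<xi>"
proof (cases "h = 0")
  case False
  show ?thesis
  proof (cases "h > 0")
    case True
    from MVT2[of a "a + h" "prim \<phi>" \<phi>] True show ?thesis using prim_deriv[OF c] that by force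
  next
    case f: False
    then have "h < 0" using False by simp
    from MVT2[of "a + h" a "prim \<phi>" \<phi>] this
    obtain z where "a + h < z" "z < a" "prim \<phi> a - prim \<phi> (a + h) = (a - (a + h)) * \<phi> z"
      using prim_deriv[OF c] by auto
    then show ?thesis by (intro that[of z]) (auto simp: algebra_simps)
  qed
qed (use that[of a] in auto)

text \<open>The compact embedding into the continuous functions: Hoelder bounds give equicontinuity,
  and the Arzela-Ascoli theorem applies. The limit \<open>w\<close> is only continuous, so the
  operators below take functions as arguments and not elements of \<open>pcf\<close>.\<close>

lemma bounded_seq_uniform_subseq:
  assumes B: "\<And>n. norm (u n :: pcf) \<le> B"
  obtains k w where "strict_mono (k :: nat \<Rightarrow> nat)" "continuous_on {0..1} w"
    "\<And>y. y \<in> {0..1} \<Longrightarrow> (\<lambda>n. ev (u (k n)) y) \<longlonglongrightarrow> w y"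
proof -
  have B0: "0 \<le> B" using B[of 0] norm_ge_zero order_trans by blast
  have a1: "norm (ev (u n) x) \<le> B" for n x using ev_bound[of "u n" x] B[of n] by simp
  have a2: "\<exists>d. 0 < d \<and> (\<forall>n y. y \<in> {0..1} \<and> norm (x - y) < d \<longrightarrow> norm (ev (u n) x - ev (u n) y) < e)"
    if x: "x \<in> {0..1}" and e: "0 < e" for x e
  proof (intro exI[of _ "(e / (B + 1))\<^sup>2"] conjI allI impI)
    show "0 < (e / (B + 1))\<^sup>2" using e B0 by simp
    fix n y assume y: "y \<in> {0..1} \<and> norm (x - y) < (e / (B + 1))\<^sup>2"
    have "\<bar>ev (u n) x - ev (u n) y\<bar> \<le> norm (u n) * sqrt \<bar>x - y\<bar>" using x y by (intro ev_holder) auto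
    also have "\<dots> \<le> B * sqrt \<bar>x - y\<bar>" by (intro mult_right_mono B) simp
    also have "\<dots> \<le> B * (e / (B + 1))"
    proof (intro mult_left_mono B0)
      show "sqrt \<bar>x - y\<bar> \<le> e / (B + 1)" using y e B0 by (intro real_le_lsqrt) auto
    qed
    also have "\<dots> < e" using e B0 by (simp add: field_simps)
    finally show "norm (ev (u n) x - ev (u n) y) < e" by simp
  qed
  obtain g k where g: "continuous_on {0..1::real} g" "strict_mono (k :: nat \<Rightarrow> nat)"
    "\<And>e. 0 < e \<Longrightarrow> \<exists>N. \<forall>n x. n \<ge> N \<and> x \<in> {0..1} \<longrightarrow> norm (ev (u (k n)) x - g x) < e"
    by (rule Arzela_Ascoli[of "{0..1::real}" "\<lambda>n. ev (u n)" B, OF compact_Icc a1 a2], assumption, assumption)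
      (rule that, assumption+)
  show ?thesis
  proof (rule that[OF g(2,1)])
    fix y :: real assume y: "y \<in> {0..1}"
    show "(\<lambda>n. ev (u (k n)) y) \<longlonglongrightarrow> g y"
      unfolding LIMSEQ_iff using g(3) y by blast
  qed
qed

text \<open>Continuity with respect to bounded pointwise convergence; on bounded sequences in the energy
  space it yields compactness.\<close>

definition seq_cont :: "((real \<Rightarrow> real) \<Rightarrow> pcf) \<Rightarrow> bool"
  where "seq_cont K \<longleftrightarrow> (\<forall>W w B. (\<forall>n. continuous_on {0..1} (W n)) \<longrightarrow> continuous_on {0..1} w \<longrightarrow>
    (\<forall>n. \<forall>y\<in>{0..1}. \<bar>W n y\<bar> \<le> B) \<longrightarrow> (\<forall>y\<in>{0..1}. (\<lambda>n::nat. W n y) \<longlonglongrightarrow> w y) \<longrightarrow> (\<lambda>n. K (W n)) \<longlonglongrightarrow> K w)"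

lemma seq_contI:
  assumes "\<And>W w B. (\<And>n::nat. continuous_on {0..1} (W n)) \<Longrightarrow> continuous_on {0..1} w \<Longrightarrow>
    (\<And>n y. y \<in> {0..1} \<Longrightarrow> \<bar>W n y\<bar> \<le> B) \<Longrightarrow> (\<And>y. y \<in> {0..1} \<Longrightarrow> (\<lambda>n. W n y) \<longlonglongrightarrow> w y) \<Longrightarrow>
    (\<lambda>n. K (W n)) \<longlonglongrightarrow> K w"
  shows "seq_cont K"
  unfolding seq_cont_def
proof (intro allI impI)
  fix W :: "nat \<Rightarrow> real \<Rightarrow> real" and w :: "real \<Rightarrow> real" and B :: real
  assume "\<forall>n. continuous_on {0..1} (W n)" "continuous_on {0..1} w"
    "\<forall>n. \<forall>y\<in>{0..1}. \<bar>W n y\<bar> \<le> B" "\<forall>y\<in>{0..1}. (\<lambda>n. W n y) \<longlonglongrightarrow> w y"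
  then show "(\<lambda>n. K (W n)) \<longlonglongrightarrow> K w" by (intro assms[of W w B]) simp_all
qed

lemma seq_cont_tendsto:
  assumes "seq_cont K" "\<And>n::nat. continuous_on {0..1} (W n)" "continuous_on {0..1} w"
    "\<And>n y. y \<in> {0..1} \<Longrightarrow> \<bar>W n y\<bar> \<le> B" "\<And>y. y \<in> {0..1} \<Longrightarrow> (\<lambda>n. W n y) \<longlonglongrightarrow> w y"
  shows "(\<lambda>n. K (W n)) \<longlonglongrightarrow> K w"
proof -
  have "(\<forall>n. continuous_on {0..1} (W n)) \<longrightarrow> continuous_on {0..1} w \<longrightarrow>
    (\<forall>n. \<forall>y\<in>{0..1}. \<bar>W n y\<bar> \<le> B) \<longrightarrow> (\<forall>y\<in>{0..1}. (\<lambda>n::nat. W n y) \<longlonglongrightarrow> w y) \<longrightarrow> (\<lambda>n. K (W n)) \<longlonglongrightarrow> K w"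
    by (rule assms(1)[unfolded seq_cont_def, THEN spec, THEN spec, THEN spec])
  then show ?thesis using assms(2-5) by simp
qed

lemma seq_contD:
  assumes "seq_cont K" "\<And>n. norm (u n) \<le> B" "continuous_on {0..1} w"
    "\<And>y. y \<in> {0..1} \<Longrightarrow> (\<lambda>n. ev (u n) y) \<longlonglongrightarrow> w y"
  shows "(\<lambda>n. K (ev (u n))) \<longlonglongrightarrow> K w"
  by (rule seq_cont_tendsto[OF assms(1) ev_continuous assms(3) _ assms(4)])
    (use assms(2) ev_bound order_trans in blast)+

lemma seq_cont_add: assumes "seq_cont K" "seq_cont L" shows "seq_cont (\<lambda>w. K w + L w)"
  by (rule seq_contI, intro tendsto_add seq_cont_tendsto[OF assms(1)] seq_cont_tendsto[OF assms(2)])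

lemma seq_cont_const: "seq_cont (\<lambda>w. c)"
  unfolding seq_cont_def by simp

lemma seq_cont_sum: "(\<And>i. i \<in> I \<Longrightarrow> seq_cont (K i)) \<Longrightarrow> seq_cont (\<lambda>w. \<Sum>i\<in>I. K i w)"
  by (induction I rule: infinite_finite_induct) (auto intro: seq_cont_const seq_cont_add)

lemma seq_cont_linear: assumes "bounded_linear P" "seq_cont K" shows "seq_cont (\<lambda>w. P (K w))"
  by (rule seq_contI, intro bounded_linear.tendsto[OF assms(1)] seq_cont_tendsto[OF assms(2)])

lemma seq_cont_eval:
  assumes "continuous_on UNIV \<phi>" "z \<in> {0..1}"
  shows "seq_cont (\<lambda>w. \<phi> (w z) *\<^sub>R e)"
  unfolding seq_cont_def
proof (intro allI impI tendsto_scaleR tendsto_const)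
  fix W :: "nat \<Rightarrow> real \<Rightarrow> real" and w :: "real \<Rightarrow> real" assume "\<forall>y\<in>{0..1}. (\<lambda>n. W n y) \<longlonglongrightarrow> w y"
  then have "(\<lambda>n. W n z) \<longlonglongrightarrow> w z" using assms(2) by blast
  then show "(\<lambda>n. \<phi> (W n z)) \<longlonglongrightarrow> \<phi> (w z)"
    by (rule continuous_on_tendsto_compose[OF assms(1)]) auto
qed

text \<open>Caratheodory's conditions without exceptional null sets and with bounds uniform in
  \<open>y\<close>. The given nonlinearity takes this form after it has been set to 0 on a null set
  and outside (0, 1).\<close>

definition caratheodory_bdd :: "(real \<Rightarrow> real \<Rightarrow> real) \<Rightarrow> bool"
  where "caratheodory_bdd f \<longleftrightarrow> (\<forall>t. (\<lambda>y. f y t) \<in> borel_measurable unit_ivl) \<and>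
    (\<forall>y. continuous_on UNIV (f y)) \<and> (\<forall>B. \<exists>C. \<forall>y t. \<bar>t\<bar> \<le> B \<longrightarrow> \<bar>f y t\<bar> \<le> C)"

lemma caratheodory_bddD:
  assumes "caratheodory_bdd f"
  shows "(\<lambda>y. f y t) \<in> borel_measurable unit_ivl" "continuous_on UNIV (f y)"
    "\<exists>C. \<forall>y t. \<bar>t\<bar> \<le> B \<longrightarrow> \<bar>f y t\<bar> \<le> C"
  using assms unfolding caratheodory_bdd_def by simp_all

lemma bdd_meas_superposition:
  assumes f: "caratheodory_bdd f" and w: "continuous_on {0..1} w"
  shows "bdd_meas (\<lambda>y. f y (w y))"
proof -
  obtain B where B: "\<And>y. 0 < y \<Longrightarrow> y < 1 \<Longrightarrow> \<bar>w y\<bar> \<le> B"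
    by (rule bdd_measE[OF bdd_meas_continuous[OF w]]) (rule that, assumption)
  obtain C where C: "\<And>y t. \<bar>t\<bar> \<le> B \<Longrightarrow> \<bar>f y t\<bar> \<le> C" using caratheodory_bddD(3)[OF f] by meson
  show ?thesis
  proof (rule bdd_measI)
    show "(\<lambda>y. f y (w y)) \<in> borel_measurable unit_ivl"
      by (rule caratheodory_measurable[OF caratheodory_bddD(1)[OF f] caratheodory_bddD(2)[OF f]
            bdd_meas_measurable[OF bdd_meas_continuous[OF w]]])
    show "\<bar>f y (w y)\<bar> \<le> C" if "0 < y" "y < 1" for y using C[OF B[OF that]] .
  qed
qed

text \<open>Dominated convergence gives L1 convergence of \<open>f y (W n y)\<close>, which
  \<open>norm_T_le\<close> turns into convergence in norm.\<close>

lemma seq_cont_superposition: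
  assumes f: "caratheodory_bdd f"
  shows "seq_cont (\<lambda>w. T (\<lambda>y. f y (w y)))"
  unfolding seq_cont_def
proof (intro allI impI)
  fix W :: "nat \<Rightarrow> real \<Rightarrow> real" and w :: "real \<Rightarrow> real" and B :: real
  assume W: "\<forall>n. continuous_on {0..1} (W n)" and w: "continuous_on {0..1} w"
    and B: "\<forall>n. \<forall>y\<in>{0..1}. \<bar>W n y\<bar> \<le> B" and lim: "\<forall>y\<in>{0..1}. (\<lambda>n. W n y) \<longlonglongrightarrow> w y"
  obtain C where C: "\<And>y t. \<bar>t\<bar> \<le> B \<Longrightarrow> \<bar>f y t\<bar> \<le> C" using caratheodory_bddD(3)[OF f] by meson
  have bW: "bdd_meas (\<lambda>y. f y (W n y))" for n by (rule bdd_meas_superposition[OF f W[rule_format]])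
  have bw: "bdd_meas (\<lambda>y. f y (w y))" by (rule bdd_meas_superposition[OF f w])
  have wB: "\<bar>w y\<bar> \<le> B" if "y \<in> {0..1}" for y
    by (rule LIMSEQ_le_const2[OF tendsto_rabs[OF lim[rule_format, OF that]]]) (use B that in auto)
  have "(\<lambda>n. itv (\<lambda>y. \<bar>f y (W n y) - f y (w y)\<bar>) 0 1) \<longlonglongrightarrow> itv (\<lambda>y. 0) 0 1"
  proof (rule itv_tendsto[where B="2 * C"])
    show "bdd_meas (\<lambda>y. \<bar>f y (W k y) - f y (w y)\<bar>)" for k
      using bdd_meas_diff[OF bW[of k] bw] by (auto simp: bdd_meas_def)
    show "\<bar>\<bar>f y (W k y) - f y (w y)\<bar>\<bar> \<le> 2 * C" if "0 < y" "y < 1" for k y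
      using C[of "W k y" y] C[of "w y" y] B wB[of y] that by force
    show "AE y in unit_ivl. (\<lambda>k. \<bar>f y (W k y) - f y (w y)\<bar>) \<longlonglongrightarrow> 0"
    proof (intro AE_I2 tendsto_rabs_zero LIM_zero)
      fix y assume "y \<in> space unit_ivl"
      then have "(\<lambda>n. W n y) \<longlonglongrightarrow> w y" using lim by auto
      then show "(\<lambda>k. f y (W k y)) \<longlonglongrightarrow> f y (w y)"
        by (rule continuous_on_tendsto_compose[OF caratheodory_bddD(2)[OF f]]) auto
    qed
  qed (rule bdd_meas_const)
  then have z: "(\<lambda>n. \<integral>y. \<bar>f y (W n y) - f y (w y)\<bar> \<partial>unit_ivl) \<longlonglongrightarrow> 0" by (simp add: itv_0_1)
  have "(\<lambda>n. T (\<lambda>y. f y (W n y)) - T (\<lambda>y. f y (w y))) \<longlonglongrightarrow> 0"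
    by (rule Lim_null_comparison[OF _ z])
      (simp add: T_diff[OF bW bw, symmetric] norm_T_le bdd_meas_diff bW bw)
  then show "(\<lambda>n. T (\<lambda>y. f y (W n y))) \<longlonglongrightarrow> T (\<lambda>y. f y (w y))" by (rule LIM_zero_cancel)
qed

text \<open>Along a subsequence the functions converge to some \<open>w\<close>, so
  \<open>K (ev (u n))\<close> converges to \<open>K w\<close>. This limit belongs to
  \<open>pcf\<close> even if \<open>w\<close> does not; hence \<open>u n\<close> itself converges to
  it, and a second passage to the limit shows that it is a fixed point.\<close>

lemma palais_smale:
  assumes K: "seq_cont K" and B: "\<And>n. norm (u n) \<le> B" and 0: "(\<lambda>n. u n - K (ev (u n))) \<longlonglongrightarrow> 0"
  obtains k v where "strict_mono (k :: nat \<Rightarrow> nat)" "(\<lambda>n. u (k n)) \<longlonglongrightarrow> v" "v = K (ev v)"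
proof -
  obtain k w where k: "strict_mono (k :: nat \<Rightarrow> nat)" and w: "continuous_on {0..1} w"
    "\<And>y. y \<in> {0..1} \<Longrightarrow> (\<lambda>n. ev (u (k n)) y) \<longlonglongrightarrow> w y"
    by (rule bounded_seq_uniform_subseq[of u B, OF B]) (rule that, assumption+)
  have l: "(\<lambda>n. K (ev (u (k n)))) \<longlonglongrightarrow> K w" by (rule seq_contD[OF K B w])
  have "(\<lambda>n. u (k n) - K (ev (u (k n)))) \<longlonglongrightarrow> 0" using LIMSEQ_subseq_LIMSEQ[OF 0 k] by (simp add: o_def)
  from tendsto_add[OF this l] have uk: "(\<lambda>n. u (k n)) \<longlonglongrightarrow> K w" by simp
  have "(\<lambda>n. ev (u (k n)) y) \<longlonglongrightarrow> ev (K w) y" for y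
    by (rule bounded_linear.tendsto[OF bounded_linear_ev uk])
  then have "(\<lambda>n. K (ev (u (k n)))) \<longlonglongrightarrow> K (ev (K w))"
    by (intro seq_contD[OF K B ev_continuous]) auto
  then have "K w = K (ev (K w))" using l LIMSEQ_unique by blast
  then show ?thesis using that[OF k uk] by simp
qed

text \<open>Otherwise a sequence in the annulus with gradients tending to 0 would have a critical
  point of the annulus as a limit.\<close>

lemma gradient_bounded_below:
  assumes K: "seq_cont K" and r: "\<And>u. r \<le> norm u \<Longrightarrow> norm u \<le> B \<Longrightarrow> u \<noteq> K (ev u)"
  obtains \<gamma> where "\<gamma> > 0" "\<And>u. r \<le> norm u \<Longrightarrow> norm u \<le> B \<Longrightarrow> \<gamma> \<le> norm (u - K (ev u))"
proof -
  have "\<exists>\<gamma>>0. \<forall>u. r \<le> norm u \<longrightarrow> norm u \<le> B \<longrightarrow> \<gamma> \<le> norm (u - K (ev u))"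
  proof (rule ccontr)
    assume n: "\<not> ?thesis"
    have "\<forall>n. \<exists>u. r \<le> norm u \<and> norm u \<le> B \<and> norm (u - K (ev u)) < inverse (real (Suc n))"
    proof
      fix n
      have "inverse (real (Suc n)) > 0" by simp
      then show "\<exists>u. r \<le> norm u \<and> norm u \<le> B \<and> norm (u - K (ev u)) < inverse (real (Suc n))"
        using n by (meson not_le)
    qed
    from choice[OF this] obtain u where u: "\<And>n. r \<le> norm (u n)" "\<And>n. norm (u n) \<le> B"
      "\<And>n. norm (u n - K (ev (u n))) < inverse (real (Suc n))" by blast
    have 0: "(\<lambda>n. u n - K (ev (u n))) \<longlonglongrightarrow> 0"
      by (rule Lim_null_comparison[OF _ LIMSEQ_inverse_real_of_nat]) (use u(3) in \<open>auto intro!: always_eventually less_imp_le\<close>)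
    obtain k v where k: "strict_mono (k :: nat \<Rightarrow> nat)" "(\<lambda>n. u (k n)) \<longlonglongrightarrow> v" "v = K (ev v)"
      by (rule palais_smale[OF K u(2) 0]) (rule that, assumption+)
    have "r \<le> norm v" by (rule LIMSEQ_le_const[OF tendsto_norm[OF k(2)]]) (use u in auto)
    moreover have "norm v \<le> B" by (rule LIMSEQ_le_const2[OF tendsto_norm[OF k(2)]]) (use u in auto)
    ultimately show False using r k(3) by blast
  qed
  then show ?thesis using that by blast
qed

text \<open>By contradiction: two bounded sequences that approach each other have the same
  continuous limit \<open>w\<close> along a subsequence, and the images under \<open>K\<close> of
  both tend to \<open>K w\<close>.\<close>

lemma gradient_uniformly_continuous:
  assumes K: "seq_cont K" and e: "\<epsilon> > 0"
  shows "\<exists>\<delta>>0. \<forall>u v. norm u \<le> B \<longrightarrow> norm v \<le> B \<longrightarrow> norm (u - v) \<le> \<delta> \<longrightarrow>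
    norm ((u - K (ev u)) - (v - K (ev v))) \<le> \<epsilon>"
proof (rule ccontr)
  assume n: "\<not> ?thesis"
  have "\<forall>n. \<exists>p. norm (fst p) \<le> B \<and> norm (snd p) \<le> B \<and> norm (fst p - snd p) \<le> inverse (real (Suc n)) \<and>
      \<epsilon> < norm ((fst p - K (ev (fst p))) - (snd p - K (ev (snd p))))"
  proof
    fix n
    have "inverse (real (Suc n)) > 0" by simp
    then obtain u v where "norm u \<le> B" "norm v \<le> B" "norm (u - v) \<le> inverse (real (Suc n))"
      "\<not> norm ((u - K (ev u)) - (v - K (ev v))) \<le> \<epsilon>" using n by blast
    then show "\<exists>p. norm (fst p) \<le> B \<and> norm (snd p) \<le> B \<and> norm (fst p - snd p) \<le> inverse (real (Suc n)) \<and>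
      \<epsilon> < norm ((fst p - K (ev (fst p))) - (snd p - K (ev (snd p))))"
      by (intro exI[of _ "(u, v)"]) auto
  qed
  from choice[OF this] obtain p where p: "\<And>n. norm (fst (p n)) \<le> B" "\<And>n. norm (snd (p n)) \<le> B"
    "\<And>n. norm (fst (p n) - snd (p n)) \<le> inverse (real (Suc n))"
    "\<And>n. \<epsilon> < norm ((fst (p n) - K (ev (fst (p n)))) - (snd (p n) - K (ev (snd (p n)))))" by blast
  obtain k w where k: "strict_mono (k :: nat \<Rightarrow> nat)" and w: "continuous_on {0..1} w"
    "\<And>y. y \<in> {0..1} \<Longrightarrow> (\<lambda>n. ev (fst (p (k n))) y) \<longlonglongrightarrow> w y"
    by (rule bounded_seq_uniform_subseq[of "\<lambda>n. fst (p n)" B, OF p(1)]) (rule that, assumption+)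
  have "(\<lambda>n. fst (p n) - snd (p n)) \<longlonglongrightarrow> 0"
    by (rule Lim_null_comparison[OF _ LIMSEQ_inverse_real_of_nat]) (use p(3) in auto)
  then have d: "(\<lambda>n. fst (p (k n)) - snd (p (k n))) \<longlonglongrightarrow> 0"
    using LIMSEQ_subseq_LIMSEQ[OF _ k] by (auto simp: o_def)
  have v: "(\<lambda>n. ev (snd (p (k n))) y) \<longlonglongrightarrow> w y" if "y \<in> {0..1}" for y
    using tendsto_diff[OF w(2)[OF that] bounded_linear.tendsto[OF bounded_linear_ev d, of y]] by simp
  have "(\<lambda>n. K (ev (fst (p (k n))))) \<longlonglongrightarrow> K w" by (rule seq_contD[OF K p(1) w])
  moreover have "(\<lambda>n. K (ev (snd (p (k n))))) \<longlonglongrightarrow> K w" by (rule seq_contD[OF K p(2) w(1) v])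
  ultimately have "(\<lambda>n. (fst (p (k n)) - snd (p (k n))) - (K (ev (fst (p (k n)))) - K (ev (snd (p (k n)))))) \<longlonglongrightarrow> 0 - (K w - K w)"
    by (intro tendsto_diff d)
  then have "(\<lambda>n. norm ((fst (p (k n)) - K (ev (fst (p (k n))))) - (snd (p (k n)) - K (ev (snd (p (k n))))))) \<longlonglongrightarrow> 0"
    by (intro tendsto_norm_zero) (simp add: algebra_simps)
  then have "\<epsilon> \<le> 0" by (rule LIMSEQ_le_const) (use p(4) in \<open>auto intro: less_imp_le\<close>)
  then show False using e by simp
qed

lemma gradient_bounded:
  assumes K: "seq_cont K"
  shows "\<exists>C. \<forall>u. norm u \<le> B \<longrightarrow> norm (u - K (ev u)) \<le> C"
proof (rule ccontr)
  assume n: "\<not> ?thesis"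
  then have "\<forall>n. \<exists>u. norm u \<le> B \<and> real n < norm (u - K (ev u))" by (meson not_le)
  from choice[OF this] obtain u where u: "\<And>n. norm (u n) \<le> B" "\<And>n. real n < norm (u n - K (ev (u n)))" by blast
  obtain k w where k: "strict_mono (k :: nat \<Rightarrow> nat)" and w: "continuous_on {0..1} w"
    "\<And>y. y \<in> {0..1} \<Longrightarrow> (\<lambda>n. ev (u (k n)) y) \<longlonglongrightarrow> w y"
    by (rule bounded_seq_uniform_subseq[of u B, OF u(1)]) (rule that, assumption+)
  have "(\<lambda>n. K (ev (u (k n)))) \<longlonglongrightarrow> K w" by (rule seq_contD[OF K u(1) w])
  then have "convergent (\<lambda>n. K (ev (u (k n))))" by (auto simp: convergent_def)
  from convergent_imp_Bseq[OF this] obtain C where C: "\<And>n. norm (K (ev (u (k n)))) \<le> C"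
    by (auto simp: Bseq_def)
  obtain n :: nat where "B + C < real n" using reals_Archimedean2 by blast
  also have "real n \<le> real (k n)" using seq_suble[OF k, of n] by simp
  also have "\<dots> < norm (u (k n) - K (ev (u (k n))))" by (rule u(2))
  also have "\<dots> \<le> B + C" using norm_triangle_ineq4[of "u (k n)" "K (ev (u (k n)))"] u(1)[of "k n"] C[of n] by linarith
  finally show False by simp
qed

section \<open>The potential of the nonlinearity and its derivative\<close>

lemma prim_superposition_measurable:
  assumes f: "caratheodory_bdd f" and w: "w \<in> borel_measurable unit_ivl"
  shows "(\<lambda>y. prim (f y) (w y)) \<in> borel_measurable unit_ivl"
proof -
  interpret finite_measure unit_ivl by (rule finite_measure_unit_ivl)
  have id: "(\<lambda>s. s) \<in> borel_measurable unit_ivl"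
    by (intro bdd_meas_measurable bdd_meas_continuous continuous_on_id)
  have "(\<lambda>p. f (fst p) (snd p * w (fst p))) \<in> borel_measurable (unit_ivl \<Otimes>\<^sub>M unit_ivl)"
  proof (rule caratheodory_measurable[where \<phi>="\<lambda>p t. f (fst p) t"])
    show "(\<lambda>p. f (fst p) t) \<in> borel_measurable (unit_ivl \<Otimes>\<^sub>M unit_ivl)" for t
      by (rule measurable_compose[OF measurable_fst caratheodory_bddD(1)[OF f]])
    show "(\<lambda>p. snd p * w (fst p)) \<in> borel_measurable (unit_ivl \<Otimes>\<^sub>M unit_ivl)"
      by (intro borel_measurable_times measurable_compose[OF measurable_fst w] measurable_compose[OF measurable_snd id])
  qed (rule caratheodory_bddD(2)[OF f])
  then have "(\<lambda>p. f (fst p) (snd p * w (fst p)) * w (fst p)) \<in> borel_measurable (unit_ivl \<Otimes>\<^sub>M unit_ivl)"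
    by (intro borel_measurable_times measurable_compose[OF measurable_fst w])
  then have "case_prod (\<lambda>y s. f y (s * w y) * w y) \<in> borel_measurable (unit_ivl \<Otimes>\<^sub>M unit_ivl)"
    by (simp add: case_prod_beta')
  from borel_measurable_lebesgue_integral[OF this] show ?thesis by (simp add: prim_def)
qed

lemma bdd_meas_prim_superposition:
  assumes f: "caratheodory_bdd f"
  shows "bdd_meas (\<lambda>y. prim (f y) (ev u y))"
proof -
  obtain C where C: "\<And>y t. \<bar>t\<bar> \<le> norm u \<Longrightarrow> \<bar>f y t\<bar> \<le> C" using caratheodory_bddD(3)[OF f] by meson
  show ?thesis
  proof (rule bdd_measI)
    show "(\<lambda>y. prim (f y) (ev u y)) \<in> borel_measurable unit_ivl"
      by (rule prim_superposition_measurable[OF f bdd_meas_measurable[OF bdd_meas_ev]])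
    fix y
    have "\<bar>prim (f y) (ev u y)\<bar> \<le> C * \<bar>ev u y\<bar>"
      by (rule prim_bound[OF caratheodory_bddD(2)[OF f]]) (use C ev_bound[of u y] in force)
    also have "\<dots> \<le> \<bar>C\<bar> * norm u" by (intro mult_mono) (auto simp: ev_bound)
    finally show "\<bar>prim (f y) (ev u y)\<bar> \<le> \<bar>C\<bar> * norm u" .
  qed
qed

text \<open>By the mean value theorem, the remainder at \<open>y\<close> divided by
  \<open>norm h\<close> is at most \<open>\<bar>f y \<xi> - f y (ev u y)\<bar>\<close> for some
  \<xi> within \<open>norm h\<close> of \<open>ev u y\<close>, because the norm dominates all
  values. Dominated convergence along null sequences does the rest.\<close>

lemma prim_superposition_deriv:
  assumes f: "caratheodory_bdd f"
  shows "((\<lambda>u. \<integral>y. prim (f y) (ev u y) \<partial>unit_ivl) has_derivative (\<lambda>v. T (\<lambda>y. f y (ev u y)) \<bullet> v)) (at u)"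
  unfolding has_derivative_at
proof (intro conjI bounded_linear_inner_right)
  have fc: "continuous_on UNIV (f y)" for y by (rule caratheodory_bddD(2)[OF f])
  have bu: "bdd_meas (\<lambda>y. f y (ev u y))" by (rule bdd_meas_superposition[OF f ev_continuous])
  let ?r = "\<lambda>h y. prim (f y) (ev (u + h) y) - prim (f y) (ev u y) - f y (ev u y) * ev h y"
  have br: "bdd_meas (?r h)" for h
    by (intro bdd_meas_diff bdd_meas_prim_superposition bdd_meas_mult bu bdd_meas_ev f)
  have split: "(\<integral>y. prim (f y) (ev (u + h) y) \<partial>unit_ivl) - (\<integral>y. prim (f y) (ev u y) \<partial>unit_ivl) - T (\<lambda>y. f y (ev u y)) \<bullet> h
      = (\<integral>y. ?r h y \<partial>unit_ivl)" for h
    using bdd_meas_integrable[OF bdd_meas_prim_superposition[OF f, of "u + h"]]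
      bdd_meas_integrable[OF bdd_meas_prim_superposition[OF f, of u]] bdd_meas_integrable[OF bdd_meas_mult[OF bu bdd_meas_ev]]
    by (simp add: inner_T[OF bu] del: ev_add)
  show "(\<lambda>h. norm ((\<integral>y. prim (f y) (ev (u + h) y) \<partial>unit_ivl) - (\<integral>y. prim (f y) (ev u y) \<partial>unit_ivl) - T (\<lambda>y. f y (ev u y)) \<bullet> h) / norm h) \<midarrow>0\<rightarrow> 0"
    unfolding split tendsto_at_iff_sequentially
  proof (intro allI impI)
    fix X :: "nat \<Rightarrow> pcf" assume X: "\<forall>i. X i \<in> UNIV - {0}" "X \<longlonglongrightarrow> 0"
    have nX: "norm (X i) > 0" for i using X(1) by auto
    obtain BX where BX: "\<And>i. norm (X i) \<le> BX"
    proof -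
      have "convergent X" using X(2) by (auto simp: convergent_def)
      from convergent_imp_Bseq[OF this] show ?thesis using that by (auto simp: Bseq_def)
    qed
    obtain C where C: "\<And>y t. \<bar>t\<bar> \<le> norm u + BX \<Longrightarrow> \<bar>f y t\<bar> \<le> C" using caratheodory_bddD(3)[OF f] by meson
    have q: "\<exists>\<xi>. \<bar>\<xi> - ev u y\<bar> \<le> norm (X i) \<and> \<bar>?r (X i) y / norm (X i)\<bar> \<le> \<bar>f y \<xi> - f y (ev u y)\<bar>" for i y
    proof -
      obtain \<xi> where x: "\<bar>\<xi> - ev u y\<bar> \<le> \<bar>ev (X i) y\<bar>"
        "prim (f y) (ev u y + ev (X i) y) - prim (f y) (ev u y) = ev (X i) y * f y \<xi>"
        by (rule prim_increment[OF fc]) (rule that, assumption+)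
      have "?r (X i) y = ev (X i) y * (f y \<xi> - f y (ev u y))" using x(2) by (simp add: algebra_simps)
      then have "\<bar>?r (X i) y\<bar> = \<bar>ev (X i) y\<bar> * \<bar>f y \<xi> - f y (ev u y)\<bar>" by (simp only: abs_mult)
      also have "\<dots> \<le> norm (X i) * \<bar>f y \<xi> - f y (ev u y)\<bar>" by (intro mult_right_mono ev_bound) simp
      finally show ?thesis using x(1) ev_bound[of "X i" y] nX[of i]
        by (intro exI[of _ \<xi>]) (auto simp: abs_divide divide_le_eq mult.commute)
    qed
    have "(\<lambda>i. itv (\<lambda>y. ?r (X i) y / norm (X i)) 0 1) \<longlonglongrightarrow> itv (\<lambda>y. 0) 0 1"
    proof (rule itv_tendsto[where B="2 * C"])
      show "bdd_meas (\<lambda>y. ?r (X i) y / norm (X i))" for i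
        using bdd_meas_cmult[OF br[of "X i"], of "inverse (norm (X i))"] by (simp add: divide_inverse mult.commute)
      show "\<bar>?r (X i) y / norm (X i)\<bar> \<le> 2 * C" for i y
      proof -
        obtain \<xi> where x: "\<bar>\<xi> - ev u y\<bar> \<le> norm (X i)" "\<bar>?r (X i) y / norm (X i)\<bar> \<le> \<bar>f y \<xi> - f y (ev u y)\<bar>"
          using q[of y i] by auto
        have "\<bar>\<xi>\<bar> \<le> norm u + BX" "\<bar>ev u y\<bar> \<le> norm u + BX"
          using x(1) BX[of i] ev_bound[of u y] nX[of i] by linarith+
        then show ?thesis using C[of \<xi> y] C[of "ev u y" y] x(2) by linarith
      qed
      show "AE y in unit_ivl. (\<lambda>i. ?r (X i) y / norm (X i)) \<longlonglongrightarrow> 0"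
      proof (rule AE_I2)
        fix y
        have "\<forall>i. \<exists>\<xi>. \<bar>\<xi> - ev u y\<bar> \<le> norm (X i) \<and> \<bar>?r (X i) y / norm (X i)\<bar> \<le> \<bar>f y \<xi> - f y (ev u y)\<bar>"
          using q by fast
        from choice[OF this] obtain \<xi> where x: "\<And>i. \<bar>\<xi> i - ev u y\<bar> \<le> norm (X i)"
          "\<And>i. \<bar>?r (X i) y / norm (X i)\<bar> \<le> \<bar>f y (\<xi> i) - f y (ev u y)\<bar>" by blast
        have "(\<lambda>i. \<xi> i - ev u y) \<longlonglongrightarrow> 0"
          by (rule Lim_null_comparison[OF _ tendsto_norm_zero[OF X(2)]]) (use x in auto)
        then have "\<xi> \<longlonglongrightarrow> ev u y" by (simp add: LIM_zero_iff)
        then have "(\<lambda>i. f y (\<xi> i)) \<longlonglongrightarrow> f y (ev u y)"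
          by (rule continuous_on_tendsto_compose[OF fc]) auto
        then have "(\<lambda>i. \<bar>f y (\<xi> i) - f y (ev u y)\<bar>) \<longlonglongrightarrow> 0" by (intro tendsto_rabs_zero LIM_zero)
        then show "(\<lambda>i. ?r (X i) y / norm (X i)) \<longlonglongrightarrow> 0"
          by (rule Lim_null_comparison[rotated]) (use x(2) in auto)
      qed
    qed (rule bdd_meas_const)
    then have "(\<lambda>i. \<bar>(\<integral>y. ?r (X i) y \<partial>unit_ivl) / norm (X i)\<bar>) \<longlonglongrightarrow> 0"
      by (intro tendsto_rabs_zero) (simp add: itv_0_1)
    then show "((\<lambda>h. norm (\<integral>y. ?r h y \<partial>unit_ivl) / norm h) \<circ> X) \<longlonglongrightarrow> 0"
      by (simp add: o_def abs_divide)
  qed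
qed

section \<open>Negative directions of quadratic forms\<close>

text \<open>Gaussian elimination: equation \<open>m\<close> is solved for an unknown
  \<open>k\<close> that occurs in it, which leaves one equation and one unknown less.\<close>

lemma underdetermined_system:
  fixes A :: "'i \<Rightarrow> nat \<Rightarrow> real"
  assumes "finite I" "m < card I"
  shows "\<exists>c. (\<exists>i\<in>I. c i \<noteq> 0) \<and> (\<forall>j<m. (\<Sum>i\<in>I. c i * A i j) = 0)"
  using assms
proof (induction m arbitrary: I A)
  case 0
  then obtain i where "i \<in> I" by fastforce
  then show ?case by (intro exI[of _ "\<lambda>_. 1"]) auto
next
  case (Suc m)
  show ?case
  proof (cases "\<forall>i\<in>I. A i m = 0")
    case True
    from Suc.IH[of I A] Suc.prems obtain c where c: "\<exists>i\<in>I. c i \<noteq> 0" "\<forall>j<m. (\<Sum>i\<in>I. c i * A i j) = 0" by auto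
    show ?thesis by (intro exI[of _ c]) (use c True in \<open>auto simp: less_Suc_eq\<close>)
  next
    case False
    then obtain k where k: "k \<in> I" "A k m \<noteq> 0" by auto
    define A' where "A' i j = A i j - A i m / A k m * A k j" for i j
    have "m < card (I - {k})" using Suc.prems k by simp
    from Suc.IH[OF _ this, of A'] Suc.prems obtain c
      where c: "\<exists>i\<in>I - {k}. c i \<noteq> 0" "\<And>j. j < m \<Longrightarrow> (\<Sum>i\<in>I - {k}. c i * A' i j) = 0" by auto
    define s where "s = (\<Sum>i\<in>I - {k}. c i * A i m) / A k m"
    define c' where "c' i = (if i = k then - s else c i)" for i
    have sum': "(\<Sum>i\<in>I. c' i * A i j) = - s * A k j + (\<Sum>i\<in>I - {k}. c i * A i j)" for j
    proof -
      have "(\<Sum>i\<in>I. c' i * A i j) = c' k * A k j + (\<Sum>i\<in>I - {k}. c' i * A i j)"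
        by (rule sum.remove) (use Suc.prems k in auto)
      also have "(\<Sum>i\<in>I - {k}. c' i * A i j) = (\<Sum>i\<in>I - {k}. c i * A i j)"
        by (intro sum.cong) (auto simp: c'_def)
      finally show ?thesis by (simp add: c'_def)
    qed
    have "(\<Sum>i\<in>I. c' i * A i j) = 0" if "j < Suc m" for j
    proof (cases "j = m")
      case True
      then show ?thesis using k unfolding sum' by (simp add: s_def)
    next
      case False
      then have "0 = (\<Sum>i\<in>I - {k}. c i * A' i j)" using c(2)[of j] that by simp
      also have "\<dots> = (\<Sum>i\<in>I - {k}. c i * A i j) - s * A k j"
        unfolding A'_def s_def by (simp add: right_diff_distrib sum_subtractf sum_distrib_right sum_divide_distrib mult.assoc)
      finally show ?thesis unfolding sum' by simp
    qed
    then show ?thesis using c(1) by (intro exI[of _ c']) (auto simp: c'_def)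
  qed
qed

text \<open>For a maximal negative orthonormal system the form is nonnegative on the complement, and there
  the Cauchy-Schwarz inequality for the form turns \<open>\<kappa> * norm u \<le> norm (L u)\<close> into coercivity.\<close>

theorem maximal_negative_system:
  fixes B :: "'h::real_inner \<Rightarrow> 'h \<Rightarrow> real" and \<phi> :: "nat \<Rightarrow> 'h \<Rightarrow> real"
  assumes bb: "bounded_bilinear B" and sym: "\<And>u v. B u v = B v u" and N: "subspace N"
    and L: "\<And>u. u \<in> N \<Longrightarrow> L u \<in> N" "\<And>u v. u \<in> N \<Longrightarrow> v \<in> N \<Longrightarrow> B u v = L u \<bullet> v"
    and \<kappa>: "\<kappa> > 0" "\<And>u. u \<in> N \<Longrightarrow> \<kappa> * norm u \<le> norm (L u)"
    and lin: "\<And>j. linear (\<phi> j)"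
    and pos: "\<And>u. u \<in> N \<Longrightarrow> (\<And>j. j < m \<Longrightarrow> \<phi> j u = 0) \<Longrightarrow> 0 \<le> B u u"
  obtains n c \<kappa>' where "n \<le> m" "\<And>i. i < n \<Longrightarrow> c i \<in> N"
    "\<And>i j. i < n \<Longrightarrow> j < n \<Longrightarrow> B (c i) (c j) = (if i = j then -1 else 0)"
    "\<kappa>' > 0" "\<And>u. u \<in> N \<Longrightarrow> \<forall>i<n. B u (c i) = 0 \<Longrightarrow> \<kappa>' * (norm u)\<^sup>2 \<le> B u u"
proof -
  interpret B: bounded_bilinear B by (rule bb)
  define sys where "sys n c \<longleftrightarrow> (\<forall>i<n. c i \<in> N) \<and> (\<forall>i<n. \<forall>j<n. B (c i) (c j) = (if i = j then -1 else 0))"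
    for n :: nat and c
  have B_sum: "B u (\<Sum>i<n. \<gamma> i *\<^sub>R c i) = (\<Sum>i<n. \<gamma> i * B u (c i))" for u n \<gamma> and c :: "nat \<Rightarrow> 'h"
    by (simp add: B.sum_right B.scaleR_right)
  have sum_N: "(\<Sum>i<n. \<gamma> i *\<^sub>R c i) \<in> N" if "\<And>i. i < n \<Longrightarrow> c i \<in> N" for n \<gamma> and c :: "nat \<Rightarrow> 'h"
    by (intro subspace_sum N subspace_scale that) auto
  have delta: "(\<Sum>i<n. \<gamma> i * (if i = j then -1 else 0)) = - \<gamma> j" if "j < n" for \<gamma> :: "nat \<Rightarrow> real" and n j :: nat
  proof -
    have "(\<Sum>i<n. \<gamma> i * (if i = j then -1 else 0)) = (\<Sum>i<n. if i = j then - \<gamma> i else 0)"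
      by (intro sum.cong) auto
    then show ?thesis using that by simp
  qed
  \<comment> \<open>Of more than \<open>m\<close> vectors some nontrivial combination is annihilated
    by the \<open>m\<close> functionals. The form is nonnegative there, yet negative on every
    nontrivial combination of the system. This bounds the size of systems, so that a largest one
    exists.\<close>
  have le: "n \<le> m" if s: "sys n c" for n c
  proof (rule ccontr)
    assume "\<not> n \<le> m"
    then have "m < card {..<n}" by simp
    from underdetermined_system[OF _ this, of "\<lambda>i j. \<phi> j (c i)"]
    obtain \<gamma> where \<gamma>: "\<exists>i\<in>{..<n}. \<gamma> i \<noteq> 0" "\<forall>j<m. (\<Sum>i<n. \<gamma> i * \<phi> j (c i)) = 0" by auto
    define u where "u = (\<Sum>i<n. \<gamma> i *\<^sub>R c i)"
    have uN: "u \<in> N" unfolding u_def by (rule sum_N) (use s in \<open>auto simp: sys_def\<close>)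
    have "\<phi> j u = 0" if "j < m" for j
      using \<gamma>(2) that unfolding u_def by (simp add: linear_sum[OF lin] linear_scale[OF lin])
    then have "0 \<le> B u u" by (rule pos[OF uN])
    moreover have "B u u = - (\<Sum>i<n. (\<gamma> i)\<^sup>2)"
    proof -
      have "B u (c j) = - \<gamma> j" if "j < n" for j
      proof -
        have "B u (c j) = (\<Sum>i<n. \<gamma> i * B (c j) (c i))" unfolding u_def by (subst sym) (rule B_sum)
        also have "\<dots> = (\<Sum>i<n. \<gamma> i * (if i = j then -1 else 0))"
          by (intro sum.cong) (use s that in \<open>auto simp: sys_def\<close>)
        also have "\<dots> = - \<gamma> j" by (rule delta[OF that])
        finally show ?thesis .
      qed
      moreover have "B u u = (\<Sum>i<n. \<gamma> i * B u (c i))"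
        by (rule B_sum[where u=u and \<gamma>=\<gamma> and c=c and n=n, folded u_def])
      ultimately have "B u u = (\<Sum>i<n. \<gamma> i * (- \<gamma> i))" by simp
      then show ?thesis by (simp add: power2_eq_square sum_negf)
    qed
    moreover have "(\<Sum>i<n. (\<gamma> i)\<^sup>2) > 0" using \<gamma>(1) by (auto intro!: sum_pos2)
    ultimately show False by linarith
  qed
  define n where "n = (GREATEST n. \<exists>c. sys n c)"
  have "\<exists>c. sys 0 c" by (auto simp: sys_def)
  then have "\<exists>c. sys n c" unfolding n_def by (rule GreatestI_nat[where b=m]) (use le in blast)
  then obtain c where c: "sys n c" by blast
  have max: "k \<le> n" if "sys k c'" for k c'
    unfolding n_def by (rule Greatest_le_nat[where b=m]) (use that le in blast)+
  define X where "X = {u \<in> N. \<forall>i<n. B u (c i) = 0}"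
  \<comment> \<open>A vector of \<open>X\<close> on which the form is negative could be normalized
    and appended to the system.\<close>
  have nonneg: "0 \<le> B u u" if u: "u \<in> X" for u
  proof (rule ccontr)
    assume neg: "\<not> 0 \<le> B u u"
    define v where "v = (1 / sqrt (- B u u)) *\<^sub>R u"
    have vv: "B v v = -1"
    proof -
      have "B v v = B u u / (sqrt (- B u u) * sqrt (- B u u))" by (simp add: v_def B.scaleR_left B.scaleR_right)
      then show ?thesis using neg by simp
    qed
    have vc: "B v (c i) = 0" if "i < n" for i
      using u that by (simp add: v_def B.scaleR_left X_def)
    have vc': "B (c i) v = 0" if "i < n" for i by (subst sym) (rule vc[OF that])
    have vN: "v \<in> N" using u N by (simp add: v_def X_def subspace_scale)
    have "sys (Suc n) (c(n := v))"
      using c vv vc vc' vN unfolding sys_def by (auto simp: less_Suc_eq)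
    then show False using max by fastforce
  qed
  obtain K where K: "K > 0" "\<And>u v. norm (B u v) \<le> norm u * norm v * K"
    using B.pos_bounded by blast
  \<comment> \<open>The projection onto \<open>X\<close> along the span of the system; the plus sign
    is due to \<open>B (c i) (c i) = -1\<close>.\<close>
  define pr where "pr w = w + (\<Sum>i<n. B w (c i) *\<^sub>R c i)" for w
  have prX: "pr w \<in> X" if w: "w \<in> N" for w
  proof -
    have "B (pr w) (c j) = 0" if "j < n" for j
    proof -
      have "B (pr w) (c j) = B w (c j) + (\<Sum>i<n. B w (c i) * B (c j) (c i))"
        unfolding pr_def B.add_left sym[of "\<Sum>i<n. B w (c i) *\<^sub>R c i" "c j"] B_sum ..
      also have "(\<Sum>i<n. B w (c i) * B (c j) (c i)) = (\<Sum>i<n. B w (c i) * (if i = j then -1 else 0))"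
        by (intro sum.cong) (use c that in \<open>auto simp: sys_def\<close>)
      also have "\<dots> = - B w (c j)" by (rule delta[OF that])
      finally show ?thesis by simp
    qed
    moreover have "pr w \<in> N" unfolding pr_def
      by (intro subspace_add N w sum_N) (use c in \<open>auto simp: sys_def\<close>)
    ultimately show ?thesis by (simp add: X_def)
  qed
  define A where "A = 1 + (\<Sum>i<n. K * norm (c i) * norm (c i))"
  have A: "A \<ge> 1" unfolding A_def using K(1) by (simp add: sum_nonneg)
  have pr_bound: "norm (pr w) \<le> A * norm w" for w
  proof -
    have "norm (\<Sum>i<n. B w (c i) *\<^sub>R c i) \<le> (\<Sum>i<n. K * norm (c i) * norm (c i) * norm w)"
    proof (rule sum_norm_le)
      fix i
      have "\<bar>B w (c i)\<bar> * norm (c i) \<le> (norm w * norm (c i) * K) * norm (c i)"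
        using K(2)[of w "c i"] by (intro mult_right_mono) auto
      then show "norm (B w (c i) *\<^sub>R c i) \<le> K * norm (c i) * norm (c i) * norm w" by (simp add: mult_ac)
    qed
    also have "\<dots> = (\<Sum>i<n. K * norm (c i) * norm (c i)) * norm w" by (simp add: sum_distrib_right)
    finally have "norm (pr w) \<le> norm w + (\<Sum>i<n. K * norm (c i) * norm (c i)) * norm w"
      unfolding pr_def by (rule order_trans[OF norm_triangle_ineq add_left_mono])
    then show ?thesis by (simp add: A_def distrib_right)
  qed
  define M where "M = K * A\<^sup>2"
  have M: "M > 0" using K A by (simp add: M_def)
  have coer: "\<kappa>\<^sup>2 / M * (norm u)\<^sup>2 \<le> B u u" if u: "u \<in> X" for u
  proof -
    have uN: "u \<in> N" using u by (simp add: X_def)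
    define w where "w = L u"
    have wN: "w \<in> N" unfolding w_def by (rule L(1)[OF uN])
    define v where "v = pr w"
    have vX: "v \<in> X" unfolding v_def by (rule prX[OF wN])
    have Buv: "B u v = (norm w)\<^sup>2"
    proof -
      have "B u v = B u w + (\<Sum>i<n. B w (c i) * B u (c i))" unfolding v_def pr_def B.add_right B_sum ..
      also have "(\<Sum>i<n. B w (c i) * B u (c i)) = 0" by (rule sum.neutral) (use u in \<open>auto simp: X_def\<close>)
      also have "B u w = (norm w)\<^sup>2" using L(2)[OF uN wN] by (simp add: w_def power2_norm_eq_inner)
      finally show ?thesis by simp
    qed
    have Bvv: "B v v \<le> M * (norm w)\<^sup>2"
    proof -
      have "B v v \<le> norm v * norm v * K" using K(2)[of v v] by (simp add: abs_le_iff)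
      also have "\<dots> \<le> (A * norm w) * (A * norm w) * K"
        unfolding v_def using pr_bound[of w] A K by (intro mult_right_mono mult_mono) auto
      finally show ?thesis by (simp add: M_def power2_eq_square mult_ac)
    qed
    \<comment> \<open>Nonnegativity on \<open>X\<close> is applied to
      \<open>u - s *\<^sub>R v\<close>. Given \<open>B u v = (norm w)\<^sup>2\<close> and
      \<open>B v v \<le> M * (norm w)\<^sup>2\<close>, the choice \<open>s = 1 / M\<close> is the
      best one.\<close>
    have "u - (1 / M) *\<^sub>R v \<in> X"
      using u vX N by (auto simp: X_def subspace_diff subspace_scale B.diff_left B.scaleR_left)
    from nonneg[OF this] have "0 \<le> B u u - 2 * (1 / M) * B u v + (1 / M)\<^sup>2 * B v v"
      by (simp add: B.diff_left B.diff_right B.scaleR_left B.scaleR_right sym[of v u] power2_eq_square algebra_simps)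
    also have "\<dots> \<le> B u u - 2 * (1 / M) * (norm w)\<^sup>2 + (1 / M)\<^sup>2 * (M * (norm w)\<^sup>2)"
      unfolding Buv by (intro add_left_mono mult_left_mono Bvv) simp
    also have "\<dots> = B u u - (norm w)\<^sup>2 / M" using M by (simp add: power2_eq_square field_simps)
    finally have "(norm w)\<^sup>2 / M \<le> B u u" by simp
    moreover have "(\<kappa> * norm u)\<^sup>2 / M \<le> (norm w)\<^sup>2 / M"
      unfolding w_def using \<kappa>(1) M by (intro divide_right_mono power_mono \<kappa>(2)[OF uN]) auto
    ultimately show ?thesis by (simp add: power_mult_distrib)
  qed
  show ?thesis
  proof (rule that[of n c "\<kappa>\<^sup>2 / M"])
    show "n \<le> m" by (rule le[OF c])
    show "\<kappa>\<^sup>2 / M > 0" using \<kappa> M by simp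
  qed (use c coer in \<open>auto simp: sys_def X_def\<close>)
qed

section \<open>The partition and the quadratic form at infinity\<close>

definition clamp :: "real \<Rightarrow> real \<Rightarrow> real \<Rightarrow> real" where "clamp a b y = max a (min y b)"

lemma ac_clamp': "0 \<le> a \<Longrightarrow> a \<le> b \<Longrightarrow> b \<le> 1 \<Longrightarrow> ac (clamp a b) (indicator {a..b})"
  unfolding clamp_def[abs_def] by (rule ac_clamp)

lemma integral_cong_off_point:
  assumes "\<And>y. 0 < y \<Longrightarrow> y < 1 \<Longrightarrow> y \<noteq> b \<Longrightarrow> p y = q y" "bdd_meas p" "bdd_meas q"
  shows "(\<integral>y. p y \<partial>unit_ivl) = (\<integral>y. q y \<partial>unit_ivl)"
proof (rule integral_cong_AE)
  show "AE y in unit_ivl. p y = q y"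
    by (rule AE_mp[OF AE_unit_ivl_neq[of b]]) (use assms(1) in \<open>auto intro!: AE_I2\<close>)
qed (intro bdd_meas_measurable assms)+

text \<open>\<phi> solves the equation with second derivative \<open>- a * \<phi> t\<close>, value 0
  and slope 1 at 0: it is linear, trigonometric or hyperbolic according to the sign of
  \<open>a\<close>. It vanishes at \<open>l\<close> exactly if \<open>a\<close> is a Dirichlet
  eigenvalue of an interval of length \<open>l\<close>.\<close>

lemma local_fundamental_solution:
  assumes l: "l > 0" and nr: "\<And>k. k \<ge> 1 \<Longrightarrow> a \<noteq> (real k)\<^sup>2 * pi\<^sup>2 / l\<^sup>2"
  obtains \<phi> \<phi>' :: "real \<Rightarrow> real" where "\<And>t. (\<phi> has_real_derivative \<phi>' t) (at t)"
    "\<And>t. (\<phi>' has_real_derivative - a * \<phi> t) (at t)" "\<phi> 0 = 0"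
    "\<And>s t. \<phi> s * \<phi>' t + \<phi>' s * \<phi> t = \<phi> (s + t)" "\<phi> l \<noteq> 0"
proof -
  consider "a = 0" | "a > 0" | "a < 0" by linarith
  then show ?thesis
  proof cases
    case 1
    show ?thesis by (rule that[of "\<lambda>t. t" "\<lambda>_. 1"]) (use 1 l in auto)
  next
    case 2
    define \<omega> where "\<omega> = sqrt a"
    have w: "\<omega> > 0" "\<omega> * \<omega> = a" using 2 by (auto simp: \<omega>_def)
    have "sin (\<omega> * l) \<noteq> 0"
    proof
      assume "sin (\<omega> * l) = 0"
      then obtain i :: int where i: "\<omega> * l = of_int i * pi" by (auto simp: sin_zero_iff_int2)
      have "0 < of_int i * pi" using w l unfolding i[symmetric] by simp
      then have ip: "i \<ge> 1" by (simp add: zero_less_mult_iff)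
      have "real (nat i) = of_int i" using ip by simp
      then have "\<omega> = real (nat i) * pi / l" using i l by (simp add: field_simps)
      then have "a = (real (nat i))\<^sup>2 * pi\<^sup>2 / l\<^sup>2"
        using w(2) by (metis power2_eq_square power_divide power_mult_distrib)
      moreover have "1 \<le> nat i" using ip by linarith
      ultimately show False using nr by blast
    qed
    then show ?thesis
      by (intro that[of "\<lambda>t. sin (\<omega> * t) / \<omega>" "\<lambda>t. cos (\<omega> * t)"])
        (use w in \<open>auto intro!: derivative_eq_intros simp: sin_add field_simps\<close>)
  next
    case 3
    define \<omega> where "\<omega> = sqrt (- a)"
    have w: "\<omega> > 0" "a = - (\<omega> * \<omega>)" using 3 by (auto simp: \<omega>_def)
    have "sinh (\<omega> * l) \<noteq> 0" using w l by simp
    then show ?thesis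
      by (intro that[of "\<lambda>t. sinh (\<omega> * t) / \<omega>" "\<lambda>t. cosh (\<omega> * t)"])
        (use w in \<open>auto intro!: derivative_eq_intros simp: sinh_add field_simps\<close>)
  qed
qed

text \<open>Testing with Green's function \<open>v\<close> of \<open>- v'' - a v\<close> on \<open>[A, B]\<close> isolates the value at \<open>y0\<close>.\<close>

lemma green_test:
  assumes AB: "0 \<le> A" "A < y0" "y0 < B" "B \<le> 1"
    and \<phi>: "\<And>t. (\<phi> has_real_derivative \<phi>' t) (at t)" "\<And>t. (\<phi>' has_real_derivative - a * \<phi> t) (at t)"
      "\<phi> 0 = 0" "\<And>s t. \<phi> s * \<phi>' t + \<phi>' s * \<phi> t = \<phi> (s + t)"
    and u: "ev u A = 0" "ev u B = 0"
  obtains v where "\<And>y. y \<le> A \<or> B \<le> y \<Longrightarrow> ev v y = 0"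
    "u \<bullet> v - a * (\<integral>y. ev u y * ev v y \<partial>unit_ivl) = ev u y0 * \<phi> (B - A)"
proof -
  have c\<phi>: "continuous_on S \<phi>" "continuous_on S \<phi>'" for S
    using DERIV_isCont[OF \<phi>(1)] DERIV_isCont[OF \<phi>(2)] by (auto intro: continuous_at_imp_continuous_on)
  have c\<phi>2: "continuous_on UNIV (\<lambda>t. - a * \<phi> t)" by (intro continuous_intros c\<phi>)
  have acid: "ac (\<lambda>y. y) (\<lambda>_. 1)" by (rule ac_C1) auto
  have acl: "ac (\<lambda>y. y - A) (\<lambda>_. 1)" using ac_diff[OF acid ac_const[of A]] by simp
  have acr: "ac (\<lambda>y. B - y) (\<lambda>_. -1)" using ac_diff[OF ac_const[of B] acid] by simp
  have ac1: "ac (\<lambda>y. clamp A y0 y - A) (\<lambda>y. indicator {A..y0} y)"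
    using ac_diff[OF ac_clamp'[of A y0] ac_const[of A]] AB by simp
  have ac2: "ac (\<lambda>y. B - clamp y0 B y) (\<lambda>y. - indicator {y0..B} y)"
    using ac_diff[OF ac_const[of B] ac_clamp'[of y0 B]] AB by simp
  have bm: "bdd_meas (\<lambda>y. \<phi> (y - A))" "bdd_meas (\<lambda>y. \<phi> (B - y))" "bdd_meas (\<lambda>y. \<phi>' (y - A))" "bdd_meas (\<lambda>y. \<phi>' (B - y))"
    by (intro bdd_meas_continuous continuous_on_compose2[OF c\<phi>(1)[of UNIV]] continuous_on_compose2[OF c\<phi>(2)[of UNIV]] continuous_intros; simp)+
  \<comment> \<open>Up to a factor this is Green's function: \<phi> measured from the left end times
    \<phi> measured from the right end. Clamping turns the two branches, which meet at
    \<open>y0\<close>, into one formula and extends it by 0, since \<phi> vanishes at 0.\<close>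
  define V where "V y = \<phi> (clamp A y0 y - A) * \<phi> (B - clamp y0 B y)" for y
  define V' where "V' y = (\<phi>' (clamp A y0 y - A) * indicator {A..y0} y) * \<phi> (B - clamp y0 B y)
    + \<phi> (clamp A y0 y - A) * (\<phi>' (B - clamp y0 B y) * - indicator {y0..B} y)" for y
  have acV: "ac V V'"
    unfolding V_def[abs_def] V'_def[abs_def]
    by (intro ac_mult ac_compI[OF ac1 \<phi>(1) c\<phi>(2)] ac_compI[OF ac2 \<phi>(1) c\<phi>(2)])
  have V0: "V y = 0" if "y \<le> A \<or> B \<le> y" for y
    using that AB \<phi>(3) by (auto simp: V_def clamp_def)
  have ev: "ev (mk V) y = (if y \<in> {0..1} then V y else 0)" for y
    by (rule ev_mk[OF acV]) (use V0 AB in auto)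
  have acmk: "ac (ev (mk V)) V'" by (rule ac_ev_mk[OF acV]) (use V0 AB in auto)
  let ?a = "\<phi> (B - y0)" and ?b = "\<phi> (y0 - A)"
  have uv: "u \<bullet> mk V = ?a * itv (\<lambda>y. D u y * \<phi>' (y - A)) A y0 - ?b * itv (\<lambda>y. D u y * \<phi>' (B - y)) y0 B"
  proof -
    have "u \<bullet> mk V = (\<integral>y. D u y * V' y \<partial>unit_ivl)" by (rule inner_eq[OF ac_D acmk])
    also have "\<dots> = (\<integral>y. ?a * (indicator {A..y0} y * (D u y * \<phi>' (y - A))) - ?b * (indicator {y0..B} y * (D u y * \<phi>' (B - y))) \<partial>unit_ivl)"
    proof (rule integral_cong_off_point[of y0])
      fix y :: real assume "0 < y" "y < 1" "y \<noteq> y0"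
      then show "D u y * V' y = ?a * (indicator {A..y0} y * (D u y * \<phi>' (y - A))) - ?b * (indicator {y0..B} y * (D u y * \<phi>' (B - y)))"
        using AB by (auto simp: V'_def clamp_def indicator_def)
    qed (intro bdd_meas_intros bm bdd_meas_D acD(1)[OF acV]; simp)+
    also have "\<dots> = ?a * itv (\<lambda>y. D u y * \<phi>' (y - A)) A y0 - ?b * itv (\<lambda>y. D u y * \<phi>' (B - y)) y0 B"
      unfolding itv_def
      using itv_integrable[OF bdd_meas_mult[OF bdd_meas_D[of u] bm(3)], of A y0]
        itv_integrable[OF bdd_meas_mult[OF bdd_meas_D[of u] bm(4)], of y0 B] by simp
    finally show ?thesis .
  qed
  have uV: "(\<integral>y. ev u y * ev (mk V) y \<partial>unit_ivl) = ?a * itv (\<lambda>y. ev u y * \<phi> (y - A)) A y0 + ?b * itv (\<lambda>y. ev u y * \<phi> (B - y)) y0 B"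
  proof -
    have "(\<integral>y. ev u y * ev (mk V) y \<partial>unit_ivl)
      = (\<integral>y. ?a * (indicator {A..y0} y * (ev u y * \<phi> (y - A))) + ?b * (indicator {y0..B} y * (ev u y * \<phi> (B - y))) \<partial>unit_ivl)"
    proof (rule integral_cong_off_point[of y0])
      fix y :: real assume "0 < y" "y < 1" "y \<noteq> y0"
      then show "ev u y * ev (mk V) y = ?a * (indicator {A..y0} y * (ev u y * \<phi> (y - A))) + ?b * (indicator {y0..B} y * (ev u y * \<phi> (B - y)))"
        using AB \<phi>(3) by (auto simp: ev V_def clamp_def indicator_def)
    qed (intro bdd_meas_intros bm bdd_meas_ev; simp)+
    also have "\<dots> = ?a * itv (\<lambda>y. ev u y * \<phi> (y - A)) A y0 + ?b * itv (\<lambda>y. ev u y * \<phi> (B - y)) y0 B"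
      unfolding itv_def
      using itv_integrable[OF bdd_meas_mult[OF bdd_meas_ev[of u] bm(1)], of A y0]
        itv_integrable[OF bdd_meas_mult[OF bdd_meas_ev[of u] bm(2)], of y0 B] by simp
    finally show ?thesis .
  qed
  have L: "itv (\<lambda>y. D u y * \<phi>' (y - A)) A y0 = ev u y0 * \<phi>' (y0 - A) + a * itv (\<lambda>y. ev u y * \<phi> (y - A)) A y0"
  proof -
    have "ac (\<lambda>y. ev u y * \<phi>' (y - A)) (\<lambda>y. D u y * \<phi>' (y - A) + ev u y * (- a * \<phi> (y - A) * 1))"
      by (intro ac_mult ac_D ac_compI[OF acl \<phi>(2) c\<phi>2])
    from acD(2)[OF this, of A y0] have "ev u y0 * \<phi>' (y0 - A) = itv (\<lambda>y. D u y * \<phi>' (y - A) + (- a) * (ev u y * \<phi> (y - A))) A y0"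
      using AB u by (simp add: algebra_simps)
    also have "\<dots> = itv (\<lambda>y. D u y * \<phi>' (y - A)) A y0 + (- a) * itv (\<lambda>y. ev u y * \<phi> (y - A)) A y0"
      by (subst itv_add) (intro bdd_meas_intros bm bdd_meas_D bdd_meas_ev, intro bdd_meas_intros bm bdd_meas_D bdd_meas_ev, simp only: itv_cmult)
    finally show ?thesis by simp
  qed
  have R: "itv (\<lambda>y. D u y * \<phi>' (B - y)) y0 B = - ev u y0 * \<phi>' (B - y0) - a * itv (\<lambda>y. ev u y * \<phi> (B - y)) y0 B"
  proof -
    have "ac (\<lambda>y. ev u y * \<phi>' (B - y)) (\<lambda>y. D u y * \<phi>' (B - y) + ev u y * (- a * \<phi> (B - y) * -1))"
      by (intro ac_mult ac_D ac_compI[OF acr \<phi>(2) c\<phi>2])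
    from acD(2)[OF this, of y0 B] have "- ev u y0 * \<phi>' (B - y0) = itv (\<lambda>y. D u y * \<phi>' (B - y) + a * (ev u y * \<phi> (B - y))) y0 B"
      using AB u by (simp add: algebra_simps)
    also have "\<dots> = itv (\<lambda>y. D u y * \<phi>' (B - y)) y0 B + a * itv (\<lambda>y. ev u y * \<phi> (B - y)) y0 B"
      by (subst itv_add) (intro bdd_meas_intros bm bdd_meas_D bdd_meas_ev, intro bdd_meas_intros bm bdd_meas_D bdd_meas_ev, simp only: itv_cmult)
    finally show ?thesis by simp
  qed
  have "u \<bullet> mk V - a * (\<integral>y. ev u y * ev (mk V) y \<partial>unit_ivl) = ev u y0 * (?b * \<phi>' (B - y0) + \<phi>' (y0 - A) * ?a)"
    unfolding uv uV L R by (simp add: algebra_simps)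
  \<comment> \<open>The jump of the derivative at \<open>y0\<close> is a Wronskian, and the addition
    formula evaluates it.\<close>
  also have "?b * \<phi>' (B - y0) + \<phi>' (y0 - A) * ?a = \<phi> (B - A)" using \<phi>(4)[of "y0 - A" "B - y0"] by simp
  finally show ?thesis
    by (intro that[of "mk V"]) (auto simp: ev V0)
qed

text \<open>The first Dirichlet eigenfunction of \<open>[A, B]\<close>, extended by 0. Sine and
  cosine have equal square integrals on \<open>[A, B]\<close>, since their product vanishes at both
  ends and has a multiple of the difference of squares as derivative; this yields the Rayleigh
  quotient.\<close>

lemma sine_test:
  assumes AB: "0 \<le> A" "A < B" "B \<le> 1"
  obtains v where "\<And>y. y \<le> A \<or> B \<le> y \<Longrightarrow> ev v y = 0"
    "v \<bullet> v = (pi / (B - A))\<^sup>2 * (\<integral>y. (ev v y)\<^sup>2 \<partial>unit_ivl)" "(\<integral>y. (ev v y)\<^sup>2 \<partial>unit_ivl) > 0"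
proof -
  define \<theta> where "\<theta> = pi / (B - A)"
  have \<theta>: "\<theta> * (B - A) = pi" using AB by (simp add: \<theta>_def)
  let ?i = "indicator {A..B} :: real \<Rightarrow> real"
  have ac1: "ac (\<lambda>y. \<theta> * (clamp A B y - A)) (\<lambda>y. \<theta> * ?i y)"
    using ac_cmult[OF ac_diff[OF ac_clamp'[of A B] ac_const[of A]], of \<theta>] AB by simp
  define S where "S y = sin (\<theta> * (clamp A B y - A))" for y
  define C where "C y = cos (\<theta> * (clamp A B y - A))" for y
  have acS: "ac S (\<lambda>y. C y * (\<theta> * ?i y))"
    unfolding S_def[abs_def] C_def[abs_def]
    by (rule ac_compI[OF ac1]) (auto intro!: derivative_eq_intros continuous_intros)
  have acC: "ac C (\<lambda>y. - S y * (\<theta> * ?i y))"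
    unfolding S_def[abs_def] C_def[abs_def]
    by (rule ac_compI[OF ac1, of cos "\<lambda>t. - sin t"]) (auto intro!: derivative_eq_intros continuous_intros)
  have S0: "S y = 0" if "y \<le> A \<or> B \<le> y" for y
    using that AB \<theta> by (auto simp: S_def clamp_def max_def min_def)
  have bS: "bdd_meas S" and bC: "bdd_meas C"
    by (intro bdd_meas_continuous ac_continuous[OF acS] ac_continuous[OF acC])+
  have SC: "(S y)\<^sup>2 + (C y)\<^sup>2 = 1" for y by (simp add: S_def C_def)
  have bI: "bdd_meas (\<lambda>y. ?i y * (C y)\<^sup>2)" "bdd_meas (\<lambda>y. ?i y * (S y)\<^sup>2)"
    unfolding power2_eq_square by (intro bdd_meas_intros bS bC; simp)+
  let ?s = "\<integral>y. ?i y * (S y)\<^sup>2 \<partial>unit_ivl" and ?c = "\<integral>y. ?i y * (C y)\<^sup>2 \<partial>unit_ivl"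
  have eq: "?c = ?s"
  proof -
    have "(\<integral>y. \<theta> * (?i y * (C y)\<^sup>2 - ?i y * (S y)\<^sup>2) \<partial>unit_ivl) = 0"
      using ac_integral[OF ac_mult[OF acS acC]] S0[of 0] S0[of 1] AB
      by (simp add: power2_eq_square algebra_simps)
    then have "\<theta> * (?c - ?s) = 0"
      using bdd_meas_integrable[OF bI(1)] bdd_meas_integrable[OF bI(2)] by simp
    then show ?thesis using \<theta> by auto
  qed
  have "?s + ?c = B - A"
  proof -
    have "?s + ?c = (\<integral>y. ?i y * (S y)\<^sup>2 + ?i y * (C y)\<^sup>2 \<partial>unit_ivl)"
      using bdd_meas_integrable[OF bI(1)] bdd_meas_integrable[OF bI(2)] by simp
    also have "\<dots> = itv (\<lambda>_. 1) A B" unfolding itv_def distrib_left[symmetric] SC ..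
    finally show ?thesis using itv_const[of A B 1] AB by simp
  qed
  then have pos: "?s > 0" using eq AB by simp
  have ev: "ev (mk S) y = (if y \<in> {0..1} then S y else 0)" for y
    by (rule ev_mk[OF acS]) (use S0 AB in auto)
  have acmk: "ac (ev (mk S)) (\<lambda>y. C y * (\<theta> * ?i y))" by (rule ac_ev_mk[OF acS]) (use S0 AB in auto)
  have int: "(\<integral>y. (ev (mk S) y)\<^sup>2 \<partial>unit_ivl) = ?s"
  proof (rule Bochner_Integration.integral_cong)
    fix y assume "y \<in> space unit_ivl"
    then show "(ev (mk S) y)\<^sup>2 = ?i y * (S y)\<^sup>2"
      by (cases "y \<le> A \<or> B \<le> y") (auto simp: ev S0)
  qed simp
  have "mk S \<bullet> mk S = (\<integral>y. \<theta>\<^sup>2 * (?i y * (C y)\<^sup>2) \<partial>unit_ivl)"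
    unfolding inner_eq[OF acmk acmk]
    by (rule Bochner_Integration.integral_cong) (auto simp: indicator_def power2_eq_square)
  then have "mk S \<bullet> mk S = \<theta>\<^sup>2 * ?s" using eq by simp
  then show ?thesis by (intro that[of "mk S"]) (use S0 pos int in \<open>auto simp: ev \<theta>_def\<close>)
qed

section \<open>Hat functions and the orthogonal splitting at the nodes\<close>

locale nodes =
  fixes m :: nat and x :: "nat \<Rightarrow> real"
  assumes part: "is_partition m x"
begin

lemma x_0 [simp]: "x 0 = 0" and x_last [simp]: "x (Suc m) = 1" and x_step: "j \<le> m \<Longrightarrow> x j < x (Suc j)"
  using part by (auto simp: is_partition_def)

lemma x_less: assumes "i < j" "j \<le> Suc m" shows "x i < x j"
  using assms
proof (induction j)
  case (Suc j)
  then have "x j < x (Suc j)" by (intro x_step) simp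
  then show ?case using Suc by (cases "i = j") auto
qed simp

lemma x_le: "i \<le> j \<Longrightarrow> j \<le> Suc m \<Longrightarrow> x i \<le> x j"
  using x_less[of i j] by (cases "i = j") auto

lemma x_bounds: "i \<le> Suc m \<Longrightarrow> 0 \<le> x i" "i \<le> Suc m \<Longrightarrow> x i \<le> 1"
  using x_le[of 0 i] x_le[of i "Suc m"] by auto

text \<open>The difference of two normalized ramps: it rises from 0 to 1 between
  \<open>x (j - 1)\<close> and \<open>x j\<close> and falls back to 0 at
  \<open>x (Suc j)\<close>.\<close>

definition hatf :: "nat \<Rightarrow> real \<Rightarrow> real"
  where "hatf j y = (1 / (x j - x (j - 1))) * (clamp (x (j - 1)) (x j) y - x (j - 1))
    - (1 / (x (Suc j) - x j)) * (clamp (x j) (x (Suc j)) y - x j)"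

definition hat :: "nat \<Rightarrow> pcf" where "hat j = mk (hatf j)"

lemma hat_facts:
  assumes j: "j \<in> {1..m}"
  shows "ac (ev (hat j)) (\<lambda>y. (1 / (x j - x (j - 1))) * indicator {x (j - 1)..x j} y - (1 / (x (Suc j) - x j)) * indicator {x j..x (Suc j)} y)"
    "\<And>y. ev (hat j) y = (if y \<in> {0..1} then hatf j y else 0)"
    "\<And>i. i \<le> Suc m \<Longrightarrow> ev (hat j) (x i) = (if i = j then 1 else 0)"
proof -
  have l: "x (j - 1) < x j" "x j < x (Suc j)" using x_less[of "j - 1" j] x_less[of j "Suc j"] j by auto
  have b: "0 \<le> x (j - 1)" "x (Suc j) \<le> 1" using x_bounds[of "j - 1"] x_bounds[of "Suc j"] j by auto
  have c1: "ac (\<lambda>y. clamp (x (j - 1)) (x j) y - x (j - 1)) (indicator {x (j - 1)..x j})"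
    using ac_diff[OF ac_clamp'[of "x (j - 1)" "x j"] ac_const[of "x (j - 1)"]] l b by simp
  have c2: "ac (\<lambda>y. clamp (x j) (x (Suc j)) y - x j) (indicator {x j..x (Suc j)})"
    using ac_diff[OF ac_clamp'[of "x j" "x (Suc j)"] ac_const[of "x j"]] l b by simp
  have a: "ac (hatf j) (\<lambda>y. (1 / (x j - x (j - 1))) * indicator {x (j - 1)..x j} y - (1 / (x (Suc j) - x j)) * indicator {x j..x (Suc j)} y)"
    unfolding hatf_def[abs_def] by (intro ac_diff ac_cmult c1 c2)
  have z: "hatf j y = (if y \<le> x (j - 1) then 0 else if y = x j then 1 else if x (Suc j) \<le> y then 0 else hatf j y)" for y
    using l by (auto simp: hatf_def clamp_def)
  have e: "hatf j 0 = 0" "hatf j 1 = 0" using z[of 0] z[of 1] b l by auto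
  show "ac (ev (hat j)) (\<lambda>y. (1 / (x j - x (j - 1))) * indicator {x (j - 1)..x j} y - (1 / (x (Suc j) - x j)) * indicator {x j..x (Suc j)} y)"
    unfolding hat_def by (rule ac_ev_mk[OF a e])
  show ev: "ev (hat j) y = (if y \<in> {0..1} then hatf j y else 0)" for y
    unfolding hat_def by (rule ev_mk[OF a e])
  show "ev (hat j) (x i) = (if i = j then 1 else 0)" if i: "i \<le> Suc m" for i
  proof -
    consider "i \<le> j - 1" "i \<noteq> j" | "i = j" | "Suc j \<le> i" using j by force
    then have "hatf j (x i) = (if i = j then 1 else 0)"
    proof cases
      case 1 then show ?thesis using z[of "x i"] x_le[of i "j - 1"] j by auto
    next
      case 2 then show ?thesis using z[of "x i"] l by auto
    next
      case 3 then show ?thesis using z[of "x i"] x_le[of "Suc j" i] i l by auto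
    qed
    then show ?thesis using ev x_bounds[OF i] by auto
  qed
qed

text \<open>The derivative of a hat is a step function, so the inner product is a difference of two
  mean slopes of \<open>v\<close> and depends on nodal values only. This is why hats are orthogonal
  to \<open>N\<close>.\<close>

lemma inner_hat:
  assumes j: "j \<in> {1..m}"
  shows "hat j \<bullet> v = (1 / (x j - x (j - 1))) * (ev v (x j) - ev v (x (j - 1))) - (1 / (x (Suc j) - x j)) * (ev v (x (Suc j)) - ev v (x j))"
proof -
  have l: "x (j - 1) < x j" "x j < x (Suc j)" using x_less[of "j - 1" j] x_less[of j "Suc j"] j by auto
  have b: "0 \<le> x (j - 1)" "x (Suc j) \<le> 1" using x_bounds[of "j - 1"] x_bounds[of "Suc j"] j by auto
  have "hat j \<bullet> v = (\<integral>y. (1 / (x j - x (j - 1))) * (indicator {x (j - 1)..x j} y * D v y) - (1 / (x (Suc j) - x j)) * (indicator {x j..x (Suc j)} y * D v y) \<partial>unit_ivl)"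
    unfolding inner_eq[OF hat_facts(1)[OF j] ac_D] by (simp add: left_diff_distrib mult.assoc)
  also have "\<dots> = (1 / (x j - x (j - 1))) * itv (D v) (x (j - 1)) (x j) - (1 / (x (Suc j) - x j)) * itv (D v) (x j) (x (Suc j))"
    unfolding itv_def using itv_integrable[OF bdd_meas_D[of v]] by simp
  finally show ?thesis
    using acD(2)[OF ac_D, of "x (j - 1)" "x j" v] acD(2)[OF ac_D, of "x j" "x (Suc j)" v] l b by simp
qed

text \<open>Nodal interpolation is the orthogonal projection onto the span of the hats, and
  \<open>P\<close> below is the one onto \<open>N\<close>.\<close>

definition interp :: "pcf \<Rightarrow> pcf" where "interp u = (\<Sum>j=1..m. ev u (x j) *\<^sub>R hat j)"
definition N :: "pcf set" where "N = {u. \<forall>j\<in>{1..m}. ev u (x j) = 0}"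
definition P :: "pcf \<Rightarrow> pcf" where "P u = u - interp u"

lemma N_nodes: "u \<in> N \<Longrightarrow> i \<le> Suc m \<Longrightarrow> ev u (x i) = 0"
  by (cases "i = 0"; cases "i = Suc m") (auto simp: N_def)

lemma subspace_N: "subspace N" by (auto simp: subspace_def N_def)

lemma ev_interp: assumes "i \<in> {1..m}" shows "ev (interp u) (x i) = ev u (x i)"
proof -
  have "ev (interp u) (x i) = (\<Sum>j=1..m. if j = i then ev u (x j) else 0)"
    unfolding interp_def ev_sum ev_scaleR
    by (intro sum.cong) (use assms in \<open>auto simp: hat_facts(3)\<close>)
  then show ?thesis using assms by simp
qed

lemma P_in_N: "P u \<in> N" by (auto simp: P_def N_def ev_interp)

lemma bounded_linear_interp: "bounded_linear interp"
  unfolding interp_def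
  by (intro bounded_linear_sum bounded_linear_compose[OF bounded_linear_scaleR_left bounded_linear_ev])

lemma bounded_linear_P: "bounded_linear P"
  unfolding P_def by (intro bounded_linear_sub bounded_linear_ident bounded_linear_interp)

lemma hat_orthogonal_N: "j \<in> {1..m} \<Longrightarrow> v \<in> N \<Longrightarrow> hat j \<bullet> v = 0"
  using N_nodes[of v j] N_nodes[of v "j - 1"] N_nodes[of v "Suc j"] by (auto simp: inner_hat)

lemma interp_orthogonal_N: "v \<in> N \<Longrightarrow> interp u \<bullet> v = 0"
  unfolding interp_def inner_sum_left by (intro sum.neutral) (auto simp: hat_orthogonal_N)

lemma P_inner: "v \<in> N \<Longrightarrow> P u \<bullet> v = u \<bullet> v"
  by (simp add: P_def inner_diff_left interp_orthogonal_N)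

lemma P_N: "u \<in> N \<Longrightarrow> P u = u"
  by (simp add: P_def interp_def N_def)

lemma locate:
  assumes "0 < y" "y < 1"
  obtains j where "j \<in> {1..m+1}" "x (j - 1) \<le> y" "y \<le> x j"
proof -
  define j where "j = (LEAST j. y \<le> x j)"
  have "y \<le> x (Suc m)" using assms by simp
  then have j: "y \<le> x j" "j \<le> Suc m" unfolding j_def by (rule LeastI, rule Least_le)
  have "j \<noteq> 0" using j assms by (intro notI) simp
  then have "\<not> y \<le> x (j - 1)" unfolding j_def by (intro not_less_Least) simp
  then show ?thesis using that[of j] j \<open>j \<noteq> 0\<close> by auto
qed

section \<open>The asymptotic linear part on functions vanishing at the nodes\<close>

definition \<alpha> :: "(nat \<Rightarrow> real) \<Rightarrow> real \<Rightarrow> real"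
  where "\<alpha> a y = (\<Sum>j=1..m+1. a j * indicator {x (j - 1)<..<x j} y)"

lemma bdd_meas_\<alpha>: "bdd_meas (\<alpha> a)"
  unfolding \<alpha>_def[abs_def] by (intro bdd_meas_sum bdd_meas_cmult bdd_meas_indicator) auto

lemma \<alpha>_eq:
  assumes j: "j \<in> {1..m+1}" and y: "x (j - 1) < y" "y < x j"
  shows "\<alpha> a y = a j"
proof -
  have "indicator {x (i - 1)<..<x i} y = (if i = j then 1 else (0::real))" if i: "i \<in> {1..m+1}" for i
  proof (cases "i = j")
    case False
    then consider "i \<le> j - 1" | "j \<le> i - 1" using i j by force
    then show ?thesis
    proof cases
      case 1
      moreover have "j - 1 \<le> Suc m" using j by auto
      ultimately show ?thesis using x_le[of i "j - 1"] y False by (auto simp: indicator_def)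
    next
      case 2
      moreover have "i - 1 \<le> Suc m" using i by auto
      ultimately show ?thesis using x_le[of j "i - 1"] y False by (auto simp: indicator_def)
    qed
  qed (use y in auto)
  then have "\<alpha> a y = (\<Sum>i=1..m+1. if i = j then a i else 0)"
    unfolding \<alpha>_def by (intro sum.cong) auto
  then show ?thesis using j by simp
qed

lemma \<alpha>_integral:
  assumes j: "j \<in> {1..m+1}" and v: "\<And>y. y \<le> x (j - 1) \<or> x j \<le> y \<Longrightarrow> w y = 0"
  shows "(\<integral>y. \<alpha> a y * w y \<partial>unit_ivl) = a j * (\<integral>y. w y \<partial>unit_ivl)"
proof -
  have "(\<integral>y. \<alpha> a y * w y \<partial>unit_ivl) = (\<integral>y. a j * w y \<partial>unit_ivl)"
  proof (rule Bochner_Integration.integral_cong)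
    show "\<alpha> a y * w y = a j * w y" for y
      by (cases "y \<le> x (j - 1) \<or> x j \<le> y") (use v \<alpha>_eq[OF j] in auto)
  qed simp
  then show ?thesis by simp
qed

lemma supported_in_N:
  assumes "j \<in> {1..m+1}" "\<And>y. y \<le> x (j - 1) \<or> x j \<le> y \<Longrightarrow> ev v y = 0"
  shows "v \<in> N"
  unfolding N_def
proof (intro CollectI ballI)
  fix i assume "i \<in> {1..m}"
  then have "x i \<le> x (j - 1) \<or> x j \<le> x i" using assms(1) x_le[of i "j - 1"] x_le[of j i] by (cases "i < j") auto
  then show "ev v (x i) = 0" by (rule assms(2))
qed

text \<open>Each value is tested separately: the function from \<open>green_test\<close> for the
  interval around \<open>y0\<close> leaves \<open>ev u y0\<close> times the value of \<phi> at the
  interval length, and that factor is nonzero because \<open>a j\<close> is not an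
  eigenvalue.\<close>

theorem nonresonant_trivial:
  assumes nr: "\<And>j. j \<in> {1..m+1} \<Longrightarrow> a j \<notin> {eigenval x j k |k. k \<ge> 1}"
    and u: "u \<in> N" and eq: "\<And>v. v \<in> N \<Longrightarrow> u \<bullet> v = (\<integral>y. \<alpha> a y * (ev u y * ev v y) \<partial>unit_ivl)"
  shows "u = 0"
proof (rule pcf_eqI)
  fix y0 :: real assume y0: "0 < y0" "y0 < 1"
  obtain j where j: "j \<in> {1..m+1}" "x (j - 1) \<le> y0" "y0 \<le> x j" using locate[OF y0] .
  have ends: "ev u (x (j - 1)) = 0" "ev u (x j) = 0" using N_nodes[OF u] j by auto
  have "ev u y0 = 0"
  proof (cases "y0 = x (j - 1) \<or> y0 = x j")
    case True then show ?thesis using ends by auto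
  next
    case False
    then have yy: "x (j - 1) < y0" "y0 < x j" using j by auto
    have l: "x j - x (j - 1) > 0" using yy by simp
    have "a j \<noteq> (real k)\<^sup>2 * pi\<^sup>2 / (x j - x (j - 1))\<^sup>2" if "k \<ge> 1" for k
      using nr[OF j(1)] that by (auto simp: eigenval_def)
    from local_fundamental_solution[OF l this]
    obtain \<phi> \<phi>' where \<phi>: "\<And>t. (\<phi> has_real_derivative \<phi>' t) (at t)"
      "\<And>t. (\<phi>' has_real_derivative - a j * \<phi> t) (at t)" "\<phi> 0 = 0"
      "\<And>s t. \<phi> s * \<phi>' t + \<phi>' s * \<phi> t = \<phi> (s + t)" "\<phi> (x j - x (j - 1)) \<noteq> 0" by metis
    have b: "0 \<le> x (j - 1)" "x j \<le> 1" using x_bounds[of "j - 1"] x_bounds[of j] j by auto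
    obtain v where v: "\<And>y. y \<le> x (j - 1) \<or> x j \<le> y \<Longrightarrow> ev v y = 0"
      "u \<bullet> v - a j * (\<integral>y. ev u y * ev v y \<partial>unit_ivl) = ev u y0 * \<phi> (x j - x (j - 1))"
      by (rule green_test[OF b(1) yy b(2) \<phi>(1-4) ends]) (rule that, assumption+)
    have "u \<bullet> v = a j * (\<integral>y. ev u y * ev v y \<partial>unit_ivl)"
    proof -
      have "v \<in> N" by (rule supported_in_N[OF j(1) v(1)])
      then have "u \<bullet> v = (\<integral>y. \<alpha> a y * (ev u y * ev v y) \<partial>unit_ivl)" by (rule eq)
      also have "\<dots> = a j * (\<integral>y. ev u y * ev v y \<partial>unit_ivl)"
        by (rule \<alpha>_integral[OF j(1)]) (simp add: v(1))
      finally show ?thesis .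
    qed
    then show ?thesis using v(2) \<phi>(5) by simp
  qed
  then show "ev u y0 = ev 0 y0" by simp
qed

text \<open>On the first eigenfunction of the interval, extended by 0, the form is
  \<open>eigenval x j 1 - a j\<close> times the square integral.\<close>

lemma supercritical_negative:
  assumes j: "j \<in> {1..m+1}" and a: "a j > eigenval x j 1"
  obtains v where "v \<in> N" "v \<bullet> v - (\<integral>y. \<alpha> a y * (ev v y * ev v y) \<partial>unit_ivl) < 0"
proof -
  have l: "x (j - 1) < x j" using x_less[of "j - 1" j] j by auto
  have b: "0 \<le> x (j - 1)" "x j \<le> 1" using x_bounds[of "j - 1"] x_bounds[of j] j by auto
  obtain v where v: "\<And>y. y \<le> x (j - 1) \<or> x j \<le> y \<Longrightarrow> ev v y = 0"
    "v \<bullet> v = (pi / (x j - x (j - 1)))\<^sup>2 * (\<integral>y. (ev v y)\<^sup>2 \<partial>unit_ivl)" "(\<integral>y. (ev v y)\<^sup>2 \<partial>unit_ivl) > 0"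
    by (rule sine_test[OF b(1) l b(2)]) (rule that, assumption+)
  have "(\<integral>y. \<alpha> a y * (ev v y * ev v y) \<partial>unit_ivl) = a j * (\<integral>y. ev v y * ev v y \<partial>unit_ivl)"
    by (rule \<alpha>_integral[OF j]) (simp add: v(1))
  then have "v \<bullet> v - (\<integral>y. \<alpha> a y * (ev v y * ev v y) \<partial>unit_ivl) = (eigenval x j 1 - a j) * (\<integral>y. (ev v y)\<^sup>2 \<partial>unit_ivl)"
    unfolding v(2) by (simp add: eigenval_def power2_eq_square power_divide algebra_simps)
  also have "\<dots> < 0" using a v(3) by (intro mult_neg_pos) auto
  finally show ?thesis using that[OF supported_in_N[OF j v(1)]] by simp
qed

end

section \<open>Existence of a nontrivial critical point\<close>

lemma sum_lessThan_add: "(\<Sum>i<m + k. h i) = (\<Sum>i<m. h i) + (\<Sum>i<k. h (m + i :: nat))" for h :: "nat \<Rightarrow> 'a::ab_group_add"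
  by (induction k) (auto simp: add.assoc)

lemma norm_sum_scaleR_square_le:
  fixes e :: "'i \<Rightarrow> 'h::real_inner"
  shows "(norm (\<Sum>i\<in>I. \<gamma> i *\<^sub>R e i))\<^sup>2 \<le> (\<Sum>i\<in>I. (norm (e i))\<^sup>2) * (\<Sum>i\<in>I. (\<gamma> i)\<^sup>2)"
proof -
  have "norm (\<Sum>i\<in>I. \<gamma> i *\<^sub>R e i) \<le> (\<Sum>i\<in>I. \<bar>\<gamma> i\<bar> * norm (e i))"
    by (rule order_trans[OF norm_sum]) simp
  also have "\<dots> \<le> L2_set (\<lambda>i. \<gamma> i) I * L2_set (\<lambda>i. norm (e i)) I"
    using L2_set_mult_ineq[of \<gamma> "\<lambda>i. norm (e i)" I] by simp
  finally have "(norm (\<Sum>i\<in>I. \<gamma> i *\<^sub>R e i))\<^sup>2 \<le> (L2_set (\<lambda>i. \<gamma> i) I * L2_set (\<lambda>i. norm (e i)) I)\<^sup>2"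
    by (intro power_mono) auto
  then show ?thesis by (simp add: L2_set_def power_mult_distrib sum_nonneg mult.commute)
qed

lemma prim_minus_linear:
  assumes c: "continuous_on UNIV \<phi>"
  shows "prim (\<lambda>s. \<phi> s - b * s) t = prim \<phi> t - b * t\<^sup>2 / 2"
proof -
  have c': "continuous_on UNIV (\<lambda>s. \<phi> s - b * s)" by (intro continuous_intros c)
  let ?d = "\<lambda>t. prim (\<lambda>s. \<phi> s - b * s) t - (prim \<phi> t - b * t\<^sup>2 / 2)"
  have "(?d has_real_derivative 0) (at t)" for t
    by (auto intro!: derivative_eq_intros prim_deriv[OF c] prim_deriv[OF c'])
  then have "?d t = ?d 0" by (intro DERIV_isconst_all) auto
  then show ?thesis by simp
qed

text \<open>The hypotheses in the form in which the variational argument uses them: the nonlinearity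
  minus its linear part grows more slowly than any linear function, \<open>t * \<iota> j t\<close>
  exceeds every multiple of \<open>t\<^sup>2\<close> up to a constant, and first-order expansions
  hold at 0. \<open>f_zero\<close> is required for every \<open>y\<close>, the exceptional null set
  having been removed beforehand.\<close>

locale impulse = nodes +
  fixes f :: "real \<Rightarrow> real \<Rightarrow> real" and a b :: "nat \<Rightarrow> real" and \<iota> :: "nat \<Rightarrow> real \<Rightarrow> real"
  assumes cb: "caratheodory_bdd f"
    and f_inf: "\<And>\<epsilon>. \<epsilon> > 0 \<Longrightarrow> \<exists>C. AE y in unit_ivl. \<forall>t. \<bar>f y t - \<alpha> a y * t\<bar> \<le> \<epsilon> * \<bar>t\<bar> + C"
    and f_zero: "\<And>\<epsilon>. \<epsilon> > 0 \<Longrightarrow> \<exists>\<delta>>0. \<forall>y t. \<bar>t\<bar> \<le> \<delta> \<longrightarrow> \<bar>f y t\<bar> \<le> \<epsilon> * \<bar>t\<bar>"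
    and \<iota>_cont: "\<And>j. j \<in> {1..m} \<Longrightarrow> continuous_on UNIV (\<iota> j)"
    and \<iota>_inf: "\<And>K j. j \<in> {1..m} \<Longrightarrow> \<exists>C. \<forall>t. K * t\<^sup>2 - C \<le> t * \<iota> j t"
    and \<iota>_zero: "\<And>\<epsilon> j. j \<in> {1..m} \<Longrightarrow> \<epsilon> > 0 \<Longrightarrow> \<exists>\<delta>>0. \<forall>t. \<bar>t\<bar> \<le> \<delta> \<longrightarrow> \<bar>\<iota> j t - b j * t\<bar> \<le> \<epsilon> * \<bar>t\<bar>"
begin

definition gr :: "nat \<Rightarrow> pcf" where "gr j = mk (green (x j))"

lemma inner_gr: "j \<in> {1..m} \<Longrightarrow> gr j \<bullet> u = ev u (x j)"
  unfolding gr_def by (rule inner_green) (use x_bounds[of j] in auto)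

text \<open>The Riesz representative of the right-hand side of the weak equation, so that solutions
  are fixed points and the gradient of \<open>E\<close> is the identity minus
  \<open>K\<close>.\<close>

definition K :: "(real \<Rightarrow> real) \<Rightarrow> pcf"
  where "K w = T (\<lambda>y. f y (w y)) + (\<Sum>j=1..m. \<iota> j (w (x j)) *\<^sub>R gr j)"

definition E :: "pcf \<Rightarrow> real"
  where "E u = (u \<bullet> u) / 2 - (\<integral>y. prim (f y) (ev u y) \<partial>unit_ivl) - (\<Sum>j=1..m. prim (\<iota> j) (ev u (x j)))"

lemma x_in: "j \<in> {1..m} \<Longrightarrow> x j \<in> {0..1}" using x_bounds[of j] by auto

lemma seq_cont_K: "seq_cont K"
  unfolding K_def
  by (intro seq_cont_add seq_cont_sum seq_cont_superposition cb seq_cont_eval \<iota>_cont x_in) auto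

lemma E_deriv: "(E has_derivative (\<lambda>v. (u - K (ev u)) \<bullet> v)) (at u)"
proof -
  have d: "((\<lambda>u. prim (\<iota> j) (ev u (x j))) has_derivative (\<lambda>v. \<iota> j (ev u (x j)) * ev v (x j))) (at u)"
    if j: "j \<in> {1..m}" for j
  proof -
    have "(prim (\<iota> j) has_derivative (\<lambda>h. \<iota> j (ev u (x j)) * h)) (at (ev u (x j)))"
      using prim_deriv[OF \<iota>_cont[OF j]] by (simp add: has_field_derivative_def)
    from has_derivative_compose[OF bounded_linear_imp_has_derivative[OF bounded_linear_ev[of "x j"]] this]
    show ?thesis .
  qed
  have "(E has_derivative (\<lambda>v. (u \<bullet> v + v \<bullet> u) / 2 - T (\<lambda>y. f y (ev u y)) \<bullet> v - (\<Sum>j=1..m. \<iota> j (ev u (x j)) * ev v (x j)))) (at u)"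
    unfolding E_def
    by (intro has_derivative_diff has_derivative_sum d prim_superposition_deriv[OF cb]) (auto intro!: derivative_eq_intros)
  then show ?thesis
  proof (rule has_derivative_eq_rhs, intro ext)
    fix v
    have "K (ev u) \<bullet> v = T (\<lambda>y. f y (ev u y)) \<bullet> v + (\<Sum>j=1..m. \<iota> j (ev u (x j)) * ev v (x j))"
      by (simp add: K_def inner_add_left inner_sum_left inner_gr)
    then show "(u \<bullet> v + v \<bullet> u) / 2 - T (\<lambda>y. f y (ev u y)) \<bullet> v - (\<Sum>j=1..m. \<iota> j (ev u (x j)) * ev v (x j)) = (u - K (ev u)) \<bullet> v"
      by (simp add: inner_diff_left inner_commute[of v u])
  qed
qed

text \<open>The quadratic form at infinity without the impulses. It is defined on the whole space
  but governs the energy on \<open>N\<close> only; off \<open>N\<close> the impulses dominate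
  it.\<close>

definition B\<^sub>i :: "pcf \<Rightarrow> pcf \<Rightarrow> real"
  where "B\<^sub>i u v = u \<bullet> v - (\<integral>y. \<alpha> a y * (ev u y * ev v y) \<partial>unit_ivl)"

lemma bdd_meas_\<alpha>_ev: "bdd_meas (\<lambda>y. \<alpha> a y * ev u y)"
  by (intro bdd_meas_mult bdd_meas_\<alpha> bdd_meas_ev)

lemma B_eq: "B\<^sub>i u v = (u - T (\<lambda>y. \<alpha> a y * ev u y)) \<bullet> v"
  by (simp add: B\<^sub>i_def inner_diff_left inner_T[OF bdd_meas_\<alpha>_ev] mult.assoc)

lemma B_sym: "B\<^sub>i u v = B\<^sub>i v u"
  by (simp add: B\<^sub>i_def inner_commute mult.commute[of "ev u _"])

lemma T_\<alpha>_add: "T (\<lambda>y. \<alpha> a y * ev (u + v) y) = T (\<lambda>y. \<alpha> a y * ev u y) + T (\<lambda>y. \<alpha> a y * ev v y)"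
  using T_add[OF bdd_meas_\<alpha>_ev bdd_meas_\<alpha>_ev, of u v] by (simp add: distrib_left)

lemma T_\<alpha>_scaleR: "T (\<lambda>y. \<alpha> a y * ev (r *\<^sub>R u) y) = r *\<^sub>R T (\<lambda>y. \<alpha> a y * ev u y)"
  using T_cmult[OF bdd_meas_\<alpha>_ev, of r u] by (simp add: mult.left_commute)

lemma \<alpha>_bound: obtains A where "A > 0" "\<And>y. 0 < y \<Longrightarrow> y < 1 \<Longrightarrow> \<bar>\<alpha> a y\<bar> \<le> A"
  by (rule bdd_measE[OF bdd_meas_\<alpha>]) (rule that, assumption+)

lemma integral_abs_le:
  assumes p: "bdd_meas p" and b: "AE y in unit_ivl. \<bar>p y\<bar> \<le> C"
  shows "\<bar>\<integral>y. p y \<partial>unit_ivl\<bar> \<le> C"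
proof -
  have "(\<integral>y. p y \<partial>unit_ivl) \<le> (\<integral>y. C \<partial>unit_ivl)" "(\<integral>y. - C \<partial>unit_ivl) \<le> (\<integral>y. p y \<partial>unit_ivl)"
    by (intro integral_mono_AE bdd_meas_integrable p bdd_meas_const; use b in eventually_elim; simp add: abs_le_iff)+
  moreover have one: "(\<integral>y. C \<partial>unit_ivl) = C" for C :: real using itv_const[of 0 1 C] unfolding itv_0_1 by simp
  ultimately show ?thesis unfolding abs_le_iff one by linarith
qed

lemma bounded_bilinear_B: "bounded_bilinear B\<^sub>i"
proof
  show "B\<^sub>i (u + u') v = B\<^sub>i u v + B\<^sub>i u' v" for u u' v
    unfolding B_eq T_\<alpha>_add by (simp add: inner_diff_left inner_add_left)
  then show "B\<^sub>i u (v + v') = B\<^sub>i u v + B\<^sub>i u v'" for u v v' by (simp add: B_sym[of u])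
  show "B\<^sub>i (r *\<^sub>R u) v = r *\<^sub>R B\<^sub>i u v" for r u v
    unfolding B_eq T_\<alpha>_scaleR by (simp add: inner_diff_left algebra_simps)
  then show "B\<^sub>i u (r *\<^sub>R v) = r *\<^sub>R B\<^sub>i u v" for r u v by (simp add: B_sym[of u])
  obtain A where A: "A > 0" "\<And>y. 0 < y \<Longrightarrow> y < 1 \<Longrightarrow> \<bar>\<alpha> a y\<bar> \<le> A" by (rule \<alpha>_bound) (rule that, assumption+)
  show "\<exists>C. \<forall>u v. norm (B\<^sub>i u v) \<le> norm u * norm v * C"
  proof (intro exI[of _ "1 + A"] allI)
    fix u v
    have "\<bar>\<integral>y. \<alpha> a y * (ev u y * ev v y) \<partial>unit_ivl\<bar> \<le> A * (norm u * norm v)"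
    proof (rule integral_abs_le)
      show "AE y in unit_ivl. \<bar>\<alpha> a y * (ev u y * ev v y)\<bar> \<le> A * (norm u * norm v)"
        unfolding abs_mult using A by (intro AE_I2 mult_mono ev_bound) auto
    qed (intro bdd_meas_mult bdd_meas_\<alpha> bdd_meas_ev)
    then have "\<bar>B\<^sub>i u v\<bar> \<le> norm u * norm v + A * (norm u * norm v)"
      using Cauchy_Schwarz_ineq2[of u v] by (simp add: B\<^sub>i_def abs_le_iff)
    then show "norm (B\<^sub>i u v) \<le> norm u * norm v * (1 + A)" by (simp add: algebra_simps)
  qed
qed

definition B\<^sub>0 :: "pcf \<Rightarrow> pcf \<Rightarrow> real"
  where "B\<^sub>0 u v = u \<bullet> v - (\<Sum>j=1..m. b j * ev u (x j) * ev v (x j))"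

lemma B0_eq: "B\<^sub>0 u v = (u - (\<Sum>j=1..m. (b j * ev u (x j)) *\<^sub>R gr j)) \<bullet> v"
  by (simp add: B\<^sub>0_def inner_diff_left inner_sum_left inner_gr)

lemma B0_sym: "B\<^sub>0 u v = B\<^sub>0 v u"
  by (simp add: B\<^sub>0_def inner_commute mult.assoc mult.commute[of "ev u _"])

lemma bounded_bilinear_B0: "bounded_bilinear B\<^sub>0"
proof
  show 1: "B\<^sub>0 (u + u') v = B\<^sub>0 u v + B\<^sub>0 u' v" for u u' v
    by (simp add: B\<^sub>0_def inner_add_left algebra_simps sum.distrib)
  then show "B\<^sub>0 u (v + v') = B\<^sub>0 u v + B\<^sub>0 u v'" for u v v' by (simp add: B0_sym[of u])
  show "B\<^sub>0 (r *\<^sub>R u) v = r *\<^sub>R B\<^sub>0 u v" for r u v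
    by (simp add: B\<^sub>0_def right_diff_distrib sum_distrib_left mult_ac)
  then show "B\<^sub>0 u (r *\<^sub>R v) = r *\<^sub>R B\<^sub>0 u v" for r u v by (simp add: B0_sym[of u])
  show "\<exists>C. \<forall>u v. norm (B\<^sub>0 u v) \<le> norm u * norm v * C"
  proof (intro exI[of _ "1 + (\<Sum>j=1..m. \<bar>b j\<bar>)"] allI)
    fix u v
    have "\<bar>\<Sum>j=1..m. b j * ev u (x j) * ev v (x j)\<bar> \<le> (\<Sum>j=1..m. \<bar>b j\<bar> * norm u * norm v)"
      by (rule order_trans[OF sum_abs]) (auto simp: abs_mult intro!: sum_mono mult_mono ev_bound)
    also have "\<dots> = (norm u * norm v) * (\<Sum>j=1..m. \<bar>b j\<bar>)" by (simp add: sum_distrib_left mult_ac)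
    finally show "norm (B\<^sub>0 u v) \<le> norm u * norm v * (1 + (\<Sum>j=1..m. \<bar>b j\<bar>))"
      using Cauchy_Schwarz_ineq2[of u v] by (simp add: B\<^sub>0_def abs_le_iff distrib_left)
  qed
qed

lemma linear_ev: "linear (\<lambda>u. ev u y)"
  by (rule bounded_linear.linear[OF bounded_linear_ev])

lemma homogeneous_lower_bound:
  fixes L :: "pcf \<Rightarrow> pcf"
  assumes hom: "\<And>r u. L (r *\<^sub>R u) = r *\<^sub>R L u" and b: "\<And>u. u \<in> M \<Longrightarrow> norm u = 1 \<Longrightarrow> \<gamma> \<le> norm (L u)" and M: "subspace M"
    and u: "u \<in> M"
  shows "\<gamma> * norm u \<le> norm (L u)"
proof (cases "u = 0")
  case True then show ?thesis using hom[of 0 u] by simp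
next
  case False
  have "\<gamma> \<le> norm (L (inverse (norm u) *\<^sub>R u))" by (rule b) (use False u M in \<open>auto simp: subspace_scale\<close>)
  also have "\<dots> = inverse (norm u) * norm (L u)" by (simp add: hom)
  finally show ?thesis using False by (simp add: field_simps)
qed

text \<open>Where all nodal values vanish, \<open>B\<^sub>0\<close> is the inner product, so the
  \<open>m\<close> evaluations at the nodes bound the number of negative directions. The lower bound
  for \<open>L\<close> comes from compactness on the unit sphere, as \<open>K0\<close> is linear
  with 0 as its only fixed point.\<close>

lemma signature_at_zero:
  assumes nr: "\<And>u. u = (\<Sum>j=1..m. (b j * ev u (x j)) *\<^sub>R gr j) \<Longrightarrow> u = 0"
  obtains n c \<kappa> where "n \<le> m"
    "\<And>i j. i < n \<Longrightarrow> j < n \<Longrightarrow> B\<^sub>0 (c i) (c j) = (if i = j then -1 else 0)"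
    "\<kappa> > 0" "\<And>u. \<forall>i<n. B\<^sub>0 u (c i) = 0 \<Longrightarrow> \<kappa> * (norm u)\<^sup>2 \<le> B\<^sub>0 u u"
proof -
  define K0 where "K0 w = (\<Sum>j=1..m. (b j * w (x j)) *\<^sub>R gr j)" for w
  have sK: "seq_cont K0" unfolding K0_def
    by (intro seq_cont_sum seq_cont_eval[where \<phi>="\<lambda>t. b _ * t"] x_in continuous_intros) auto
  obtain \<gamma> where \<gamma>: "\<gamma> > 0" "\<And>u. 1 \<le> norm u \<Longrightarrow> norm u \<le> 1 \<Longrightarrow> \<gamma> \<le> norm (u - K0 (ev u))"
  proof (rule gradient_bounded_below[OF sK, of 1 1])
    show "u \<noteq> K0 (ev u)" if "1 \<le> norm u" for u using nr[of u] that by (auto simp: K0_def)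
  qed (rule that, assumption+)
  define L where "L u = u - K0 (ev u)" for u
  have hom: "L (r *\<^sub>R u) = r *\<^sub>R L u" for r u
    by (simp add: L_def K0_def scaleR_right_diff_distrib scaleR_sum_right mult_ac)
  show ?thesis
  proof (rule maximal_negative_system[OF bounded_bilinear_B0 B0_sym subspace_UNIV, of L \<gamma> "\<lambda>j u. ev u (x (Suc j))" m])
    show "B\<^sub>0 u v = L u \<bullet> v" for u v by (simp add: B0_eq L_def K0_def)
    show "\<gamma> * norm u \<le> norm (L u)" for u
      by (rule homogeneous_lower_bound[OF hom _ subspace_UNIV]) (use \<gamma> in \<open>auto simp: L_def\<close>)
    show "0 \<le> B\<^sub>0 u u" if "\<And>j. j < m \<Longrightarrow> ev u (x (Suc j)) = 0" for u
    proof -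
      have "ev u (x j) = 0" if "j \<in> {1..m}" for j using that \<open>\<And>j. j < m \<Longrightarrow> ev u (x (Suc j)) = 0\<close>[of "j - 1"] by auto
      then show ?thesis by (simp add: B\<^sub>0_def)
    qed
    fix n c \<kappa>'
    assume "n \<le> m" "\<And>i j. i < n \<Longrightarrow> j < n \<Longrightarrow> B\<^sub>0 (c i) (c j) = (if i = j then - 1 else 0)" "0 < \<kappa>'"
      "\<And>u. u \<in> UNIV \<Longrightarrow> \<forall>i<n. B\<^sub>0 u (c i) = 0 \<Longrightarrow> \<kappa>' * (norm u)\<^sup>2 \<le> B\<^sub>0 u u"
    then show thesis by (intro that[of n c \<kappa>']) auto
  qed (use \<gamma> linear_ev in auto)
qed

text \<open>Projecting the representative of the form to \<open>N\<close> gives \<open>L\<close>,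
  which nonresonance makes injective and compactness bounds from below. Evaluation at
  \<open>q\<close> grid points bounds the number of negative directions: a function vanishing there
  has values at most \<open>norm u / sqrt (real q)\<close>, so the inner product dominates once
  \<open>q > A\<close>.\<close>

lemma signature_at_infinity:
  assumes nr: "\<And>j. j \<in> {1..m+1} \<Longrightarrow> a j \<notin> {eigenval x j k |k. k \<ge> 1}"
  obtains k :: nat and e :: "nat \<Rightarrow> pcf" and \<kappa> :: real where "\<And>i. i < k \<Longrightarrow> e i \<in> N"
    "\<And>i j. i < k \<Longrightarrow> j < k \<Longrightarrow> B\<^sub>i (e i) (e j) = (if i = j then -1 else 0)"
    "\<kappa> > 0" "\<And>u. u \<in> N \<Longrightarrow> \<forall>i<k. B\<^sub>i u (e i) = 0 \<Longrightarrow> \<kappa> * (norm u)\<^sup>2 \<le> B\<^sub>i u u"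
proof -
  obtain A where A: "A > 0" "\<And>y. 0 < y \<Longrightarrow> y < 1 \<Longrightarrow> \<bar>\<alpha> a y\<bar> \<le> A" by (rule \<alpha>_bound) (rule that, assumption+)
  \<comment> \<open>Cut off outside (0, 1), because \<open>A\<close> is a bound on that interval
    while \<open>caratheodory_bdd\<close> asks for one at every \<open>y\<close>.\<close>
  define \<alpha>0 where "\<alpha>0 y t = (if 0 < y \<and> y < 1 then \<alpha> a y * t else 0)" for y t
  have c0: "caratheodory_bdd \<alpha>0"
    unfolding caratheodory_bdd_def
  proof (intro conjI allI)
    show "(\<lambda>y. \<alpha>0 y t) \<in> borel_measurable unit_ivl" for t
    proof -
      have "(\<lambda>y. \<alpha> a y * t) \<in> borel_measurable unit_ivl" using bdd_meas_measurable[OF bdd_meas_\<alpha>] by simp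
      then show ?thesis by (subst measurable_cong[where g="\<lambda>y. \<alpha> a y * t"]) (auto simp: \<alpha>0_def)
    qed
    show "continuous_on UNIV (\<alpha>0 y)" for y
      unfolding \<alpha>0_def by (cases "0 < y"; cases "y < 1") (simp_all add: continuous_intros)
    show "\<exists>C. \<forall>y t. \<bar>t\<bar> \<le> B \<longrightarrow> \<bar>\<alpha>0 y t\<bar> \<le> C" for B
    proof (intro exI[of _ "A * \<bar>B\<bar>"] allI impI)
      fix y t :: real assume "\<bar>t\<bar> \<le> B"
      then show "\<bar>\<alpha>0 y t\<bar> \<le> A * \<bar>B\<bar>"
        using A by (auto simp: \<alpha>0_def abs_mult intro!: mult_mono)
    qed
  qed
  have T0: "T (\<lambda>y. \<alpha>0 y (w y)) = T (\<lambda>y. \<alpha> a y * w y)" if w: "bdd_meas (\<lambda>y. \<alpha> a y * w y)" for w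
  proof (rule pcf_inner_eqI)
    have eq: "\<alpha>0 y (w y) = \<alpha> a y * w y" if "0 < y" "y < 1" for y using that by (simp add: \<alpha>0_def)
    have bm: "bdd_meas (\<lambda>y. \<alpha>0 y (w y))"
      using w eq measurable_cong[of unit_ivl "\<lambda>y. \<alpha>0 y (w y)" "\<lambda>y. \<alpha> a y * w y" borel] by (auto simp: bdd_meas_def)
    show "T (\<lambda>y. \<alpha>0 y (w y)) \<bullet> v = T (\<lambda>y. \<alpha> a y * w y) \<bullet> v" for v
      unfolding inner_T[OF bm] inner_T[OF w]
      by (intro Bochner_Integration.integral_cong) (auto simp: eq)
  qed
  define K1 where "K1 w = P (T (\<lambda>y. \<alpha>0 y (w y)))" for w
  have K1_ev: "K1 (ev u) = P (T (\<lambda>y. \<alpha> a y * ev u y))" for u unfolding K1_def by (simp add: T0[OF bdd_meas_\<alpha>_ev])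
  have sK: "seq_cont K1" unfolding K1_def by (rule seq_cont_linear[OF bounded_linear_P seq_cont_superposition[OF c0]])
  interpret P: bounded_linear P by (rule bounded_linear_P)
  obtain \<gamma> where \<gamma>: "\<gamma> > 0" "\<And>u. 1 \<le> norm u \<Longrightarrow> norm u \<le> 1 \<Longrightarrow> \<gamma> \<le> norm (u - K1 (ev u))"
  proof (rule gradient_bounded_below[OF sK, of 1 1])
    show "u \<noteq> K1 (ev u)" if "1 \<le> norm u" for u
    proof
      assume e: "u = K1 (ev u)"
      then have uN: "u \<in> N" unfolding K1_def using P_in_N by metis
      have "u \<bullet> v = (\<integral>y. \<alpha> a y * (ev u y * ev v y) \<partial>unit_ivl)" if "v \<in> N" for v
      proof -
        have "u \<bullet> v = P (T (\<lambda>y. \<alpha> a y * ev u y)) \<bullet> v" using e K1_ev by simp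
        then show ?thesis using P_inner[OF that] inner_T[OF bdd_meas_\<alpha>_ev] by (simp add: mult.assoc)
      qed
      then have "u = 0" by (intro nonresonant_trivial[of a]) (use nr uN in auto)
      then show False using that by simp
    qed
  qed (rule that, assumption+)
  define L where "L u = P (u - T (\<lambda>y. \<alpha> a y * ev u y))" for u
  have hom: "L (r *\<^sub>R u) = r *\<^sub>R L u" for r u
    unfolding L_def T_\<alpha>_scaleR by (simp add: P.scaleR flip: scaleR_right_diff_distrib)
  obtain q :: nat where q: "A < real q" using reals_Archimedean2 by blast
  have q0: "q > 0" using q A by (intro gr0I) auto
  show ?thesis
  proof (rule maximal_negative_system[OF bounded_bilinear_B B_sym subspace_N, of L \<gamma> "\<lambda>j u. ev u (real j / real q)" q])
    show "L u \<in> N" for u unfolding L_def by (rule P_in_N)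
    show "B\<^sub>i u v = L u \<bullet> v" if "v \<in> N" for u v unfolding L_def P_inner[OF that] by (rule B_eq)
    show "\<gamma> * norm u \<le> norm (L u)" if "u \<in> N" for u
    proof (rule homogeneous_lower_bound[OF hom _ subspace_N that])
      fix u assume "u \<in> N" "norm u = 1"
      then show "\<gamma> \<le> norm (L u)" using \<gamma>(2)[of u] by (simp add: L_def P.diff K1_ev P_N)
    qed
    show "0 \<le> B\<^sub>i u u" if z: "\<And>j. j < q \<Longrightarrow> ev u (real j / real q) = 0" for u
    proof -
      have s: "(ev u y)\<^sup>2 \<le> (norm u)\<^sup>2 / real q" if y: "0 < y" "y < 1" for y
      proof -
        define j where "j = nat \<lfloor>y * real q\<rfloor>"
        have "0 \<le> y * real q" using y q0 by simp
        then have j: "real j \<le> y * real q" "y * real q < real j + 1" unfolding j_def by linarith+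
        have "y * real q < real q" using y q0 by simp
        then have jq: "j < q" using j by linarith
        have d: "\<bar>y - real j / real q\<bar> \<le> 1 / real q" 
        proof -
          have "y - real j / real q = (y * real q - real j) / real q" using q0 by (simp add: field_simps)
          moreover have "\<bar>y * real q - real j\<bar> \<le> 1" using j by linarith
          ultimately show ?thesis using q0 by (simp add: abs_divide divide_right_mono)
        qed
        have "\<bar>ev u y - ev u (real j / real q)\<bar> \<le> norm u * sqrt \<bar>y - real j / real q\<bar>"
          by (rule ev_holder) (use y jq in auto)
        also have "\<dots> \<le> norm u * sqrt (1 / real q)" using d by (intro mult_left_mono) auto
        finally have "\<bar>ev u y\<bar>\<^sup>2 \<le> (norm u * sqrt (1 / real q))\<^sup>2" using z[OF jq] by (intro power_mono) auto
        then show ?thesis by (simp add: power_mult_distrib)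
      qed
      have "\<bar>\<integral>y. \<alpha> a y * (ev u y * ev u y) \<partial>unit_ivl\<bar> \<le> A * ((norm u)\<^sup>2 / real q)"
      proof (rule integral_abs_le)
        show "AE y in unit_ivl. \<bar>\<alpha> a y * (ev u y * ev u y)\<bar> \<le> A * ((norm u)\<^sup>2 / real q)"
          unfolding abs_mult using A s by (intro AE_I2 mult_mono) (auto simp: power2_eq_square)
      qed (intro bdd_meas_mult bdd_meas_\<alpha> bdd_meas_ev)
      also have "\<dots> \<le> (norm u)\<^sup>2"
      proof -
        have "A * (norm u)\<^sup>2 \<le> real q * (norm u)\<^sup>2" using q by (intro mult_right_mono) auto
        then show ?thesis using q0 by (simp add: field_simps)
      qed
      finally show ?thesis by (simp add: B\<^sub>i_def power2_norm_eq_inner[symmetric] abs_le_iff)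
    qed
    fix k :: nat and e \<kappa>'
    assume "\<And>i. i < k \<Longrightarrow> e i \<in> N" "\<And>i j. i < k \<Longrightarrow> j < k \<Longrightarrow> B\<^sub>i (e i) (e j) = (if i = j then - 1 else 0)" "0 < \<kappa>'"
      "\<And>u. u \<in> N \<Longrightarrow> \<forall>i<k. B\<^sub>i u (e i) = 0 \<Longrightarrow> \<kappa>' * (norm u)\<^sup>2 \<le> B\<^sub>i u u"
    then show thesis by (intro that[of k e \<kappa>']) auto
  qed (use \<gamma> linear_ev in auto)
qed

lemma E_near_zero:
  assumes \<eta>: "\<eta> > 0"
  obtains \<delta> where "\<delta> > 0" "\<And>u. norm u \<le> \<delta> \<Longrightarrow> \<bar>E u - B\<^sub>0 u u / 2\<bar> \<le> \<eta> * (norm u)\<^sup>2"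
proof -
  \<comment> \<open>One share of the error for the nonlinearity and one for each of the
    \<open>m\<close> impulses.\<close>
  define \<epsilon> where "\<epsilon> = \<eta> / (1 + real m)"
  have \<epsilon>: "\<epsilon> > 0" "\<epsilon> * (1 + real m) = \<eta>" using \<eta> by (auto simp: \<epsilon>_def)
  obtain \<delta>f where \<delta>f: "\<delta>f > 0" "\<And>y t. \<bar>t\<bar> \<le> \<delta>f \<Longrightarrow> \<bar>f y t\<bar> \<le> \<epsilon> * \<bar>t\<bar>" using f_zero[OF \<epsilon>(1)] by auto
  have "\<exists>\<delta>>0. \<forall>t. \<bar>t\<bar> \<le> \<delta> \<longrightarrow> \<bar>\<iota> j t - b j * t\<bar> \<le> \<epsilon> * \<bar>t\<bar>" if "j \<in> {1..m}" for j
    by (rule \<iota>_zero[OF that \<epsilon>(1)])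
  then obtain \<Delta> where \<Delta>: "\<And>j. j \<in> {1..m} \<Longrightarrow> \<Delta> j > 0"
    "\<And>j t. j \<in> {1..m} \<Longrightarrow> \<bar>t\<bar> \<le> \<Delta> j \<Longrightarrow> \<bar>\<iota> j t - b j * t\<bar> \<le> \<epsilon> * \<bar>t\<bar>" by metis
  define \<delta> where "\<delta> = Min (insert \<delta>f (\<Delta> ` {1..m}))"
  have \<delta>0: "\<delta> > 0" unfolding \<delta>_def using \<delta>f(1) \<Delta>(1) by auto
  have \<delta>le: "\<delta> \<le> \<delta>f" "\<And>j. j \<in> {1..m} \<Longrightarrow> \<delta> \<le> \<Delta> j" unfolding \<delta>_def by (intro Min_le; simp)+
  have "\<bar>E u - B\<^sub>0 u u / 2\<bar> \<le> \<eta> * (norm u)\<^sup>2" if u: "norm u \<le> \<delta>" for u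
  proof -
    have ub: "\<bar>ev u y\<bar> \<le> \<delta>" for y using ev_bound[of u y] u by linarith
    have sq: "\<epsilon> * \<bar>ev u y\<bar> * \<bar>ev u y\<bar> \<le> \<epsilon> * (norm u)\<^sup>2" for y
      using mult_mono[OF ev_bound[of u y] ev_bound[of u y]] \<epsilon> by (simp add: power2_eq_square)
    have 1: "\<bar>\<integral>y. prim (f y) (ev u y) \<partial>unit_ivl\<bar> \<le> \<epsilon> * (norm u)\<^sup>2"
    proof (rule integral_abs_le[OF bdd_meas_prim_superposition[OF cb] AE_I2])
      fix y
      have "\<bar>prim (f y) (ev u y)\<bar> \<le> (\<epsilon> * \<bar>ev u y\<bar>) * \<bar>ev u y\<bar>"
      proof (rule prim_bound[OF caratheodory_bddD(2)[OF cb]])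
        fix s assume s: "\<bar>s\<bar> \<le> \<bar>ev u y\<bar>"
        then have "\<bar>f y s\<bar> \<le> \<epsilon> * \<bar>s\<bar>" using ub[of y] \<delta>le(1) by (intro \<delta>f(2)) linarith
        also have "\<dots> \<le> \<epsilon> * \<bar>ev u y\<bar>" using s \<epsilon> by (intro mult_left_mono) auto
        finally show "\<bar>f y s\<bar> \<le> \<epsilon> * \<bar>ev u y\<bar>" .
      qed
      then show "\<bar>prim (f y) (ev u y)\<bar> \<le> \<epsilon> * (norm u)\<^sup>2" using sq[of y] by linarith
    qed
    have 2: "\<bar>prim (\<iota> j) (ev u (x j)) - b j * (ev u (x j))\<^sup>2 / 2\<bar> \<le> \<epsilon> * (norm u)\<^sup>2" if j: "j \<in> {1..m}" for j
    proof -
      have "\<bar>prim (\<lambda>s. \<iota> j s - b j * s) (ev u (x j))\<bar> \<le> (\<epsilon> * \<bar>ev u (x j)\<bar>) * \<bar>ev u (x j)\<bar>"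
      proof (rule prim_bound)
        show "continuous_on UNIV (\<lambda>s. \<iota> j s - b j * s)" by (intro continuous_intros \<iota>_cont j)
        fix s assume s: "\<bar>s\<bar> \<le> \<bar>ev u (x j)\<bar>"
        then have "\<bar>\<iota> j s - b j * s\<bar> \<le> \<epsilon> * \<bar>s\<bar>" using ub[of "x j"] \<delta>le(2)[OF j] by (intro \<Delta>(2)[OF j]) linarith
        also have "\<dots> \<le> \<epsilon> * \<bar>ev u (x j)\<bar>" using s \<epsilon> by (intro mult_left_mono) auto
        finally show "\<bar>\<iota> j s - b j * s\<bar> \<le> \<epsilon> * \<bar>ev u (x j)\<bar>" .
      qed
      then show ?thesis using sq[of "x j"] by (simp add: prim_minus_linear[OF \<iota>_cont[OF j]])
    qed
    let ?I = "\<integral>y. prim (f y) (ev u y) \<partial>unit_ivl"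
    let ?J = "\<Sum>j=1..m. prim (\<iota> j) (ev u (x j)) - b j * (ev u (x j))\<^sup>2 / 2"
    have "E u - B\<^sub>0 u u / 2 = - ?I - ?J"
      by (simp add: E_def B\<^sub>0_def sum_subtractf sum_divide_distrib diff_divide_distrib power2_eq_square mult.assoc)
    then have "\<bar>E u - B\<^sub>0 u u / 2\<bar> \<le> \<bar>?I\<bar> + \<bar>?J\<bar>" by linarith
    moreover have "\<bar>?J\<bar> \<le> real m * (\<epsilon> * (norm u)\<^sup>2)"
    proof -
      have "\<bar>?J\<bar> \<le> (\<Sum>j=1..m. \<bar>prim (\<iota> j) (ev u (x j)) - b j * (ev u (x j))\<^sup>2 / 2\<bar>)" by (rule sum_abs)
      also have "\<dots> \<le> (\<Sum>j=1..m. \<epsilon> * (norm u)\<^sup>2)" by (rule sum_mono) (rule 2)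
      finally show ?thesis by simp
    qed
    moreover have "\<epsilon> * (norm u)\<^sup>2 + real m * (\<epsilon> * (norm u)\<^sup>2) = \<eta> * (norm u)\<^sup>2"
      unfolding \<epsilon>(2)[symmetric] by (simp add: algebra_simps)
    ultimately show ?thesis using 1 by linarith
  qed
  then show ?thesis using that \<delta>0 by blast
qed

lemma f_part_estimate:
  assumes \<epsilon>: "\<epsilon> > 0"
  obtains C where "C \<ge> 0"
    "\<And>u h. \<bar>T (\<lambda>y. f y (ev u y)) \<bullet> h - (\<integral>y. \<alpha> a y * (ev u y * ev h y) \<partial>unit_ivl)\<bar> \<le> (\<epsilon> * norm u + C) * norm h"
proof -
  obtain C0 where C0: "AE y in unit_ivl. \<forall>t. \<bar>f y t - \<alpha> a y * t\<bar> \<le> \<epsilon> * \<bar>t\<bar> + C0" using f_inf[OF \<epsilon>] by blast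
  have "\<bar>T (\<lambda>y. f y (ev u y)) \<bullet> h - (\<integral>y. \<alpha> a y * (ev u y * ev h y) \<partial>unit_ivl)\<bar> \<le> (\<epsilon> * norm u + \<bar>C0\<bar>) * norm h" for u h
  proof -
    have bf: "bdd_meas (\<lambda>y. f y (ev u y))" by (rule bdd_meas_superposition[OF cb ev_continuous])
    have b1: "bdd_meas (\<lambda>y. f y (ev u y) * ev h y)" by (intro bdd_meas_mult bf bdd_meas_ev)
    have b2: "bdd_meas (\<lambda>y. \<alpha> a y * (ev u y * ev h y))" by (intro bdd_meas_mult bdd_meas_\<alpha> bdd_meas_ev)
    have "T (\<lambda>y. f y (ev u y)) \<bullet> h - (\<integral>y. \<alpha> a y * (ev u y * ev h y) \<partial>unit_ivl)
      = (\<integral>y. f y (ev u y) * ev h y - \<alpha> a y * (ev u y * ev h y) \<partial>unit_ivl)"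
      unfolding inner_T[OF bf] using bdd_meas_integrable[OF b1] bdd_meas_integrable[OF b2] by simp
    also have "\<bar>\<dots>\<bar> \<le> (\<epsilon> * norm u + \<bar>C0\<bar>) * norm h"
    proof (rule integral_abs_le[OF bdd_meas_diff[OF b1 b2]])
      show "AE y in unit_ivl. \<bar>f y (ev u y) * ev h y - \<alpha> a y * (ev u y * ev h y)\<bar> \<le> (\<epsilon> * norm u + \<bar>C0\<bar>) * norm h"
        using C0
      proof eventually_elim
        fix y assume y: "\<forall>t. \<bar>f y t - \<alpha> a y * t\<bar> \<le> \<epsilon> * \<bar>t\<bar> + C0"
        have "f y (ev u y) * ev h y - \<alpha> a y * (ev u y * ev h y) = (f y (ev u y) - \<alpha> a y * ev u y) * ev h y"
          by (simp add: algebra_simps)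
        also have "\<bar>\<dots>\<bar> \<le> (\<epsilon> * norm u + \<bar>C0\<bar>) * norm h"
          unfolding abs_mult
        proof (rule mult_mono[OF _ ev_bound])
          have "\<epsilon> * \<bar>ev u y\<bar> \<le> \<epsilon> * norm u" using \<epsilon> ev_bound by (intro mult_left_mono) auto
          then show "\<bar>f y (ev u y) - \<alpha> a y * ev u y\<bar> \<le> \<epsilon> * norm u + \<bar>C0\<bar>" using y[rule_format, of "ev u y"] by linarith
        qed (use \<epsilon> in auto)
        finally show "\<bar>f y (ev u y) * ev h y - \<alpha> a y * (ev u y * ev h y)\<bar> \<le> (\<epsilon> * norm u + \<bar>C0\<bar>) * norm h" .
      qed
    qed
    finally show ?thesis .
  qed
  then show ?thesis using that[of "\<bar>C0\<bar>"] by simp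
qed

text \<open>The superlinear impulses act like \<open>K * (u (x j))\<^sup>2\<close> with \<open>K\<close> as large as required; they make the
  whole complement of \<open>N\<close> a negative direction at infinity.\<close>

lemma gradient_at_infinity:
  fixes k :: nat and e :: "nat \<Rightarrow> pcf"
  assumes e: "\<And>i. i < k \<Longrightarrow> e i \<in> N"
    "\<And>i j. i < k \<Longrightarrow> j < k \<Longrightarrow> B\<^sub>i (e i) (e j) = (if i = j then -1 else 0)"
    and \<kappa>1: "\<kappa>1 > 0" "\<And>u. u \<in> N \<Longrightarrow> \<forall>i<k. B\<^sub>i u (e i) = 0 \<Longrightarrow> \<kappa>1 * (norm u)\<^sup>2 \<le> B\<^sub>i u u"
  obtains R where "R > 0"
    "\<And>u. R \<le> norm u \<Longrightarrow> 1 \<le> (u - K (ev u)) \<bullet> (u - 2 *\<^sub>R (interp u + (\<Sum>i<k. - B\<^sub>i (P u) (e i) *\<^sub>R e i)))"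
proof -
  interpret B: bounded_bilinear B\<^sub>i by (rule bounded_bilinear_B)
  obtain K1 where K1: "K1 > 0" "\<And>u v. norm (B\<^sub>i u v) \<le> norm u * norm v * K1" using B.pos_bounded by blast
  define C1 where "C1 = 1 + (\<Sum>i<k. (norm (e i))\<^sup>2)"
  define C2 where "C2 = 1 + (\<Sum>j=1..m. (norm (hat j))\<^sup>2)"
  have C12: "C1 \<ge> 1" "C2 \<ge> 1" unfolding C1_def C2_def by (simp_all add: sum_nonneg)
  define \<kappa> where "\<kappa> = min \<kappa>1 (1 / C1)"
  have \<kappa>: "\<kappa> > 0" "\<kappa> \<le> \<kappa>1" "\<kappa> \<le> 1 / C1" using \<kappa>1(1) C12 by (auto simp: \<kappa>_def)
  \<comment> \<open>With this slope the impulses outweigh \<open>B\<^sub>i w w\<close> and the cross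
    term \<open>2 * B\<^sub>i w vm\<close>, split by Young's inequality, and still leave
    \<open>\<kappa> / 2 * (norm w)\<^sup>2\<close>. The factor \<open>C2\<close> passes from nodal
    values to the norm of the interpolant.\<close>
  define KK where "KK = C2 * (\<kappa> / 2 + K1 + 2 * K1\<^sup>2 / \<kappa>)"
  have "\<exists>C. \<forall>t. KK * t\<^sup>2 - C \<le> t * \<iota> j t" if "j \<in> {1..m}" for j by (rule \<iota>_inf[OF that])
  then obtain Cj where Cj: "\<And>j t. j \<in> {1..m} \<Longrightarrow> KK * t\<^sup>2 - Cj j \<le> t * \<iota> j t" by metis
  define C3 where "C3 = \<bar>\<Sum>j=1..m. Cj j\<bar>"
  obtain C where C: "C \<ge> 0"
    "\<And>u h. \<bar>T (\<lambda>y. f y (ev u y)) \<bullet> h - (\<integral>y. \<alpha> a y * (ev u y * ev h y) \<partial>unit_ivl)\<bar> \<le> (\<kappa> / 12 * norm u + C) * norm h"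
    by (rule f_part_estimate[of "\<kappa> / 12"]) (use \<kappa> in simp, rule that, assumption+)
  \<comment> \<open>Chosen so that \<open>\<kappa> / 12 * r \<ge> C + C3 + 1\<close> for all
    \<open>r \<ge> R\<close>, which decides the final comparison.\<close>
  define R where "R = max 1 (12 * (C + C3 + 1) / \<kappa>)"
  have "1 \<le> (u - K (ev u)) \<bullet> (u - 2 *\<^sub>R (interp u + (\<Sum>i<k. - B\<^sub>i (P u) (e i) *\<^sub>R e i)))" if u: "R \<le> norm u" for u
  proof -
    define w where "w = interp u"
    define v where "v = P u"
    define \<gamma> where "\<gamma> i = - B\<^sub>i v (e i)" for i
    define vm where "vm = (\<Sum>i<k. \<gamma> i *\<^sub>R e i)"
    define vp where "vp = v - vm"
    \<comment> \<open>\<open>u\<close> with the signs of its expanding components reversed. Its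
      nodal values are opposite to those of \<open>u\<close>, so the impulses enter with the
      favourable sign.\<close>
    define h where "h = vp - vm - w"
    have uw: "u = w + vm + vp" by (simp add: w_def v_def vp_def P_def)
    have h_eq: "u - 2 *\<^sub>R (interp u + (\<Sum>i<k. - B\<^sub>i (P u) (e i) *\<^sub>R e i)) = h"
    proof -
      have "interp u + (\<Sum>i<k. - B\<^sub>i (P u) (e i) *\<^sub>R e i) = w + vm" by (simp add: w_def vm_def \<gamma>_def v_def)
      then show ?thesis by (simp only: h_def uw scaleR_2) simp
    qed
    have vN: "v \<in> N" unfolding v_def by (rule P_in_N)
    have vmN: "vm \<in> N" unfolding vm_def by (intro subspace_sum subspace_N subspace_scale e) auto
    have vpN: "vp \<in> N" unfolding vp_def by (intro subspace_diff subspace_N vN vmN)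
    have vm_e: "B\<^sub>i vm (e j) = - \<gamma> j" if "j < k" for j
    proof -
      have "B\<^sub>i vm (e j) = (\<Sum>i<k. \<gamma> i * B\<^sub>i (e i) (e j))" unfolding vm_def by (simp add: B.sum_left B.scaleR_left)
      also have "\<dots> = (\<Sum>i<k. if i = j then - \<gamma> i else 0)" by (intro sum.cong) (auto simp: e(2) that)
      also have "\<dots> = - \<gamma> j" using that by simp
      finally show ?thesis .
    qed
    have vp_e: "B\<^sub>i vp (e j) = 0" if "j < k" for j
      using vm_e[OF that] by (simp add: vp_def B.diff_left \<gamma>_def)
    have vp_vm: "B\<^sub>i vp vm = 0"
      unfolding vm_def by (simp add: B.sum_right B.scaleR_right vp_e)
    have vmvm: "B\<^sub>i vm vm = - (\<Sum>i<k. (\<gamma> i)\<^sup>2)"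
    proof -
      have "B\<^sub>i vm (\<Sum>i<k. \<gamma> i *\<^sub>R e i) = (\<Sum>i<k. \<gamma> i * B\<^sub>i vm (e i))"
        by (simp add: B.sum_right B.scaleR_right)
      then have "B\<^sub>i vm vm = (\<Sum>i<k. \<gamma> i * B\<^sub>i vm (e i))" unfolding vm_def[symmetric] .
      then show ?thesis by (simp add: vm_e power2_eq_square sum_negf)
    qed
    have vm_norm: "(norm vm)\<^sup>2 \<le> C1 * (\<Sum>i<k. (\<gamma> i)\<^sup>2)"
    proof -
      have "(norm vm)\<^sup>2 \<le> (\<Sum>i<k. (norm (e i))\<^sup>2) * (\<Sum>i<k. (\<gamma> i)\<^sup>2)" unfolding vm_def by (rule norm_sum_scaleR_square_le)
      also have "\<dots> \<le> C1 * (\<Sum>i<k. (\<gamma> i)\<^sup>2)" by (intro mult_right_mono) (auto simp: C1_def sum_nonneg)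
      finally show ?thesis .
    qed
    define s where "s = (\<Sum>j=1..m. (ev u (x j))\<^sup>2)"
    have w_norm: "(norm w)\<^sup>2 \<le> C2 * s"
    proof -
      have "(norm w)\<^sup>2 \<le> (\<Sum>j=1..m. (norm (hat j))\<^sup>2) * s" unfolding w_def interp_def s_def by (rule norm_sum_scaleR_square_le)
      also have "\<dots> \<le> C2 * s" by (intro mult_right_mono) (auto simp: C2_def s_def sum_nonneg)
      finally show ?thesis .
    qed
    have hx: "ev h (x j) = - ev u (x j)" if "j \<in> {1..m}" for j
      using that vmN vpN ev_interp[OF that, of u] by (simp add: h_def w_def N_def)
    have G: "(u - K (ev u)) \<bullet> h = u \<bullet> h - T (\<lambda>y. f y (ev u y)) \<bullet> h + (\<Sum>j=1..m. ev u (x j) * \<iota> j (ev u (x j)))"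
    proof -
      have "(\<Sum>j=1..m. \<iota> j (ev u (x j)) *\<^sub>R gr j) \<bullet> h = (\<Sum>j=1..m. - (ev u (x j) * \<iota> j (ev u (x j))))"
        unfolding inner_sum_left by (intro sum.cong) (auto simp: inner_gr hx)
      then show ?thesis by (simp add: K_def inner_diff_left inner_add_left sum_negf)
    qed
    have imp: "KK * s - C3 \<le> (\<Sum>j=1..m. ev u (x j) * \<iota> j (ev u (x j)))"
    proof -
      have "(\<Sum>j=1..m. KK * (ev u (x j))\<^sup>2 - Cj j) \<le> (\<Sum>j=1..m. ev u (x j) * \<iota> j (ev u (x j)))"
        by (intro sum_mono Cj)
      moreover have "(\<Sum>j=1..m. KK * (ev u (x j))\<^sup>2 - Cj j) = KK * s - (\<Sum>j=1..m. Cj j)"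
        by (simp add: s_def sum_subtractf sum_distrib_left)
      ultimately show ?thesis unfolding C3_def by linarith
    qed
    \<comment> \<open>The mixed products with \<open>vp\<close> drop out:
      \<open>B\<^sub>i vp vm = 0\<close>, and \<open>B\<^sub>i w vp\<close> occurs twice with
      opposite signs. Only the cross term of \<open>w\<close> and \<open>vm\<close>
      survives.\<close>
    have Buh: "B\<^sub>i u h = B\<^sub>i vp vp + (\<Sum>i<k. (\<gamma> i)\<^sup>2) - 2 * B\<^sub>i w vm - B\<^sub>i w w"
      unfolding uw h_def using vp_vm vmvm B_sym[of vm vp] B_sym[of vm w] B_sym[of vp w]
      by (simp add: B.add_left B.diff_right)
    let ?S = "(norm vp)\<^sup>2 + (norm vm)\<^sup>2 + (norm w)\<^sup>2"
    have pq: "\<kappa> * (norm vp)\<^sup>2 \<le> B\<^sub>i vp vp"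
    proof -
      have "\<kappa> * (norm vp)\<^sup>2 \<le> \<kappa>1 * (norm vp)\<^sup>2" using \<kappa> by (intro mult_right_mono) auto
      then show ?thesis using \<kappa>1(2)[OF vpN] vp_e by fastforce
    qed
    have qm: "\<kappa> * (norm vm)\<^sup>2 \<le> (\<Sum>i<k. (\<gamma> i)\<^sup>2)"
    proof -
      have "\<kappa> * (norm vm)\<^sup>2 \<le> (1 / C1) * (C1 * (\<Sum>i<k. (\<gamma> i)\<^sup>2))"
        using \<kappa> C12 vm_norm by (intro mult_mono) auto
      then show ?thesis using C12 by simp
    qed
    have mixed: "2 * B\<^sub>i w vm \<le> \<kappa> / 2 * (norm vm)\<^sup>2 + 2 * K1\<^sup>2 / \<kappa> * (norm w)\<^sup>2"
    proof -
      have "0 \<le> (\<kappa> / 2) * (norm vm - 2 * K1 / \<kappa> * norm w)\<^sup>2" using \<kappa> by simp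
      also have "\<dots> = \<kappa> / 2 * (norm vm)\<^sup>2 + 2 * K1\<^sup>2 / \<kappa> * (norm w)\<^sup>2 - 2 * (norm w * norm vm * K1)"
        using \<kappa>(1) by (simp add: power2_eq_square field_simps)
      finally show ?thesis using K1(2)[of w vm] by (simp add: abs_le_iff)
    qed
    have ww: "B\<^sub>i w w \<le> K1 * (norm w)\<^sup>2" using K1(2)[of w w] by (simp add: power2_eq_square abs_le_iff mult_ac)
    have KKs: "(\<kappa> / 2 + K1 + 2 * K1\<^sup>2 / \<kappa>) * (norm w)\<^sup>2 \<le> KK * s"
    proof -
      have "(\<kappa> / 2 + K1 + 2 * K1\<^sup>2 / \<kappa>) * (norm w)\<^sup>2 \<le> (\<kappa> / 2 + K1 + 2 * K1\<^sup>2 / \<kappa>) * (C2 * s)"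
        using \<kappa> K1 by (intro mult_left_mono w_norm) auto
      then show ?thesis by (simp add: KK_def mult_ac)
    qed
    \<comment> \<open>A common bound for \<open>norm u\<close> and \<open>norm h\<close>. As
      \<open>\<kappa> / 2 * ?S = \<kappa> / 6 * r\<^sup>2\<close>, half of the gain absorbs the
      error \<open>\<kappa> / 12 * r\<^sup>2\<close> of the nonlinearity.\<close>
    define r where "r = sqrt (3 * ?S)"
    have r2: "r\<^sup>2 = 3 * ?S" unfolding r_def by simp
    have nb: "norm (p + q + t) \<le> r" if "(norm p)\<^sup>2 + (norm q)\<^sup>2 + (norm t)\<^sup>2 = ?S" for p q t :: pcf
    proof -
      have "norm (p + q + t) \<le> norm p + norm q + norm t"
        by (rule order_trans[OF norm_triangle_ineq]) (simp add: norm_triangle_ineq)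
      moreover have "norm p + norm q + norm t \<le> r"
        unfolding r_def that[symmetric]
      proof (rule real_le_rsqrt)
        have "0 \<le> (norm p - norm q)\<^sup>2 + (norm q - norm t)\<^sup>2 + (norm p - norm t)\<^sup>2" by simp
        then show "(norm p + norm q + norm t)\<^sup>2 \<le> 3 * ((norm p)\<^sup>2 + (norm q)\<^sup>2 + (norm t)\<^sup>2)"
          by (simp add: power2_eq_square algebra_simps)
      qed
      ultimately show ?thesis by linarith
    qed
    have nu: "norm u \<le> r" using nb[of w vm vp] by (simp add: uw)
    have nh: "norm h \<le> r" using nb[of vp "- vm" "- w"] by (simp add: h_def)
    have r0: "r \<ge> 1" "12 * (C + C3 + 1) / \<kappa> \<le> r" using u nu by (auto simp: R_def)
    have fpart: "T (\<lambda>y. f y (ev u y)) \<bullet> h \<le> (\<integral>y. \<alpha> a y * (ev u y * ev h y) \<partial>unit_ivl) + (\<kappa> / 12 * r + C) * r"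
    proof -
      have "(\<kappa> / 12 * norm u + C) * norm h \<le> (\<kappa> / 12 * r + C) * r"
        using nu nh C(1) \<kappa> r0 by (intro mult_mono add_right_mono mult_left_mono) auto
      then show ?thesis using C(2)[of u h] by linarith
    qed
    have "\<kappa> / 2 * ?S - C3 - (\<kappa> / 12 * r + C) * r \<le> (u - K (ev u)) \<bullet> h"
    proof -
      have "(u - K (ev u)) \<bullet> h \<ge> B\<^sub>i u h - (\<kappa> / 12 * r + C) * r + KK * s - C3"
        unfolding G B\<^sub>i_def using fpart imp by linarith
      moreover have "B\<^sub>i u h + KK * s \<ge> \<kappa> / 2 * ?S"
      proof -
        have "0 \<le> \<kappa> / 2 * (norm vp)\<^sup>2" using \<kappa> by simp
        then show ?thesis unfolding Buh using pq qm mixed ww KKs by (simp add: algebra_simps)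
      qed
      ultimately show ?thesis by linarith
    qed
    moreover have "\<kappa> / 2 * ?S = \<kappa> / 6 * r\<^sup>2" using r2 by simp
    ultimately have low: "\<kappa> / 12 * r * r - C * r - C3 \<le> (u - K (ev u)) \<bullet> h"
      by (simp add: power2_eq_square algebra_simps)
    have "C + C3 + 1 \<le> \<kappa> / 12 * r" using r0(2) \<kappa>(1) by (simp add: field_simps)
    then have "(C + C3 + 1) * r \<le> \<kappa> / 12 * r * r" using r0 by (intro mult_right_mono) auto
    moreover have "C3 + 1 \<le> (C3 + 1) * r" using r0 by (simp add: C3_def mult_le_cancel_left1)
    ultimately have "1 \<le> \<kappa> / 12 * r * r - C * r - C3" by (simp add: algebra_simps)
    then show ?thesis unfolding h_eq using low by linarith
  qed
  moreover have "R > 0" by (simp add: R_def)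
  ultimately show ?thesis using that by blast
qed

theorem nontrivial_critical_point:
  assumes nr_a: "\<And>j. j \<in> {1..m+1} \<Longrightarrow> a j \<notin> {eigenval x j k |k. k \<ge> 1}"
    and nr_b: "\<And>u. u = (\<Sum>j=1..m. (b j * ev u (x j)) *\<^sub>R gr j) \<Longrightarrow> u = 0"
    and alt: "(\<exists>j\<in>{1..m+1}. a j > eigenval x j 1) \<or>
      (\<exists>w. w \<noteq> 0 \<and> (\<forall>v\<in>N. w \<bullet> v = 0) \<and> 0 \<le> B\<^sub>0 w w)"
  shows "\<exists>u. u \<noteq> 0 \<and> u = K (ev u)"
proof (rule ccontr)
  assume nocrit: "\<not> ?thesis"
  interpret B: bounded_bilinear B\<^sub>i by (rule bounded_bilinear_B)
  interpret B0: bounded_bilinear B\<^sub>0 by (rule bounded_bilinear_B0)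
  obtain k :: nat and e :: "nat \<Rightarrow> pcf" and \<kappa>1 :: real where e: "\<And>i. i < k \<Longrightarrow> e i \<in> N"
    "\<And>i j. i < k \<Longrightarrow> j < k \<Longrightarrow> B\<^sub>i (e i) (e j) = (if i = j then -1 else 0)"
    and \<kappa>1: "\<kappa>1 > 0" "\<And>u. u \<in> N \<Longrightarrow> \<forall>i<k. B\<^sub>i u (e i) = 0 \<Longrightarrow> \<kappa>1 * (norm u)\<^sup>2 \<le> B\<^sub>i u u"
    by (rule signature_at_infinity[OF nr_a], assumption) (rule that, assumption+)
  obtain n :: nat and c :: "nat \<Rightarrow> pcf" and \<kappa>0 :: real where n: "n \<le> m" and c: "\<And>i j. i < n \<Longrightarrow> j < n \<Longrightarrow> B\<^sub>0 (c i) (c j) = (if i = j then -1 else 0)"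
    and \<kappa>0: "\<kappa>0 > 0" "\<And>u. \<forall>i<n. B\<^sub>0 u (c i) = 0 \<Longrightarrow> \<kappa>0 * (norm u)\<^sup>2 \<le> B\<^sub>0 u u"
    by (rule signature_at_zero[OF nr_b], assumption) (rule that, assumption+)
  have B0_sum: "B\<^sub>0 (\<Sum>i<n. \<gamma> i *\<^sub>R c i) (\<Sum>i<n. \<gamma> i *\<^sub>R c i) = - (\<Sum>i<n. (\<gamma> i)\<^sup>2)" for \<gamma>
  proof -
    have "B\<^sub>0 (\<Sum>i<n. \<gamma> i *\<^sub>R c i) (c j) = - \<gamma> j" if "j < n" for j
    proof -
      have "B\<^sub>0 (\<Sum>i<n. \<gamma> i *\<^sub>R c i) (c j) = (\<Sum>i<n. \<gamma> i * B\<^sub>0 (c i) (c j))" by (simp add: B0.sum_left B0.scaleR_left)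
      also have "\<dots> = (\<Sum>i<n. if i = j then - \<gamma> i else 0)" by (intro sum.cong) (auto simp: c that)
      also have "\<dots> = - \<gamma> j" using that by simp
      finally show ?thesis .
    qed
    then show ?thesis by (simp add: B0.sum_right B0.scaleR_right power2_eq_square sum_negf)
  qed
  have nmk: "n < m + k"
    using alt
  proof
    assume "\<exists>j\<in>{1..m+1}. a j > eigenval x j 1"
    then obtain j where j: "j \<in> {1..m+1}" "a j > eigenval x j 1" by blast
    obtain v where v: "v \<in> N" "v \<bullet> v - (\<integral>y. \<alpha> a y * (ev v y * ev v y) \<partial>unit_ivl) < 0"
      by (rule supercritical_negative[of j a]) (use j in auto)
    have "k \<noteq> 0"
    proof
      assume "k = 0"
      then have "\<kappa>1 * (norm v)\<^sup>2 \<le> B\<^sub>i v v" by (intro \<kappa>1(2)[OF v(1)]) simp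
      moreover have "0 \<le> \<kappa>1 * (norm v)\<^sup>2" using \<kappa>1(1) by simp
      ultimately show False using v(2) by (simp add: B\<^sub>i_def)
    qed
    then show ?thesis using n by simp
  next
    assume "\<exists>w. w \<noteq> 0 \<and> (\<forall>v\<in>N. w \<bullet> v = 0) \<and> 0 \<le> B\<^sub>0 w w"
    then obtain w where w: "w \<noteq> 0" "\<And>v. v \<in> N \<Longrightarrow> w \<bullet> v = 0" "0 \<le> B\<^sub>0 w w" by blast
    have "n \<noteq> m"
    proof
      \<comment> \<open>The \<open>m\<close> negative vectors together with \<open>w\<close> are
        \<open>m + 1\<close> vectors with \<open>m\<close> nodal values each, so some combination
        \<open>v\<close> lies in \<open>N\<close>. There the form is the inner product, and
        \<open>w\<close> is orthogonal to \<open>v\<close>; thus the form is nonnegative at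
        \<open>u = v - \<gamma> m *\<^sub>R w\<close>, a combination of negative vectors. This
        forces all coefficients to vanish.\<close>
      assume nm: "n = m"
      define A where "A i j = ev (if i < m then c i else w) (x (Suc j))" for i j
      have "m < card {..<Suc m}" by simp
      from underdetermined_system[OF _ this, of A]
      obtain \<gamma> where \<gamma>: "\<exists>i\<in>{..<Suc m}. \<gamma> i \<noteq> 0" "\<And>j. j < m \<Longrightarrow> (\<Sum>i<Suc m. \<gamma> i * A i j) = 0" by auto
      define u where "u = (\<Sum>i<n. \<gamma> i *\<^sub>R c i)"
      define v where "v = u + \<gamma> m *\<^sub>R w"
      have Buu: "B\<^sub>0 u u = - (\<Sum>i<n. (\<gamma> i)\<^sup>2)" unfolding u_def by (rule B0_sum)
      have vN: "v \<in> N"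
        unfolding N_def
      proof (intro CollectI ballI)
        fix j assume j: "j \<in> {1..m}"
        have "ev v (x (Suc (j - 1))) = (\<Sum>i<Suc m. \<gamma> i * A i (j - 1))"
          by (simp add: v_def u_def nm A_def)
        also have "\<dots> = 0" by (rule \<gamma>(2)) (use j in auto)
        finally show "ev v (x j) = 0" using j by simp
      qed
      have vw: "v \<bullet> w = 0" using w(2)[OF vN] by (simp add: inner_commute)
      have B0v: "B\<^sub>0 v z = v \<bullet> z" for z using vN by (simp add: B\<^sub>0_def N_def)
      have u_eq: "u = v - \<gamma> m *\<^sub>R w" by (simp add: v_def)
      have "B\<^sub>0 u u = v \<bullet> v + (\<gamma> m)\<^sup>2 * B\<^sub>0 w w"
        unfolding u_eq using vw B0_sym[of w v]
        by (simp add: B0.diff_left B0.diff_right B0.scaleR_left B0.scaleR_right B0v power2_eq_square)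
      moreover have "0 \<le> (\<gamma> m)\<^sup>2 * B\<^sub>0 w w" using w(3) by simp
      ultimately have "v \<bullet> v \<le> - (\<Sum>i<n. (\<gamma> i)\<^sup>2)" using Buu by linarith
      moreover have "0 \<le> (\<Sum>i<n. (\<gamma> i)\<^sup>2)" by (simp add: sum_nonneg)
      ultimately have z: "v \<bullet> v = 0" "(\<Sum>i<n. (\<gamma> i)\<^sup>2) = 0" using inner_ge_zero[of v] by linarith+
      then have v0: "v = 0" and g0: "\<And>i. i < n \<Longrightarrow> \<gamma> i = 0" by (auto simp: sum_nonneg_eq_0_iff)
      then have "u = 0" by (simp add: u_def)
      then have "\<gamma> m *\<^sub>R w = 0" using v0 by (simp add: v_def)
      then have "\<gamma> m = 0" using w(1) by simp
      then show False using \<gamma>(1) g0 nm by (auto simp: less_Suc_eq)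
    qed
    then show ?thesis using n by simp
  qed
  obtain R where R: "R > 0"
    "\<And>u. R \<le> norm u \<Longrightarrow> 1 \<le> (u - K (ev u)) \<bullet> (u - 2 *\<^sub>R (interp u + (\<Sum>i<k. - B\<^sub>i (P u) (e i) *\<^sub>R e i)))"
    by (rule gradient_at_infinity[OF e \<kappa>1], assumption, assumption, assumption, assumption, assumption) (rule that, assumption+)
  \<comment> \<open>The descending directions at infinity: the \<open>m\<close> hats, where the
    impulses act, and the \<open>k\<close> negative directions in \<open>N\<close>. The dual
    functionals are nodal values and products with \<open>e i\<close> after projection to
    \<open>N\<close>; the minus sign comes from \<open>B\<^sub>i (e i) (e i) = -1\<close>.\<close>
  define yy where "yy i = (if i < m then hat (Suc i) else e (i - m))" for i
  define ll where "ll i u = (if i < m then ev u (x (Suc i)) else - B\<^sub>i (P u) (e (i - m)))" for i u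
  have Ysum: "(\<Sum>i<m + k. ll i u *\<^sub>R yy i) = interp u + (\<Sum>i<k. - B\<^sub>i (P u) (e i) *\<^sub>R e i)" for u
    unfolding sum_lessThan_add by (simp add: ll_def yy_def interp_def sum.atLeast1_atMost_eq)
  have P_hat: "P (hat j) = 0" if "j \<in> {1..m}" for j
  proof -
    have "interp (hat j) = (\<Sum>i=1..m. if i = j then hat i else 0)"
      unfolding interp_def by (intro sum.cong) (use that in \<open>auto simp: hat_facts(3)\<close>)
    then show ?thesis using that by (simp add: P_def)
  qed
  define C4 where "C4 = 1 + (\<Sum>i<n. (norm (c i))\<^sup>2)"
  have C4: "C4 \<ge> 1" by (simp add: C4_def sum_nonneg)
  \<comment> \<open>The error may consume half of \<open>B\<^sub>0 u u / 2\<close>: a quarter of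
    \<kappa>0 remains on the positive side and 1/4 on the negative one, where \<open>C4\<close>
    converts coefficients into the norm.\<close>
  define \<eta> where "\<eta> = min (\<kappa>0 / 4) (1 / (4 * C4))"
  have \<eta>: "\<eta> > 0" "\<eta> \<le> \<kappa>0 / 4" "\<eta> \<le> 1 / (4 * C4)" using \<kappa>0(1) C4 by (auto simp: \<eta>_def)
  obtain \<delta> where \<delta>: "\<delta> > 0" "\<And>u. norm u \<le> \<delta> \<Longrightarrow> \<bar>E u - B\<^sub>0 u u / 2\<bar> \<le> \<eta> * (norm u)\<^sup>2"
    by (rule E_near_zero[OF \<eta>(1)]) (rule that, assumption+)
  define \<rho> where "\<rho> = \<delta> / C4"
  have \<rho>: "\<rho> > 0" "\<rho> \<le> \<delta>" "\<rho> * C4 = \<delta>" using \<delta>(1) C4 by (auto simp: \<rho>_def field_simps)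
  define \<kappa> where "\<kappa> = min (\<kappa>0 / 4) (1 / 4)"
  have \<kappa>: "\<kappa> > 0" "\<kappa> \<le> \<kappa>0 / 4" "\<kappa> \<le> 1 / 4" using \<kappa>0(1) by (auto simp: \<kappa>_def)
  have "linking_geometry E (\<lambda>u. u - K (ev u)) (m + k) yy ll R n c (\<lambda>i u. - B\<^sub>0 u (c i)) \<kappa> \<rho>"
  proof (rule linking_geometry.intro)
    show "(E has_derivative (\<lambda>v. (u - K (ev u)) \<bullet> v)) (at u)" for u by (rule E_deriv)
    show "\<exists>\<delta>>0. \<forall>u v. norm u \<le> B \<longrightarrow> norm v \<le> B \<longrightarrow> norm (u - v) \<le> \<delta> \<longrightarrow> norm (u - K (ev u) - (v - K (ev v))) \<le> \<epsilon>"
      if "\<epsilon> > 0" for B \<epsilon> by (rule gradient_uniformly_continuous[OF seq_cont_K that])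
    show "\<exists>C. \<forall>u. norm u \<le> B \<longrightarrow> norm (u - K (ev u)) \<le> C" for B by (rule gradient_bounded[OF seq_cont_K])
    show "bounded_linear (ll i)" for i
    proof (cases "i < m")
      case True
      then have "ll i = (\<lambda>u. ev u (x (Suc i)))" by (auto simp: ll_def)
      then show ?thesis by (simp only: bounded_linear_ev)
    next
      case False
      then have "ll i = (\<lambda>u. - B\<^sub>i (P u) (e (i - m)))" by (auto simp: ll_def)
      then show ?thesis
        by (simp only: bounded_linear_minus[OF bounded_linear_compose[OF B.bounded_linear_left bounded_linear_P]])
    qed
    show "ll i (yy j) = (if i = j then 1 else 0)" if "i < m + k" "j < m + k" for i j
    proof -
      consider "i < m" "j < m" | "i < m" "\<not> j < m" | "\<not> i < m" "j < m" | "\<not> i < m" "\<not> j < m" by blast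
      then show ?thesis
      proof cases
        case 1 then show ?thesis by (simp add: ll_def yy_def hat_facts(3))
      next
        case 2 then show ?thesis using e(1)[of "j - m"] that by (auto simp: ll_def yy_def N_def)
      next
        case 3 then show ?thesis by (simp add: ll_def yy_def P_hat B.zero_left)
      next
        case 4
        then show ?thesis using that e(1)[of "j - m"] e(2)[of "j - m" "i - m"] by (auto simp: ll_def yy_def P_N)
      qed
    qed
    show "R > 0" by (rule R)
    show "1 \<le> (u - K (ev u)) \<bullet> (u - 2 *\<^sub>R (\<Sum>i<m + k. ll i u *\<^sub>R yy i))" if "R \<le> norm u" for u
      unfolding Ysum by (rule R(2)[OF that])
    show "\<exists>\<gamma>>0. \<forall>u. r \<le> norm u \<longrightarrow> norm u \<le> B \<longrightarrow> \<gamma> \<le> norm (u - K (ev u))" if r: "r > 0" for r B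
    proof -
      have "u \<noteq> K (ev u)" if "r \<le> norm u" for u
      proof -
        have "u \<noteq> 0" using r that by auto
        then show ?thesis using nocrit by blast
      qed
      from gradient_bounded_below[OF seq_cont_K this] show ?thesis by metis
    qed
    show "n < m + k" by (rule nmk)
    show "bounded_linear (\<lambda>u. - B\<^sub>0 u (c i))" for i by (intro bounded_linear_minus B0.bounded_linear_left)
    show "- B\<^sub>0 (c j) (c i) = (if i = j then 1 else 0)" if "i < n" "j < n" for i j using c[OF that(2,1)] by auto
    show "\<kappa> > 0" "\<rho> > 0" by (rule \<kappa> \<rho>)+
    show "\<kappa> * (norm u)\<^sup>2 \<le> E u" if u: "\<forall>i<n. - B\<^sub>0 u (c i) = 0" "norm u \<le> \<rho>" for u
    proof -
      have "\<kappa>0 * (norm u)\<^sup>2 \<le> B\<^sub>0 u u" by (rule \<kappa>0(2)) (use u in simp)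
      moreover have "\<bar>E u - B\<^sub>0 u u / 2\<bar> \<le> \<eta> * (norm u)\<^sup>2" by (rule \<delta>(2)) (use u \<rho> in simp)
      moreover have "\<eta> * (norm u)\<^sup>2 \<le> \<kappa>0 / 4 * (norm u)\<^sup>2" "\<kappa> * (norm u)\<^sup>2 \<le> \<kappa>0 / 4 * (norm u)\<^sup>2"
        using \<eta> \<kappa> by (intro mult_right_mono; simp)+
      ultimately show ?thesis by (simp add: abs_le_iff)
    qed
    show "E (\<Sum>i<n. z i *\<^sub>R c i) \<le> - \<kappa> * (\<Sum>i<n. (z i)\<^sup>2)" if z: "(\<Sum>i<n. (z i)\<^sup>2) \<le> \<rho>\<^sup>2" for z
    proof -
      define u where "u = (\<Sum>i<n. z i *\<^sub>R c i)"
      let ?s = "\<Sum>i<n. (z i)\<^sup>2"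
      have s0: "0 \<le> ?s" by (simp add: sum_nonneg)
      have nu: "(norm u)\<^sup>2 \<le> C4 * ?s"
      proof -
        have "(norm u)\<^sup>2 \<le> (\<Sum>i<n. (norm (c i))\<^sup>2) * ?s" unfolding u_def by (rule norm_sum_scaleR_square_le)
        also have "\<dots> \<le> C4 * ?s" using s0 by (intro mult_right_mono) (auto simp: C4_def)
        finally show ?thesis .
      qed
      have "norm u \<le> \<delta>"
      proof (rule power2_le_imp_le)
        have "C4 * ?s \<le> C4 * \<rho>\<^sup>2" using z C4 by (intro mult_left_mono) auto
        also have "\<dots> \<le> C4 * (C4 * \<rho>\<^sup>2)" using C4 by (intro mult_left_mono) (auto simp: mult_le_cancel_right1)
        also have "\<dots> = \<delta>\<^sup>2" unfolding \<rho>(3)[symmetric] by (simp add: power2_eq_square)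
        finally show "(norm u)\<^sup>2 \<le> \<delta>\<^sup>2" using nu by linarith
      qed (use \<delta> in simp)
      from \<delta>(2)[OF this] have "E u \<le> B\<^sub>0 u u / 2 + \<eta> * (norm u)\<^sup>2" by (simp add: abs_le_iff)
      also have "B\<^sub>0 u u = - ?s" unfolding u_def by (rule B0_sum)
      also have "\<eta> * (norm u)\<^sup>2 \<le> (1 / (4 * C4)) * (C4 * ?s)" using \<eta> nu C4 by (intro mult_mono) auto
      also have "- ?s / 2 + (1 / (4 * C4)) * (C4 * ?s) = - (1 / 4) * ?s" using C4 by (simp add: field_simps)
      also have "\<dots> \<le> - \<kappa> * ?s" using \<kappa>(3) s0 by (intro mult_right_mono) auto
      finally show ?thesis by (simp add: u_def)
    qed
  qed
  from linking_geometry.inconsistent[OF this] show False .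
qed

end

section \<open>Critical points and weak solutions\<close>

text \<open>Lebesgue measure is complete, so every subset of the exceptional null set is measurable.
  This permits the return from the regularized nonlinearity to the given one.\<close>

lemma AE_eq_measurable:
  fixes f g :: "real \<Rightarrow> real"
  assumes g: "g \<in> borel_measurable unit_ivl" and e: "AE y in unit_ivl. f y = g y"
  shows "f \<in> borel_measurable unit_ivl"
proof -
  obtain N where N: "{y \<in> space unit_ivl. \<not> f y = g y} \<subseteq> N" "emeasure unit_ivl N = 0" "N \<in> sets unit_ivl"
    by (rule AE_E[OF e])
  have nl: "N \<in> null_sets lebesgue"
    using N(2,3) null_sets_restrict_space[of "{0<..<1::real}" lebesgue N] by (auto simp: null_sets_def)
  have sub: "A \<in> sets lebesgue" if "A \<subseteq> N" for A
    using completion.complete2[OF that nl] by auto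
  show ?thesis
  proof (rule measurableI)
    fix B :: "real set" assume B: "B \<in> sets borel"
    have gB: "g -` B \<inter> space unit_ivl \<in> sets unit_ivl" using measurable_sets[OF g B] .
    have eq: "f -` B \<inter> space unit_ivl = ((g -` B \<inter> space unit_ivl) - N) \<union> (f -` B \<inter> space unit_ivl \<inter> N)"
      using N(1) by auto
    have m: "f -` B \<inter> space unit_ivl \<inter> N \<in> sets unit_ivl"
      using sub[of "f -` B \<inter> space unit_ivl \<inter> N"] by (auto simp: sets_restrict_space_iff)
    show "f -` B \<inter> space unit_ivl \<in> sets unit_ivl"
      by (subst eq) (intro sets.Un sets.Diff gB N(3) m)
  qed simp
qed

section \<open>Square-integrable functions and weak derivatives\<close>

lemma L2D:
  assumes "p \<in> L2"
  shows "p \<in> borel_measurable unit_ivl" "integrable unit_ivl (\<lambda>y. (p y)\<^sup>2)" "integrable unit_ivl p"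
proof -
  show m: "p \<in> borel_measurable unit_ivl" and i: "integrable unit_ivl (\<lambda>y. (p y)\<^sup>2)" using assms by (auto simp: L2_def)
  have "integrable unit_ivl (\<lambda>y. 1 + (p y)\<^sup>2)"
    by (intro Bochner_Integration.integrable_add i bdd_meas_integrable[OF bdd_meas_const])
  then show "integrable unit_ivl p"
  proof (rule Bochner_Integration.integrable_bound[OF _ m])
    have "\<bar>t\<bar> \<le> 1 + t\<^sup>2" for t :: real
    proof -
      have "0 \<le> (\<bar>t\<bar> - 1)\<^sup>2" by simp
      then show ?thesis by (simp add: power2_diff)
    qed
    then show "AE y in unit_ivl. norm (p y) \<le> norm (1 + (p y)\<^sup>2)" by (intro AE_I2) (simp add: add_nonneg_nonneg)
  qed
qed

lemma bdd_meas_L2: "bdd_meas p \<Longrightarrow> p \<in> L2"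
  using bdd_meas_integrable[OF bdd_meas_mult[of p p]] by (auto simp: L2_def power2_eq_square bdd_meas_def)

lemma L2_diff:
  assumes p: "p \<in> L2" and q: "q \<in> L2"
  shows "(\<lambda>y. p y - q y) \<in> L2"
proof -
  note mp = L2D(1)[OF p] and mq = L2D(1)[OF q]
  have "integrable unit_ivl (\<lambda>y. 2 * (p y)\<^sup>2 + 2 * (q y)\<^sup>2)" using L2D(2)[OF p] L2D(2)[OF q] by simp
  then have "integrable unit_ivl (\<lambda>y. (p y - q y)\<^sup>2)"
  proof (rule Bochner_Integration.integrable_bound)
    have "(s - t)\<^sup>2 \<le> 2 * s\<^sup>2 + 2 * t\<^sup>2" for s t :: real
    proof -
      have "0 \<le> (s + t)\<^sup>2" by simp
      then show ?thesis by (simp add: power2_eq_square algebra_simps)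
    qed
    then show "AE y in unit_ivl. norm ((p y - q y)\<^sup>2) \<le> norm (2 * (p y)\<^sup>2 + 2 * (q y)\<^sup>2)" by (intro AE_I2) simp
  qed (use mp mq in simp)
  then show ?thesis using mp mq by (simp add: L2_def)
qed

text \<open>The variance of \<open>\<bar>p y\<bar>\<close> under the probability measure
  \<open>unit_ivl\<close> is nonnegative.\<close>

lemma L1_square_le_L2:
  assumes "p \<in> L2"
  shows "(\<integral>y. \<bar>p y\<bar> \<partial>unit_ivl)\<^sup>2 \<le> (\<integral>y. (p y)\<^sup>2 \<partial>unit_ivl)"
proof -
  let ?c = "\<integral>y. \<bar>p y\<bar> \<partial>unit_ivl"
  have one: "(\<integral>y. c \<partial>unit_ivl) = c" for c :: real using itv_const[of 0 1 c] unfolding itv_0_1 by simp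
  have i1: "integrable unit_ivl (\<lambda>y. \<bar>p y\<bar>)" using L2D(3)[OF assms] by simp
  have i2: "integrable unit_ivl (\<lambda>y. 2 * ?c * \<bar>p y\<bar>)" using i1 by simp
  have i3: "integrable unit_ivl (\<lambda>y. ?c\<^sup>2)" by (rule bdd_meas_integrable[OF bdd_meas_const])
  have "0 \<le> (\<integral>y. (\<bar>p y\<bar> - ?c)\<^sup>2 \<partial>unit_ivl)" by (intro integral_nonneg_AE) auto
  also have "\<dots> = (\<integral>y. (p y)\<^sup>2 - 2 * ?c * \<bar>p y\<bar> + ?c\<^sup>2 \<partial>unit_ivl)"
    by (intro Bochner_Integration.integral_cong) (auto simp: power2_diff)
  also have "\<dots> = (\<integral>y. (p y)\<^sup>2 \<partial>unit_ivl) - (\<integral>y. 2 * ?c * \<bar>p y\<bar> \<partial>unit_ivl) + (\<integral>y. ?c\<^sup>2 \<partial>unit_ivl)"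
    by (subst Bochner_Integration.integral_add) (use i2 i3 L2D(2)[OF assms] in auto)
  also have "\<dots> = (\<integral>y. (p y)\<^sup>2 \<partial>unit_ivl) - ?c\<^sup>2" unfolding one by (simp add: power2_eq_square)
  finally show ?thesis by simp
qed

lemma L1_tendsto_if_L2_tendsto:
  assumes "\<And>n. p n \<in> L2" "(\<lambda>n. \<integral>y. (p n y)\<^sup>2 \<partial>unit_ivl) \<longlonglongrightarrow> 0"
  shows "(\<lambda>n. \<integral>y. \<bar>p n y\<bar> \<partial>unit_ivl) \<longlonglongrightarrow> 0"
proof -
  have "(\<lambda>n. (\<integral>y. \<bar>p n y\<bar> \<partial>unit_ivl)\<^sup>2) \<longlonglongrightarrow> 0"
    by (rule tendsto_sandwich[OF _ _ tendsto_const assms(2)]) (use L1_square_le_L2[OF assms(1)] in auto)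
  then have "(\<lambda>n. sqrt ((\<integral>y. \<bar>p n y\<bar> \<partial>unit_ivl)\<^sup>2)) \<longlonglongrightarrow> sqrt 0" by (rule tendsto_real_sqrt)
  then show ?thesis by (simp add: integral_nonneg_AE)
qed

lemma integral_mult_tendsto:
  assumes b: "bdd_meas b" and p: "\<And>n. p n \<in> L2" "q \<in> L2" and l: "(\<lambda>n. \<integral>y. (p n y - q y)\<^sup>2 \<partial>unit_ivl) \<longlonglongrightarrow> 0"
  shows "(\<lambda>n. \<integral>y. b y * p n y \<partial>unit_ivl) \<longlonglongrightarrow> (\<integral>y. b y * q y \<partial>unit_ivl)" "integrable unit_ivl (\<lambda>y. b y * q y)"
proof -
  obtain B where B: "B > 0" "\<And>y. 0 < y \<Longrightarrow> y < 1 \<Longrightarrow> \<bar>b y\<bar> \<le> B" by (rule bdd_measE[OF b]) (rule that, assumption+)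
  have int: "integrable unit_ivl (\<lambda>y. b y * r y)" if r: "r \<in> L2" for r
  proof (rule Bochner_Integration.integrable_bound[of _ "\<lambda>y. B * r y"])
    show "integrable unit_ivl (\<lambda>y. B * r y)" using L2D(3)[OF r] by simp
    show "AE y in unit_ivl. norm (b y * r y) \<le> norm (B * r y)"
      using B by (intro AE_I2) (auto simp: abs_mult intro!: mult_right_mono)
  qed (use L2D(1)[OF r] bdd_meas_measurable[OF b] in simp)
  show "integrable unit_ivl (\<lambda>y. b y * q y)" by (rule int[OF p(2)])
  have "(\<lambda>n. (\<integral>y. b y * p n y \<partial>unit_ivl) - (\<integral>y. b y * q y \<partial>unit_ivl)) \<longlonglongrightarrow> 0"
  proof (rule Lim_null_comparison)
    have d: "(\<lambda>y. p n y - q y) \<in> L2" for n by (rule L2_diff[OF p])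
    show "\<forall>\<^sub>F n in sequentially. norm ((\<integral>y. b y * p n y \<partial>unit_ivl) - (\<integral>y. b y * q y \<partial>unit_ivl)) \<le> B * (\<integral>y. \<bar>p n y - q y\<bar> \<partial>unit_ivl)"
    proof (intro always_eventually allI)
      fix n
      have "(\<integral>y. b y * p n y \<partial>unit_ivl) - (\<integral>y. b y * q y \<partial>unit_ivl) = (\<integral>y. b y * (p n y - q y) \<partial>unit_ivl)"
        using int[OF p(1)[of n]] int[OF p(2)] by (simp add: right_diff_distrib)
      also have "norm \<dots> \<le> (\<integral>y. norm (b y * (p n y - q y)) \<partial>unit_ivl)" by (rule integral_norm_bound)
      also have "\<dots> \<le> (\<integral>y. B * \<bar>p n y - q y\<bar> \<partial>unit_ivl)"
      proof (rule integral_mono_AE)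
        show "integrable unit_ivl (\<lambda>y. norm (b y * (p n y - q y)))" using int[OF d[of n]] by (rule integrable_norm)
        show "integrable unit_ivl (\<lambda>y. B * \<bar>p n y - q y\<bar>)" using L2D(3)[OF d[of n]] by simp
        show "AE y in unit_ivl. norm (b y * (p n y - q y)) \<le> B * \<bar>p n y - q y\<bar>"
          using B by (intro AE_I2) (auto simp: abs_mult intro!: mult_right_mono)
      qed
      finally show "norm ((\<integral>y. b y * p n y \<partial>unit_ivl) - (\<integral>y. b y * q y \<partial>unit_ivl)) \<le> B * (\<integral>y. \<bar>p n y - q y\<bar> \<partial>unit_ivl)"
        by simp
    qed
    show "(\<lambda>n. B * (\<integral>y. \<bar>p n y - q y\<bar> \<partial>unit_ivl)) \<longlonglongrightarrow> 0"
      by (intro tendsto_mult_right_zero L1_tendsto_if_L2_tendsto d l)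
  qed
  then show "(\<lambda>n. \<integral>y. b y * p n y \<partial>unit_ivl) \<longlonglongrightarrow> (\<integral>y. b y * q y \<partial>unit_ivl)" by (simp add: LIM_zero_iff)
qed

lemma bdd_meas_C1c: assumes "\<phi> \<in> C1c" shows "bdd_meas \<phi>" "bdd_meas (deriv \<phi>)"
  by (rule bdd_meas_continuous[OF ac_continuous[OF C1c_ac[OF assms]]]) (rule acD(1)[OF C1c_ac[OF assms]])

lemma integrable_mult_bdd:
  assumes b: "bdd_meas b" and r: "integrable unit_ivl r"
  shows "integrable unit_ivl (\<lambda>y. r y * b y)"
proof -
  obtain B where B: "B > 0" "\<And>y. 0 < y \<Longrightarrow> y < 1 \<Longrightarrow> \<bar>b y\<bar> \<le> B" by (rule bdd_measE[OF b]) (rule that, assumption+)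
  show ?thesis
  proof (rule Bochner_Integration.integrable_bound[of _ "\<lambda>y. B * r y"])
    show "AE y in unit_ivl. norm (r y * b y) \<le> norm (B * r y)"
      using B by (intro AE_I2) (auto simp: abs_mult mult.commute[of B] intro!: mult_left_mono)
  qed (use r borel_measurable_integrable[OF r] bdd_meas_measurable[OF b] in auto)
qed

lemma weak_deriv_unique:
  assumes "has_weak_deriv u p" "has_weak_deriv v q" "\<And>y. 0 < y \<Longrightarrow> y < 1 \<Longrightarrow> u y = v y"
  shows "AE y in unit_ivl. p y = q y"
proof -
  have L: "p \<in> L2" "q \<in> L2" using assms by (auto simp: has_weak_deriv_def)
  have "AE y in unit_ivl. p y - q y = 0"
  proof (rule AE_zero_if_test_integrals_zero)
    show "integrable unit_ivl (\<lambda>y. p y - q y)" using L2D(3)[OF L(1)] L2D(3)[OF L(2)] by simp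
    fix \<phi> assume \<phi>: "\<phi> \<in> C1c"
    have "(\<integral>y. u y * deriv \<phi> y \<partial>unit_ivl) = (\<integral>y. v y * deriv \<phi> y \<partial>unit_ivl)"
      by (intro Bochner_Integration.integral_cong) (auto simp: assms(3))
    then have "(\<integral>y. p y * \<phi> y \<partial>unit_ivl) = (\<integral>y. q y * \<phi> y \<partial>unit_ivl)"
      using assms(1,2) \<phi> by (auto simp: has_weak_deriv_def)
    then show "(\<integral>y. (p y - q y) * \<phi> y \<partial>unit_ivl) = 0"
      using integrable_mult_bdd[OF bdd_meas_C1c(1)[OF \<phi>] L2D(3)[OF L(1)]] integrable_mult_bdd[OF bdd_meas_C1c(1)[OF \<phi>] L2D(3)[OF L(2)]]
      by (simp add: left_diff_distrib)
  qed
  then show ?thesis by eventually_elim simp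
qed

lemma ac_has_weak_deriv:
  assumes "ac u p"
  shows "has_weak_deriv u p"
  unfolding has_weak_deriv_def
proof (intro conjI ballI)
  show "u \<in> L2" "p \<in> L2" by (intro bdd_meas_L2 bdd_meas_continuous ac_continuous[OF assms] acD(1)[OF assms])+
  fix \<phi> assume \<phi>: "\<phi> \<in> C1c"
  note b = bdd_meas_C1c[OF \<phi>]
  have bu: "bdd_meas u" by (intro bdd_meas_continuous ac_continuous[OF assms])
  have "(\<integral>y. p y * \<phi> y + u y * deriv \<phi> y \<partial>unit_ivl) = 0"
    using ac_integral[OF ac_mult[OF assms C1c_ac[OF \<phi>]]] C1cD(3)[OF \<phi>, of 0] C1cD(3)[OF \<phi>, of 1] by simp
  moreover have "(\<integral>y. p y * \<phi> y + u y * deriv \<phi> y \<partial>unit_ivl) = (\<integral>y. p y * \<phi> y \<partial>unit_ivl) + (\<integral>y. u y * deriv \<phi> y \<partial>unit_ivl)"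
    by (intro Bochner_Integration.integral_add bdd_meas_integrable bdd_meas_mult b bu acD(1)[OF assms])
  ultimately show "(\<integral>y. u y * deriv \<phi> y \<partial>unit_ivl) = - (\<integral>y. p y * \<phi> y \<partial>unit_ivl)" by simp
qed

section \<open>Density of the test functions\<close>

lemma C1c_mk:
  assumes "\<phi> \<in> C1c"
  shows "ev (mk \<phi>) y = (if y \<in> {0..1} then \<phi> y else 0)" "ac (ev (mk \<phi>)) (deriv \<phi>)"
  using ev_mk[OF C1c_ac[OF assms]] ac_ev_mk[OF C1c_ac[OF assms]] C1cD(3)[OF assms, of 0] C1cD(3)[OF assms, of 1] by auto

lemma C1c_lin:
  assumes "\<phi> \<in> C1c" "\<psi> \<in> C1c"
  shows "(\<lambda>y. \<phi> y - c * \<psi> y) \<in> C1c"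
proof (rule C1cI)
  show "((\<lambda>y. \<phi> y - c * \<psi> y) has_real_derivative deriv \<phi> y - c * deriv \<psi> y) (at y)" for y
    by (intro DERIV_diff DERIV_cmult C1cD assms)
  show "continuous_on UNIV (\<lambda>y. deriv \<phi> y - c * deriv \<psi> y)" by (intro continuous_intros C1cD assms)
  show "closed (closure {y. \<phi> y \<noteq> 0} \<union> closure {y. \<psi> y \<noteq> 0})" by (intro closed_Un closed_closure)
  show "closure {y. \<phi> y \<noteq> 0} \<union> closure {y. \<psi> y \<noteq> 0} \<subseteq> {0<..<1}" using assms by (auto simp: C1c_def)
  show "\<phi> y - c * \<psi> y = 0" if "y \<notin> closure {y. \<phi> y \<noteq> 0} \<union> closure {y. \<psi> y \<noteq> 0}" for y
  proof -
    have "\<phi> y = 0" "\<psi> y = 0"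
      using that closure_subset[of "{y. \<phi> y \<noteq> 0}"] closure_subset[of "{y. \<psi> y \<noteq> 0}"] by blast+
    then show ?thesis by simp
  qed
qed

text \<open>The primitive from 0 vanishes to the left of the support of \<eta>, and to its right
  because the total integral is 0.\<close>

lemma C1c_primitive:
  assumes \<chi>: "\<eta> \<in> C1c" and 0: "(\<integral>y. \<eta> y \<partial>unit_ivl) = 0"
  obtains \<phi> where "\<phi> \<in> C1c" "deriv \<phi> = \<eta>"
proof -
  have c: "continuous_on UNIV \<eta>" using DERIV_isCont[OF C1cD(1)[OF \<chi>]] by (simp add: continuous_at_imp_continuous_on)
  define \<phi> where "\<phi> = prim \<eta>"
  have d: "(\<phi> has_real_derivative \<eta> y) (at y)" for y unfolding \<phi>_def by (rule prim_deriv[OF c])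
  define S where "S = closure {y. \<eta> y \<noteq> 0}"
  have S: "compact S" "S \<subseteq> {0<..<1}" using \<chi> by (auto simp: C1c_def S_def)
  obtain \<alpha> \<beta> where ab: "0 < \<alpha>" "\<beta> < 1" "S \<subseteq> {\<alpha>..\<beta>}"
  proof (cases "S = {}")
    case True then show ?thesis using that[of "1/2" "1/2"] by auto
  next
    case False
    obtain s where "s \<in> S" "\<forall>t\<in>S. s \<le> t" using compact_attains_inf[OF S(1) False] by blast
    moreover obtain t where "t \<in> S" "\<forall>s\<in>S. s \<le> t" using compact_attains_sup[OF S(1) False] by blast
    ultimately have "S \<subseteq> {s..t}" "0 < s" "t < 1" using S(2) by auto
    then show ?thesis by (intro that[of s t])
  qed
  have z: "\<eta> y = 0" if "y < \<alpha> \<or> \<beta> < y" for y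
    using that ab(3) closure_subset[of "{y. \<eta> y \<noteq> 0}"] unfolding S_def by force
  have l: "\<phi> y = 0" if "y < \<alpha>" for y
  proof -
    have "\<exists>c. \<forall>y\<in>{..<\<alpha>}. \<phi> y = c"
      by (rule has_field_derivative_zero_constant) (use d z in \<open>auto intro: has_field_derivative_at_within[OF DERIV_cong]\<close>)
    then obtain c where c: "\<forall>y\<in>{..<\<alpha>}. \<phi> y = c" by blast
    then have "\<phi> y = \<phi> 0" using that ab(1) by auto
    then show ?thesis by (simp add: \<phi>_def)
  qed
  have r: "\<phi> y = 0" if "\<beta> < y" for y
  proof -
    have "\<exists>c. \<forall>y\<in>{\<beta><..}. \<phi> y = c"
      by (rule has_field_derivative_zero_constant) (use d z in \<open>auto intro: has_field_derivative_at_within[OF DERIV_cong]\<close>)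
    then obtain c where c: "\<forall>y\<in>{\<beta><..}. \<phi> y = c" by blast
    then have "\<phi> y = \<phi> 1" using that ab(2) by auto
    moreover have "\<phi> 1 = 0" using 0 by (simp add: \<phi>_def prim_def)
    ultimately show ?thesis by simp
  qed
  show ?thesis
  proof (rule that[of \<phi>])
    show "deriv \<phi> = \<eta>" using d by (auto intro!: ext DERIV_imp_deriv)
    show "\<phi> \<in> C1c"
      by (rule C1cI[OF d c, of "{\<alpha>..\<beta>}"]) (use ab l r in force)+
  qed
qed

lemma C1c_unit_integral: obtains \<theta> where "\<theta> \<in> C1c" "(\<integral>y. \<theta> y \<partial>unit_ivl) = 1"
proof -
  let ?b = "bump (1/8)"
  have b: "?b \<in> C1c" by (rule bump_C1c) simp
  \<comment> \<open>On [1/4, 3/4] one has \<open>y * (1 - y) \<ge> 3/16\<close>, so for parameter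
    1/8 the square in \<open>bump\<close> is at least 1/256, and
    \<open>s / (s + 1/8) \<ge> 1/33\<close> for such \<open>s\<close>.\<close>
  have "itv (\<lambda>y. (1/33) * indicator {1/4..3/4} y) 0 1 \<le> itv ?b 0 1"
  proof (rule itv_mono)
    show "(1/33) * indicator {1/4..3/4} y \<le> ?b y" for y :: real
    proof (cases "y \<in> {1/4..3/4}")
      case True
      then have "0 \<le> (y - 1/4) * (3/4 - y)" by (intro mult_nonneg_nonneg) auto
      moreover have "(y - 1/4) * (3/4 - y) = y * (1 - y) - 3/16" by (simp add: field_simps)
      ultimately have "1/16 \<le> y * (1 - y) - 1/8" by linarith
      then have v: "1/16 \<le> max 0 (y * (1 - y) - 1/8)" by simp
      have p: "(1/16)\<^sup>2 \<le> (max 0 (y * (1 - y) - 1/8))\<^sup>2" by (rule power_mono[OF v]) simp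
      have q: "(1/16)\<^sup>2 = (1/256::real)" by (simp add: power2_eq_square)
      have s: "1/256 \<le> (max 0 (y * (1 - y) - 1/8))\<^sup>2" using p unfolding q .
      have "1/33 \<le> s / (s + 1/8)" if "1/256 \<le> s" for s :: real using that by (simp add: field_simps)
      from this[OF s] have "1/33 \<le> ?b y" unfolding bump_def .
      then show ?thesis using True by simp
    next
      case False then show ?thesis using bump_bounds[of "1/8" y] by simp
    qed
  qed (intro bdd_meas_cmult bdd_meas_indicator bdd_meas_C1c(1)[OF b], simp, intro bdd_meas_C1c(1)[OF b])
  moreover have "itv (\<lambda>y. (1/33) * indicator {1/4..3/4} y) 0 1 = (1/33) * itv (\<lambda>_. 1) (1/4) (3/4)"
    unfolding itv_cmult unfolding itv_0_1 by (simp add: itv_def)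
  moreover have "itv (\<lambda>_. 1) (1/4) (3/4) = 1/2" by (subst itv_const) auto
  ultimately have pos: "(\<integral>y. ?b y \<partial>unit_ivl) > 0" by (simp add: itv_0_1)
  show ?thesis
  proof (rule that[of "\<lambda>y. ?b y * inverse (\<integral>y. ?b y \<partial>unit_ivl)"])
    show "(\<lambda>y. ?b y * inverse (\<integral>y. ?b y \<partial>unit_ivl)) \<in> C1c"
      by (rule C1c_mult[OF b, of _ "\<lambda>_. 0"]) auto
    show "(\<integral>y. ?b y * inverse (\<integral>y. ?b y \<partial>unit_ivl) \<partial>unit_ivl) = 1" using pos by simp
  qed
qed

text \<open>The derivative is approximated first: test functions converge to \<open>D u\<close>, a
  multiple of \<theta> corrects their mean to 0, and the primitives are then test functions again.
  The corrections tend to 0 because \<open>D u\<close> itself has mean 0.\<close>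

lemma test_functions_dense:
  obtains \<phi> :: "nat \<Rightarrow> real \<Rightarrow> real" where "\<And>n. \<phi> n \<in> C1c" "(\<lambda>n. mk (\<phi> n)) \<longlonglongrightarrow> u"
    "(\<lambda>n. \<integral>y. (deriv (\<phi> n) y - D u y)\<^sup>2 \<partial>unit_ivl) \<longlonglongrightarrow> 0"
proof -
  obtain B where B: "B > 0" "\<And>y. 0 < y \<Longrightarrow> y < 1 \<Longrightarrow> \<bar>D u y\<bar> \<le> B"
    by (rule bdd_measE[OF bdd_meas_D]) (rule that, assumption+)
  obtain \<psi> where \<psi>: "\<And>k. \<psi> k \<in> C1c" "\<And>k y. \<bar>\<psi> k y\<bar> \<le> B + 1" "AE y in unit_ivl. (\<lambda>k. \<psi> k y) \<longlonglongrightarrow> D u y"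
    by (rule bdd_meas_C1c_approx[OF bdd_meas_D B(2)], assumption, assumption) (rule that, assumption+)
  obtain \<theta> where \<theta>: "\<theta> \<in> C1c" "(\<integral>y. \<theta> y \<partial>unit_ivl) = 1" by (rule C1c_unit_integral)
  define c where "c k = (\<integral>y. \<psi> k y \<partial>unit_ivl)" for k
  define \<eta> where "\<eta> k y = \<psi> k y - c k * \<theta> y" for k y
  have \<eta>: "\<eta> k \<in> C1c" for k unfolding \<eta>_def by (rule C1c_lin[OF \<psi>(1) \<theta>(1)])
  have "(\<integral>y. \<eta> k y \<partial>unit_ivl) = 0" for k
    unfolding \<eta>_def using bdd_meas_integrable[OF bdd_meas_C1c(1)[OF \<psi>(1)[of k]]] bdd_meas_integrable[OF bdd_meas_C1c(1)[OF \<theta>(1)]] \<theta>(2)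
    by (simp add: c_def)
  then have "\<forall>k. \<exists>\<phi>. \<phi> \<in> C1c \<and> deriv \<phi> = \<eta> k" using C1c_primitive[OF \<eta>] by metis
  from choice[OF this] obtain \<phi> where \<phi>: "\<And>k. \<phi> k \<in> C1c" "\<And>k. deriv (\<phi> k) = \<eta> k" by blast
  obtain Bt where Bt: "Bt > 0" "\<And>y. 0 < y \<Longrightarrow> y < 1 \<Longrightarrow> \<bar>\<theta> y\<bar> \<le> Bt"
    by (rule bdd_measE[OF bdd_meas_C1c(1)[OF \<theta>(1)]]) (rule that, assumption+)
  have c0: "c \<longlonglongrightarrow> 0"
  proof -
    have "(\<lambda>k. itv (\<psi> k) 0 1) \<longlonglongrightarrow> itv (D u) 0 1"
      by (rule itv_tendsto[where B="B + 1"]) (use \<psi> bdd_meas_C1c bdd_meas_D in auto)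
    then show ?thesis using ac_integral[OF ac_D, of u] by (simp add: itv_0_1 c_def[abs_def])
  qed
  have cB: "\<bar>c k\<bar> \<le> B + 1" for k
    unfolding c_def using itv_abs_le[OF bdd_meas_C1c(1)[OF \<psi>(1)[of k]] \<psi>(2), of 0 1] by (simp add: itv_0_1)
  have conv: "(\<lambda>k. \<integral>y. (\<eta> k y - D u y)\<^sup>2 \<partial>unit_ivl) \<longlonglongrightarrow> 0"
  proof -
    let ?C = "(B + 1) + (B + 1) * Bt + B"
    have "(\<lambda>k. itv (\<lambda>y. (\<eta> k y - D u y)\<^sup>2) 0 1) \<longlonglongrightarrow> itv (\<lambda>_. 0) 0 1"
    proof (rule itv_tendsto[where B="?C\<^sup>2"])
      show "bdd_meas (\<lambda>y. (\<eta> k y - D u y)\<^sup>2)" for k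
        unfolding power2_eq_square by (intro bdd_meas_mult bdd_meas_diff bdd_meas_C1c(1)[OF \<eta>] bdd_meas_D)
      show "\<bar>(\<eta> k y - D u y)\<^sup>2\<bar> \<le> ?C\<^sup>2" if y: "0 < y" "y < 1" for k y
      proof -
        have "\<bar>c k * \<theta> y\<bar> \<le> (B + 1) * Bt" unfolding abs_mult using cB Bt(2)[OF y] B by (intro mult_mono) auto
        then have "\<bar>\<eta> k y - D u y\<bar> \<le> ?C" unfolding \<eta>_def using \<psi>(2)[of k y] B(2)[OF y] by linarith
        then have "\<bar>\<eta> k y - D u y\<bar>\<^sup>2 \<le> ?C\<^sup>2" by (intro power_mono) auto
        then show ?thesis by simp
      qed
      show "AE y in unit_ivl. (\<lambda>k. (\<eta> k y - D u y)\<^sup>2) \<longlonglongrightarrow> 0"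
        using \<psi>(3)
      proof eventually_elim
        fix y assume l: "(\<lambda>k. \<psi> k y) \<longlonglongrightarrow> D u y"
        have "(\<lambda>k. (\<psi> k y - c k * \<theta> y - D u y)\<^sup>2) \<longlonglongrightarrow> (D u y - 0 * \<theta> y - D u y)\<^sup>2"
          by (intro tendsto_intros l c0)
        then show "(\<lambda>k. (\<eta> k y - D u y)\<^sup>2) \<longlonglongrightarrow> 0" by (simp add: \<eta>_def)
      qed
    qed (rule bdd_meas_const)
    then show ?thesis by (simp add: itv_0_1)
  qed
  have nrm: "(norm (mk (\<phi> k) - u))\<^sup>2 = (\<integral>y. (\<eta> k y - D u y)\<^sup>2 \<partial>unit_ivl)" for k
  proof -
    have "ac (ev (mk (\<phi> k) - u)) (\<lambda>y. \<eta> k y - D u y)"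
      using ac_diff[OF C1c_mk(2)[OF \<phi>(1)[of k]] ac_D[of u]] \<phi>(2)[of k] by (auto elim: ac_cong)
    from inner_eq[OF this this] show ?thesis unfolding power2_norm_eq_inner by (simp only: power2_eq_square)
  qed
  have "(\<lambda>k. sqrt (\<integral>y. (\<eta> k y - D u y)\<^sup>2 \<partial>unit_ivl)) \<longlonglongrightarrow> sqrt 0" by (rule tendsto_real_sqrt[OF conv])
  then have "(\<lambda>k. norm (mk (\<phi> k) - u)) \<longlonglongrightarrow> 0" unfolding nrm[symmetric] by simp
  then have "(\<lambda>k. mk (\<phi> k)) \<longlonglongrightarrow> u" by (simp add: tendsto_norm_zero_iff LIM_zero_iff)
  then show ?thesis using that[OF \<phi>(1)] conv \<phi>(2) by simp
qed

lemma ev_in_H10: "ev u \<in> H10"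
proof -
  obtain \<phi> where \<phi>: "\<And>n. \<phi> n \<in> C1c" "(\<lambda>n. mk (\<phi> n)) \<longlonglongrightarrow> u"
    "(\<lambda>n. \<integral>y. (deriv (\<phi> n) y - D u y)\<^sup>2 \<partial>unit_ivl) \<longlonglongrightarrow> 0"
    by (rule test_functions_dense) (rule that, assumption+)
  have "(\<lambda>n. \<integral>y. (\<phi> n y - ev u y)\<^sup>2 \<partial>unit_ivl) \<longlonglongrightarrow> 0"
  proof (rule tendsto_sandwich[OF _ _ tendsto_const])
    have "(\<lambda>n. norm (mk (\<phi> n) - u)) \<longlonglongrightarrow> 0" using \<phi>(2) by (simp add: tendsto_norm_zero_iff LIM_zero_iff)
    from tendsto_power[OF this, of 2] show "(\<lambda>n. (norm (mk (\<phi> n) - u))\<^sup>2) \<longlonglongrightarrow> 0" by simp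
    have "(\<integral>y. (\<phi> n y - ev u y)\<^sup>2 \<partial>unit_ivl) \<le> (norm (mk (\<phi> n) - u))\<^sup>2" for n
    proof -
      have b: "bdd_meas (\<lambda>y. (\<phi> n y - ev u y)\<^sup>2)"
        unfolding power2_eq_square by (intro bdd_meas_mult bdd_meas_diff bdd_meas_C1c(1)[OF \<phi>(1)] bdd_meas_ev)
      have "\<bar>(\<phi> n y - ev u y)\<^sup>2\<bar> \<le> (norm (mk (\<phi> n) - u))\<^sup>2" if y: "0 < y" "y < 1" for y
      proof -
        have "\<bar>\<phi> n y - ev u y\<bar> \<le> norm (mk (\<phi> n) - u)"
          using ev_bound[of "mk (\<phi> n) - u" y] y by (simp add: C1c_mk(1)[OF \<phi>(1)])
        then have "\<bar>\<phi> n y - ev u y\<bar>\<^sup>2 \<le> (norm (mk (\<phi> n) - u))\<^sup>2" by (intro power_mono) auto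
        then show ?thesis by simp
      qed
      from itv_abs_le[OF b this, of 0 1] show ?thesis by (simp add: itv_0_1 abs_le_iff)
    qed
    then show "\<forall>\<^sub>F n in sequentially. (\<integral>y. (\<phi> n y - ev u y)\<^sup>2 \<partial>unit_ivl) \<le> (norm (mk (\<phi> n) - u))\<^sup>2" by simp
  qed (simp add: integral_nonneg_AE)
  then show ?thesis
    using \<phi>(1,3) ev_continuous ac_has_weak_deriv[OF ac_D] unfolding H10_def by blast
qed

text \<open>Averaging over a short interval to the right of \<open>z\<close>: convergence in \<open>L\<^sup>1\<close> together with the
  equicontinuity of a bounded sequence gives convergence of the point values.\<close>

lemma point_values_converge:
  assumes \<phi>: "\<And>n. \<phi> n \<in> C1c" and M: "\<And>n. norm (mk (\<phi> n)) \<le> M" and v: "continuous_on {0..1} v"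
    and l: "(\<lambda>n. \<integral>y. \<bar>\<phi> n y - v y\<bar> \<partial>unit_ivl) \<longlonglongrightarrow> 0" and z: "0 \<le> z" "z < 1"
  shows "(\<lambda>n. \<phi> n z) \<longlonglongrightarrow> v z"
proof (rule LIMSEQ_I)
  fix e :: real assume e: "e > 0"
  have M0: "0 \<le> M" using M[of 0] norm_ge_zero order_trans by blast
  from v z e obtain \<delta> where \<delta>: "\<delta> > 0" "\<And>y. y \<in> {0..1} \<Longrightarrow> dist y z < \<delta> \<Longrightarrow> dist (v y) (v z) < e / 4"
    unfolding continuous_on_iff by (metis atLeastAtMost_iff divide_pos_pos less_eq_real_def zero_less_numeral)
  \<comment> \<open>Over \<open>[z, z + h]\<close> both \<open>v\<close> and every
    \<open>\<phi> n\<close> vary by at most \<open>e / 4\<close>, so that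
    \<open>\<bar>\<phi> n y - v y\<bar>\<close> stays above its value at \<open>z\<close> minus
    \<open>e / 2\<close>.\<close>
  define h where "h = Min {1 - z, \<delta> / 2, (e / (4 * (M + 1)))\<^sup>2}"
  have h: "h > 0" "h \<le> 1 - z" "h \<le> \<delta> / 2" "h \<le> (e / (4 * (M + 1)))\<^sup>2"
  proof -
    show "h > 0" using z \<delta>(1) e M0 by (simp add: h_def)
    show "h \<le> 1 - z" "h \<le> \<delta> / 2" "h \<le> (e / (4 * (M + 1)))\<^sup>2" unfolding h_def by (intro Min_le; simp)+
  qed
  have Mh: "M * sqrt h \<le> e / 4"
  proof -
    have "sqrt h \<le> e / (4 * (M + 1))" using h e M0 by (intro real_le_lsqrt) auto
    then have "M * sqrt h \<le> M * (e / (4 * (M + 1)))" using M0 by (intro mult_left_mono)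
    also have "\<dots> \<le> (M + 1) * (e / (4 * (M + 1)))" using M0 e by (intro mult_right_mono) auto
    also have "\<dots> = e / 4" using M0 by (simp add: field_simps)
    finally show ?thesis .
  qed
  have est: "h * (\<bar>\<phi> n z - v z\<bar> - e / 2) \<le> (\<integral>y. \<bar>\<phi> n y - v y\<bar> \<partial>unit_ivl)" for n
  proof -
    have b: "bdd_meas (\<lambda>y. \<bar>\<phi> n y - v y\<bar>)"
      using bdd_meas_diff[OF bdd_meas_C1c(1)[OF \<phi>[of n]] bdd_meas_continuous[OF v]] by (auto simp: bdd_meas_def)
    have "h * (\<bar>\<phi> n z - v z\<bar> - e / 2) = itv (\<lambda>_. \<bar>\<phi> n z - v z\<bar> - e / 2) z (z + h)"
      using itv_const[of z "z + h" "\<bar>\<phi> n z - v z\<bar> - e / 2"] z h by simp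
    also have "\<dots> \<le> itv (\<lambda>y. \<bar>\<phi> n y - v y\<bar>) 0 1"
      unfolding itv_def
    proof (rule integral_mono_AE)
      show "AE y in unit_ivl. indicator {z..z + h} y * (\<bar>\<phi> n z - v z\<bar> - e / 2) \<le> indicator {0..1} y * \<bar>\<phi> n y - v y\<bar>"
      proof (rule AE_I2)
        fix y assume "y \<in> space unit_ivl"
        then have y: "0 < y" "y < 1" by auto
        show "indicator {z..z + h} y * (\<bar>\<phi> n z - v z\<bar> - e / 2) \<le> indicator {0..1} y * \<bar>\<phi> n y - v y\<bar>"
        proof (cases "y \<in> {z..z + h}")
          case True
          have "\<bar>\<phi> n y - \<phi> n z\<bar> \<le> norm (mk (\<phi> n)) * sqrt \<bar>y - z\<bar>"
            using ev_holder[of y z "mk (\<phi> n)"] y z by (simp add: C1c_mk(1)[OF \<phi>])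
          also have "\<dots> \<le> M * sqrt h" using M[of n] True M0 by (intro mult_mono) auto
          finally have "\<bar>\<phi> n y - \<phi> n z\<bar> \<le> e / 4" using Mh by linarith
          moreover have "\<bar>v y - v z\<bar> < e / 4"
            using \<delta>(2)[of y] True y h \<delta>(1) by (auto simp: dist_real_def)
          ultimately have "\<bar>\<phi> n z - v z\<bar> - e / 2 \<le> \<bar>\<phi> n y - v y\<bar>" by linarith
          then show ?thesis using True y by simp
        qed (use y in simp)
      qed
    qed (intro itv_integrable bdd_meas_const b)+
    finally show ?thesis by (simp add: itv_0_1)
  qed
  have "h * (e / 2) > 0" using h e by simp
  from order_tendstoD(2)[OF l this] obtain n0
    where n0: "\<And>n. n \<ge> n0 \<Longrightarrow> (\<integral>y. \<bar>\<phi> n y - v y\<bar> \<partial>unit_ivl) < h * (e / 2)" by (auto simp: eventually_sequentially)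
  have "\<bar>\<phi> n z - v z\<bar> < e" if "n \<ge> n0" for n
  proof -
    have "h * (\<bar>\<phi> n z - v z\<bar> - e / 2) < h * (e / 2)" using est[of n] n0[OF that] by linarith
    then show ?thesis using h(1) by simp
  qed
  then show "\<exists>no. \<forall>n\<ge>no. norm (\<phi> n z - v z) < e" by auto
qed

text \<open>A critical point satisfies the weak equation for test functions; both sides are continuous in
  the \<open>H\<^sup>1\<close> norm, so it holds on all of \<open>H10\<close>.\<close>

lemma weak_equation_H10:
  assumes b: "bdd_meas b" and J: "finite J" "\<And>j. j \<in> J \<Longrightarrow> 0 \<le> z j \<and> z j < 1"
    and eq: "\<And>v. u \<bullet> v = (\<integral>y. b y * ev v y \<partial>unit_ivl) + (\<Sum>j\<in>J. c j * ev v (z j))"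
    and v: "v \<in> H10" "has_weak_deriv v dv"
  shows "integrable unit_ivl (\<lambda>y. b y * v y)"
    "(\<integral>y. D u y * dv y \<partial>unit_ivl) = (\<integral>y. b y * v y \<partial>unit_ivl) + (\<Sum>j\<in>J. c j * v (z j))"
proof -
  from v(1) obtain dv' \<phi> where vc: "continuous_on {0..1} v" and dv': "has_weak_deriv v dv'" and \<phi>: "\<And>n. \<phi> n \<in> C1c"
    and l0: "(\<lambda>n. \<integral>y. (\<phi> n y - v y)\<^sup>2 \<partial>unit_ivl) \<longlonglongrightarrow> 0"
    and l1': "(\<lambda>n. \<integral>y. (deriv (\<phi> n) y - dv' y)\<^sup>2 \<partial>unit_ivl) \<longlonglongrightarrow> 0"
    unfolding H10_def by blast
  have L: "v \<in> L2" "dv \<in> L2" "dv' \<in> L2" using v(2) dv' by (auto simp: has_weak_deriv_def)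
  have L\<phi>: "\<phi> n \<in> L2" "deriv (\<phi> n) \<in> L2" for n by (intro bdd_meas_L2 bdd_meas_C1c[OF \<phi>])+
  \<comment> \<open>\<open>H10\<close> provides some weak derivative of \<open>v\<close>, which
    coincides with the given \<open>dv\<close> only almost everywhere.\<close>
  have ae: "AE y in unit_ivl. dv' y = dv y" by (rule weak_deriv_unique[OF dv' v(2)]) simp
  have l1: "(\<lambda>n. \<integral>y. (deriv (\<phi> n) y - dv y)\<^sup>2 \<partial>unit_ivl) \<longlonglongrightarrow> 0"
  proof -
    have "(\<integral>y. (deriv (\<phi> n) y - dv' y)\<^sup>2 \<partial>unit_ivl) = (\<integral>y. (deriv (\<phi> n) y - dv y)\<^sup>2 \<partial>unit_ivl)" for n
      by (rule integral_cong_AE)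
        (use ae L2D(1)[OF L\<phi>(2)[of n]] L2D(1)[OF L(2)] L2D(1)[OF L(3)] in \<open>auto elim: eventually_mono\<close>)
    then show ?thesis using l1' by simp
  qed
  show "integrable unit_ivl (\<lambda>y. b y * v y)" by (rule integral_mult_tendsto(2)[OF b L\<phi>(1) L(1) l0])
  have t1: "(\<lambda>n. \<integral>y. b y * \<phi> n y \<partial>unit_ivl) \<longlonglongrightarrow> (\<integral>y. b y * v y \<partial>unit_ivl)"
    by (rule integral_mult_tendsto(1)[OF b L\<phi>(1) L(1) l0])
  have t2: "(\<lambda>n. \<integral>y. D u y * deriv (\<phi> n) y \<partial>unit_ivl) \<longlonglongrightarrow> (\<integral>y. D u y * dv y \<partial>unit_ivl)"
    by (rule integral_mult_tendsto(1)[OF bdd_meas_D L\<phi>(2) L(2) l1])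
  obtain M where M: "\<And>n. norm (mk (\<phi> n)) \<le> M"
  proof -
    have "Bseq (\<lambda>n. \<integral>y. (deriv (\<phi> n) y - dv y)\<^sup>2 \<partial>unit_ivl)"
      by (rule convergent_imp_Bseq) (use l1 in \<open>auto simp: convergent_def\<close>)
    then obtain Q where Q: "\<And>n. \<bar>\<integral>y. (deriv (\<phi> n) y - dv y)\<^sup>2 \<partial>unit_ivl\<bar> \<le> Q" by (auto simp: Bseq_def)
    have n2: "(norm (mk (\<phi> n)))\<^sup>2 \<le> 2 * Q + 2 * (\<integral>y. (dv y)\<^sup>2 \<partial>unit_ivl)" for n
    proof -
      have i1: "integrable unit_ivl (\<lambda>y. (deriv (\<phi> n) y - dv y)\<^sup>2)" by (rule L2D(2)[OF L2_diff[OF L\<phi>(2) L(2)]])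
      have i2: "integrable unit_ivl (\<lambda>y. (dv y)\<^sup>2)" by (rule L2D(2)[OF L(2)])
      have "(norm (mk (\<phi> n)))\<^sup>2 = (\<integral>y. (deriv (\<phi> n) y)\<^sup>2 \<partial>unit_ivl)"
        unfolding power2_norm_eq_inner inner_eq[OF C1c_mk(2)[OF \<phi>] C1c_mk(2)[OF \<phi>]] by (simp add: power2_eq_square)
      also have "\<dots> \<le> (\<integral>y. 2 * (deriv (\<phi> n) y - dv y)\<^sup>2 + 2 * (dv y)\<^sup>2 \<partial>unit_ivl)"
      proof (rule integral_mono)
        have "s\<^sup>2 \<le> 2 * (s - t)\<^sup>2 + 2 * t\<^sup>2" for s t :: real
        proof -
          have "0 \<le> (s - 2 * t)\<^sup>2" by simp
          then show ?thesis by (simp add: power2_eq_square algebra_simps)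
        qed
        then show "(deriv (\<phi> n) y)\<^sup>2 \<le> 2 * (deriv (\<phi> n) y - dv y)\<^sup>2 + 2 * (dv y)\<^sup>2" for y .
      qed (use L2D(2)[OF L\<phi>(2)] i1 i2 in auto)
      also have "\<dots> = 2 * (\<integral>y. (deriv (\<phi> n) y - dv y)\<^sup>2 \<partial>unit_ivl) + 2 * (\<integral>y. (dv y)\<^sup>2 \<partial>unit_ivl)"
        using i1 i2 by simp
      finally show ?thesis using Q[of n] by linarith
    qed
    show ?thesis by (rule that[of "sqrt (2 * Q + 2 * (\<integral>y. (dv y)\<^sup>2 \<partial>unit_ivl))"], rule real_le_rsqrt, rule n2)
  qed
  have l0': "(\<lambda>n. \<integral>y. \<bar>\<phi> n y - v y\<bar> \<partial>unit_ivl) \<longlonglongrightarrow> 0"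
    by (rule L1_tendsto_if_L2_tendsto[OF L2_diff[OF L\<phi>(1) L(1)] l0])
  have t3: "(\<lambda>n. \<phi> n (z j)) \<longlonglongrightarrow> v (z j)" if "j \<in> J" for j
    using J(2)[OF that] by (intro point_values_converge[OF \<phi> M vc l0']) auto
  have "(\<integral>y. D u y * deriv (\<phi> n) y \<partial>unit_ivl) = (\<integral>y. b y * \<phi> n y \<partial>unit_ivl) + (\<Sum>j\<in>J. c j * \<phi> n (z j))" for n
  proof -
    have "(\<integral>y. D u y * deriv (\<phi> n) y \<partial>unit_ivl) = u \<bullet> mk (\<phi> n)" by (rule inner_eq[OF ac_D C1c_mk(2)[OF \<phi>], symmetric])
    also have "\<dots> = (\<integral>y. b y * ev (mk (\<phi> n)) y \<partial>unit_ivl) + (\<Sum>j\<in>J. c j * ev (mk (\<phi> n)) (z j))" by (rule eq)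
    also have "(\<integral>y. b y * ev (mk (\<phi> n)) y \<partial>unit_ivl) = (\<integral>y. b y * \<phi> n y \<partial>unit_ivl)"
      by (intro Bochner_Integration.integral_cong) (auto simp: C1c_mk(1)[OF \<phi>])
    also have "(\<Sum>j\<in>J. c j * ev (mk (\<phi> n)) (z j)) = (\<Sum>j\<in>J. c j * \<phi> n (z j))"
      by (intro sum.cong) (use J(2) in \<open>force simp: C1c_mk(1)[OF \<phi>]\<close>)+
    finally show ?thesis .
  qed
  moreover have "(\<lambda>n. (\<integral>y. b y * \<phi> n y \<partial>unit_ivl) + (\<Sum>j\<in>J. c j * \<phi> n (z j))) \<longlonglongrightarrow> (\<integral>y. b y * v y \<partial>unit_ivl) + (\<Sum>j\<in>J. c j * v (z j))"
    by (intro tendsto_intros t1 t3)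
  ultimately show "(\<integral>y. D u y * dv y \<partial>unit_ivl) = (\<integral>y. b y * v y \<partial>unit_ivl) + (\<Sum>j\<in>J. c j * v (z j))"
    using t2 LIMSEQ_unique by simp
qed

section \<open>Reduction of the hypotheses\<close>

text \<open>At \<open>\<bar>t\<bar> = T\<close> the terms
  \<open>C * \<bar>t\<bar> powr (r - 1)\<close> and \<open>\<epsilon> * \<bar>t\<bar>\<close>
  coincide. Beyond \<open>T\<close> the linear one dominates because \<open>r < 2\<close>; below it
  a constant does.\<close>

lemma powr_sublinear:
  fixes r C \<epsilon> :: real
  assumes r: "1 < r" "r < 2" and C: "C > 0" and e: "\<epsilon> > 0"
  obtains C' where "\<And>t. C * (\<bar>t\<bar> powr (r - 1) + 1) \<le> \<epsilon> * \<bar>t\<bar> + C'"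
proof -
  define T where "T = (C / \<epsilon>) powr (1 / (2 - r))"
  have T: "T > 0" "T powr (2 - r) = C / \<epsilon>" using C e r by (auto simp: T_def powr_powr)
  have "C * (\<bar>t\<bar> powr (r - 1) + 1) \<le> \<epsilon> * \<bar>t\<bar> + C * (T powr (r - 1) + 1)" for t
  proof (cases "\<bar>t\<bar> < T")
    case True
    then have "C * (\<bar>t\<bar> powr (r - 1) + 1) \<le> C * (T powr (r - 1) + 1)"
      using r C by (intro mult_left_mono add_right_mono powr_mono2) auto
    then show ?thesis using e by (smt (verit) mult_nonneg_nonneg)
  next
    case False
    then have t: "\<bar>t\<bar> > 0" using T by linarith
    have "C / \<epsilon> \<le> \<bar>t\<bar> powr (2 - r)" unfolding T(2)[symmetric] using False T r by (intro powr_mono2) auto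
    then have 1: "C * \<bar>t\<bar> powr (r - 1) \<le> (\<epsilon> * \<bar>t\<bar> powr (2 - r)) * \<bar>t\<bar> powr (r - 1)"
      using e by (intro mult_right_mono) (auto simp: field_simps)
    have "\<bar>t\<bar> powr (2 - r) * \<bar>t\<bar> powr (r - 1) = \<bar>t\<bar>" using t by (simp add: powr_add[symmetric])
    then have "C * \<bar>t\<bar> powr (r - 1) \<le> \<epsilon> * \<bar>t\<bar>" using 1 by (simp add: mult.assoc)
    moreover have "0 \<le> C * T powr (r - 1)" using C by simp
    ultimately show ?thesis by (simp add: distrib_left)
  qed
  then show ?thesis by (rule that)
qed

text \<open>For \<open>K > 0\<close> the two powers coincide at \<open>\<bar>t\<bar> = T\<close>;
  beyond it the exponent \<open>\<mu> > 2\<close> wins, and below it the quadratic term is at most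
  \<open>K * T\<^sup>2\<close>.\<close>

lemma powr_superquadratic:
  fixes \<mu> c K :: real
  assumes m: "\<mu> > 2" and c: "c > 0"
  obtains C where "\<And>t. K * t\<^sup>2 - C \<le> c * \<bar>t\<bar> powr \<mu>"
proof (cases "K > 0")
  case False
  have "K * t\<^sup>2 - 0 \<le> c * \<bar>t\<bar> powr \<mu>" for t :: real
  proof -
    have "K * t\<^sup>2 \<le> 0" using False by (simp add: mult_nonpos_nonneg)
    also have "0 \<le> c * \<bar>t\<bar> powr \<mu>" using c by simp
    finally show ?thesis by simp
  qed
  then show ?thesis by (rule that)
next
  case True
  define T where "T = (K / c) powr (1 / (\<mu> - 2))"
  have T: "T > 0" "T powr (\<mu> - 2) = K / c" using c True m by (auto simp: T_def powr_powr)
  have "K * t\<^sup>2 - K * T\<^sup>2 \<le> c * \<bar>t\<bar> powr \<mu>" for t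
  proof (cases "\<bar>t\<bar> < T")
    case True': True
    then have "\<bar>t\<bar>\<^sup>2 \<le> T\<^sup>2" by (intro power_mono) auto
    then have "K * t\<^sup>2 \<le> K * T\<^sup>2" using True by simp
    then show ?thesis using c by (smt (verit) mult_nonneg_nonneg powr_ge_zero)
  next
    case False
    then have t: "\<bar>t\<bar> > 0" using T by linarith
    have "K / c \<le> \<bar>t\<bar> powr (\<mu> - 2)" unfolding T(2)[symmetric] using False T m by (intro powr_mono2) auto
    then have 1: "K * t\<^sup>2 \<le> (c * \<bar>t\<bar> powr (\<mu> - 2)) * t\<^sup>2"
      using c by (intro mult_right_mono) (auto simp: field_simps)
    have "\<bar>t\<bar> powr (\<mu> - 2) * t\<^sup>2 = \<bar>t\<bar> powr (\<mu> - 2) * \<bar>t\<bar> powr 2" using t by simp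
    also have "\<dots> = \<bar>t\<bar> powr \<mu>" unfolding powr_add[symmetric] by simp
    finally have "\<bar>t\<bar> powr (\<mu> - 2) * t\<^sup>2 = \<bar>t\<bar> powr \<mu>" .
    then have "K * t\<^sup>2 \<le> c * \<bar>t\<bar> powr \<mu>" using 1 by (simp add: mult.assoc)
    moreover have "0 \<le> K * T\<^sup>2" using True by simp
    ultimately show ?thesis by linarith
  qed
  then show ?thesis by (rule that)
qed

section \<open>A regular representative of the nonlinearity; piecewise affine functions\<close>

context nodes
begin

text \<open>Smallness at 0 comes with one null set for each \<epsilon>; the values
  \<open>1 / (n + 1)\<close> suffice, so a single null set \<open>Z\<close> covers all exceptions.
  On \<open>Z\<close> and outside (0, 1) the nonlinearity is set to 0, which is continuous, bounded
  and small at 0.\<close>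

lemma regularize_nonlinearity:
  fixes f g :: "real \<Rightarrow> real \<Rightarrow> real"
  assumes f: "caratheodory f"
    and split: "\<And>y t. y \<in> {0<..<1} \<Longrightarrow> f y t = \<alpha> a y * t + g y t"
    and r: "1 < r" "r < 2" and C: "C > 0"
    and growth: "AE y in unit_ivl. \<forall>t. \<bar>g y t\<bar> \<le> C * (\<bar>t\<bar> powr (r - 1) + 1)"
    and small: "\<And>\<epsilon>. \<epsilon> > 0 \<Longrightarrow> \<exists>\<delta>>0. AE y in unit_ivl. \<forall>t. \<bar>t\<bar> \<le> \<delta> \<longrightarrow> \<bar>f y t\<bar> \<le> \<epsilon> * \<bar>t\<bar>"
  obtains F where "caratheodory_bdd F" "AE y in unit_ivl. \<forall>t. F y t = f y t"
    "\<And>\<epsilon>. \<epsilon> > 0 \<Longrightarrow> \<exists>C. AE y in unit_ivl. \<forall>t. \<bar>F y t - \<alpha> a y * t\<bar> \<le> \<epsilon> * \<bar>t\<bar> + C"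
    "\<And>\<epsilon>. \<epsilon> > 0 \<Longrightarrow> \<exists>\<delta>>0. \<forall>y t. \<bar>t\<bar> \<le> \<delta> \<longrightarrow> \<bar>F y t\<bar> \<le> \<epsilon> * \<bar>t\<bar>"
proof -
  have "\<forall>n. \<exists>\<delta>>0. AE y in unit_ivl. \<forall>t. \<bar>t\<bar> \<le> \<delta> \<longrightarrow> \<bar>f y t\<bar> \<le> inverse (real (Suc n)) * \<bar>t\<bar>"
    by (intro allI small) simp
  from choice[OF this] obtain \<delta> where \<delta>: "\<And>n. \<delta> n > 0"
    "\<And>n. AE y in unit_ivl. \<forall>t. \<bar>t\<bar> \<le> \<delta> n \<longrightarrow> \<bar>f y t\<bar> \<le> inverse (real (Suc n)) * \<bar>t\<bar>" by blast
  let ?P = "\<lambda>y. continuous_on UNIV (f y) \<and> (\<forall>t. \<bar>g y t\<bar> \<le> C * (\<bar>t\<bar> powr (r - 1) + 1)) \<and>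
    (\<forall>n t. \<bar>t\<bar> \<le> \<delta> n \<longrightarrow> \<bar>f y t\<bar> \<le> inverse (real (Suc n)) * \<bar>t\<bar>)"
  have "AE y in unit_ivl. \<forall>n t. \<bar>t\<bar> \<le> \<delta> n \<longrightarrow> \<bar>f y t\<bar> \<le> inverse (real (Suc n)) * \<bar>t\<bar>"
    using \<delta>(2) by (subst AE_all_countable) blast
  then have "AE y in unit_ivl. ?P y" using f growth by (auto simp: caratheodory_def)
  then obtain Z where Z: "{y \<in> space unit_ivl. \<not> ?P y} \<subseteq> Z" "emeasure unit_ivl Z = 0" "Z \<in> sets unit_ivl"
    by (rule AE_E)
  have P: "?P y" if "y \<in> {0<..<1} - Z" for y using Z(1) that by auto
  define F where "F y t = (if y \<in> {0<..<1} - Z then f y t else 0)" for y t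
  have Z_null: "Z \<in> null_sets unit_ivl" using Z(2,3) by (auto simp: null_sets_def)
  have ae: "AE y in unit_ivl. y \<in> {0<..<1} - Z" using AE_not_in[OF Z_null] AE_space[of unit_ivl] by eventually_elim auto
  obtain A where A: "A > 0" "\<And>y. 0 < y \<Longrightarrow> y < 1 \<Longrightarrow> \<bar>\<alpha> a y\<bar> \<le> A" 
    by (rule bdd_measE[OF bdd_meas_\<alpha>]) (rule that, assumption+)
  have "caratheodory_bdd F" unfolding caratheodory_bdd_def
  proof (intro conjI allI)
    fix t
    have eq: "F y t = indicator ({0<..<1} - Z) y * f y t" for y by (simp add: F_def indicator_def)
    have "{0<..<1} - Z \<in> sets unit_ivl"
      using sets.compl_sets[OF Z(3)] by simp
    then show "(\<lambda>y. F y t) \<in> borel_measurable unit_ivl"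
      unfolding eq using f by (intro borel_measurable_times borel_measurable_indicator) (auto simp: caratheodory_def)
  next
    fix y show "continuous_on UNIV (F y)"
      using P[of y] by (cases "y \<in> {0<..<1} - Z") (auto simp: F_def[abs_def])
  next
    fix B :: real
    have "\<bar>F y t\<bar> \<le> A * B + C * (B powr (r - 1) + 1)" if t: "\<bar>t\<bar> \<le> B" for y t
    proof (cases "y \<in> {0<..<1} - Z")
      case True
      have "\<bar>f y t\<bar> \<le> \<bar>\<alpha> a y * t\<bar> + \<bar>g y t\<bar>" using split[of y t] True by simp
      moreover have "\<bar>\<alpha> a y * t\<bar> \<le> A * B" unfolding abs_mult using A True t by (intro mult_mono) auto
      moreover have "\<bar>g y t\<bar> \<le> C * (\<bar>t\<bar> powr (r - 1) + 1)" using P[OF True] by blast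
      moreover have "C * (\<bar>t\<bar> powr (r - 1) + 1) \<le> C * (B powr (r - 1) + 1)"
        using r C t by (intro mult_left_mono add_right_mono powr_mono2) auto
      ultimately show ?thesis using True by (simp add: F_def)
    next
      case False
      have "0 \<le> A * B" "0 \<le> C * (B powr (r - 1) + 1)" using A C t by auto
      then show ?thesis using False by (auto simp: F_def)
    qed
    then show "\<exists>C. \<forall>y t. \<bar>t\<bar> \<le> B \<longrightarrow> \<bar>F y t\<bar> \<le> C" by blast
  qed
  moreover have "AE y in unit_ivl. \<forall>t. F y t = f y t" using ae by eventually_elim (simp add: F_def)
  moreover have "\<exists>C. AE y in unit_ivl. \<forall>t. \<bar>F y t - \<alpha> a y * t\<bar> \<le> \<epsilon> * \<bar>t\<bar> + C" if e: "\<epsilon> > 0" for \<epsilon>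
  proof -
    obtain C' where C': "\<And>t. C * (\<bar>t\<bar> powr (r - 1) + 1) \<le> \<epsilon> * \<bar>t\<bar> + C'"
      by (rule powr_sublinear[OF r C e]) (rule that, assumption)
    have "AE y in unit_ivl. \<forall>t. \<bar>F y t - \<alpha> a y * t\<bar> \<le> \<epsilon> * \<bar>t\<bar> + C'" using ae
    proof eventually_elim
      case (elim y)
      have "\<bar>g y t\<bar> \<le> \<epsilon> * \<bar>t\<bar> + C'" for t using P[OF elim] C'[of t] order_trans by blast
      then show ?case using elim split[of y] by (simp add: F_def)
    qed
    then show ?thesis by blast
  qed
  moreover have "\<exists>\<delta>>0. \<forall>y t. \<bar>t\<bar> \<le> \<delta> \<longrightarrow> \<bar>F y t\<bar> \<le> \<epsilon> * \<bar>t\<bar>" if e: "\<epsilon> > 0" for \<epsilon>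
  proof -
    obtain n where n: "inverse (real (Suc n)) < \<epsilon>" using reals_Archimedean[OF e] by blast
    have "\<bar>F y t\<bar> \<le> \<epsilon> * \<bar>t\<bar>" if t: "\<bar>t\<bar> \<le> \<delta> n" for y t
    proof (cases "y \<in> {0<..<1} - Z")
      case True
      have "\<bar>f y t\<bar> \<le> inverse (real (Suc n)) * \<bar>t\<bar>" using P[OF True] t by blast
      also have "\<dots> \<le> \<epsilon> * \<bar>t\<bar>" using n by (intro mult_right_mono) auto
      finally show ?thesis using True by (simp add: F_def)
    qed (use e in \<open>auto simp: F_def\<close>)
    then show ?thesis using \<delta>(1)[of n] by blast
  qed
  ultimately show ?thesis by (rule that)
qed

lemma hat_affine:
  assumes i: "i \<in> {1..m}" and j: "j \<in> {1..m+1}"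
  shows "\<exists>\<gamma> \<delta>. \<forall>y\<in>{x (j - 1)..x j}. ev (hat i) y = \<gamma> + \<delta> * y"
proof -
  have clamp_affine: "\<exists>\<gamma> \<delta>. \<forall>y\<in>{x (j - 1)..x j}. clamp (x (k - 1)) (x k) y = \<gamma> + \<delta> * y" if k: "k \<in> {1..m+1}" for k
  proof -
    have l: "x (k - 1) \<le> x k" using x_le[of "k - 1" k] k by auto
    consider "k = j" | "j \<le> k - 1" | "k \<le> j - 1" by linarith
    then show ?thesis
    proof cases
      case 1 then show ?thesis by (intro exI[of _ 0] exI[of _ 1]) (auto simp: clamp_def)
    next
      case 2
      then have "x j \<le> x (k - 1)" using x_le[of j "k - 1"] k by auto
      then show ?thesis using l by (intro exI[of _ "x (k - 1)"] exI[of _ 0]) (auto simp: clamp_def)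
    next
      case 3
      then have "x k \<le> x (j - 1)" using x_le[of k "j - 1"] j by auto
      then show ?thesis using l by (intro exI[of _ "x k"] exI[of _ 0]) (auto simp: clamp_def)
    qed
  qed
  obtain \<gamma> \<delta> where 1: "\<And>y. y \<in> {x (j - 1)..x j} \<Longrightarrow> clamp (x (i - 1)) (x i) y = \<gamma> + \<delta> * y"
    using clamp_affine[of i] i by auto
  obtain \<gamma>' \<delta>' where 2: "\<And>y. y \<in> {x (j - 1)..x j} \<Longrightarrow> clamp (x i) (x (Suc i)) y = \<gamma>' + \<delta>' * y"
    using clamp_affine[of "Suc i"] i by auto
  let ?p = "1 / (x i - x (i - 1))" and ?q = "1 / (x (Suc i) - x i)"
  have "ev (hat i) y = (?p * (\<gamma> - x (i - 1)) - ?q * (\<gamma>' - x i)) + (?p * \<delta> - ?q * \<delta>') * y"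
    if y: "y \<in> {x (j - 1)..x j}" for y
  proof -
    have "j - 1 \<le> Suc m" "j \<le> Suc m" using j by auto
    then have "y \<in> {0..1}" using y x_bounds(1)[of "j - 1"] x_bounds(2)[of j] by auto
    then have "ev (hat i) y = ?p * (\<gamma> + \<delta> * y - x (i - 1)) - ?q * (\<gamma>' + \<delta>' * y - x i)"
      unfolding hat_facts(2)[OF i] hatf_def 1[OF y] 2[OF y] by simp
    then show ?thesis by (simp add: ring_distribs)
  qed
  then show ?thesis by blast
qed

text \<open>Both sides are affine between neighbouring nodes and agree at the nodes.\<close>

lemma piecewise_affine_eq:
  assumes w: "w \<in> piecewise_affine m x" and y: "0 \<le> y" "y \<le> 1"
  shows "ev (\<Sum>i=1..m. w (x i) *\<^sub>R hat i) y = w y"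
proof -
  let ?W = "\<Sum>i=1..m. w (x i) *\<^sub>R hat i"
  have w01: "w 0 = 0" "w 1 = 0" using w by (auto simp: piecewise_affine_def)
  have node: "ev ?W (x k) = w (x k)" if k: "k \<le> Suc m" for k
  proof -
    have "ev ?W (x k) = (\<Sum>i=1..m. if i = k then w (x i) else 0)"
      unfolding ev_sum ev_scaleR by (intro sum.cong) (use k in \<open>auto simp: hat_facts(3)\<close>)
    also have "\<dots> = (if k \<in> {1..m} then w (x k) else 0)" by simp
    also have "\<dots> = w (x k)"
    proof (cases "k \<in> {1..m}")
      case False
      then have "k = 0 \<or> k = Suc m" using k by auto
      then show ?thesis using False w01 by auto
    qed simp
    finally show ?thesis .
  qed
  consider "y = 0" | "y = 1" | "0 < y" "y < 1" using y by linarith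
  then show ?thesis
  proof cases
    case 3
    then obtain j where j: "j \<in> {1..m+1}" "x (j - 1) \<le> y" "y \<le> x j" by (rule locate)
    have "\<forall>i\<in>{1..m}. \<exists>\<gamma> \<delta>. \<forall>y\<in>{x (j - 1)..x j}. ev (hat i) y = \<gamma> + \<delta> * y"
      using hat_affine j(1) by blast
    then obtain \<gamma> \<delta> where h: "\<And>i y. i \<in> {1..m} \<Longrightarrow> y \<in> {x (j - 1)..x j} \<Longrightarrow> ev (hat i) y = \<gamma> i + \<delta> i * y"
      by metis
    define c where "c = (\<Sum>i=1..m. w (x i) * \<gamma> i)"
    define d where "d = (\<Sum>i=1..m. w (x i) * \<delta> i)"
    have W: "ev ?W y = c + d * y" if "y \<in> {x (j - 1)..x j}" for y
    proof -
      have "ev ?W y = (\<Sum>i=1..m. w (x i) * \<gamma> i + w (x i) * \<delta> i * y)"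
        unfolding ev_sum ev_scaleR by (intro sum.cong) (use that h in \<open>auto simp: distrib_left\<close>)
      then show ?thesis by (simp add: c_def d_def sum.distrib sum_distrib_right)
    qed
    obtain c' d' where w': "\<And>y. y \<in> {x (j - 1)..x j} \<Longrightarrow> w y = c' + d' * y"
      using w j(1) unfolding piecewise_affine_def by blast
    have l: "x (j - 1) < x j" using x_less[of "j - 1" j] j by auto
    have "c + d * x (j - 1) = c' + d' * x (j - 1)" "c + d * x j = c' + d' * x j"
      using node[of "j - 1"] node[of j] W[of "x (j - 1)"] W[of "x j"] w'[of "x (j - 1)"] w'[of "x j"] l j(1) by auto
    then have "(d - d') * (x j - x (j - 1)) = 0" "c + d * x j = c' + d' * x j" by (auto simp: algebra_simps)
    then have "d = d'" "c = c'" using l by auto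
    then show ?thesis using W[of y] w'[of y] j by simp
  qed (use w01 in simp_all)
qed

end

lemma green_deriv:
  assumes "0 < y" "y \<noteq> z"
  shows "(green z has_real_derivative (if y < z then 1 else 0) - z) (at y)"
proof (cases "y < z")
  case True
  have "((\<lambda>y. y - z * y) has_real_derivative 1 - z) (at y)" by (auto intro!: derivative_eq_intros)
  then have "(green z has_real_derivative 1 - z) (at y)"
    by (rule has_field_derivative_transform_within_open[of _ _ _ "{0<..<z}"]) (use assms True in \<open>auto simp: green_def\<close>)
  then show ?thesis using True by simp
next
  case False
  have "((\<lambda>y. max 0 z - z * y) has_real_derivative - z) (at y)" by (auto intro!: derivative_eq_intros)
  then have "(green z has_real_derivative - z) (at y)"
    by (rule has_field_derivative_transform_within_open[of _ _ _ "{z<..}"]) (use assms False in \<open>auto simp: green_def\<close>)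
  then show ?thesis using False by simp
qed

lemma step_locally_constant:
  fixes p z :: real
  shows "p \<noteq> z \<Longrightarrow> ((\<lambda>y. if y < z then 1 else 0 :: real) has_real_derivative 0) (at p)"
    "((\<lambda>y. if y < z then 1 else 0 :: real) \<longlongrightarrow> (if p \<le> z then 1 else 0)) (at_left p)"
    "((\<lambda>y. if y < z then 1 else 0 :: real) \<longlongrightarrow> (if p < z then 1 else 0)) (at_right p)"
proof -
  show "((\<lambda>y. if y < z then 1 else 0 :: real) has_real_derivative 0) (at p)" if "p \<noteq> z"
  proof (cases "p < z")
    case True
    show ?thesis
      by (rule has_field_derivative_transform_within_open[of "\<lambda>_. 1" _ _ "{..<z}"]) (use True in auto)
  next
    case False
    show ?thesis
      by (rule has_field_derivative_transform_within_open[of "\<lambda>_. 0" _ _ "{z<..}"]) (use False that in auto)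
  qed
  show "((\<lambda>y. if y < z then 1 else 0 :: real) \<longlongrightarrow> (if p \<le> z then 1 else 0)) (at_left p)"
  proof (rule tendsto_eventually)
    show "\<forall>\<^sub>F y in at_left p. (if y < z then 1 else 0 :: real) = (if p \<le> z then 1 else 0)"
    proof (cases "p \<le> z")
      case True
      then show ?thesis by (intro eventually_at_leftI[of "p - 1"]) auto
    next
      case False
      then show ?thesis by (intro eventually_at_leftI[of z]) auto
    qed
  qed
  show "((\<lambda>y. if y < z then 1 else 0 :: real) \<longlongrightarrow> (if p < z then 1 else 0)) (at_right p)"
  proof (rule tendsto_eventually)
    show "\<forall>\<^sub>F y in at_right p. (if y < z then 1 else 0 :: real) = (if p < z then 1 else 0)"
    proof (cases "p < z")
      case True
      then show ?thesis by (intro eventually_at_rightI[of p z]) auto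
    next
      case False
      then show ?thesis by (intro eventually_at_rightI[of p "p + 1"]) auto
    qed
  qed
qed

section \<open>From the original hypotheses to the abstract setting and back\<close>

context impulse
begin

text \<open>Such a \<open>u\<close> is a combination of Green's functions, hence affine between the
  nodes, and the derivative of \<open>green (x j)\<close> drops by 1 at \<open>x j\<close>. So
  \<open>u\<close> solves the problem that defines resonance. The copy \<open>U\<close> has a
  derivative given by a formula at every point off the nodes.\<close>

lemma nonresonant:
  assumes b: "b \<notin> resonance_set m x" and u: "u = (\<Sum>j=1..m. (b j * ev u (x j)) *\<^sub>R gr j)"
  shows "u = 0"
proof (rule ccontr)
  assume u0: "u \<noteq> 0"
  define \<beta> where "\<beta> j = b j * ev u (x j)" for j
  define U where "U y = (\<Sum>j=1..m. \<beta> j * green (x j) y)" for y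
  define U' where "U' y = (\<Sum>j=1..m. \<beta> j * ((if y < x j then 1 else 0) - x j))" for y
  have ev_gr: "ev (gr j) y = green (x j) y" if "j \<in> {1..m}" "y \<in> {0..1}" for j y
    using ev_mk[OF ac_green[of "x j"], of y] x_in[OF that(1)] that(2) by (simp add: gr_def green_def)
  have U: "U y = ev u y" if "y \<in> {0..1}" for y
  proof -
    have "ev u y = (\<Sum>j=1..m. \<beta> j * ev (gr j) y)"
      using arg_cong[OF u, of "\<lambda>w. ev w y"] by (simp add: \<beta>_def)
    also have "\<dots> = U y" unfolding U_def by (intro sum.cong) (use that ev_gr in auto)
    finally show ?thesis ..
  qed
  have "nontrivial U"
  proof -
    obtain y where "0 < y" "y < 1" "ev u y \<noteq> ev 0 y" using u0 pcf_eqI[of u 0] by blast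
    then show ?thesis unfolding nontrivial_def by (intro bexI[of _ y]) (auto simp: U)
  qed
  moreover have "continuous_on {0..1} U" "U 0 = 0" "U 1 = 0"
    using ev_continuous[of u] continuous_on_cong[of "{0..1}" "{0..1}" U "ev u"] U by auto
  moreover have "(U has_real_derivative U' y) (at y) \<and> (U' has_real_derivative 0) (at y)" if y: "y \<in> {0<..<1} - x ` {1..m}" for y
  proof
    have ne: "y \<noteq> x j" if "j \<in> {1..m}" for j using y that by auto
    show "(U has_real_derivative U' y) (at y)"
      unfolding U_def[abs_def] U'_def
      by (intro DERIV_sum DERIV_cmult green_deriv) (use y ne in auto)
    have "(U' has_real_derivative (\<Sum>j=1..m. \<beta> j * (0 - 0))) (at y)"
      unfolding U'_def[abs_def]
      by (intro DERIV_sum DERIV_cmult DERIV_diff step_locally_constant(1) DERIV_const ne) auto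
    then show "(U' has_real_derivative 0) (at y)" by simp
  qed
  moreover have "\<exists>l r. (U' \<longlongrightarrow> l) (at_left (x j)) \<and> (U' \<longlongrightarrow> r) (at_right (x j)) \<and> r = l - b j * U (x j)"
    if j: "j \<in> {1..m}" for j
  proof (intro exI conjI)
    let ?l = "\<Sum>i=1..m. \<beta> i * ((if x j \<le> x i then 1 else 0) - x i)"
    let ?r = "\<Sum>i=1..m. \<beta> i * ((if x j < x i then 1 else 0) - x i)"
    show "(U' \<longlongrightarrow> ?l) (at_left (x j))" "(U' \<longlongrightarrow> ?r) (at_right (x j))"
      unfolding U'_def[abs_def] by (intro tendsto_intros step_locally_constant)+
    have inj: "x i = x j \<longleftrightarrow> i = j" if "i \<in> {1..m}" for i
      using x_less[of i j] x_less[of j i] that j by (cases i j rule: linorder_cases) auto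
    have "?l - ?r = (\<Sum>i=1..m. if i = j then \<beta> i else 0)"
      unfolding sum_subtractf[symmetric]
    proof (rule sum.cong)
      fix i assume "i \<in> {1..m}"
      from inj[OF this] show "\<beta> i * ((if x j \<le> x i then 1 else 0) - x i) - \<beta> i * ((if x j < x i then 1 else 0) - x i) = (if i = j then \<beta> i else 0)"
        by (auto simp: algebra_simps)
    qed simp
    also have "\<dots> = b j * U (x j)" using j U[OF x_in[OF j]] by (simp add: \<beta>_def)
    finally show "?r = ?l - b j * U (x j)" by simp
  qed
  ultimately have "b \<in> resonance_set m x" unfolding resonance_set_def by blast
  with b show False ..
qed

text \<open>The witness is the combination of hats with the nodal values of \<open>w\<close>. It is
  orthogonal to \<open>N\<close>, and uniqueness of weak derivatives identifies its energy with the
  integral of the square of \<open>dw\<close>.\<close>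

lemma piecewise_affine_alternative:
  assumes w: "w \<in> piecewise_affine m x" "nontrivial w" and dw: "has_weak_deriv w dw"
    and ge: "(\<integral>y. (dw y)\<^sup>2 \<partial>unit_ivl) \<ge> (\<Sum>j=1..m. b j * (w (x j))\<^sup>2)"
  shows "\<exists>w. w \<noteq> 0 \<and> (\<forall>v\<in>N. w \<bullet> v = 0) \<and> 0 \<le> B\<^sub>0 w w"
proof (intro exI conjI ballI)
  let ?W = "\<Sum>i=1..m. w (x i) *\<^sub>R hat i"
  note W = piecewise_affine_eq[OF w(1)]
  obtain y where "0 \<le> y" "y \<le> 1" "w y \<noteq> 0" using w(2) by (auto simp: nontrivial_def)
  then have "ev ?W y \<noteq> ev 0 y" using W[of y] by simp
  then show "?W \<noteq> 0" by metis
  show "?W \<bullet> v = 0" if "v \<in> N" for v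
    unfolding inner_sum_left by (intro sum.neutral) (use that in \<open>auto simp: hat_orthogonal_N\<close>)
  have "AE y in unit_ivl. D ?W y = dw y"
    by (rule weak_deriv_unique[OF ac_has_weak_deriv[OF ac_D] dw]) (rule W, auto)
  then have "AE y in unit_ivl. D ?W y * D ?W y = (dw y)\<^sup>2" by eventually_elim (simp add: power2_eq_square)
  then have "?W \<bullet> ?W = (\<integral>y. (dw y)\<^sup>2 \<partial>unit_ivl)"
    unfolding inner_eq[OF ac_D ac_D]
    by (intro integral_cong_AE)
      (use bdd_meas_measurable[OF bdd_meas_D[of ?W]] dw in \<open>auto simp: has_weak_deriv_def L2_def\<close>)
  moreover have "(\<Sum>j=1..m. b j * ev ?W (x j) * ev ?W (x j)) = (\<Sum>j=1..m. b j * (w (x j))\<^sup>2)"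
  proof (intro sum.cong refl)
    fix j assume "j \<in> {1..m}"
    then have e: "ev ?W (x j) = w (x j)" using x_in by (intro W) auto
    show "b j * ev ?W (x j) * ev ?W (x j) = b j * (w (x j))\<^sup>2" unfolding e by (simp add: power2_eq_square)
  qed
  ultimately show "0 \<le> B\<^sub>0 ?W ?W" using ge by (simp only: B\<^sub>0_def diff_ge_0_iff_ge)
qed

lemma critical_point_weak_solution:
  assumes u: "u = K (ev u)"
  shows "weak_solution m x f \<iota> (ev u)"
proof -
  have b: "bdd_meas (\<lambda>y. f y (ev u y))" by (rule bdd_meas_superposition[OF cb ev_continuous])
  have eq: "u \<bullet> v = (\<integral>y. f y (ev u y) * ev v y \<partial>unit_ivl) + (\<Sum>j\<in>{1..m}. \<iota> j (ev u (x j)) * ev v (x j))" for v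
  proof -
    have "u \<bullet> v = K (ev u) \<bullet> v" using u by simp
    also have "\<dots> = T (\<lambda>y. f y (ev u y)) \<bullet> v + (\<Sum>j=1..m. \<iota> j (ev u (x j)) * ev v (x j))"
      by (simp add: K_def inner_add_left inner_sum_left inner_gr)
    finally show ?thesis unfolding inner_T[OF b] .
  qed
  have z: "0 \<le> x j \<and> x j < 1" if "j \<in> {1..m}" for j
    using x_bounds[of j] x_less[of j "Suc m"] that by auto
  show ?thesis
    unfolding weak_solution_def
  proof (intro conjI exI[of _ "D u"] ballI allI impI)
    show "ev u \<in> H10" by (rule ev_in_H10)
    show "has_weak_deriv (ev u) (D u)" by (rule ac_has_weak_deriv[OF ac_D])
  qed (rule weak_equation_H10[OF b finite_atLeastAtMost z eq]; assumption)+
qed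

end

text \<open>The integrands differ on a null set only; measurability of the new one, and with it the
  integrability clause, comes from completeness of the measure.\<close>

lemma weak_solution_AE_cong:
  assumes u: "weak_solution m x F \<iota> u" and F: "AE y in unit_ivl. \<forall>t. F y t = f y t"
  shows "weak_solution m x f \<iota> u"
proof -
  have "integrable unit_ivl (\<lambda>y. f y (u y) * v y) \<and>
      (\<integral>y. f y (u y) * v y \<partial>unit_ivl) = (\<integral>y. F y (u y) * v y \<partial>unit_ivl)"
    if i: "integrable unit_ivl (\<lambda>y. F y (u y) * v y)" for v
  proof -
    have ae: "AE y in unit_ivl. f y (u y) * v y = F y (u y) * v y" using F by eventually_elim simp
    have m: "(\<lambda>y. f y (u y) * v y) \<in> borel_measurable unit_ivl"
      by (rule AE_eq_measurable[OF borel_measurable_integrable[OF i] ae])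
    show ?thesis
      using integrable_cong_AE[OF m borel_measurable_integrable[OF i] ae]
        integral_cong_AE[OF m borel_measurable_integrable[OF i] ae] i by simp
  qed
  note transfer = this
  show ?thesis
    unfolding weak_solution_def
  proof (intro conjI)
    show "u \<in> H10" using u by (simp add: weak_solution_def)
    from u obtain du where du: "has_weak_deriv u du"
      and eq: "\<And>v dv. v \<in> H10 \<Longrightarrow> has_weak_deriv v dv \<Longrightarrow> integrable unit_ivl (\<lambda>y. F y (u y) * v y)"
        "\<And>v dv. v \<in> H10 \<Longrightarrow> has_weak_deriv v dv \<Longrightarrow>
          (\<integral>y. du y * dv y \<partial>unit_ivl) = (\<integral>y. F y (u y) * v y \<partial>unit_ivl) + (\<Sum>j=1..m. \<iota> j (u (x j)) * v (x j))"
      unfolding weak_solution_def by blast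
    show "\<exists>du. has_weak_deriv u du \<and> (\<forall>v\<in>H10. \<forall>dv. has_weak_deriv v dv \<longrightarrow>
        integrable unit_ivl (\<lambda>y. f y (u y) * v y) \<and>
        (\<integral>y. du y * dv y \<partial>unit_ivl) = (\<integral>y. f y (u y) * v y \<partial>unit_ivl) + (\<Sum>j=1..m. \<iota> j (u (x j)) * v (x j)))"
    proof (intro exI[of _ du] conjI ballI allI impI du)
      fix v dv assume v: "v \<in> H10" "has_weak_deriv v dv"
      note t = transfer[OF eq(1)[OF v]]
      show "integrable unit_ivl (\<lambda>y. f y (u y) * v y)" using t by blast
      show "(\<integral>y. du y * dv y \<partial>unit_ivl) = (\<integral>y. f y (u y) * v y \<partial>unit_ivl) + (\<Sum>j=1..m. \<iota> j (u (x j)) * v (x j))"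
        unfolding eq(2)[OF v] t[THEN conjunct2] ..
    qed
  qed
qed

theorem theorem4p1:
  fixes m :: nat and x :: "nat \<Rightarrow> real"
    and f g :: "real \<Rightarrow> real \<Rightarrow> real" and \<iota> h :: "nat \<Rightarrow> real \<Rightarrow> real"
    and a b :: "nat \<Rightarrow> real" and r C \<mu> c C' :: real
  assumes m: "m \<ge> 1" and x: "is_partition m x"
    and f: "caratheodory f"
    and \<iota>: "\<And>j. j \<in> {1..m} \<Longrightarrow> continuous_on UNIV (\<iota> j)"
    and i_split: "\<And>y t. y \<in> {0<..<1} \<Longrightarrow>
      f y t = (\<Sum>j=1..m+1. a j * indicator {x (j - 1)<..<x j} y * t) + g y t"
    and i_growth: "1 < r" "r < 2" "C > 0"
      "AE y in unit_ivl. \<forall>t. \<bar>g y t\<bar> \<le> C * (\<bar>t\<bar> powr (r - 1) + 1)"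
    and ii: "\<mu> > 2" "c > 0" "C' > 0"
      "\<And>j t. j \<in> {1..m} \<Longrightarrow> t * \<iota> j t \<ge> c * \<bar>t\<bar> powr \<mu> - C'"
    and iii: "\<And>\<epsilon>. \<epsilon> > 0 \<Longrightarrow>
      \<exists>\<delta>>0. AE y in unit_ivl. \<forall>t. \<bar>t\<bar> \<le> \<delta> \<longrightarrow> \<bar>f y t\<bar> \<le> \<epsilon> * \<bar>t\<bar>"
    and iv_split: "\<And>j t. j \<in> {1..m} \<Longrightarrow> \<iota> j t = b j * t + h j t"
    and iv_small: "\<And>j \<epsilon>. j \<in> {1..m} \<Longrightarrow> \<epsilon> > 0 \<Longrightarrow>
      \<exists>\<delta>>0. \<forall>t. \<bar>t\<bar> \<le> \<delta> \<longrightarrow> \<bar>h j t\<bar> \<le> \<epsilon> * \<bar>t\<bar>"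
    and v_a: "\<And>j. j \<in> {1..m+1} \<Longrightarrow> a j \<notin> {eigenval x j k |k. k \<ge> 1}"
    and v_b: "b \<notin> resonance_set m x"
    and alternative:
      "(\<exists>j\<^sub>0\<in>{1..m+1}. a j\<^sub>0 > eigenval x j\<^sub>0 1) \<or>
       (\<exists>w\<^sub>0\<in>piecewise_affine m x. nontrivial w\<^sub>0 \<and>
         (\<exists>dw\<^sub>0. has_weak_deriv w\<^sub>0 dw\<^sub>0 \<and>
           (\<integral>y. (dw\<^sub>0 y)\<^sup>2 \<partial>unit_ivl) \<ge> (\<Sum>j=1..m. b j * (w\<^sub>0 (x j))\<^sup>2)))"
  shows "\<exists>u. weak_solution m x f \<iota> u \<and> nontrivial u"
proof -
  interpret nodes m x by (rule nodes.intro[OF x])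
  have split: "f y t = \<alpha> a y * t + g y t" if "y \<in> {0<..<1}" for y t
    using i_split[OF that, of t] by (simp only: \<alpha>_def sum_distrib_right)
  obtain F where F: "caratheodory_bdd F" "AE y in unit_ivl. \<forall>t. F y t = f y t"
    "\<And>\<epsilon>. \<epsilon> > 0 \<Longrightarrow> \<exists>C. AE y in unit_ivl. \<forall>t. \<bar>F y t - \<alpha> a y * t\<bar> \<le> \<epsilon> * \<bar>t\<bar> + C"
    "\<And>\<epsilon>. \<epsilon> > 0 \<Longrightarrow> \<exists>\<delta>>0. \<forall>y t. \<bar>t\<bar> \<le> \<delta> \<longrightarrow> \<bar>F y t\<bar> \<le> \<epsilon> * \<bar>t\<bar>"
    by (rule regularize_nonlinearity[OF f split i_growth iii]) (assumption | rule that, assumption+)+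
  \<comment> \<open>The variational argument runs with the regular representative \<open>F\<close>;
    the solution is transferred to \<open>f\<close> at the end.\<close>
  interpret impulse m x F a b \<iota>
  proof
    show "\<exists>C. \<forall>t. K * t\<^sup>2 - C \<le> t * \<iota> j t" if j: "j \<in> {1..m}" for K j
    proof -
      obtain C where C: "\<And>t. K * t\<^sup>2 - C \<le> c * \<bar>t\<bar> powr \<mu>"
        by (rule powr_superquadratic[OF ii(1,2)]) (rule that, assumption)
      have "K * t\<^sup>2 - (C + C') \<le> t * \<iota> j t" for t using C[of t] ii(4)[OF j, of t] by linarith
      then show ?thesis by blast
    qed
    show "\<exists>\<delta>>0. \<forall>t. \<bar>t\<bar> \<le> \<delta> \<longrightarrow> \<bar>\<iota> j t - b j * t\<bar> \<le> \<epsilon> * \<bar>t\<bar>" if "j \<in> {1..m}" "\<epsilon> > 0" for \<epsilon> j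
      using iv_small[OF that] by (simp add: iv_split[OF that(1)])
  qed (fact F \<iota>)+
  have "\<exists>u. u \<noteq> 0 \<and> u = K (ev u)"
  proof (rule nontrivial_critical_point)
    show "a j \<notin> {eigenval x j k |k. k \<ge> 1}" if "j \<in> {1..m+1}" for j by (rule v_a[OF that])
    show "u = 0" if "u = (\<Sum>j=1..m. (b j * ev u (x j)) *\<^sub>R gr j)" for u
      by (rule nonresonant[OF v_b that])
    show "(\<exists>j\<in>{1..m+1}. a j > eigenval x j 1) \<or> (\<exists>w. w \<noteq> 0 \<and> (\<forall>v\<in>N. w \<bullet> v = 0) \<and> 0 \<le> B\<^sub>0 w w)"
      using alternative
    proof (elim disjE bexE conjE exE)
      fix w dw
      assume w: "w \<in> piecewise_affine m x" "nontrivial w" "has_weak_deriv w dw"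
        "(\<Sum>j=1..m. b j * (w (x j))\<^sup>2) \<le> (\<integral>y. (dw y)\<^sup>2 \<partial>unit_ivl)"
      show ?thesis by (rule disjI2, rule piecewise_affine_alternative[OF w])
    qed blast
  qed
  then obtain u where u: "u \<noteq> 0" "u = K (ev u)" by blast
  obtain y where "0 < y" "y < 1" "ev u y \<noteq> ev 0 y" using u(1) pcf_eqI[of u 0] by blast
  then have "nontrivial (ev u)" unfolding nontrivial_def by (intro bexI[of _ y]) auto
  with weak_solution_AE_cong[OF critical_point_weak_solution[OF u(2)] F(2)] show ?thesis by blast
qed

end
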